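(* Let $\mathcal{H}_{\pm}$ be the bulk Hamiltonians on $\mathcal{D}_{\pm}$ satisfying the standing assumptions in the context. For each switch function $\Lambda_2$ in the $x_2$-direction, the bulk spin conductance $$\sigma_{\pm}^{\Lambda_2}:=\frac{1}{2\pi}Tr_{ka_1^{\pm},\mathcal{D}_{\pm}}^{pv,1}(\Sigma_{\pm}^{\Lambda_2,\Lambda_1 S})$$ is well-defined: the limit defining the principal-value trace exists, and its value is independent of the choice of the switch function $\Lambda_1$ in the $x_1$-direction, of the density function $\rho$, and of the step size $k\in\mathbb{N}$, $k\ge1$. Here $$\Sigma_{\pm}^{\Lambda_2,\Lambda_1 S}:=\int_{\mathbb{C}}dm(z)\frac{\partial \tilde{\rho}}{\partial \overline{z}}\Big[R_{\pm}(z) [\mathcal{H}_{\pm},\Lambda_2] R_{\pm}(z) [\mathcal{H}_{\pm},\Lambda_1 S] R_{\pm}(z)- R_{\pm}(z) [\mathcal{H}_{\pm},\Lambda_1 S] R_{\pm}(z) [\mathcal{H}_{\pm},\Lambda_2] R_{\pm}(z) \Big].$$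
   Context: Hilbert space. For a discrete set $\mathcal{D}\subset\mathbb{R}^2$, $H_{\mathcal{D}}=\ell^2(\mathcal{D})\otimes\mathbb{C}^2$; an operator $A$ on $H_{\mathcal{D}}$ has a kernel $A(\bm{x},\bm{y})$ ($2\times 2$ matrices, $\bm{x},\bm{y}\in\mathcal{D}$). $A$ bounded is called tight-binding if there are $\lambda,C_\lambda>0$ with $|A(\bm{x},\bm{y})|\le C_\lambda e^{-\lambda\|\bm{x}-\bm{y}\|_1}$ for all $\bm{x},\bm{y}\in\mathcal{D}$ ($\|\cdot\|_1$ is the $\ell^1$-norm on $\mathbb{R}^2$). $Tr_{\mathcal{D}}$ is the usual trace on trace-class operators on $H_{\mathcal{D}}$. Multiplication by a function of position is regarded as an operator on $H_{\mathcal{D}}$. $[A,B]=AB-BA$. The spin operator is $S=\mathrm{Id}\otimes\frac12\sigma_z$, $\sigma_z$ the third Pauli matrix. Lattices. $\mathcal{D}_{\pm}=\mathbb{Z}(a_1^{\pm}\bm{e}_1)\oplus\mathbb{Z}(a_2^{\pm}\bm{e}_2)$ with $a_1^{\pm},a_2^{\pm}\in\mathbb{N}$ positive. $\mathcal{D}_e\subset\mathbb{R}^2$ is a discrete set such that, for some $L>0$, $\mathcal{D}_e\cap\{\pm x_1>L\}=\mathcal{D}_{\pm}\cap\{\pm x_1>L\}$. Hamiltonians. $\mathcal{H}_{\pm}$ on $H_{\mathcal{D}_{\pm}}$ and $\mathcal{H}_e$ on $H_{\mathcal{D}_e}$ are bounded self-adjoint operators with $$\mathcal{H}_{e}=\mathbbm{1}_{\{x_1>L\}}\mathcal{H}_{+}\mathbbm{1}_{\{x_1>L\}}+\mathbbm{1}_{\{x_1<-L\}}\mathcal{H}_{-}\mathbbm{1}_{\{x_1<-L\}}+\mathcal{H}_{\delta},$$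 where $\mathcal{H}_\delta$ is tight-binding on $H_{\mathcal{D}_e}$ and $|\mathcal{H}_{\delta}(\bm{x},\bm{y})|\le C_\nu e^{-\nu(|x_1|+|y_1|)}$ for some $\nu,C_\nu>0$ and all $\bm{x},\bm{y}\in\mathcal{D}_e$ ($\mathcal{H}_e$ enters this statement only through the number $b$ below). Assumptions: (i) $\mathcal{H}_{*}$, $*\in\{+,-,e,\delta\}$, are tight-binding with the same decay length $\lambda>0$, and $\nu=\lambda$; (ii) $\mathcal{H}_{\pm}(\bm{x}+\bm{n},\bm{y}+\bm{n})=\mathcal{H}_{\pm}(\bm{x},\bm{y})$ for all $\bm{n}\in\mathcal{D}_{\pm}$; (iii) there is an open interval $\Delta\subset\mathbb{R}$ with $\Delta\cap\mathrm{Spec}(\mathcal{H}_+)=\Delta\cap\mathrm{Spec}(\mathcal{H}_-)=\emptyset$ (common spectral gap). $R_{\pm}(z)=(\mathcal{H}_{\pm}-z)^{-1}$. Density function. $\rho\in C_c^\infty(\mathbb{R})$ with $\rho(x)=1$ for $x\in(b,\inf\Delta)$ and $\rho(x)=0$ for $x\in(\sup\Delta,+\infty)$, where $b=\inf\bigcup_{*\in\{+,-,e\}}\mathrm{Spec}(\mathcal{H}_* )$. An almost-analytic extension $\tilde\rho\in C_c^\infty(\mathbb{C})$ of $\rho$ satisfies $\tilde\rho|_{\mathbb{R}}=\rho$, for every $N>0$ there is $C_N$ with $|\partial_{\bar z}\tilde\rho|\le C_N|\mathrm{Im}\,z|^N$, and $\mathrm{supp}\,\tilde\rho\subset\{|\mathrm{Im}\,z|\le1\}$.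 $dm(z)$ is Lebesgue measure on $\mathbb{C}$. Switch functions. For $j\in\{1,2\}$, a switch function in the $x_j$-direction is a measurable $\Lambda_j:\mathbb{R}^2\to[0,1]$ depending only on $x_j$, with $\Lambda_j=1$ for $x_j>b_1$ and $\Lambda_j=0$ for $x_j<b_2$, for some reals $b_1>b_2$. Principal-value trace. For $a>0$, $n\in\mathbb{Z}$ let $\Omega_{n,a}=[na,(n+1)a)\times\mathbb{R}$. If each $\mathbbm{1}_{\Omega_{n,a}\cap\mathcal{D}}A$ is trace-class, $$Tr^{pv,1}_{a,\mathcal{D}}(A):=\lim_{N\to\infty}\sum_{n=-N}^{N-1}Tr_{\mathcal{D}}(\mathbbm{1}_{\Omega_{n,a}\cap\mathcal{D}}A)$$ whenever the limit exists.
   Formalization: The case b = inf Δ is excluded: there (b, inf Δ) is empty, so ρ is unconstrained at b, which may be a flat-band eigenvalue of the bulk Hamiltonians, and the conductance can then depend on ρ. *)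

theory Defs
  imports "HOL-Analysis.Analysis"
begin

section \<open>The Hilbert space of square-summable functions\<close>

typedef 'i ell2 = "{f :: 'i \<Rightarrow> complex. (\<lambda>i. (cmod (f i))\<^sup>2) summable_on UNIV}"
  morphisms ell2_fun Abs_ell2
  by (rule exI[of _ "\<lambda>_. 0"]) simp

setup_lifting type_definition_ell2

lemma ell2_eqI: "(\<And>i. ell2_fun x i = ell2_fun y i) \<Longrightarrow> x = y"
  by (simp add: ell2_fun_inject[symmetric] fun_eq_iff)

lemma ell2_summable: "(\<lambda>i. (cmod (ell2_fun x i))\<^sup>2) summable_on UNIV"
  using ell2_fun[of x] by simp

lemma square_summable_bound:
  fixes f :: "'i \<Rightarrow> complex"
  assumes "\<And>F. finite F \<Longrightarrow> L2_set (\<lambda>i. cmod (f i)) F \<le> B"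
  shows "(\<lambda>i. (cmod (f i))\<^sup>2) summable_on UNIV"
    and "sqrt (\<Sum>\<^sub>\<infinity>i. (cmod (f i))\<^sup>2) \<le> B"
proof -
  have B: "B \<ge> 0"
    using assms[of "{}"] by simp
  have fin: "(\<Sum>i\<in>F. (cmod (f i))\<^sup>2) \<le> B\<^sup>2" if "finite F" for F
    using assms[OF that] unfolding L2_set_def by (rule sqrt_le_D)
  show s: "(\<lambda>i. (cmod (f i))\<^sup>2) summable_on UNIV"
    by (rule nonneg_bdd_above_summable_on) (use fin in \<open>auto intro!: bdd_aboveI2\<close>)
  have "(\<Sum>\<^sub>\<infinity>i. (cmod (f i))\<^sup>2) \<le> B\<^sup>2"
    by (rule infsum_le_finite_sums[OF s fin])
  then show "sqrt (\<Sum>\<^sub>\<infinity>i. (cmod (f i))\<^sup>2) \<le> B"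
    using B by (simp add: real_le_lsqrt)
qed

lemma L2_set_le_of_summable:
  fixes f :: "'i \<Rightarrow> complex"
  assumes "(\<lambda>i. (cmod (f i))\<^sup>2) summable_on UNIV" and "finite F"
  shows "L2_set (\<lambda>i. cmod (f i)) F \<le> sqrt (\<Sum>\<^sub>\<infinity>i. (cmod (f i))\<^sup>2)"
  unfolding L2_set_def
  by (rule real_sqrt_le_mono, rule finite_sum_le_infsum[OF assms]) auto

lemma L2_set_add_le:
  fixes f g :: "'i \<Rightarrow> complex"
  shows "L2_set (\<lambda>i. cmod (f i + g i)) F \<le> L2_set (\<lambda>i. cmod (f i)) F + L2_set (\<lambda>i. cmod (g i)) F"
  by (rule order_trans[OF L2_set_mono L2_set_triangle_ineq]) (auto intro: norm_triangle_ineq)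

lemma square_summable_cmult:
  fixes f :: "'i \<Rightarrow> complex"
  assumes "(\<lambda>i. (cmod (f i))\<^sup>2) summable_on UNIV"
  shows "(\<lambda>i. (cmod (c * f i))\<^sup>2) summable_on UNIV"
  using summable_on_cmult_right[OF assms, of "(cmod c)\<^sup>2"]
  by (simp add: norm_mult power_mult_distrib)

instantiation ell2 :: (type) real_normed_vector
begin

lift_definition zero_ell2 :: "'a ell2" is "\<lambda>_. 0" by simp

lift_definition plus_ell2 :: "'a ell2 \<Rightarrow> 'a ell2 \<Rightarrow> 'a ell2" is "\<lambda>f g i. f i + g i"
proof -
  fix f g :: "'a \<Rightarrow> complex"
  assume f: "(\<lambda>i. (cmod (f i))\<^sup>2) summable_on UNIV" and g: "(\<lambda>i. (cmod (g i))\<^sup>2) summable_on UNIV"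
  show "(\<lambda>i. (cmod (f i + g i))\<^sup>2) summable_on UNIV"
    by (rule square_summable_bound(1))
      (rule order_trans[OF L2_set_add_le add_mono[OF L2_set_le_of_summable[OF f] L2_set_le_of_summable[OF g]]])
qed

lift_definition uminus_ell2 :: "'a ell2 \<Rightarrow> 'a ell2" is "\<lambda>f i. - f i" by simp

lift_definition scaleR_ell2 :: "real \<Rightarrow> 'a ell2 \<Rightarrow> 'a ell2" is "\<lambda>r f i. complex_of_real r * f i"
  by (rule square_summable_cmult)

definition minus_ell2 :: "'a ell2 \<Rightarrow> 'a ell2 \<Rightarrow> 'a ell2" where
  "minus_ell2 x y = x + - y"

definition norm_ell2 :: "'a ell2 \<Rightarrow> real" where
  "norm_ell2 x = sqrt (\<Sum>\<^sub>\<infinity>i. (cmod (ell2_fun x i))\<^sup>2)"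

definition sgn_ell2 :: "'a ell2 \<Rightarrow> 'a ell2" where
  "sgn_ell2 x = inverse (norm x) *\<^sub>R x"

definition dist_ell2 :: "'a ell2 \<Rightarrow> 'a ell2 \<Rightarrow> real" where
  "dist_ell2 x y = norm (x - y)"

definition uniformity_ell2 :: "('a ell2 \<times> 'a ell2) filter" where
  "uniformity_ell2 = (INF e\<in>{0 <..}. principal {(x, y). dist x y < e})"

definition open_ell2 :: "'a ell2 set \<Rightarrow> bool" where
  "open_ell2 U = (\<forall>x\<in>U. \<forall>\<^sub>F (x', y) in uniformity. x' = x \<longrightarrow> y \<in> U)"

instance
proof
  fix x y z :: "'a ell2" and a b :: real
  show "x + y + z = x + (y + z)"
    by (rule ell2_eqI) (simp only: plus_ell2.rep_eq add.assoc)
  show "x + y = y + x"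
    by (rule ell2_eqI) (simp only: plus_ell2.rep_eq add.commute)
  show "0 + x = x"
    by (rule ell2_eqI) (simp only: plus_ell2.rep_eq zero_ell2.rep_eq add_0)
  show "- x + x = 0"
    by (rule ell2_eqI) (simp only: plus_ell2.rep_eq zero_ell2.rep_eq uminus_ell2.rep_eq left_minus)
  show "x - y = x + - y"
    by (rule minus_ell2_def)
  show "a *\<^sub>R (x + y) = a *\<^sub>R x + a *\<^sub>R y"
    by (rule ell2_eqI) (simp only: plus_ell2.rep_eq scaleR_ell2.rep_eq distrib_left)
  show "(a + b) *\<^sub>R x = a *\<^sub>R x + b *\<^sub>R x"
    by (rule ell2_eqI) (simp only: plus_ell2.rep_eq scaleR_ell2.rep_eq of_real_add distrib_right)
  show "a *\<^sub>R b *\<^sub>R x = (a * b) *\<^sub>R x"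
    by (rule ell2_eqI) (simp only: scaleR_ell2.rep_eq of_real_mult mult.assoc)
  show "1 *\<^sub>R x = x"
    by (rule ell2_eqI) (simp only: scaleR_ell2.rep_eq of_real_1 mult_1)
  show "dist x y = norm (x - y)" "sgn x = inverse (norm x) *\<^sub>R x"
    by (rule dist_ell2_def, rule sgn_ell2_def)
  show "uniformity = (INF e\<in>{0 <..}. principal {(x, y :: 'a ell2). dist x y < e})"
    by (rule uniformity_ell2_def)
  show "open U = (\<forall>x\<in>U. \<forall>\<^sub>F (x', y) in uniformity. x' = x \<longrightarrow> y \<in> U)" for U :: "'a ell2 set"
    by (rule open_ell2_def)
  have "x = 0" if "norm x = 0"
  proof (rule ell2_eqI)
    fix i
    have "(cmod (ell2_fun x i))\<^sup>2 = 0"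
      using that nonneg_infsum_le_0D[OF _ ell2_summable[of x], of i]
      by (simp add: norm_ell2_def)
    then show "ell2_fun x i = ell2_fun 0 i"
      by (simp add: zero_ell2.rep_eq)
  qed
  then show "norm x = 0 \<longleftrightarrow> x = 0"
    by (auto simp: norm_ell2_def zero_ell2.rep_eq)
  have "L2_set (\<lambda>i. cmod (ell2_fun (x + y) i)) F \<le> norm x + norm y" if "finite F" for F
    using L2_set_add_le[of "ell2_fun x" "ell2_fun y" F]
      L2_set_le_of_summable[OF ell2_summable[of x] that] L2_set_le_of_summable[OF ell2_summable[of y] that]
    unfolding norm_ell2_def plus_ell2.rep_eq by linarith
  then show "norm (x + y) \<le> norm x + norm y"
    unfolding norm_ell2_def[of "x + y"] by (rule square_summable_bound(2))
  have "(\<Sum>\<^sub>\<infinity>i. (cmod (ell2_fun (a *\<^sub>R x) i))\<^sup>2) = (\<Sum>\<^sub>\<infinity>i. a\<^sup>2 * (cmod (ell2_fun x i))\<^sup>2)"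
    by (rule infsum_cong) (simp add: scaleR_ell2.rep_eq norm_mult power_mult_distrib)
  also have "\<dots> = a\<^sup>2 * (\<Sum>\<^sub>\<infinity>i. (cmod (ell2_fun x i))\<^sup>2)"
    by (rule infsum_cmult_right')
  finally show "norm (a *\<^sub>R x) = \<bar>a\<bar> * norm x"
    unfolding norm_ell2_def by (simp only: real_sqrt_mult real_sqrt_abs)
qed

end

lemma ell2_fun_simps [simp]:
  "ell2_fun 0 i = 0"
  "ell2_fun (x + y) i = ell2_fun x i + ell2_fun y i"
  "ell2_fun (- x) i = - ell2_fun x i"
  "ell2_fun (x - y) i = ell2_fun x i - ell2_fun y i"
  "ell2_fun (r *\<^sub>R x) i = complex_of_real r * ell2_fun x i"
  unfolding minus_ell2_def
  by (simp_all add: zero_ell2.rep_eq plus_ell2.rep_eq uminus_ell2.rep_eq scaleR_ell2.rep_eq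
      del: add_uminus_conv_diff)

lemma L2_set_le_norm_ell2: "finite F \<Longrightarrow> L2_set (\<lambda>i. cmod (ell2_fun x i)) F \<le> norm x"
  unfolding norm_ell2_def by (rule L2_set_le_of_summable[OF ell2_summable])

lemma cmod_ell2_le_norm: "cmod (ell2_fun x i) \<le> norm x"
  using L2_set_le_norm_ell2[of "{i}" x] by simp

instance ell2 :: (type) banach
proof
  fix X :: "nat \<Rightarrow> 'a ell2"
  assume X: "Cauchy X"
  have "Cauchy (\<lambda>n. ell2_fun (X n) i)" for i
  proof (rule CauchyI)
    fix e :: real assume "e > 0"
    with X obtain M where "\<forall>m\<ge>M. \<forall>n\<ge>M. norm (X m - X n) < e"
      by (meson CauchyD)
    moreover have "norm (ell2_fun (X m) i - ell2_fun (X n) i) \<le> norm (X m - X n)" for m n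
      using cmod_ell2_le_norm[of "X m - X n" i] by simp
    ultimately show "\<exists>M. \<forall>m\<ge>M. \<forall>n\<ge>M. norm (ell2_fun (X m) i - ell2_fun (X n) i) < e"
      by (meson order_le_less_trans)
  qed
  then have "\<exists>l. (\<lambda>n. ell2_fun (X n) i) \<longlonglongrightarrow> l" for i
    using Cauchy_convergent convergent_def by blast
  then obtain l where l: "\<And>i. (\<lambda>n. ell2_fun (X n) i) \<longlonglongrightarrow> l i"
    by metis
  have tail: "L2_set (\<lambda>i. cmod (l i - ell2_fun (X n) i)) F \<le> e"
    if "finite F" and le: "\<forall>m\<ge>M. norm (X m - X n) < e" for n F M e
  proof (rule tendsto_upperbound)
    show "(\<lambda>m. L2_set (\<lambda>i. cmod (ell2_fun (X m) i - ell2_fun (X n) i)) F)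
        \<longlonglongrightarrow> L2_set (\<lambda>i. cmod (l i - ell2_fun (X n) i)) F"
      unfolding L2_set_def by (intro tendsto_intros l)
    show "\<forall>\<^sub>F m in sequentially. L2_set (\<lambda>i. cmod (ell2_fun (X m) i - ell2_fun (X n) i)) F \<le> e"
      using eventually_ge_at_top[of M]
    proof eventually_elim
      case (elim m)
      show ?case
        using L2_set_le_norm_ell2[OF \<open>finite F\<close>, of "X m - X n"] le elim by force
    qed
  qed simp
  have cau: "\<exists>M. \<forall>n\<ge>M. \<forall>m\<ge>M. norm (X m - X n) < e" if "e > 0" for e
    using CauchyD[OF X that] by blast
  obtain N where N: "\<forall>m\<ge>N. norm (X m - X N) < 1"
    using cau[of 1] by force
  have "(\<lambda>i. (cmod (l i - ell2_fun (X N) i))\<^sup>2) summable_on UNIV"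
    by (rule square_summable_bound(1)[where B=1]) (rule tail[OF _ N])
  then have "ell2_fun (Abs_ell2 (\<lambda>i. l i - ell2_fun (X N) i)) = (\<lambda>i. l i - ell2_fun (X N) i)"
    by (simp add: Abs_ell2_inverse)
  then obtain d where d: "\<And>i. ell2_fun d i = l i - ell2_fun (X N) i"
    by metis
  define x where "x = d + X N"
  have x: "ell2_fun x i = l i" for i
    by (simp add: x_def d)
  have "X \<longlonglongrightarrow> x"
  proof (rule LIMSEQ_I)
    fix e :: real assume "e > 0"
    then obtain M where M: "\<forall>n\<ge>M. \<forall>m\<ge>M. norm (X m - X n) < e / 2"
      using cau[of "e / 2"] by auto
    have "norm (X n - x) < e" if "n \<ge> M" for n
    proof -
      have "norm (x - X n) \<le> e / 2"
        unfolding norm_ell2_def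
      proof (rule square_summable_bound(2))
        fix F :: "'a set" assume "finite F"
        have "\<forall>m\<ge>M. norm (X m - X n) < e / 2"
          using M that by blast
        from tail[OF \<open>finite F\<close> this] show "L2_set (\<lambda>i. cmod (ell2_fun (x - X n) i)) F \<le> e / 2"
          by (simp add: x)
      qed
      then show ?thesis
        using \<open>e > 0\<close> by (simp add: norm_minus_commute)
    qed
    then show "\<exists>M. \<forall>n\<ge>M. norm (X n - x) < e"
      by blast
  qed
  then show "convergent X"
    by (rule convergentI)
qed

definition cinner :: "'i ell2 \<Rightarrow> 'i ell2 \<Rightarrow> complex" where
  "cinner x y = (\<Sum>\<^sub>\<infinity>i. cnj (ell2_fun x i) * ell2_fun y i)"

lift_definition cscale :: "complex \<Rightarrow> 'i ell2 \<Rightarrow> 'i ell2" is "\<lambda>c f i. c * f i"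
  by (rule square_summable_cmult)

lift_definition ket :: "'i \<Rightarrow> 'i ell2" is "\<lambda>i j. if j = i then 1 else 0"
proof -
  fix i :: 'i
  have "(\<lambda>j. (cmod (if j = i then 1 else 0))\<^sup>2) summable_on {i}"
    by simp
  then show "(\<lambda>j. (cmod (if j = i then 1 else 0))\<^sup>2) summable_on UNIV"
    by (rule summable_on_cong_neutral[THEN iffD1, rotated -1]) auto
qed


section \<open>Operators\<close>

text \<open>Bounded operators are elements of \<open>'i ell2 \<Rightarrow>\<^sub>L 'i ell2\<close>, which carries the operator norm but
  only asks for real linearity; complex linearity is a separate requirement, see \<open>op_on\<close>.\<close>

type_synonym 'i bop = "'i ell2 \<Rightarrow>\<^sub>L 'i ell2"

text \<open>Multiplication by a function; only meaningful for bounded functions.\<close>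

definition mult_op :: "('i \<Rightarrow> complex) \<Rightarrow> 'i bop" where
  "mult_op g = Blinfun (\<lambda>x. Abs_ell2 (\<lambda>i. g i * ell2_fun x i))"

lemma mult_op_apply:
  assumes "\<And>i. cmod (g i) \<le> C"
  shows "ell2_fun (mult_op g x) i = g i * ell2_fun x i"
proof -
  have C: "C \<ge> 0"
    using assms norm_ge_zero order_trans by blast
  have bd: "L2_set (\<lambda>i. cmod (g i * ell2_fun x i)) F \<le> C * norm x" if "finite F" for x F
  proof -
    have "L2_set (\<lambda>i. cmod (g i * ell2_fun x i)) F \<le> L2_set (\<lambda>i. C * cmod (ell2_fun x i)) F"
      by (rule L2_set_mono) (auto simp: norm_mult intro!: mult_right_mono assms)
    also have "\<dots> = C * L2_set (\<lambda>i. cmod (ell2_fun x i)) F"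
      using C by (simp add: L2_set_right_distrib)
    also have "\<dots> \<le> C * norm x"
      using C L2_set_le_norm_ell2[OF that] by (simp add: mult_left_mono)
    finally show ?thesis .
  qed
  define T where "T = (\<lambda>x. Abs_ell2 (\<lambda>i. g i * ell2_fun x i))"
  have T: "ell2_fun (T x) i = g i * ell2_fun x i" for x i
    unfolding T_def by (subst Abs_ell2_inverse) (use square_summable_bound(1)[OF bd] in auto)
  have "bounded_linear T"
  proof (rule bounded_linear_intro)
    show "T (x + y) = T x + T y" "T (r *\<^sub>R x) = r *\<^sub>R T x" for x y r
      by (rule ell2_eqI; simp add: T algebra_simps)+
    show "norm (T x) \<le> norm x * C" for x
      using square_summable_bound(2)[OF bd, of x] by (simp add: norm_ell2_def T mult.commute)
  qed
  then show ?thesis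
    by (simp add: mult_op_def T_def[symmetric] bounded_linear_Blinfun_apply T)
qed

definition scale_op :: "complex \<Rightarrow> 'i bop \<Rightarrow> 'i bop" where
  "scale_op c A = mult_op (\<lambda>_. c) o\<^sub>L A"

lemma scale_op_apply: "scale_op c A x = cscale c (A x)"
  by (rule ell2_eqI) (simp add: scale_op_def mult_op_apply[of _ "cmod c"] cscale.rep_eq)

definition commutator :: "'i bop \<Rightarrow> 'i bop \<Rightarrow> 'i bop" where
  "commutator A B = (A o\<^sub>L B) - (B o\<^sub>L A)"

definition selfadjoint :: "'i bop \<Rightarrow> bool" where
  "selfadjoint A \<longleftrightarrow> (\<forall>x y. cinner (A x) y = cinner x (A y))"

text \<open>\<open>absolute_value A B\<close> says that \<open>B\<close> is the positive square root of the adjoint of \<open>A\<close> times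
  \<open>A\<close>; the equation for the square is tested against all pairs of vectors.\<close>

definition absolute_value :: "'i bop \<Rightarrow> 'i bop \<Rightarrow> bool" where
  "absolute_value A B \<longleftrightarrow>
     (\<forall>c x. B (cscale c x) = cscale c (B x)) \<and> selfadjoint B \<and> (\<forall>x. 0 \<le> Re (cinner x (B x))) \<and>
     (\<forall>x y. cinner x (B (B y)) = cinner (A x) (A y))"


section \<open>Lattice operators with spin\<close>

type_synonym plane = "real^2"

text \<open>The space \<open>H_D\<close> is the closed subspace of \<open>ell2\<close> over \<open>plane \<times> 2\<close> of the vectors supported on
  \<open>D \<times> UNIV\<close>, the second index being the spin. A bounded operator on \<open>H_D\<close> is extended by zero on the
  orthogonal complement; thus the identity of \<open>H_D\<close> is the projection \<open>id_on D\<close>, and inverses,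
  spectra and traces below are those of \<open>H_D\<close>, not of the ambient space.\<close>

type_synonym lop = "(plane \<times> 2) bop"

definition position_op :: "plane set \<Rightarrow> (plane \<Rightarrow> real) \<Rightarrow> lop" where
  "position_op D f = mult_op (\<lambda>(x, s). if x \<in> D then complex_of_real (f x) else 0)"

definition id_on :: "plane set \<Rightarrow> lop" where
  "id_on D = position_op D (\<lambda>_. 1)"

lemma position_op_apply:
  assumes "\<And>x. \<bar>f x\<bar> \<le> C"
  shows "ell2_fun (position_op D f u) (x, s) = (if x \<in> D then complex_of_real (f x) * ell2_fun u (x, s) else 0)"
proof -
  let ?g = "\<lambda>(x, s :: 2). if x \<in> D then complex_of_real (f x) else 0"
  have "cmod (?g i) \<le> max C 0" for i
    using assms[of "fst i"] by (auto split: prod.splits)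
  from mult_op_apply[of ?g, OF this, of u "(x, s)"] show ?thesis
    by (simp add: position_op_def)
qed

definition op_on :: "plane set \<Rightarrow> lop \<Rightarrow> bool" where
  "op_on D A \<longleftrightarrow> (\<forall>c x. A (cscale c x) = cscale c (A x)) \<and> id_on D o\<^sub>L A o\<^sub>L id_on D = A"

definition pauli_z :: "complex^2^2" where
  "pauli_z = vector [vector [1, 0], vector [0, - 1]]"

text \<open>The spin operator is diagonal in the basis of the \<open>ket (x, s)\<close>, with the diagonal entries of
  \<open>pauli_z / 2\<close> as eigenvalues.\<close>

definition spin_op :: "plane set \<Rightarrow> lop" where
  "spin_op D = mult_op (\<lambda>(x, s). if x \<in> D then pauli_z $ s $ s / 2 else 0)"

lemma spin_op_apply:
  "ell2_fun (spin_op D u) (x, s) =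
     (if x \<in> D then (if s = 1 then 1 / 2 else - 1 / 2) * ell2_fun u (x, s) else 0)"
proof -
  have s: "pauli_z $ s $ s = (if s = 1 then 1 else - 1)" for s :: 2
    using exhaust_2[of s] by (auto simp: pauli_z_def)
  let ?g = "\<lambda>(x :: plane, s). if x \<in> D then pauli_z $ s $ s / 2 else 0"
  have "cmod (?g i) \<le> 1" for i
    by (auto simp: s split: prod.splits)
  from mult_op_apply[of ?g, OF this, of u "(x, s)"] show ?thesis
    by (simp add: spin_op_def s)
qed

definition op_kernel :: "lop \<Rightarrow> plane \<Rightarrow> plane \<Rightarrow> complex^2^2" where
  "op_kernel A x y = (\<chi> s t. ell2_fun (A (ket (y, t))) (x, s))"

definition norm1 :: "plane \<Rightarrow> real" where
  "norm1 x = \<bar>x $ 1\<bar> + \<bar>x $ 2\<bar>"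

definition tight_binding :: "plane set \<Rightarrow> real \<Rightarrow> lop \<Rightarrow> bool" where
  "tight_binding D lam A \<longleftrightarrow> op_on D A \<and> lam > 0 \<and>
     (\<exists>C>0. \<forall>x\<in>D. \<forall>y\<in>D. norm (op_kernel A x y) \<le> C * exp (- lam * norm1 (x - y)))"

definition inverse_on :: "plane set \<Rightarrow> lop \<Rightarrow> lop \<Rightarrow> bool" where
  "inverse_on D A B \<longleftrightarrow> op_on D B \<and> A o\<^sub>L B = id_on D \<and> B o\<^sub>L A = id_on D"

definition spectrum :: "plane set \<Rightarrow> lop \<Rightarrow> complex set" where
  "spectrum D H = {z. \<nexists>R. inverse_on D (H - scale_op z (id_on D)) R}"

definition resolvent :: "plane set \<Rightarrow> lop \<Rightarrow> complex \<Rightarrow> lop" where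
  "resolvent D H z = (THE R. inverse_on D (H - scale_op z (id_on D)) R)"

lemma resolvent_eqI:
  assumes "inverse_on D (H - scale_op z (id_on D)) R"
  shows "resolvent D H z = R"
  unfolding resolvent_def
proof (rule the_equality)
  show "inverse_on D (H - scale_op z (id_on D)) R"
    by (rule assms)
next
  fix R' assume R': "inverse_on D (H - scale_op z (id_on D)) R'"
  let ?K = "H - scale_op z (id_on D)"
  have id: "id_on D (id_on D u) = id_on D u" for u
    by (rule ell2_eqI) (auto simp: id_on_def position_op_apply[of _ 1])
  have lr: "id_on D (B u) = B u \<and> B (id_on D u) = B u" if "op_on D B" for B u
  proof -
    have B: "B u = id_on D (B (id_on D u))" for u
      using that by (metis blinfun_apply_blinfun_compose op_on_def)
    show ?thesis
      by (subst (2 4) B, subst (1 3) B) (simp only: id)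
  qed
  have op: "op_on D R" "op_on D R'" and inv: "?K o\<^sub>L R = id_on D" "R' o\<^sub>L ?K = id_on D"
    using assms R' by (simp_all only: inverse_on_def)
  have "R' = R' o\<^sub>L (?K o\<^sub>L R)"
    unfolding inv by (rule blinfun_eqI) (simp only: blinfun_apply_blinfun_compose lr[OF op(2)])
  also have "\<dots> = (R' o\<^sub>L ?K) o\<^sub>L R"
    by (rule blinfun_eqI) (simp only: blinfun_apply_blinfun_compose)
  also have "\<dots> = R"
    unfolding inv by (rule blinfun_eqI) (simp only: blinfun_apply_blinfun_compose lr[OF op(1)])
  finally show "R' = R" .
qed

definition trace_class :: "plane set \<Rightarrow> lop \<Rightarrow> bool" where
  "trace_class D A \<longleftrightarrow> op_on D A \<and>
     (\<exists>B. absolute_value A B \<and> (\<lambda>i. Re (cinner (ket i) (B (ket i)))) summable_on D \<times> UNIV)"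

definition op_trace :: "plane set \<Rightarrow> lop \<Rightarrow> complex" where
  "op_trace D A = (\<Sum>\<^sub>\<infinity>i\<in>D \<times> UNIV. cinner (ket i) (A (ket i)))"

definition strip :: "int \<Rightarrow> real \<Rightarrow> plane set" where
  "strip n a = {x. of_int n * a \<le> x $ 1 \<and> x $ 1 < (of_int n + 1) * a}"

definition strip_op :: "plane set \<Rightarrow> real \<Rightarrow> int \<Rightarrow> lop \<Rightarrow> lop" where
  "strip_op D a n A = position_op D (indicator (strip n a)) o\<^sub>L A"

definition pv_trace_exists :: "real \<Rightarrow> plane set \<Rightarrow> lop \<Rightarrow> bool" where
  "pv_trace_exists a D A \<longleftrightarrow> (\<forall>n. trace_class D (strip_op D a n A)) \<and>
     convergent (\<lambda>N. \<Sum>n = - int N..int N - 1. op_trace D (strip_op D a n A))"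

definition pv_trace :: "real \<Rightarrow> plane set \<Rightarrow> lop \<Rightarrow> complex" where
  "pv_trace a D A = lim (\<lambda>N. \<Sum>n = - int N..int N - 1. op_trace D (strip_op D a n A))"


section \<open>Density functions and switch functions\<close>

primrec C_times :: "nat \<Rightarrow> ('a::euclidean_space \<Rightarrow> complex) \<Rightarrow> bool" where
  "C_times 0 f \<longleftrightarrow> continuous_on UNIV f"
| "C_times (Suc n) f \<longleftrightarrow>
     (\<forall>x. f differentiable (at x)) \<and> (\<forall>v. C_times n (\<lambda>x. frechet_derivative f (at x) v))"

definition test_function :: "('a::euclidean_space \<Rightarrow> complex) \<Rightarrow> bool" where
  "test_function f \<longleftrightarrow> (\<forall>n. C_times n f) \<and> compact (closure {x. f x \<noteq> 0})"

definition dbar :: "(complex \<Rightarrow> complex) \<Rightarrow> complex \<Rightarrow> complex" where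
  "dbar f z = (frechet_derivative f (at z) 1 + \<i> * frechet_derivative f (at z) \<i>) / 2"

definition almost_analytic_extension :: "(real \<Rightarrow> complex) \<Rightarrow> (complex \<Rightarrow> complex) \<Rightarrow> bool" where
  "almost_analytic_extension \<rho> \<rho>' \<longleftrightarrow>
     test_function \<rho>' \<and> (\<forall>x. \<rho>' (complex_of_real x) = \<rho> x) \<and>
     (\<forall>N>0. \<exists>C. \<forall>z. cmod (dbar \<rho>' z) \<le> C * \<bar>Im z\<bar> ^ N) \<and>
     closure {z. \<rho>' z \<noteq> 0} \<subseteq> {z. \<bar>Im z\<bar> \<le> 1}"

text \<open>The endpoints of the gap are taken in the extended reals, so that the gap may be unbounded. If
  \<open>b\<close> equals the lower endpoint, the second clause is void and \<open>\<rho> b\<close> is unconstrained although \<open>b\<close> may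
  be a spectral value; this degenerate case has to be excluded where density functions are used.\<close>

definition density_function :: "real \<Rightarrow> real set \<Rightarrow> (real \<Rightarrow> complex) \<Rightarrow> bool" where
  "density_function b \<Delta> \<rho> \<longleftrightarrow> test_function \<rho> \<and>
     (\<forall>x. b < x \<and> ereal x < (INF d\<in>\<Delta>. ereal d) \<longrightarrow> \<rho> x = 1) \<and>
     (\<forall>x. (SUP d\<in>\<Delta>. ereal d) < ereal x \<longrightarrow> \<rho> x = 0)"

definition switch_function :: "2 \<Rightarrow> (plane \<Rightarrow> real) \<Rightarrow> bool" where
  "switch_function j \<Lambda> \<longleftrightarrow> \<Lambda> \<in> borel_measurable borel \<and> range \<Lambda> \<subseteq> {0..1} \<and>
     (\<forall>x y. x $ j = y $ j \<longrightarrow> \<Lambda> x = \<Lambda> y) \<and>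
     (\<exists>b1 b2. b1 > b2 \<and> (\<forall>x. x $ j > b1 \<longrightarrow> \<Lambda> x = 1) \<and> (\<forall>x. x $ j < b2 \<longrightarrow> \<Lambda> x = 0))"


section \<open>Bulk Hamiltonians and the bulk spin conductance\<close>

datatype side = Plus | Minus

definition bulk_lattice :: "nat \<Rightarrow> nat \<Rightarrow> plane set" where
  "bulk_lattice a1 a2 = {of_int m *\<^sub>R (real a1 *\<^sub>R axis 1 1) + of_int n *\<^sub>R (real a2 *\<^sub>R axis 2 1) | m n :: int. True}"

definition translation_invariant :: "plane set \<Rightarrow> lop \<Rightarrow> bool" where
  "translation_invariant D H \<longleftrightarrow>
     (\<forall>n\<in>D. \<forall>x\<in>D. \<forall>y\<in>D. op_kernel H (x + n) (y + n) = op_kernel H x y)"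

definition spin_integrand ::
  "plane set \<Rightarrow> lop \<Rightarrow> (complex \<Rightarrow> complex) \<Rightarrow> (plane \<Rightarrow> real) \<Rightarrow> (plane \<Rightarrow> real) \<Rightarrow> complex \<Rightarrow> lop" where
  "spin_integrand D H \<rho>' \<Lambda>2 \<Lambda>1 z =
     (let R = resolvent D H z;
          A = commutator H (position_op D \<Lambda>2);
          B = commutator H (position_op D \<Lambda>1 o\<^sub>L spin_op D)
      in scale_op (dbar \<rho>' z) ((R o\<^sub>L A o\<^sub>L R o\<^sub>L B o\<^sub>L R) - (R o\<^sub>L B o\<^sub>L R o\<^sub>L A o\<^sub>L R)))"

text \<open>The integral is taken in the operator norm. On the real axis, where the resolvent need not
  exist, the factor \<open>dbar \<rho>'\<close> vanishes.\<close>

definition spin_Sigma ::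
  "plane set \<Rightarrow> lop \<Rightarrow> (complex \<Rightarrow> complex) \<Rightarrow> (plane \<Rightarrow> real) \<Rightarrow> (plane \<Rightarrow> real) \<Rightarrow> lop" where
  "spin_Sigma D H \<rho>' \<Lambda>2 \<Lambda>1 = integral UNIV (spin_integrand D H \<rho>' \<Lambda>2 \<Lambda>1)"

definition bulk_spin_conductance ::
  "nat \<Rightarrow> nat \<Rightarrow> lop \<Rightarrow> (plane \<Rightarrow> real) \<Rightarrow> (plane \<Rightarrow> real) \<Rightarrow> (complex \<Rightarrow> complex) \<Rightarrow> nat \<Rightarrow> complex" where
  "bulk_spin_conductance a1 a2 H \<Lambda>2 \<Lambda>1 \<rho>' k =
     1 / (2 * complex_of_real pi) *
     pv_trace (real (k * a1)) (bulk_lattice a1 a2) (spin_Sigma (bulk_lattice a1 a2) H \<rho>' \<Lambda>2 \<Lambda>1)"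

end

theory Submission
  imports Defs "HOL-Complex_Analysis.Complex_Analysis" "HOL-Real_Asymp.Real_Asymp"
begin

text \<open>Since \<open>R [H, G] R = [G, R]\<close> for the resolvent \<open>R\<close>, the integrand is
  \<open>\<partial>\<rho>' (R A [G, R] - [G, R] A R)\<close> with \<open>A = [H, \<Lambda>\<^sub>2]\<close> and \<open>G = \<Lambda>\<^sub>1 S\<close>. Its second factor is
  holomorphic off the spectrum and decays like \<open>|z|\<^sup>-\<^sup>2\<close>, so by Green's formula the integral is \<open>-1/2\<close> times the
  integral over a vertical line through the gap, whatever the density function: \<open>\<rho>' - 1\<close> and \<open>\<rho>'\<close> are flat
  at the spectrum on the two sides of the gap. On this line the Combes-Thomas estimate applies, and a diagonal entry of
  the integral becomes \<open>\<Sum>j. G j * k i j\<close> with a kernel \<open>k\<close> that decays exponentially in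
  \<open>|i - j|\<close> and away from the \<open>x\<^sub>1\<close>-axis, is invariant under the translations in the \<open>x\<^sub>1\<close>-direction
  and satisfies \<open>(\<Sum>i. k i j) = 0\<close>. Writing \<open>\<kappa> l\<close> for the sum of the entries of \<open>k\<close>, weighted by spin,
  between two columns of sites at distance \<open>l\<close>, the traces over symmetric strips tend to \<open>- (\<Sum>l. l * \<kappa> l)\<close>,
  which contains neither \<open>\<Lambda>\<^sub>1\<close> nor the width of the strips.\<close>

section \<open>Square-summable functions and matrix entries\<close>

text \<open>Two obstacles shape the proof. The density function is prescribed on open intervals
  only, while the spectrum may reach their end points. Green's formula is therefore applied to
  products extended by zero across the spectrum. They are C1 there because
  \<open>\<rho>' - 1\<close> and \<open>\<rho>'\<close> vanish to order 5 on the closed intervals,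
  whereas the holomorphic factor has a singularity of order at most 2 in the distance to the
  spectrum. Secondly, single strips have absolutely convergent traces, but the sum over the strips
  converges by a cancellation, the zero column sums of the kernel. They hold because a column sum on
  the line is a diagonal entry of \<open>R R A + A R R\<close>, the \<open>z\<close>-derivative of
  \<open>R A + A R\<close>, which decays at both ends. The kernel arises because
  \<open>R A R = [\<Lambda>, R]\<close>, with \<open>\<Lambda>\<close> the switch in
  \<open>A\<close>, has zero diagonal: this removes the two terms with \<open>G\<close> outermost
  and leaves those in which \<open>G\<close> stands between two operators. Two resolvents remain in
  every term, each bounded on the line by \<open>1 / sqrt (g\<^sup>2 + t\<^sup>2)\<close>, so the
  integral over \<open>t\<close> converges.\<close>

lemma ell2_fun_ket [simp]: "ell2_fun (ket i) j = (if j = i then 1 else 0)"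
  by (simp add: ket.rep_eq)

lemma ell2_fun_cscale [simp]: "ell2_fun (cscale c x) i = c * ell2_fun x i"
  by (simp add: cscale.rep_eq)

lemma norm_ell2_power2: "(norm x)\<^sup>2 = (\<Sum>\<^sub>\<infinity>i. (cmod (ell2_fun x i))\<^sup>2)"
  unfolding norm_ell2_def by (intro real_sqrt_pow2 infsum_nonneg) auto

lemma has_sum_norm_ell2_power2: "((\<lambda>i. (cmod (ell2_fun x i))\<^sup>2) has_sum (norm x)\<^sup>2) UNIV"
  unfolding norm_ell2_power2 using ell2_summable by (rule has_sum_infsum)

lemma norm_ket [simp]: "norm (ket i) = 1"
proof -
  have "((\<lambda>j. (cmod (ell2_fun (ket i) j))\<^sup>2) has_sum 1) {i}"
    using has_sum_finite[of "{i}" "\<lambda>j. (cmod (ell2_fun (ket i) j))\<^sup>2"] by simp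
  then have "((\<lambda>j. (cmod (ell2_fun (ket i) j))\<^sup>2) has_sum 1) UNIV"
    by (rule has_sum_cong_neutral[THEN iffD1, rotated -1]) auto
  then have "(norm (ket i))\<^sup>2 = 1"
    using has_sum_norm_ell2_power2 has_sum_unique by blast
  then show ?thesis
    using norm_ge_zero[of "ket i"] by (simp add: power2_eq_1_iff)
qed

lemma norm_cscale: "norm (cscale c x) = cmod c * norm x"
proof -
  have "((\<lambda>i. (cmod c)\<^sup>2 * (cmod (ell2_fun x i))\<^sup>2) has_sum (cmod c)\<^sup>2 * (norm x)\<^sup>2) UNIV"
    by (rule has_sum_cmult_right[OF has_sum_norm_ell2_power2])
  then have "(norm (cscale c x))\<^sup>2 = (cmod c * norm x)\<^sup>2"
    using has_sum_unique[OF has_sum_norm_ell2_power2[of "cscale c x"]]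
    by (simp add: norm_mult power_mult_distrib)
  then show ?thesis
    by simp
qed

lemma cscale_simps [simp]:
  "cscale c (x + y) = cscale c x + cscale c y" "cscale c (x - y) = cscale c x - cscale c y"
  "cscale (c + d) x = cscale c x + cscale d x" "cscale (c - d) x = cscale c x - cscale d x"
  "cscale c (cscale d x) = cscale (c * d) x" "cscale 1 x = x" "cscale 0 x = 0" "cscale c 0 = 0"
  "cscale c (- x) = - cscale c x"
  by (rule ell2_eqI; simp add: algebra_simps)+

lemma bounded_linear_ell2_fun: "bounded_linear (\<lambda>x. ell2_fun x i)"
  by (rule bounded_linear_intro[where K=1]) (auto simp: cmod_ell2_le_norm scaleR_conv_of_real)

lemma bounded_bilinear_cscale: "bounded_bilinear cscale"
proof (unfold_locales, goal_cases)
  case (3 r a b) show ?case by (rule ell2_eqI) (simp add: scaleR_conv_of_real)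
next
  case (4 a r b) show ?case by (rule ell2_eqI) simp
next
  case 5 show ?case by (rule exI[of _ 1]) (simp add: norm_cscale)
qed simp_all

lemma ell2_fun_sum: "ell2_fun (sum f F) i = (\<Sum>k\<in>F. ell2_fun (f k) i)"
  by (induction F rule: infinite_finite_induct) auto

lemma ell2_fun_truncation:
  "finite F \<Longrightarrow> ell2_fun (\<Sum>j\<in>F. cscale (ell2_fun x j) (ket j)) i = (if i \<in> F then ell2_fun x i else 0)"
  by (simp add: ell2_fun_sum if_distrib cong: if_cong)

text \<open>The squared norm of the remainder after a finite \<open>F\<close> is
  \<open>(norm x)\<^sup>2\<close> minus the partial sum of squares. Bounded complex linear maps are
  thereby determined by their entries.\<close>

lemma ket_expansion: "((\<lambda>i. cscale (ell2_fun x i) (ket i)) has_sum x) UNIV"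
  unfolding has_sum_def
proof (rule tendstoI)
  fix e :: real assume "e > 0"
  have finF: "\<forall>\<^sub>F F in finite_subsets_at_top (UNIV :: 'a set). finite F"
    by (rule eventually_finite_subsets_at_top_weakI)
  have lim: "((\<lambda>F. \<Sum>i\<in>F. (cmod (ell2_fun x i))\<^sup>2) \<longlongrightarrow> (norm x)\<^sup>2) (finite_subsets_at_top UNIV)"
    using has_sum_norm_ell2_power2 by (simp add: has_sum_def)
  have "\<forall>\<^sub>F F in finite_subsets_at_top UNIV. dist (\<Sum>i\<in>F. (cmod (ell2_fun x i))\<^sup>2) ((norm x)\<^sup>2) < e\<^sup>2"
    by (rule tendstoD[OF lim]) (use \<open>e > 0\<close> in simp)
  then show "\<forall>\<^sub>F F in finite_subsets_at_top UNIV. dist (\<Sum>i\<in>F. cscale (ell2_fun x i) (ket i)) x < e"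
    using finF
  proof eventually_elim
    case (elim F)
    let ?d = "x - (\<Sum>j\<in>F. cscale (ell2_fun x j) (ket j))"
    have d: "ell2_fun ?d i = (if i \<in> F then 0 else ell2_fun x i)" for i
      using elim by (simp add: ell2_fun_truncation)
    have 1: "((\<lambda>i. (cmod (ell2_fun x i))\<^sup>2) has_sum ((norm x)\<^sup>2 - (\<Sum>i\<in>F. (cmod (ell2_fun x i))\<^sup>2))) (UNIV - F)"
      by (rule has_sum_Diff[OF has_sum_norm_ell2_power2 has_sum_finite]) (use elim in auto)
    have "((\<lambda>i. (cmod (ell2_fun ?d i))\<^sup>2) has_sum ((norm x)\<^sup>2 - (\<Sum>i\<in>F. (cmod (ell2_fun x i))\<^sup>2))) UNIV"
      by (rule has_sum_cong_neutral[THEN iffD1, OF _ _ _ 1]) (auto simp only: d if_True if_False, auto)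
    then have "(norm ?d)\<^sup>2 = (norm x)\<^sup>2 - (\<Sum>i\<in>F. (cmod (ell2_fun x i))\<^sup>2)"
      using has_sum_unique has_sum_norm_ell2_power2 by blast
    also have "\<dots> < e\<^sup>2"
      using elim by (simp add: dist_real_def)
    finally have "norm ?d < e"
      using \<open>e > 0\<close> by (meson less_imp_le power2_less_imp_less)
    then show ?case
      by (simp add: dist_norm norm_minus_commute)
  qed
qed

definition complex_linear :: "'i bop \<Rightarrow> bool" where
  "complex_linear A \<longleftrightarrow> (\<forall>c x. A (cscale c x) = cscale c (A x))"

text \<open>Row index first. \<open>op_kernel\<close> collects these scalars into 2 by 2 blocks; all
  estimates below are made on the scalars.\<close>

definition ent :: "'i bop \<Rightarrow> 'i \<Rightarrow> 'i \<Rightarrow> complex" where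
  "ent A i j = ell2_fun (A (ket j)) i"

lemma complex_linearD: "complex_linear A \<Longrightarrow> A (cscale c x) = cscale c (A x)"
  by (simp add: complex_linear_def)

lemma complex_linear_add [intro]: "complex_linear A \<Longrightarrow> complex_linear B \<Longrightarrow> complex_linear (A + B)"
  and complex_linear_diff [intro]: "complex_linear A \<Longrightarrow> complex_linear B \<Longrightarrow> complex_linear (A - B)"
  and complex_linear_compose [intro]: "complex_linear A \<Longrightarrow> complex_linear B \<Longrightarrow> complex_linear (A o\<^sub>L B)"
  and complex_linear_scale_op [intro]: "complex_linear A \<Longrightarrow> complex_linear (scale_op c A)"
  and complex_linear_scaleR [intro]: "complex_linear A \<Longrightarrow> complex_linear (r *\<^sub>R A)"
  and complex_linear_id [intro, simp]: "complex_linear id_blinfun"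
  and complex_linear_0 [intro, simp]: "complex_linear 0"
       apply (simp_all add: complex_linear_def blinfun.add_left blinfun.diff_left blinfun.scaleR_left scale_op_apply mult.commute)
  apply (auto intro!: ell2_eqI simp: algebra_simps)
  done

lemma ent_simps [simp]:
  "ent (A + B) i j = ent A i j + ent B i j" "ent (A - B) i j = ent A i j - ent B i j"
  "ent (scale_op c A) i j = c * ent A i j" "ent 0 i j = 0"
  "ent id_blinfun i j = (if i = j then 1 else 0)"
  "ent (r *\<^sub>R A) i j = complex_of_real r * ent A i j"
  by (simp_all add: ent_def blinfun.add_left blinfun.diff_left scale_op_apply blinfun.scaleR_left)

lemma cmod_ent_le: "cmod (ent A i j) \<le> norm A"
  using order_trans[OF cmod_ell2_le_norm norm_blinfun, of A "ket j" i] by (simp add: ent_def)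

lemma bounded_linear_ent: "bounded_linear (\<lambda>A. ent A i j)"
  unfolding ent_def
  by (rule bounded_linear_compose[OF bounded_linear_ell2_fun blinfun.bounded_linear_left])

lemma has_sum_apply_ket:
  assumes "complex_linear A"
  shows "((\<lambda>j. ent A i j * ell2_fun x j) has_sum ell2_fun (A x) i) UNIV"
proof -
  have "bounded_linear (\<lambda>x. ell2_fun (A x) i)"
    by (rule bounded_linear_compose[OF bounded_linear_ell2_fun blinfun.bounded_linear_right])
  from has_sum_bounded_linear[OF this ket_expansion[of x]] show ?thesis
    by (simp add: o_def ent_def complex_linearD[OF assms] mult.commute)
qed

lemma complex_linear_eqI:
  assumes "complex_linear A" "complex_linear B" "\<And>i j. ent A i j = ent B i j"
  shows "A = B"
proof (rule blinfun_eqI, rule ell2_eqI)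
  fix x i
  show "ell2_fun (A x) i = ell2_fun (B x) i"
    using has_sum_unique[OF has_sum_apply_ket[OF assms(1), of i x]] has_sum_apply_ket[OF assms(2), of i x]
    by (simp add: assms(3))
qed

lemma has_sum_ent_compose:
  "complex_linear A \<Longrightarrow> ((\<lambda>k. ent A i k * ent B k j) has_sum ent (A o\<^sub>L B) i j) UNIV"
  using has_sum_apply_ket[of A i "B (ket j)"] by (simp add: ent_def)

lemma complex_linear_mult_op [intro]:
  assumes "\<And>i. cmod (g i) \<le> C" shows "complex_linear (mult_op g)"
  unfolding complex_linear_def by (auto intro!: ell2_eqI simp: mult_op_apply[OF assms])

lemma ent_mult_op: 
  assumes "\<And>i. cmod (g i) \<le> C"
  shows "ent (mult_op g) i j = (if i = j then g i else 0)"
    and "ent (mult_op g o\<^sub>L A) i j = g i * ent A i j"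
    and "complex_linear A \<Longrightarrow> ent (A o\<^sub>L mult_op g) i j = ent A i j * g j"
proof -
  show "ent (mult_op g) i j = (if i = j then g i else 0)" "ent (mult_op g o\<^sub>L A) i j = g i * ent A i j"
    by (simp_all add: ent_def mult_op_apply[OF assms])
  have "mult_op g (ket j) = cscale (g j) (ket j)"
    by (rule ell2_eqI) (simp add: mult_op_apply[OF assms])
  then show "complex_linear A \<Longrightarrow> ent (A o\<^sub>L mult_op g) i j = ent A i j * g j"
    by (simp add: ent_def complex_linearD)
qed

lemma norm_mult_op_le:
  assumes "\<And>i. cmod (g i) \<le> C"
  shows "norm (mult_op g) \<le> C"
proof (rule norm_blinfun_bound)
  show C: "C \<ge> 0"
    using assms norm_ge_zero order_trans by blast
  fix x
  have "norm (mult_op g x) \<le> norm (cscale (of_real C) x)"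
    unfolding norm_ell2_def[of "mult_op g x"]
  proof (rule square_summable_bound(2))
    fix F :: "'a set" assume "finite F"
    have "L2_set (\<lambda>i. cmod (ell2_fun (mult_op g x) i)) F
        \<le> L2_set (\<lambda>i. cmod (ell2_fun (cscale (of_real C) x) i)) F"
      using C assms by (intro L2_set_mono) (auto simp: mult_op_apply[OF assms] norm_mult mult_right_mono)
    also have "\<dots> \<le> norm (cscale (of_real C) x)"
      by (rule L2_set_le_norm_ell2[OF \<open>finite F\<close>])
    finally show "L2_set (\<lambda>i. cmod (ell2_fun (mult_op g x) i)) F \<le> norm (cscale (of_real C) x)" .
  qed
  then show "norm (mult_op g x) \<le> C * norm x"
    using C by (simp add: norm_cscale)
qed

lemma norm_scale_op: "norm (scale_op c A) = cmod c * norm A"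
proof -
  have le: "norm (scale_op c A) \<le> cmod c * norm A" for c and A :: "'a bop"
    by (rule norm_blinfun_bound) (auto simp: scale_op_apply norm_cscale mult.assoc intro!: mult_left_mono norm_blinfun)
  show ?thesis
  proof (cases "c = 0")
    case False
    have "scale_op (inverse c) (scale_op c A) = A"
      using False by (intro blinfun_eqI) (simp add: scale_op_apply)
    then have "norm A \<le> cmod (inverse c) * norm (scale_op c A)"
      using le[of "inverse c" "scale_op c A"] by simp
    then show ?thesis
      using le[of c A] False by (intro antisym) (simp_all add: norm_inverse norm_divide field_simps)
  qed (use le[of 0 A] in simp)
qed

lemma bounded_bilinear_scale_op: "bounded_bilinear scale_op"
proof (unfold_locales, goal_cases)
  case (3 r a b) show ?case
    by (rule blinfun_eqI, rule ell2_eqI) (simp add: scale_op_apply blinfun.scaleR_left scaleR_conv_of_real)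
next
  case (4 a r b) show ?case
    by (rule blinfun_eqI, rule ell2_eqI) (simp add: scale_op_apply blinfun.scaleR_left)
next
  case 5 show ?case by (rule exI[of _ 1]) (simp add: norm_scale_op)
qed (rule blinfun_eqI, simp add: scale_op_apply blinfun.add_left)+

lemma scale_op_compose:
  "scale_op c A o\<^sub>L B = scale_op c (A o\<^sub>L B)"
  "complex_linear A \<Longrightarrow> A o\<^sub>L scale_op c B = scale_op c (A o\<^sub>L B)"
  by (rule blinfun_eqI; simp add: scale_op_apply complex_linearD)+

lemma scale_op_simps [simp]:
  "scale_op c (scale_op d A) = scale_op (c * d) A" "scale_op 1 A = A" "scale_op 0 A = 0"
  by (rule blinfun_eqI; simp add: scale_op_apply)+

lemma compose_simps:
  "(A + B) o\<^sub>L C = (A o\<^sub>L C) + (B o\<^sub>L C)" "C o\<^sub>L (A + B) = (C o\<^sub>L A) + (C o\<^sub>L B)"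
  "(A - B) o\<^sub>L C = (A o\<^sub>L C) - (B o\<^sub>L C)" "C o\<^sub>L (A - B) = (C o\<^sub>L A) - (C o\<^sub>L B)"
  by (rule blinfun_eqI; simp add: blinfun.add_left blinfun.diff_left blinfun.add_right blinfun.diff_right)+

lemma compose_assoc: "(A o\<^sub>L B) o\<^sub>L C = A o\<^sub>L (B o\<^sub>L C)"
  by (rule blinfun_eqI) simp

lemma compose_id [simp]: "A o\<^sub>L id_blinfun = A" "id_blinfun o\<^sub>L A = A"
  by (rule blinfun_eqI; simp)+

section \<open>The inner product\<close>

lemma cinner_abs_summable:
  "(\<lambda>i. cmod (cnj (ell2_fun x i) * ell2_fun y i)) summable_on UNIV"
  and cinner_abs_bound: "(\<Sum>\<^sub>\<infinity>i. cmod (cnj (ell2_fun x i) * ell2_fun y i)) \<le> norm x * norm y"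
proof -
  have fin: "(\<Sum>i\<in>F. cmod (cnj (ell2_fun x i) * ell2_fun y i)) \<le> norm x * norm y" if "finite F" for F
  proof -
    have "(\<Sum>i\<in>F. cmod (cnj (ell2_fun x i) * ell2_fun y i))
        \<le> L2_set (\<lambda>i. cmod (ell2_fun x i)) F * L2_set (\<lambda>i. cmod (ell2_fun y i)) F"
      using L2_set_mult_ineq[of "\<lambda>i. cmod (ell2_fun x i)" "\<lambda>i. cmod (ell2_fun y i)" F] by (simp add: norm_mult)
    also have "\<dots> \<le> norm x * norm y"
      using that by (intro mult_mono L2_set_le_norm_ell2) auto
    finally show ?thesis .
  qed
  show s: "(\<lambda>i. cmod (cnj (ell2_fun x i) * ell2_fun y i)) summable_on UNIV"
    by (rule nonneg_bdd_above_summable_on) (use fin in \<open>auto intro!: bdd_aboveI2\<close>)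
  show "(\<Sum>\<^sub>\<infinity>i. cmod (cnj (ell2_fun x i) * ell2_fun y i)) \<le> norm x * norm y"
    by (rule infsum_le_finite_sums[OF s fin])
qed

lemma cinner_has_sum: "((\<lambda>i. cnj (ell2_fun x i) * ell2_fun y i) has_sum cinner x y) UNIV"
  unfolding cinner_def using abs_summable_summable[OF cinner_abs_summable] by (rule has_sum_infsum)

lemma cmod_cinner_le: "cmod (cinner x y) \<le> norm x * norm y"
  unfolding cinner_def
  using norm_infsum_bound[OF cinner_abs_summable[of x y]] cinner_abs_bound[of x y] by linarith

lemma cinner_add_right: "cinner x (y + z) = cinner x y + cinner x z"
  using has_sum_unique[OF cinner_has_sum[of x "y + z"]] has_sum_add[OF cinner_has_sum cinner_has_sum, of x y x z]
  by (simp add: algebra_simps)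

lemma cinner_add_left: "cinner (x + y) z = cinner x z + cinner y z"
  using has_sum_unique[OF cinner_has_sum[of "x + y" z]] has_sum_add[OF cinner_has_sum cinner_has_sum, of x z y z]
  by (simp add: algebra_simps)

lemma cinner_cscale_right: "cinner x (cscale c y) = c * cinner x y"
  using has_sum_unique[OF cinner_has_sum[of x "cscale c y"]] has_sum_cmult_right[OF cinner_has_sum[of x y], of c]
  by (simp add: algebra_simps)

lemma cinner_cscale_left: "cinner (cscale c x) y = cnj c * cinner x y"
  using has_sum_unique[OF cinner_has_sum[of "cscale c x" y]] has_sum_cmult_right[OF cinner_has_sum[of x y], of "cnj c"]
  by (simp add: algebra_simps)

lemma cinner_commute: "cinner y x = cnj (cinner x y)"
proof -
  have "((\<lambda>i. cnj (cnj (ell2_fun x i) * ell2_fun y i)) has_sum cnj (cinner x y)) UNIV"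
    using has_sum_bounded_linear[OF bounded_linear_cnj cinner_has_sum] by (simp add: o_def)
  then show ?thesis
    using has_sum_unique[OF cinner_has_sum[of y x]] by (simp add: mult.commute)
qed

lemma cinner_self: "cinner x x = of_real ((norm x)\<^sup>2)"
proof -
  have "((\<lambda>i. of_real ((cmod (ell2_fun x i))\<^sup>2)) has_sum complex_of_real ((norm x)\<^sup>2)) UNIV"
    using has_sum_bounded_linear[OF bounded_linear_of_real has_sum_norm_ell2_power2] by (simp add: o_def)
  then show ?thesis
    using has_sum_unique[OF cinner_has_sum[of x x]]
    by (simp add: complex_norm_square mult.commute del: of_real_power)
qed

lemma scaleR_eq_cscale: "r *\<^sub>R x = cscale (of_real r) x"
  by (rule ell2_eqI) simp

lemma cinner_scaleR [simp]: "cinner (r *\<^sub>R x) y = of_real r * cinner x y" "cinner x (r *\<^sub>R y) = of_real r * cinner x y"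
  by (simp_all add: scaleR_eq_cscale cinner_cscale_left cinner_cscale_right)

lemma bounded_bilinear_cinner: "bounded_bilinear cinner"
proof (unfold_locales, goal_cases)
  case 5 show ?case by (rule exI[of _ 1]) (simp add: cmod_cinner_le)
qed (simp_all add: cinner_add_left cinner_add_right scaleR_conv_of_real)

lemmas cinner_diff_left = bounded_bilinear.diff_left[OF bounded_bilinear_cinner]
  and cinner_diff_right = bounded_bilinear.diff_right[OF bounded_bilinear_cinner]

lemma cinner_ket_left [simp]: "cinner (ket i) x = ell2_fun x i"
proof -
  have "((\<lambda>j. cnj (ell2_fun (ket i) j) * ell2_fun x j) has_sum ell2_fun x i) {i}"
    using has_sum_finite[of "{i}" "\<lambda>j. cnj (ell2_fun (ket i) j) * ell2_fun x j"] by simp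
  then have "((\<lambda>j. cnj (ell2_fun (ket i) j) * ell2_fun x j) has_sum ell2_fun x i) UNIV"
    by (rule has_sum_cong_neutral[THEN iffD1, rotated -1]) auto
  then show ?thesis
    using has_sum_unique[OF cinner_has_sum] by blast
qed

text \<open>The coordinates of the adjoint applied to \<open>x\<close> have to be
  \<open>cinner (A (ket i)) x\<close>; the work lies in their square summability. Needed for
  absolute values.\<close>

lemma adjoint_exists:
  assumes "complex_linear A"
  obtains A' where "complex_linear A'" "\<And>x y. cinner (A' x) y = cinner x (A y)"
proof -
  define T where "T = (\<lambda>x. Abs_ell2 (\<lambda>i. cinner (A (ket i)) x))"
  have bd: "L2_set (\<lambda>i. cmod (cinner (A (ket i)) x)) F \<le> norm A * norm x" if F: "finite F" for x F
  proof -
    define s where "s = (L2_set (\<lambda>i. cmod (cinner (A (ket i)) x)) F)"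
    \<comment> \<open>Pairing the image of the truncated coordinate vector \<open>v\<close> with
      \<open>x\<close> gives \<open>s\<^sup>2 \<le> norm A * s * norm x\<close>, because
      \<open>norm v = s\<close>; cancelling \<open>s\<close> is the bound.\<close>
    define v where "v = (\<Sum>i\<in>F. cscale (cinner (A (ket i)) x) (ket i))"
    have vi: "ell2_fun v i = (if i \<in> F then cinner (A (ket i)) x else 0)" for i
      using F by (simp add: v_def ell2_fun_sum if_distrib cong: if_cong)
    have "((\<lambda>i. (cmod (ell2_fun v i))\<^sup>2) has_sum s\<^sup>2) F"
      using has_sum_finite[OF F, of "\<lambda>i. (cmod (ell2_fun v i))\<^sup>2"]
      by (simp add: s_def L2_set_def vi sum_nonneg)
    then have "((\<lambda>i. (cmod (ell2_fun v i))\<^sup>2) has_sum s\<^sup>2) UNIV"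
      by (rule has_sum_cong_neutral[THEN iffD1, rotated -1]) (auto simp: vi)
    then have "(norm v)\<^sup>2 = s\<^sup>2"
      using has_sum_norm_ell2_power2 has_sum_unique by blast
    then have nv: "norm v = s"
      by (simp add: s_def)
    have "cinner (A v) x = (\<Sum>i\<in>F. cnj (cinner (A (ket i)) x) * cinner (A (ket i)) x)"
      unfolding v_def blinfun.sum_right bounded_bilinear.sum_left[OF bounded_bilinear_cinner]
      by (simp add: complex_linearD[OF assms] cinner_cscale_left)
    also have "\<dots> = of_real (s\<^sup>2)"
      by (simp add: s_def L2_set_def sum_nonneg complex_norm_square mult.commute del: of_real_power)
    finally have "s\<^sup>2 = cmod (cinner (A v) x)"
      by (simp add: norm_power)
    also have "\<dots> \<le> norm A * norm v * norm x"
      by (rule order_trans[OF cmod_cinner_le mult_right_mono[OF norm_blinfun]]) simp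
    finally have "s * s \<le> (norm A * norm x) * s"
      by (simp add: nv power2_eq_square mult_ac)
    moreover have "s \<ge> 0" "norm A * norm x \<ge> 0" by (auto simp: s_def)
    ultimately show ?thesis
      unfolding s_def[symmetric] by (cases "s = 0") auto
  qed
  have T: "ell2_fun (T x) i = cinner (A (ket i)) x" for x i
    unfolding T_def by (subst Abs_ell2_inverse) (use square_summable_bound(1)[OF bd] in auto)
  have "bounded_linear T"
  proof (rule bounded_linear_intro)
    show "T (x + y) = T x + T y" "T (r *\<^sub>R x) = r *\<^sub>R T x" for x y r
      by (rule ell2_eqI; simp add: T cinner_add_right)+
    show "norm (T x) \<le> norm x * norm A" for x
      using square_summable_bound(2)[OF bd, of x] by (simp add: norm_ell2_def T mult.commute)
  qed
  then have app: "blinfun_apply (Blinfun T) = T"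
    by (rule bounded_linear_Blinfun_apply)
  show thesis
  proof (rule that[of "Blinfun T"])
    show "complex_linear (Blinfun T)"
      unfolding complex_linear_def app by (auto intro!: ell2_eqI simp: T cinner_cscale_right)
    fix x y
    have "bounded_linear (\<lambda>y. cinner x (A y))"
      by (rule bounded_linear_compose[OF bounded_bilinear.bounded_linear_right[OF bounded_bilinear_cinner] blinfun.bounded_linear_right])
    from has_sum_bounded_linear[OF this ket_expansion[of y]]
    have "((\<lambda>i. ell2_fun y i * cinner x (A (ket i))) has_sum cinner x (A y)) UNIV"
      by (simp add: o_def complex_linearD[OF assms] cinner_cscale_right)
    moreover have "((\<lambda>i. ell2_fun y i * cinner x (A (ket i))) has_sum cinner (T x) y) UNIV"
      using cinner_has_sum[of "T x" y] by (simp add: T cinner_commute[of x] mult.commute)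
    ultimately show "cinner (Blinfun T x) y = cinner x (A y)"
      unfolding app using has_sum_unique by blast
  qed
qed

text \<open>Each \<open>cmod (ent A i j)\<close> is split into two square roots: Cauchy-Schwarz
  spends one on the row sum, the other is left for the column sum once the order of summation is
  exchanged. This is done on truncations of \<open>x\<close> and extended by continuity.\<close>

lemma schur_test:
  assumes A: "complex_linear A"
    and row: "\<And>i F. finite F \<Longrightarrow> (\<Sum>j\<in>F. cmod (ent A i j)) \<le> r"
    and col: "\<And>j F. finite F \<Longrightarrow> (\<Sum>i\<in>F. cmod (ent A i j)) \<le> r"
  shows "norm A \<le> r"
proof (rule norm_blinfun_bound)
  show r: "r \<ge> 0" using row[of "{}"] by simp
  fix x
  define t where "t F = (\<Sum>j\<in>F. cscale (ell2_fun x j) (ket j))" for F :: "'a set"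
  have fin: "norm (A (t G)) \<le> r * norm x" if G: "finite G" for G
    unfolding norm_ell2_def[of "A (t G)"]
  proof (rule square_summable_bound(2))
    fix F :: "'a set" assume F: "finite F"
    have e: "ell2_fun (A (t G)) i = (\<Sum>j\<in>G. ent A i j * ell2_fun x j)" for i
      by (simp add: t_def blinfun.sum_right ell2_fun_sum complex_linearD[OF A] ent_def mult.commute)
    have row_sq: "(cmod (ell2_fun (A (t G)) i))\<^sup>2 \<le> r * (\<Sum>j\<in>G. cmod (ent A i j) * (cmod (ell2_fun x j))\<^sup>2)" for i
    proof -
      have "cmod (ell2_fun (A (t G)) i) \<le> (\<Sum>j\<in>G. cmod (ent A i j) * cmod (ell2_fun x j))"
        unfolding e by (rule order_trans[OF norm_sum]) (simp add: norm_mult)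
      also have "\<dots> = (\<Sum>j\<in>G. sqrt (cmod (ent A i j)) * (sqrt (cmod (ent A i j)) * cmod (ell2_fun x j)))"
        by (simp add: mult.assoc[symmetric])
      finally have "(cmod (ell2_fun (A (t G)) i))\<^sup>2
          \<le> (\<Sum>j\<in>G. sqrt (cmod (ent A i j)) * (sqrt (cmod (ent A i j)) * cmod (ell2_fun x j)))\<^sup>2"
        by (rule power_mono) simp
      also have "\<dots> \<le> (\<Sum>j\<in>G. (sqrt (cmod (ent A i j)))\<^sup>2) * (\<Sum>j\<in>G. (sqrt (cmod (ent A i j)) * cmod (ell2_fun x j))\<^sup>2)"
        by (rule Cauchy_Schwarz_ineq_sum)
      also have "\<dots> = (\<Sum>j\<in>G. cmod (ent A i j)) * (\<Sum>j\<in>G. cmod (ent A i j) * (cmod (ell2_fun x j))\<^sup>2)"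
        by (simp add: power_mult_distrib)
      also have "\<dots> \<le> r * (\<Sum>j\<in>G. cmod (ent A i j) * (cmod (ell2_fun x j))\<^sup>2)"
        by (rule mult_right_mono[OF row[OF G]]) (auto intro!: sum_nonneg)
      finally show ?thesis .
    qed
    have "(\<Sum>i\<in>F. (cmod (ell2_fun (A (t G)) i))\<^sup>2)
        \<le> (\<Sum>i\<in>F. r * (\<Sum>j\<in>G. cmod (ent A i j) * (cmod (ell2_fun x j))\<^sup>2))"
      by (rule sum_mono[OF row_sq])
    also have "\<dots> = r * (\<Sum>j\<in>G. (\<Sum>i\<in>F. cmod (ent A i j)) * (cmod (ell2_fun x j))\<^sup>2)"
      unfolding sum_distrib_left sum_distrib_right by (rule sum.swap)
    also have "\<dots> \<le> r * (\<Sum>j\<in>G. r * (cmod (ell2_fun x j))\<^sup>2)"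
      by (intro mult_left_mono[OF _ r] sum_mono mult_right_mono col[OF F] zero_le_power2)
    also have "\<dots> = r\<^sup>2 * (\<Sum>j\<in>G. (cmod (ell2_fun x j))\<^sup>2)"
      unfolding sum_distrib_left[symmetric] by (simp add: power2_eq_square)
    also have "\<dots> \<le> r\<^sup>2 * (norm x)\<^sup>2"
    proof (rule mult_left_mono)
      show "(\<Sum>j\<in>G. (cmod (ell2_fun x j))\<^sup>2) \<le> (norm x)\<^sup>2"
        by (rule finite_sum_le_has_sum[OF has_sum_norm_ell2_power2 G]) auto
    qed simp
    finally show "L2_set (\<lambda>i. cmod (ell2_fun (A (t G)) i)) F \<le> r * norm x"
      unfolding L2_set_def using r by (intro real_le_lsqrt) (auto simp: sum_nonneg power_mult_distrib)
  qed
  have "((\<lambda>F. norm (A (t F))) \<longlongrightarrow> norm (A x)) (finite_subsets_at_top UNIV)"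
    using ket_expansion[of x] unfolding has_sum_def t_def by (intro tendsto_intros)
  then show "norm (A x) \<le> r * norm x"
    by (rule tendsto_upperbound) (auto intro!: eventually_finite_subsets_at_top_weakI fin)
qed

section \<open>Operators on a discrete set\<close>

abbreviation sites :: "plane set \<Rightarrow> (plane \<times> 2) set" where "sites D \<equiv> D \<times> UNIV"

lemma position_op_weight_bound:
  assumes "\<And>x. \<bar>f x\<bar> \<le> C"
  shows "cmod ((\<lambda>(x, s :: 2). if x \<in> D then complex_of_real (f x) else 0) i) \<le> C"
  using assms[of "fst i"] by (auto split: prod.splits)

lemma position_op_props:
  assumes "\<And>x. \<bar>f x\<bar> \<le> C"
  shows complex_linear_position_op: "complex_linear (position_op D f)"
    and norm_position_op_le: "norm (position_op D f) \<le> C"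
    and ent_position_op_left: "ent (position_op D f o\<^sub>L A) i j = (if fst i \<in> D then f (fst i) else 0) * ent A i j"
    and ent_position_op_right: "complex_linear A \<Longrightarrow> ent (A o\<^sub>L position_op D f) i j = ent A i j * (if fst j \<in> D then f (fst j) else 0)"
  unfolding position_op_def
     apply (rule complex_linear_mult_op[OF position_op_weight_bound[OF assms]])
    apply (rule norm_mult_op_le[OF position_op_weight_bound[OF assms]])
   apply (subst ent_mult_op(2)[OF position_op_weight_bound[OF assms]], simp add: case_prod_beta)
  apply (subst ent_mult_op(3)[OF position_op_weight_bound[OF assms]], simp_all add: case_prod_beta)
  done

lemma complex_linear_id_on [simp, intro]: "complex_linear (id_on D)"
  unfolding id_on_def by (rule complex_linear_position_op[where C=1]) simp

text \<open>Compression by \<open>id_on D\<close> masks the entries with an index outside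
  \<open>sites D\<close>. Membership can thus be tested on entries and passes to sums and multiples
  at once.\<close>

lemma op_on_iff:
  "op_on D A \<longleftrightarrow> complex_linear A \<and> (\<forall>i j. i \<notin> sites D \<or> j \<notin> sites D \<longrightarrow> ent A i j = 0)"
proof -
  have 1: "\<bar>1::real\<bar> \<le> 1" by simp
  have e: "ent (id_on D o\<^sub>L A o\<^sub>L id_on D) i j = (if i \<in> sites D \<and> j \<in> sites D then ent A i j else 0)"
    if "complex_linear A" for i j
  proof -
    have "complex_linear (id_on D o\<^sub>L A)" using that by auto
    from ent_position_op_right[OF 1 this, where D=D and i=i and j=j] show ?thesis
      using ent_position_op_left[OF 1, where D=D and A=A and i=i and j=j] by (auto simp: id_on_def mem_Times_iff)
  qed
  show ?thesis
  proof
    assume "op_on D A"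
    then have c: "complex_linear A" and "id_on D o\<^sub>L A o\<^sub>L id_on D = A"
      by (auto simp: op_on_def complex_linear_def)
    then show "complex_linear A \<and> (\<forall>i j. i \<notin> sites D \<or> j \<notin> sites D \<longrightarrow> ent A i j = 0)"
      using e[OF c] by metis
  next
    assume a: "complex_linear A \<and> (\<forall>i j. i \<notin> sites D \<or> j \<notin> sites D \<longrightarrow> ent A i j = 0)"
    then have c: "complex_linear A" by simp
    have "id_on D o\<^sub>L A o\<^sub>L id_on D = A"
      by (rule complex_linear_eqI) (use c a in \<open>auto simp only: e[OF c] intro!: complex_linear_compose complex_linear_id_on\<close>, auto)
    then show "op_on D A"
      using c by (simp add: op_on_def complex_linear_def)
  qed
qed

lemma op_on_complex_linear: "op_on D A \<Longrightarrow> complex_linear A"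
  by (simp add: op_on_iff)

lemma op_on_id [simp]:
  assumes "op_on D A" shows "id_on D o\<^sub>L A = A" "A o\<^sub>L id_on D = A"
proof -
  have 1: "\<bar>1::real\<bar> \<le> 1" by simp
  note c = op_on_complex_linear[OF assms]
  show "id_on D o\<^sub>L A = A"
    by (rule complex_linear_eqI)
       (use c assms in \<open>auto simp: id_on_def op_on_iff mem_Times_iff ent_position_op_left[OF 1]
         complex_linear_position_op[OF 1]\<close>)
  show "A o\<^sub>L id_on D = A"
    by (rule complex_linear_eqI)
       (use c assms in \<open>auto simp: id_on_def op_on_iff mem_Times_iff ent_position_op_right[OF 1 c]
         complex_linear_position_op[OF 1]\<close>)
qed

lemma op_on_compose [intro]:
  assumes "op_on D A" "op_on D B" shows "op_on D (A o\<^sub>L B)"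
proof -
  have "id_on D o\<^sub>L (A o\<^sub>L B) o\<^sub>L id_on D = (id_on D o\<^sub>L A) o\<^sub>L (B o\<^sub>L id_on D)"
    by (simp only: compose_assoc)
  then have "id_on D o\<^sub>L (A o\<^sub>L B) o\<^sub>L id_on D = A o\<^sub>L B"
    by (simp only: op_on_id[OF assms(1)] op_on_id[OF assms(2)])
  moreover have "complex_linear (A o\<^sub>L B)"
    using assms by (intro complex_linear_compose op_on_complex_linear)
  ultimately show ?thesis
    by (simp only: op_on_def complex_linear_def simp_thms)
qed

lemma op_on_add [intro]: "op_on D A \<Longrightarrow> op_on D B \<Longrightarrow> op_on D (A + B)"
  and op_on_diff [intro]: "op_on D A \<Longrightarrow> op_on D B \<Longrightarrow> op_on D (A - B)"
  and op_on_scale_op [intro]: "op_on D A \<Longrightarrow> op_on D (scale_op c A)"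
  and op_on_scaleR [intro]: "op_on D A \<Longrightarrow> op_on D (r *\<^sub>R A)"
  and op_on_0 [intro]: "op_on D 0"
  by (auto simp: op_on_iff)

lemma op_on_position_op [intro]:
  assumes "\<And>x. \<bar>f x\<bar> \<le> C" shows "op_on D (position_op D f)"
proof -
  have "ent (position_op D f) i j = 0" if "i \<notin> sites D \<or> j \<notin> sites D" for i j
    using ent_position_op_left[OF assms, where D=D and A=id_blinfun and i=i and j=j] that by (cases "i = j") (auto simp: mem_Times_iff)
  then show ?thesis
    using complex_linear_position_op[OF assms] by (simp add: op_on_iff)
qed

lemma op_on_id_on [intro, simp]: "op_on D (id_on D)"
  unfolding id_on_def by (rule op_on_position_op[where C=1]) simp

lemma id_on_apply: "ell2_fun (id_on D u) i = (if i \<in> sites D then ell2_fun u i else 0)"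
  by (cases i) (simp add: id_on_def position_op_apply[of _ 1])

section \<open>Absolute values and the trace class\<close>

text \<open>For \<open>\<parallel>X\<parallel> \<le> 1\<close> the iteration \<open>Y \<mapsto> (X + Y\<^sup>2) / 2\<close> converges in norm, because it is dominated by
  the same iteration for the number 1; the limit is \<open>1 - sqrt (1 - X)\<close>.\<close>

lemma sqrt_iteration:
  fixes X :: "'i bop"
  assumes X: "norm X \<le> 1" "complex_linear X" "selfadjoint X"
  obtains Y where "complex_linear Y" "selfadjoint Y" "norm Y \<le> 1" "Y + Y = X + (Y o\<^sub>L Y)"
proof -
  define Y where "Y = rec_nat 0 (\<lambda>_ Y. (1/2) *\<^sub>R (X + (Y o\<^sub>L Y)))"
  have Y0: "Y 0 = 0" and YS: "Y (Suc n) = (1/2) *\<^sub>R (X + (Y n o\<^sub>L Y n))" for n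
    by (simp_all add: Y_def)
  define y :: "nat \<Rightarrow> real" where "y = rec_nat 0 (\<lambda>_ y. (1 + y * y) / 2)"
  have y0: "y 0 = 0" and yS: "y (Suc n) = (1 + y n * y n) / 2" for n
    by (simp_all add: y_def)
  have y01: "0 \<le> y n \<and> y n \<le> 1" for n
  proof (induction n)
    case (Suc n)
    then have "y n * y n \<le> 1" by (simp add: mult_le_one)
    then show ?case using Suc by (simp add: yS)
  qed (simp add: y0)
  have ymono: "y n \<le> y (Suc n)" for n
    using zero_le_power2[of "1 - y n"] by (simp add: yS power2_eq_square algebra_simps)
  have nY: "norm (Y n) \<le> y n" for n
  proof (induction n)
    case (Suc n)
    have "norm (Y n o\<^sub>L Y n) \<le> y n * y n"
      by (rule order_trans[OF norm_blinfun_compose mult_mono[OF Suc Suc]]) (use y01 in auto)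
    then have "norm (X + (Y n o\<^sub>L Y n)) \<le> 1 + y n * y n"
      using norm_triangle_le X(1) by (meson add_mono order_trans norm_triangle_ineq)
    then show ?case by (simp add: YS yS)
  qed (simp add: Y0 y0)
  have dY: "norm (Y (Suc n) - Y n) \<le> y (Suc n) - y n" for n
  proof (induction n)
    case 0
    show ?case using X(1) by (simp add: YS Y0 yS y0)
  next
    case (Suc n)
    let ?d = "Y (Suc n) - Y n" and ?e = "y (Suc n) - y n"
    \<comment> \<open>A difference of squares without commutativity: with \<open>d = Y' - Y\<close>
      one has \<open>Y' Y' - Y Y = Y' d + d Y\<close>. The scalar majorant obeys the same
      identity.\<close>
    have "Y (Suc (Suc n)) - Y (Suc n) = (1/2) *\<^sub>R ((Y (Suc n) o\<^sub>L ?d) + (?d o\<^sub>L Y n))"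
      unfolding YS[of "Suc n"] YS[of n] scaleR_diff_right[symmetric] 
      unfolding YS[of n, symmetric] by (simp add: compose_simps)
    moreover have "norm ((Y (Suc n) o\<^sub>L ?d) + (?d o\<^sub>L Y n)) \<le> y (Suc n) * ?e + ?e * y n"
      by (rule norm_triangle_le, intro add_mono order_trans[OF norm_blinfun_compose] mult_mono)
         (use nY Suc y01 ymono in auto)
    ultimately have "norm (Y (Suc (Suc n)) - Y (Suc n)) \<le> (y (Suc n) * ?e + ?e * y n) / 2"
      by simp
    also have "\<dots> = (y (Suc n) * y (Suc n) - y n * y n) / 2"
      by (rule arg_cong[where f="\<lambda>x. x / 2"]) (simp add: algebra_simps)
    also have "\<dots> = y (Suc (Suc n)) - y (Suc n)"
      unfolding arg_cong2[where f="(-)", OF yS[of "Suc n"] yS[of n]] by (simp add: diff_divide_distrib add_divide_distrib)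
    finally show ?case .
  qed
  have dY': "norm (Y (n + k) - Y n) \<le> y (n + k) - y n" for n k
  proof (induction k)
    case (Suc k)
    have "norm (Y (n + Suc k) - Y n) \<le> norm (Y (Suc (n + k)) - Y (n + k)) + norm (Y (n + k) - Y n)"
      using norm_triangle_ineq[of "Y (Suc (n + k)) - Y (n + k)" "Y (n + k) - Y n"] by simp
    also have "\<dots> \<le> y (n + Suc k) - y n"
      using Suc dY[of "n + k"] by simp
    finally show ?case .
  qed simp
  have "convergent y"
    by (rule Bseq_monoseq_convergent)
       (use y01 ymono in \<open>auto intro!: BseqI'[of _ 1] incseq_imp_monoseq incseq_SucI\<close>)
  then have "Cauchy y"
    by (rule convergent_Cauchy)
  have "Cauchy Y"
  proof (rule CauchyI')
    fix e :: real assume "e > 0"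
    with \<open>Cauchy y\<close> obtain M where M: "\<forall>m\<ge>M. \<forall>n\<ge>M. norm (y m - y n) < e"
      by (meson CauchyD)
    have "norm (Y m - Y n) < e" if "m \<ge> M" "n > m" for m n
    proof -
      have "norm (Y n - Y m) \<le> y n - y m"
        using dY'[of m "n - m"] that by simp
      also have "\<dots> < e" using M that by (smt (verit) le_less_trans less_imp_le real_norm_def)
      finally show ?thesis by (simp add: norm_minus_commute)
    qed
    then show "\<exists>M. \<forall>m\<ge>M. \<forall>n>m. dist (Y m) (Y n) < e"
      by (auto simp: dist_norm)
  qed
  then obtain L where L: "Y \<longlonglongrightarrow> L"
    using Cauchy_convergent convergent_def by blast
  have Lx: "(\<lambda>n. Y n x) \<longlonglongrightarrow> L x" for x
    by (rule blinfun.tendsto[OF L tendsto_const])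
  have cl: "complex_linear (Y n)" for n
    by (induction n) (auto simp: Y0 YS intro!: X)
  have sa: "selfadjoint (Y n)" for n
  proof (induction n)
    case (Suc n)
    show ?case
      using X(3) Suc unfolding selfadjoint_def YS
      by (simp add: blinfun.scaleR_left blinfun.add_left cinner_add_left cinner_add_right)
  qed (simp add: Y0 selfadjoint_def bounded_bilinear.zero_left[OF bounded_bilinear_cinner]
        bounded_bilinear.zero_right[OF bounded_bilinear_cinner])
  show thesis
  proof (rule that)
    show "complex_linear L"
      unfolding complex_linear_def
    proof (intro allI)
      fix c x
      have "(\<lambda>n. Y n (cscale c x)) \<longlonglongrightarrow> cscale c (L x)"
        unfolding complex_linearD[OF cl]
        by (rule bounded_bilinear.tendsto[OF bounded_bilinear_cscale tendsto_const Lx])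
      then show "L (cscale c x) = cscale c (L x)"
        using LIMSEQ_unique Lx by blast
    qed
    show "selfadjoint L"
      unfolding selfadjoint_def
    proof (intro allI)
      fix x z
      have "(\<lambda>n. cinner (Y n x) z) \<longlonglongrightarrow> cinner (L x) z" "(\<lambda>n. cinner x (Y n z)) \<longlonglongrightarrow> cinner x (L z)"
        by (intro bounded_bilinear.tendsto[OF bounded_bilinear_cinner] tendsto_const Lx)+
      moreover have "cinner (Y n x) z = cinner x (Y n z)" for n
        using sa by (simp add: selfadjoint_def)
      ultimately show "cinner (L x) z = cinner x (L z)"
        using LIMSEQ_unique by simp
    qed
    show "norm L \<le> 1"
      by (rule tendsto_upperbound[OF tendsto_norm[OF L]])
         (use nY y01 in \<open>auto intro!: always_eventually intro: order_trans\<close>)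
    have "(\<lambda>n. (1/2) *\<^sub>R (X + (Y n o\<^sub>L Y n))) \<longlonglongrightarrow> (1/2) *\<^sub>R (X + (L o\<^sub>L L))"
      by (intro tendsto_intros bounded_bilinear.tendsto[OF bounded_bilinear_blinfun_compose] L)
    moreover have "(\<lambda>n. (1/2) *\<^sub>R (X + (Y n o\<^sub>L Y n))) \<longlonglongrightarrow> L"
      using LIMSEQ_Suc[OF L] by (simp add: YS)
    ultimately have "L = (1/2) *\<^sub>R (X + (L o\<^sub>L L))"
      using LIMSEQ_unique by blast
    then have "L + L = 2 *\<^sub>R ((1/2) *\<^sub>R (X + (L o\<^sub>L L)))"
      by (metis scaleR_2)
    then show "L + L = X + (L o\<^sub>L L)"
      by simp
  qed
qed

lemma norm_diff_power2: "(norm (x - y :: 'i ell2))\<^sup>2 = (norm x)\<^sup>2 - 2 * Re (cinner x y) + (norm y)\<^sup>2"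
proof -
  have "(norm v)\<^sup>2 = Re (cinner v v)" for v :: "'i ell2"
    by (simp add: cinner_self)
  then show ?thesis
    by (simp add: cinner_diff_left cinner_diff_right cinner_commute[of y x])
qed

text \<open>With the adjoint \<open>A'\<close> and \<open>P = A' A / M\<close>, the operator
  \<open>X = 1 - P\<close> has norm at most 1 because
  \<open>(norm (P x))\<^sup>2 \<le> Re (cinner x (P x))\<close>. The iteration for \<open>X\<close>
  makes \<open>P\<close> the square of \<open>1 - Y\<close>, whence
  \<open>B = sqrt M (1 - Y)\<close>.\<close>

lemma absolute_value_exists:
  assumes A: "complex_linear A"
  obtains B where "absolute_value A B"
proof -
  from adjoint_exists[OF A] obtain A'
    where A': "complex_linear A'" and adj: "\<And>x y. cinner (A' x) y = cinner x (A y)" by metis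
  have adj': "cinner x (A' w) = cinner (A x) w" for x w
    by (metis adj cinner_commute)
  \<comment> \<open>The summand 1 keeps \<open>M\<close> positive when \<open>A\<close> is
    zero.\<close>
  define M where "M = (norm A' + 1)\<^sup>2"
  have M: "M > 0" "(norm A')\<^sup>2 \<le> M"
    unfolding M_def using add_nonneg_pos[OF norm_ge_zero[of A'] zero_less_one] by (auto intro!: power_mono)
  define P where "P = (1/M) *\<^sub>R (A' o\<^sub>L A)"
  have Pip: "cinner x (P y) = of_real (1/M) * cinner (A x) (A y)" for x y
    unfolding P_def blinfun.scaleR_left cinner_scaleR by (simp add: adj')
  have Pip': "cinner (P x) y = of_real (1/M) * cinner (A x) (A y)" for x y
    unfolding P_def blinfun.scaleR_left cinner_scaleR by (simp add: adj)
  define X where "X = id_blinfun - P"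
  have "norm X \<le> 1"
  proof (rule norm_blinfun_bound)
    fix x
    have "norm (P x) = norm (A' (A x)) / M"
      using M by (simp add: P_def blinfun.scaleR_left)
    also have "\<dots> \<le> norm A' * norm (A x) / M"
      using M by (intro divide_right_mono norm_blinfun) auto
    finally have "(norm (P x))\<^sup>2 \<le> (norm A' * norm (A x) / M)\<^sup>2"
      by (rule power_mono) simp
    also have "\<dots> = (norm A')\<^sup>2 * ((norm (A x))\<^sup>2 / M\<^sup>2)"
      by (simp add: power_divide power_mult_distrib)
    also have "\<dots> \<le> M * ((norm (A x))\<^sup>2 / M\<^sup>2)"
      by (rule mult_right_mono[OF M(2)]) simp
    also have "\<dots> = (norm (A x))\<^sup>2 / M"
      using M by (simp add: power2_eq_square)
    finally have "(norm (P x))\<^sup>2 \<le> (norm (A x))\<^sup>2 / M" .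
    moreover have "Re (cinner x (P x)) = (norm (A x))\<^sup>2 / M"
      unfolding Pip cinner_self using M by simp
    moreover have "(norm (A x))\<^sup>2 / M \<ge> 0" using M by simp
    ultimately have "(norm (x - P x))\<^sup>2 \<le> (norm x)\<^sup>2"
      unfolding norm_diff_power2 by linarith
    then show "norm (X x) \<le> 1 * norm x"
      by (simp add: X_def blinfun.diff_left)
  qed simp
  moreover have "complex_linear X"
    unfolding X_def P_def using A A' by blast
  moreover have "selfadjoint X"
    unfolding selfadjoint_def X_def
    by (simp add: blinfun.diff_left cinner_diff_left cinner_diff_right Pip Pip')
  ultimately obtain Y where Y: "complex_linear Y" "selfadjoint Y" "norm Y \<le> 1" "Y + Y = X + (Y o\<^sub>L Y)"
    by (rule sqrt_iteration)
  define B where "B = sqrt M *\<^sub>R (id_blinfun - Y)"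
  have Bx: "B x = sqrt M *\<^sub>R (x - Y x)" for x
    by (simp add: B_def blinfun.scaleR_left blinfun.diff_left)
  have "complex_linear B"
    unfolding B_def using Y(1) by blast
  moreover have "selfadjoint B"
    using Y(2) by (simp add: selfadjoint_def Bx cinner_diff_left cinner_diff_right)
  moreover have "0 \<le> Re (cinner x (B x))" for x
  proof -
    have "Re (cinner x (Y x)) \<le> norm x * (norm Y * norm x)"
      by (rule order_trans[OF complex_Re_le_cmod order_trans[OF cmod_cinner_le mult_left_mono[OF norm_blinfun]]]) simp
    also have "\<dots> \<le> norm x * (1 * norm x)"
      by (intro mult_left_mono mult_right_mono Y(3)) auto
    finally show ?thesis
      using M by (simp add: Bx cinner_diff_right cinner_self power2_eq_square)
  qed
  moreover have "cinner x (B (B y)) = cinner (A x) (A y)" for x y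
  proof -
    have e: "Y z + Y z = (z - P z) + Y (Y z)" for z
      using arg_cong[OF Y(4), of "\<lambda>T. T z"] by (simp add: blinfun.add_left X_def blinfun.diff_left)
    have "B (B y) = (sqrt M * sqrt M) *\<^sub>R (y - (Y y + Y y) + Y (Y y))"
      by (simp add: Bx blinfun.scaleR_right blinfun.diff_right algebra_simps)
    also have "\<dots> = M *\<^sub>R P y"
      using M by (simp add: e)
    finally show ?thesis
      using M by (simp add: Pip mult.assoc[symmetric] del: of_real_divide flip: of_real_mult)
  qed
  ultimately have "absolute_value A B"
    by (simp add: absolute_value_def complex_linear_def)
  then show thesis
    by (rule that)
qed

text \<open>The diagonal entries of the absolute value \<open>B\<close> are at most
  \<open>norm (B (ket i))\<close>, which equals \<open>norm (A (ket i))\<close>; so \<open>B\<close>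
  need not be known explicitly.\<close>

lemma trace_class_criterion:
  assumes A: "op_on D A" and s: "(\<lambda>i. norm (A (ket i))) summable_on sites D"
  shows "trace_class D A"
proof -
  obtain B where B: "absolute_value A B"
    using absolute_value_exists[OF op_on_complex_linear[OF A]] .
  have nB: "norm (B x) = norm (A x)" for x
  proof -
    have "cinner (B x) (B x) = cinner (A x) (A x)"
      using B by (auto simp: absolute_value_def selfadjoint_def)
    then show ?thesis
      by (simp add: cinner_self del: of_real_power)
  qed
  have "(\<lambda>i. Re (cinner (ket i) (B (ket i)))) summable_on sites D"
  proof (rule summable_on_comparison_test[OF s])
    fix i
    show "0 \<le> Re (cinner (ket i) (B (ket i)))"
      using B by (simp only: absolute_value_def)
    show "Re (cinner (ket i) (B (ket i))) \<le> norm (A (ket i))"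
      using order_trans[OF complex_Re_le_cmod cmod_ell2_le_norm[of "B (ket i)" i]] by (simp add: nB)
  qed
  then show ?thesis
    using A B by (auto simp: trace_class_def)
qed

lemma norm_ell2_le_infsum:
  assumes "(\<lambda>i. cmod (ell2_fun x i)) summable_on UNIV"
  shows "norm x \<le> (\<Sum>\<^sub>\<infinity>i. cmod (ell2_fun x i))"
  unfolding norm_ell2_def
proof (rule square_summable_bound(2))
  fix F :: "'a set" assume F: "finite F"
  have "L2_set (\<lambda>i. cmod (ell2_fun x i)) F \<le> (\<Sum>i\<in>F. cmod (ell2_fun x i))"
    by (rule L2_set_le_sum) simp
  also have "\<dots> \<le> (\<Sum>\<^sub>\<infinity>i. cmod (ell2_fun x i))"
    by (rule finite_sum_le_infsum[OF assms F]) auto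
  finally show "L2_set (\<lambda>i. cmod (ell2_fun x i)) F \<le> (\<Sum>\<^sub>\<infinity>i. cmod (ell2_fun x i))" .
qed

lemma trace_class_if_summable_entries:
  assumes A: "op_on D A" and s: "(\<lambda>(j, i). cmod (ent A i j)) summable_on sites D \<times> sites D"
  shows "trace_class D A"
proof (rule trace_class_criterion[OF A])
  have s1: "(\<lambda>i. cmod (ent A i j)) summable_on sites D" if "j \<in> sites D" for j
    using summable_on_SigmaD1[OF s that] by simp
  have s2: "(\<lambda>j. \<Sum>\<^sub>\<infinity>i\<in>sites D. cmod (ent A i j)) summable_on sites D"
    using summable_on_Sigma_banach[OF s] by simp
  show "(\<lambda>j. norm (A (ket j))) summable_on sites D"
  proof (rule summable_on_comparison_test[OF s2])
    fix j assume j: "j \<in> sites D"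
    have z: "ell2_fun (A (ket j)) i = 0" if "i \<notin> sites D" for i
      using A that unfolding op_on_iff ent_def by blast
    have "(\<lambda>i. cmod (ell2_fun (A (ket j)) i)) summable_on UNIV"
      by (rule summable_on_cong_neutral[THEN iffD1, OF _ _ _ s1[OF j]]) (auto simp: ent_def z)
    then have "norm (A (ket j)) \<le> (\<Sum>\<^sub>\<infinity>i. cmod (ell2_fun (A (ket j)) i))"
      by (rule norm_ell2_le_infsum)
    also have "\<dots> = (\<Sum>\<^sub>\<infinity>i\<in>sites D. cmod (ent A i j))"
      by (rule infsum_cong_neutral) (auto simp: ent_def z)
    finally show "norm (A (ket j)) \<le> (\<Sum>\<^sub>\<infinity>i\<in>sites D. cmod (ent A i j))" .
  qed simp
qed

section \<open>Resolvents of self-adjoint operators\<close>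

text \<open>The equation \<open>u = w + K u\<close> is solved by Banach's fixed point theorem.
  Uniqueness of the fixed point yields linearity and the left inverse; the bound
  \<open>1 / (1 - norm K)\<close> yields continuity.\<close>

lemma neumann_inverse:
  fixes K :: "'i bop"
  assumes K: "complex_linear K" "norm K < 1"
  obtains B where "complex_linear B" "(id_blinfun - K) o\<^sub>L B = id_blinfun" "B o\<^sub>L (id_blinfun - K) = id_blinfun"
proof -
  have ex1: "\<exists>!u. w + K u = u" for w
  proof (rule banach_fix_type[of "norm K"])
    show "\<forall>x y. dist (w + K x) (w + K y) \<le> norm K * dist x y"
      by (auto simp: dist_norm blinfun.diff_right[symmetric] intro: norm_blinfun)
  qed (use K in auto)
  define T where "T w = (THE u. w + K u = u)" for w
  have T: "w + K (T w) = T w" for w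
    unfolding T_def by (rule theI'[OF ex1])
  have uniq: "T w = u" if "w + K u = u" for w u
    using ex1 T that by metis
  have "bounded_linear T"
  proof (rule bounded_linear_intro)
    fix x y r
    have "(x + K (T x)) + (y + K (T y)) = T x + T y" "r *\<^sub>R (x + K (T x)) = r *\<^sub>R T x"
      by (simp_all only: T)
    then show "T (x + y) = T x + T y" "T (r *\<^sub>R x) = r *\<^sub>R T x"
      by (intro uniq; simp add: blinfun.add_right blinfun.scaleR_right algebra_simps)+
    have "norm (T x) \<le> norm x + norm K * norm (T x)"
      using norm_triangle_ineq[of x "K (T x)"] norm_blinfun[of K "T x"] by (simp add: T)
    then have "(1 - norm K) * norm (T x) \<le> norm x"
      by (simp add: algebra_simps)
    then show "norm (T x) \<le> norm x * (1 / (1 - norm K))"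
      using K(2) by (simp add: field_simps)
  qed
  then have app: "blinfun_apply (Blinfun T) = T"
    by (rule bounded_linear_Blinfun_apply)
  show thesis
  proof (rule that[of "Blinfun T"])
    have "T (cscale c x) = cscale c (T x)" for c x
    proof (rule uniq)
      have "cscale c (x + K (T x)) = cscale c (T x)"
        by (simp only: T)
      then show "cscale c x + K (cscale c (T x)) = cscale c (T x)"
        by (simp add: complex_linearD[OF K(1)])
    qed
    then show "complex_linear (Blinfun T)"
      by (simp add: complex_linear_def app)
    have "T w - K (T w) = w" for w
      using T[of w] by (simp add: algebra_simps)
    then show "(id_blinfun - K) o\<^sub>L Blinfun T = id_blinfun"
      by (intro blinfun_eqI) (simp add: app blinfun.diff_left)
    have "T (w - K w) = w" for w
      by (rule uniq) simp
    then show "Blinfun T o\<^sub>L (id_blinfun - K) = id_blinfun"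
      by (intro blinfun_eqI) (simp add: app blinfun.diff_left)
  qed
qed

lemma norm_id_on_le: "norm (id_on D) \<le> 1"
  unfolding id_on_def by (rule norm_position_op_le) simp

text \<open>One has \<open>A + E = A (1 - K)\<close> with \<open>K = - R E\<close> of norm below 1;
  the new inverse is \<open>B R\<close>, where \<open>B\<close> inverts
  \<open>1 - K\<close>.\<close>

lemma inverse_on_perturb:
  assumes A: "op_on D A" and inv: "inverse_on D A R" and E: "op_on D E" and small: "norm E * norm R < 1"
  obtains R' where "inverse_on D (A + E) R'"
proof -
  have R: "op_on D R" and AR: "A o\<^sub>L R = id_on D" and RA: "R o\<^sub>L A = id_on D"
    using inv by (auto simp: inverse_on_def)
  define K where "K = 0 - (R o\<^sub>L E)"
  have K: "op_on D K"
    unfolding K_def using R E by blast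
  have "norm K < 1"
    using norm_blinfun_compose[of R E] small by (simp add: K_def mult.commute)
  with op_on_complex_linear[OF K] obtain B where B: "complex_linear B"
    "(id_blinfun - K) o\<^sub>L B = id_blinfun" "B o\<^sub>L (id_blinfun - K) = id_blinfun"
    by (rule neumann_inverse)
  have B1: "B = id_blinfun - (R o\<^sub>L E o\<^sub>L B)"
    using B(2) by (simp add: K_def compose_simps algebra_simps)
  \<comment> \<open>\<open>B\<close> is an inverse on the ambient space, not an operator on
    \<open>H_D\<close>. The factor \<open>R\<close> on the right and the fixed point equation for
    \<open>B\<close> confine the product to \<open>H_D\<close>.\<close>
  have op: "op_on D (B o\<^sub>L R)"
  proof -
    have BR: "B o\<^sub>L R = R - (R o\<^sub>L (E o\<^sub>L (B o\<^sub>L R)))"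
      by (subst B1) (simp only: compose_simps compose_id compose_assoc)
    have "id_on D o\<^sub>L (B o\<^sub>L R) = (id_on D o\<^sub>L R) - ((id_on D o\<^sub>L R) o\<^sub>L (E o\<^sub>L (B o\<^sub>L R)))"
      by (subst BR) (simp only: compose_simps compose_assoc)
    then have 1: "id_on D o\<^sub>L (B o\<^sub>L R) = B o\<^sub>L R"
      using BR by (simp only: op_on_id[OF R])
    have "id_on D o\<^sub>L (B o\<^sub>L R) o\<^sub>L id_on D = B o\<^sub>L R"
      unfolding 1 by (simp only: compose_assoc op_on_id[OF R])
    moreover have "complex_linear (B o\<^sub>L R)"
      using B(1) R op_on_complex_linear by blast
    ultimately show ?thesis
      unfolding op_on_def by (simp only: complex_linear_def simp_thms)
  qed
  have "A + E = A o\<^sub>L (id_blinfun - K)"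
    unfolding K_def using op_on_id[OF E] by (simp add: compose_simps compose_assoc[symmetric] AR)
  then have "(A + E) o\<^sub>L (B o\<^sub>L R) = A o\<^sub>L (((id_blinfun - K) o\<^sub>L B) o\<^sub>L R)"
    by (simp only: compose_assoc)
  then have 1: "(A + E) o\<^sub>L (B o\<^sub>L R) = id_on D"
    by (simp add: B AR)
  have "R o\<^sub>L (A + E) = (id_blinfun - K) o\<^sub>L id_on D"
    unfolding K_def by (simp add: compose_simps RA compose_assoc op_on_id[OF E])
  then have "(B o\<^sub>L R) o\<^sub>L (A + E) = (B o\<^sub>L (id_blinfun - K)) o\<^sub>L id_on D"
    by (simp only: compose_assoc)
  then have 2: "(B o\<^sub>L R) o\<^sub>L (A + E) = id_on D"
    by (simp add: B)
  show thesis
    by (rule that[of "B o\<^sub>L R"]) (simp only: inverse_on_def 1 2 op simp_thms)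
qed

abbreviation shifted :: "plane set \<Rightarrow> lop \<Rightarrow> complex \<Rightarrow> lop" where
  "shifted D H z \<equiv> H - scale_op z (id_on D)"

lemma resolvent_inverse:
  assumes "z \<notin> spectrum D H" shows "inverse_on D (shifted D H z) (resolvent D H z)"
proof -
  obtain R where "inverse_on D (shifted D H z) R"
    using assms by (auto simp: spectrum_def)
  then show ?thesis
    using resolvent_eqI by blast
qed

lemma op_on_resolvent: "z \<notin> spectrum D H \<Longrightarrow> op_on D (resolvent D H z)"
  using resolvent_inverse by (auto simp: inverse_on_def)

lemma op_on_shifted: "op_on D H \<Longrightarrow> op_on D (shifted D H z)"
  by blast

lemma spectrum_perturb:
  assumes H: "op_on D H" and z: "z \<notin> spectrum D H" and small: "cmod (w - z) * norm (resolvent D H z) < 1"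
  shows "w \<notin> spectrum D H"
proof -
  have "norm (scale_op (z - w) (id_on D)) * norm (resolvent D H z) < 1"
  proof (rule le_less_trans[OF _ small], rule mult_right_mono)
    show "norm (scale_op (z - w) (id_on D)) \<le> cmod (w - z)"
      using mult_left_mono[OF norm_id_on_le[of D], of "cmod (z - w)"]
      by (simp add: norm_scale_op norm_minus_commute)
  qed simp
  then obtain R' where R': "inverse_on D (shifted D H z + scale_op (z - w) (id_on D)) R'"
    using inverse_on_perturb[OF op_on_shifted[OF H] resolvent_inverse[OF z]] by blast
  have "shifted D H z + scale_op (z - w) (id_on D) = shifted D H w"
    by (rule blinfun_eqI) (simp add: blinfun.add_left blinfun.diff_left scale_op_apply)
  with R' have "inverse_on D (shifted D H w) R'"
    by (simp only:)
  then show ?thesis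
    unfolding spectrum_def by blast
qed

lemma open_resolvent_set:
  assumes "op_on D H" shows "open (- spectrum D H)"
proof (rule openI)
  fix z assume "z \<in> - spectrum D H"
  let ?e = "1 / (norm (resolvent D H z) + 1)"
  have p: "norm (resolvent D H z) + 1 > 0" by (simp add: add_nonneg_pos)
  have "w \<notin> spectrum D H" if "w \<in> ball z ?e" for w
  proof (rule spectrum_perturb[OF assms])
    have "cmod (w - z) * norm (resolvent D H z) \<le> cmod (w - z) * (norm (resolvent D H z) + 1)"
      by (intro mult_left_mono) auto
    also have "\<dots> < 1"
      using that p by (simp add: dist_norm norm_minus_commute field_simps)
    finally show "cmod (w - z) * norm (resolvent D H z) < 1" .
  qed (use \<open>z \<in> - spectrum D H\<close> in auto)
  then show "\<exists>T>0. ball z T \<subseteq> - spectrum D H"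
    using p by (intro exI[of _ ?e]) auto
qed

lemma resolvent_identity:
  assumes "z \<notin> spectrum D H" "w \<notin> spectrum D H"
  shows "resolvent D H w - resolvent D H z = scale_op (w - z) (resolvent D H w o\<^sub>L resolvent D H z)"
proof -
  let ?R = "resolvent D H"
  note z = resolvent_inverse[OF assms(1)] and w = resolvent_inverse[OF assms(2)]
  note opz = op_on_resolvent[OF assms(1)] and opw = op_on_resolvent[OF assms(2)]
  have "?R w - ?R z = (?R w o\<^sub>L (shifted D H z o\<^sub>L ?R z)) - ((?R w o\<^sub>L shifted D H w) o\<^sub>L ?R z)"
    using z w by (simp add: inverse_on_def op_on_id[OF opz] op_on_id[OF opw])
  also have "\<dots> = ?R w o\<^sub>L ((shifted D H z - shifted D H w) o\<^sub>L ?R z)"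
    by (simp only: compose_simps compose_assoc)
  also have "shifted D H z - shifted D H w = scale_op (w - z) (id_on D)"
    by (rule blinfun_eqI) (simp add: blinfun.add_left blinfun.diff_left scale_op_apply)
  finally show ?thesis
    by (simp add: scale_op_compose op_on_complex_linear[OF opw] op_on_id[OF opz])
qed

text \<open>Pythagoras: \<open>cinner u (T u)\<close> is real and its coefficient
  \<open>cnj p * q\<close> is purely imaginary, so the cross terms have no real part.\<close>

lemma norm_selfadjoint_combination:
  assumes "selfadjoint T" and pq: "Re (cnj p * q) = 0"
  shows "(norm (cscale p u + cscale q (T u)))\<^sup>2 = (cmod p)\<^sup>2 * (norm u)\<^sup>2 + (cmod q)\<^sup>2 * (norm (T u))\<^sup>2"
proof -
  have r: "cinner (T u) u = cinner u (T u)"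
    using assms(1) by (simp add: selfadjoint_def)
  then have im: "Im (cinner u (T u)) = 0"
    using cinner_commute[of "T u" u] by (simp add: complex_eq_iff)
  have "Re (cnj p * q * cinner u (T u)) = 0" "Re (cnj q * p * cinner u (T u)) = 0"
  proof -
    have "cnj q * p = cnj (cnj p * q)" by simp
    then have "Re (cnj q * p) = 0" using pq by (simp only: complex_cnj_cancel_iff cnj.sel)
    then show "Re (cnj p * q * cinner u (T u)) = 0" "Re (cnj q * p * cinner u (T u)) = 0"
      using pq im by (simp_all only: times_complex.sel(1)[of "_ * _" "cinner _ _"] mult_zero_left mult_zero_right diff_self)
  qed
  moreover have "(norm (cscale p u + cscale q (T u)))\<^sup>2 = Re (cinner (cscale p u + cscale q (T u)) (cscale p u + cscale q (T u)))"
    by (simp add: cinner_self)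
  moreover have "cinner (cscale p u + cscale q (T u)) (cscale p u + cscale q (T u)) =
      cnj p * p * cinner u u + cnj p * q * cinner u (T u) + cnj q * p * cinner u (T u) + cnj q * q * cinner (T u) (T u)"
    by (simp add: cinner_add_left cinner_add_right cinner_cscale_left cinner_cscale_right r algebra_simps)
  moreover have "Re (cnj a * a * cinner b b) = (cmod a)\<^sup>2 * (norm b)\<^sup>2" for a and b :: "'a ell2"
  proof -
    have "cnj a * a = of_real ((cmod a)\<^sup>2)"
      by (simp only: complex_norm_square mult.commute[of a])
    then show ?thesis
      by (simp only: cinner_self of_real_mult[symmetric] Re_complex_of_real)
  qed
  ultimately show ?thesis
    by (simp only: plus_complex.sel add_0_right)
qed

lemma selfadjoint_position_op:
  assumes "\<And>x. \<bar>f x\<bar> \<le> C" shows "selfadjoint (position_op D f)"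
proof -
  have "cnj (ell2_fun (position_op D f x) i) * ell2_fun y i = cnj (ell2_fun x i) * ell2_fun (position_op D f y) i" for x y i
    by (cases i) (simp add: position_op_apply[OF assms])
  then show ?thesis
    by (simp add: selfadjoint_def cinner_def)
qed

lemma selfadjoint_shifted:
  assumes "selfadjoint H" shows "selfadjoint (shifted D H (complex_of_real c))"
proof -
  have "selfadjoint (id_on D)"
    unfolding id_on_def by (rule selfadjoint_position_op[where C=1]) simp
  then show ?thesis
    using assms by (simp add: selfadjoint_def blinfun.diff_left cinner_diff_left cinner_diff_right
        scale_op_apply cinner_cscale_left cinner_cscale_right)
qed

text \<open>For a suitable imaginary \<open>al\<close> the operator
  \<open>K = 1 - al (H - z)\<close> on \<open>H_D\<close> is a strict contraction, so
  \<open>al (H - z) = 1 - K\<close> is invertible there.\<close>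

lemma spectrum_real:
  assumes H: "op_on D H" "selfadjoint H" and z: "Im z \<noteq> 0"
  shows "z \<notin> spectrum D H"
proof -
  define x y where "x = Re z" and "y = Im z"
  have zxy: "z = of_real x + \<i> * of_real y"
    by (simp add: x_def y_def complex_eq_iff)
  define T where "T = shifted D H (of_real x)"
  have T: "selfadjoint T" "op_on D T"
    unfolding T_def using H selfadjoint_shifted by auto
  define M where "M = norm T"
  \<comment> \<open>On \<open>H_D\<close> one has \<open>K = (1 - t y) - \<i> t T\<close>, whose
    squared norm is at most \<open>q = 1 - 2 t y + t\<^sup>2 (y\<^sup>2 + M\<^sup>2)\<close>. This
    \<open>t\<close> minimises the quadratic.\<close>
  define t where "t = y / (y\<^sup>2 + M\<^sup>2)"
  have y0: "y \<noteq> 0" using z by (simp add: y_def)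
  then have yM: "y\<^sup>2 + M\<^sup>2 > 0" by (simp add: add_pos_nonneg)
  have t0: "t \<noteq> 0" using y0 yM by (simp add: t_def)
  define q where "q = (1 - t * y)\<^sup>2 + t\<^sup>2 * M\<^sup>2"
  have "q = 1 - 2 * (t * y) + t\<^sup>2 * (y\<^sup>2 + M\<^sup>2)"
    by (simp add: q_def power2_eq_square algebra_simps)
  also have "t\<^sup>2 * (y\<^sup>2 + M\<^sup>2) = t * y"
    using yM by (simp add: t_def power2_eq_square)
  finally have q: "q = 1 - y\<^sup>2 / (y\<^sup>2 + M\<^sup>2)"
    by (simp add: t_def power2_eq_square)
  have q1: "q < 1" "q \<ge> 0"
    using y0 yM unfolding q by (auto simp: q_def[symmetric]) 
  define al where "al = \<i> * of_real t"
  have al0: "al \<noteq> 0" using t0 by (simp add: al_def)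
  define K where "K = id_on D - scale_op al (shifted D H z)"
  have Kop: "op_on D K"
    unfolding K_def using H(1) by blast
  have "norm K \<le> sqrt q"
  proof (rule norm_blinfun_bound)
    fix u
    define v where "v = id_on D u"
    have idv: "id_on D v = v"
      by (rule ell2_eqI) (simp add: v_def id_on_apply)
    have "K u = K v"
      using arg_cong[OF op_on_id(2)[OF Kop], of "\<lambda>T. T u"] by (simp add: v_def)
    also have "K v = cscale (of_real (1 - t * y)) v + cscale (- al) (T v)"
      by (rule ell2_eqI) (simp add: K_def T_def blinfun.diff_left scale_op_apply idv zxy al_def algebra_simps)
    finally have "(norm (K u))\<^sup>2 = (1 - t * y)\<^sup>2 * (norm v)\<^sup>2 + t\<^sup>2 * (norm (T v))\<^sup>2"
      using norm_selfadjoint_combination[OF T(1), of "of_real (1 - t * y)" "- al" v]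
      by (simp add: al_def norm_mult power2_abs del: of_real_diff of_real_mult)
    also have "\<dots> \<le> (1 - t * y)\<^sup>2 * (norm v)\<^sup>2 + t\<^sup>2 * (M * norm v)\<^sup>2"
      unfolding M_def by (intro add_left_mono mult_left_mono power_mono norm_blinfun) auto
    also have "\<dots> = q * (norm v)\<^sup>2"
      by (simp add: q_def power_mult_distrib algebra_simps)
    also have "\<dots> \<le> q * (norm u)\<^sup>2"
    proof (intro mult_left_mono power_mono)
      show "norm v \<le> norm u"
        unfolding v_def using order_trans[OF norm_blinfun mult_right_mono[OF norm_id_on_le norm_ge_zero], of D u] by simp
    qed (use q1 in auto)
    also have "\<dots> = (sqrt q * norm u)\<^sup>2"
      using q1 by (simp add: power_mult_distrib)
    finally show "norm (K u) \<le> sqrt q * norm u"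
      by (rule power2_le_imp_le) (use q1 in auto)
  qed (use q1 in auto)
  also have "sqrt q < 1" using q1 by simp
  finally have "norm K < 1" .
  moreover have "norm (0 - K) * norm (id_on D) \<le> norm K * 1"
    using norm_id_on_le by (intro mult_mono) auto
  ultimately have small: "norm (0 - K) * norm (id_on D) < 1" by linarith
  have "inverse_on D (id_on D) (id_on D)"
    by (simp add: inverse_on_def)
  then obtain R' where "inverse_on D (id_on D + (0 - K)) R'"
    using inverse_on_perturb[OF op_on_id_on _ _ small] op_on_diff[OF op_on_0 Kop] by blast
  moreover have "id_on D + (0 - K) = scale_op al (shifted D H z)"
    by (simp add: K_def)
  ultimately have R': "op_on D R'" "scale_op al (shifted D H z) o\<^sub>L R' = id_on D"
    "R' o\<^sub>L scale_op al (shifted D H z) = id_on D"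
    by (auto simp: inverse_on_def)
  have "inverse_on D (shifted D H z) (scale_op al R')"
    unfolding inverse_on_def
  proof (intro conjI)
    show "op_on D (scale_op al R')" using R'(1) by blast
    show "shifted D H z o\<^sub>L scale_op al R' = id_on D"
      using R'(2) scale_op_compose(2)[OF op_on_complex_linear[OF op_on_shifted[OF H(1)]]] by (simp add: scale_op_compose(1))
    show "scale_op al R' o\<^sub>L shifted D H z = id_on D"
      using R'(3) scale_op_compose(2)[OF op_on_complex_linear[OF R'(1)]] by (simp add: scale_op_compose(1))
  qed
  then show ?thesis
    by (auto simp: spectrum_def)
qed

text \<open>\<open>H - z\<close> is a perturbation of \<open>- z\<close>, whose inverse on
  \<open>H_D\<close> has norm at most \<open>1 / cmod z\<close>.\<close>

lemma spectrum_bounded: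
  assumes H: "op_on D H" and z: "cmod z > norm H"
  shows "z \<notin> spectrum D H"
proof -
  have z0: "cmod z > 0" by (rule le_less_trans[OF norm_ge_zero z])
  have inv: "inverse_on D (scale_op (- z) (id_on D)) (scale_op (- inverse z) (id_on D))"
    using z0 by (auto simp: inverse_on_def scale_op_compose)
  have "norm (scale_op (- inverse z) (id_on D)) \<le> inverse (cmod z)"
    using mult_left_mono[OF norm_id_on_le[of D], of "inverse (cmod z)"] by (simp add: norm_scale_op norm_inverse)
  then have "norm H * norm (scale_op (- inverse z) (id_on D)) \<le> norm H * inverse (cmod z)"
    by (rule mult_left_mono) simp
  also have "\<dots> < 1"
    using z z0 by (simp add: field_simps)
  finally obtain R' where "inverse_on D (scale_op (- z) (id_on D) + H) R'"
    using inverse_on_perturb[OF _ inv H] by blast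
  moreover have "scale_op (- z) (id_on D) + H = shifted D H z"
    by (rule blinfun_eqI, rule ell2_eqI) (simp add: blinfun.add_left blinfun.diff_left scale_op_apply)
  ultimately show ?thesis
    by (auto simp: spectrum_def)
qed

section \<open>Norm bounds for the resolvent\<close>

lemma resolvent_apply_shifted:
  assumes "z \<notin> spectrum D H"
  shows "shifted D H z (resolvent D H z w) = id_on D w" "resolvent D H z (shifted D H z w) = id_on D w"
    "id_on D (resolvent D H z w) = resolvent D H z w"
proof -
  note i = resolvent_inverse[OF assms, unfolded inverse_on_def]
  show "shifted D H z (resolvent D H z w) = id_on D w" "resolvent D H z (shifted D H z w) = id_on D w"
    using i by (metis blinfun_apply_blinfun_compose)+
  show "id_on D (resolvent D H z w) = resolvent D H z w"
    using op_on_id(1)[of D "resolvent D H z"] i by (metis blinfun_apply_blinfun_compose)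
qed

text \<open>For \<open>T = H - c\<close> the squared norm of \<open>(T - \<i> t) v\<close> is
  \<open>(norm (T v))\<^sup>2 + t\<^sup>2 (norm v)\<^sup>2\<close>, so a lower bound
  \<open>g\<close> for \<open>T\<close> combines with \<open>t\<close> as a sum of squares. The
  choice \<open>g = 0\<close> gives the usual bound by the imaginary part; a positive
  \<open>g\<close> comes from the gap.\<close>

lemma norm_resolvent_shift:
  assumes H: "op_on D H" "selfadjoint H" and z: "Complex c t \<notin> spectrum D H"
    and g: "\<And>v. id_on D v = v \<Longrightarrow> g * norm v \<le> norm (shifted D H (of_real c) v)" and g0: "g \<ge> 0" and gt: "g\<^sup>2 + t\<^sup>2 > 0"
  shows "norm (resolvent D H (Complex c t)) \<le> 1 / sqrt (g\<^sup>2 + t\<^sup>2)"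
proof (rule norm_blinfun_bound)
  fix w
  define v where "v = resolvent D H (Complex c t) w"
  let ?T = "shifted D H (of_real c)"
  have idv: "id_on D v = v"
    using resolvent_apply_shifted(3)[OF z] by (simp add: v_def)
  have "cscale (- \<i> * of_real t) v + cscale 1 (?T v) = shifted D H (Complex c t) v"
    by (rule ell2_eqI) (simp add: blinfun.diff_left scale_op_apply idv Complex_eq algebra_simps)
  also have "\<dots> = id_on D w"
    unfolding v_def by (rule resolvent_apply_shifted(1)[OF z])
  finally have e: "cscale (- \<i> * of_real t) v + cscale 1 (?T v) = id_on D w" .
  have "(norm (cscale (- \<i> * of_real t) v + cscale 1 (?T v)))\<^sup>2
      = (cmod (- \<i> * of_real t))\<^sup>2 * (norm v)\<^sup>2 + (cmod 1)\<^sup>2 * (norm (?T v))\<^sup>2"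
    by (rule norm_selfadjoint_combination[OF selfadjoint_shifted[OF H(2)]]) simp
  then have "(norm (id_on D w))\<^sup>2 = t\<^sup>2 * (norm v)\<^sup>2 + (norm (?T v))\<^sup>2"
    unfolding e by (simp add: norm_mult)
  moreover have "norm (id_on D w) \<le> norm w"
    using order_trans[OF norm_blinfun mult_right_mono[OF norm_id_on_le norm_ge_zero], of D w] by simp
  then have "(norm (id_on D w))\<^sup>2 \<le> (norm w)\<^sup>2"
    by (rule power_mono) simp
  moreover have "(g * norm v)\<^sup>2 \<le> (norm (?T v))\<^sup>2"
    by (rule power_mono[OF g[OF idv]]) (use g0 in simp)
  ultimately have "(g\<^sup>2 + t\<^sup>2) * (norm v)\<^sup>2 \<le> (norm w)\<^sup>2"
    by (simp add: power_mult_distrib algebra_simps)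
  then have "(sqrt (g\<^sup>2 + t\<^sup>2) * norm v)\<^sup>2 \<le> (norm w)\<^sup>2"
    using gt by (simp add: power_mult_distrib)
  then have "sqrt (g\<^sup>2 + t\<^sup>2) * norm v \<le> norm w"
    by (rule power2_le_imp_le) simp
  then show "norm (resolvent D H (Complex c t) w) \<le> 1 / sqrt (g\<^sup>2 + t\<^sup>2) * norm w"
    using gt by (simp add: v_def field_simps)
qed (use gt in simp)

lemma norm_resolvent_Im:
  assumes "op_on D H" "selfadjoint H" "Im z \<noteq> 0"
  shows "norm (resolvent D H z) \<le> 1 / \<bar>Im z\<bar>"
  using norm_resolvent_shift[of D H "Re z" "Im z" 0] spectrum_real[OF assms] assms by simp

text \<open>The resolvent at \<open>c\<close> provides the lower bound \<open>g\<close> for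
  \<open>H - c\<close>. Along the whole vertical line through \<open>c\<close> the squared resolvent
  norm is then dominated by an integrable Lorentzian.\<close>

lemma norm_resolvent_gap:
  assumes H: "op_on D H" "selfadjoint H" and c: "complex_of_real c \<notin> spectrum D H"
  obtains g where "g > 0" "\<And>t. Complex c t \<notin> spectrum D H"
    "\<And>t. norm (resolvent D H (Complex c t)) \<le> 1 / sqrt (g\<^sup>2 + t\<^sup>2)"
proof -
  define g where "g = 1 / (norm (resolvent D H (of_real c)) + 1)"
  have p: "norm (resolvent D H (of_real c)) + 1 > 0" by (simp add: add_nonneg_pos)
  have g0: "g > 0" using p by (simp add: g_def)
  have g: "g * norm v \<le> norm (shifted D H (of_real c) v)" if "id_on D v = v" for v
  proof -
    have "norm v = norm (resolvent D H (of_real c) (shifted D H (of_real c) v))"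
      using resolvent_apply_shifted(2)[OF c] that by simp
    also have "\<dots> \<le> norm (resolvent D H (of_real c)) * norm (shifted D H (of_real c) v)"
      by (rule norm_blinfun)
    also have "\<dots> \<le> (norm (resolvent D H (of_real c)) + 1) * norm (shifted D H (of_real c) v)"
      by (rule mult_right_mono) auto
    finally show ?thesis
      using p by (simp add: g_def field_simps)
  qed
  have ns: "Complex c t \<notin> spectrum D H" for t
    using c spectrum_real[OF H, of "Complex c t"] by (cases "t = 0") (auto simp: complex_of_real_def)
  show thesis
    by (rule that[OF g0 ns norm_resolvent_shift[OF H ns g]]) (use g0 in \<open>auto simp: add_pos_nonneg\<close>)
qed

lemma norm_resolvent_large:
  assumes H: "op_on D H" and z: "cmod z > norm H"
  shows "norm (resolvent D H z) \<le> 1 / (cmod z - norm H)"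
proof (rule norm_blinfun_bound)
  fix w
  define v where "v = resolvent D H z w"
  note ns = spectrum_bounded[OF assms]
  have idv: "id_on D v = v"
    using resolvent_apply_shifted(3)[OF ns] by (simp add: v_def)
  have "id_on D w = H v - cscale z v"
    using resolvent_apply_shifted(1)[OF ns, of w] unfolding v_def[symmetric]
    by (simp add: blinfun.diff_left scale_op_apply idv)
  then have "cscale z v = H v - id_on D w"
    by (simp only: algebra_simps)
  then have "cmod z * norm v = norm (H v - id_on D w)"
    by (simp only: norm_cscale[symmetric])
  also have "\<dots> \<le> norm (H v) + norm (id_on D w)"
    by (rule norm_triangle_ineq4)
  also have "\<dots> \<le> norm H * norm v + 1 * norm w"
    by (intro add_mono norm_blinfun order_trans[OF norm_blinfun mult_right_mono[OF norm_id_on_le norm_ge_zero]])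
  finally have "cmod z * norm v \<le> norm H * norm v + norm w"
    by simp
  then show "norm (resolvent D H z w) \<le> 1 / (cmod z - norm H) * norm w"
    using z by (simp add: v_def field_simps)
qed (use z in simp)

section \<open>Operator-valued holomorphic functions\<close>

text \<open>Complex differentiability: the real Frechet derivative is required to be multiplication
  of a fixed operator by the complex increment, which on operators is
  \<open>scale_op\<close>.\<close>

definition op_derivative :: "(complex \<Rightarrow> 'i bop) \<Rightarrow> 'i bop \<Rightarrow> complex \<Rightarrow> bool" where
  "op_derivative F F' z \<longleftrightarrow> (F has_derivative (\<lambda>h. scale_op h F')) (at z)"

lemma op_derivative_const: "op_derivative (\<lambda>_. A) 0 z"
  by (simp add: op_derivative_def bounded_bilinear.zero_right[OF bounded_bilinear_scale_op])

lemma op_derivative_diff: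
  "op_derivative F F' z \<Longrightarrow> op_derivative G G' z \<Longrightarrow> op_derivative (\<lambda>z. F z - G z) (F' - G') z"
  unfolding op_derivative_def bounded_bilinear.diff_right[OF bounded_bilinear_scale_op]
  by (rule has_derivative_diff)

lemma op_derivative_compose:
  assumes "op_derivative F F' z" "op_derivative G G' z" "complex_linear (F z)"
  shows "op_derivative (\<lambda>z. F z o\<^sub>L G z) ((F z o\<^sub>L G') + (F' o\<^sub>L G z)) z"
proof -
  have "((\<lambda>z. F z o\<^sub>L G z) has_derivative (\<lambda>h. (F z o\<^sub>L scale_op h G') + (scale_op h F' o\<^sub>L G z))) (at z)"
    using assms(1,2) unfolding op_derivative_def
    by (rule bounded_bilinear.FDERIV[OF bounded_bilinear_blinfun_compose])
  then show ?thesis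
    unfolding op_derivative_def
    by (simp add: scale_op_compose assms(3) bounded_bilinear.add_right[OF bounded_bilinear_scale_op])
qed

lemma op_derivative_isCont: "op_derivative F F' z \<Longrightarrow> isCont F z"
  unfolding op_derivative_def by (rule has_derivative_continuous)

lemma op_derivative_ent:
  assumes "op_derivative F F' z"
  shows "((\<lambda>z. ent (F z) i j) has_field_derivative ent F' i j) (at z)"
proof -
  have "((\<lambda>z. ent (F z) i j) has_derivative (\<lambda>h. ent (scale_op h F') i j)) (at z)"
    using assms unfolding op_derivative_def by (rule bounded_linear.has_derivative[OF bounded_linear_ent])
  then show ?thesis
    by (simp add: has_field_derivative_def mult_commute_abs)
qed

text \<open>By the resolvent identity the remainder is \<open>(w - z) (R w - R z) R z\<close>, and
  by the same identity this is of second order where \<open>R w\<close> stays bounded. The radius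
  \<open>1 / (2 r)\<close> ensures \<open>norm (R w) \<le> 2 r\<close>.\<close>

lemma op_derivative_resolvent:
  assumes H: "op_on D H" and z: "z \<notin> spectrum D H"
  shows "op_derivative (resolvent D H) (resolvent D H z o\<^sub>L resolvent D H z) z"
proof -
  let ?R = "resolvent D H"
  define r where "r = norm (?R z) + 1"
  have r: "r > 0" "norm (?R z) \<le> r" by (auto simp: r_def add_nonneg_pos)
  have bound: "norm (?R w - ?R z - scale_op (w - z) (?R z o\<^sub>L ?R z)) \<le> cmod (w - z) * (cmod (w - z) * (2 * r^3))"
    if w: "cmod (w - z) < 1 / (2 * r)" for w
  proof -
    have le2: "cmod (w - z) * norm (?R z) \<le> 1/2"
    proof -
      have "cmod (w - z) * norm (?R z) \<le> 1 / (2 * r) * r"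
        using w r by (intro mult_mono) auto
      then show ?thesis using r by simp
    qed
    have nw: "w \<notin> spectrum D H"
      by (rule spectrum_perturb[OF H z]) (use le2 in linarith)
    note ri = resolvent_identity[OF z nw]
    have ndiff: "norm (?R w - ?R z) \<le> cmod (w - z) * (norm (?R w) * norm (?R z))"
      unfolding ri norm_scale_op by (intro mult_left_mono norm_blinfun_compose) simp
    also have "\<dots> \<le> 1/2 * norm (?R w)"
      using mult_right_mono[OF le2, of "norm (?R w)"] by (simp add: mult_ac)
    finally have "norm (?R w) \<le> 2 * norm (?R z)"
      using norm_triangle_ineq2[of "?R w" "?R z"] by linarith
    then have nRw: "norm (?R w) \<le> 2 * r"
      using r by linarith
    have d2: "norm (?R w - ?R z) \<le> cmod (w - z) * (2 * r * r)"
      by (rule order_trans[OF ndiff]) (use nRw r in \<open>intro mult_left_mono mult_mono\<close>, auto)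
    have "?R w - ?R z - scale_op (w - z) (?R z o\<^sub>L ?R z) = scale_op (w - z) ((?R w - ?R z) o\<^sub>L ?R z)"
      by (subst (1) ri) (simp add: compose_simps bounded_bilinear.diff_right[OF bounded_bilinear_scale_op])
    then have "norm (?R w - ?R z - scale_op (w - z) (?R z o\<^sub>L ?R z)) = cmod (w - z) * norm ((?R w - ?R z) o\<^sub>L ?R z)"
      by (simp add: norm_scale_op)
    also have "\<dots> \<le> cmod (w - z) * (cmod (w - z) * (2 * r * r) * r)"
      using d2 r by (intro mult_left_mono order_trans[OF norm_blinfun_compose] mult_mono) auto
    finally show ?thesis
      by (simp add: power3_eq_cube mult_ac)
  qed
  have lim: "((\<lambda>w. norm (?R w - ?R z - scale_op (w - z) (?R z o\<^sub>L ?R z)) / cmod (w - z)) \<longlongrightarrow> 0) (at z)"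
  proof (rule Lim_null_comparison)
    have "\<forall>\<^sub>F w in at z. dist w z < 1 / (2 * r)"
      using r by (auto simp: eventually_at intro!: exI[of _ "1 / (2 * r)"])
    then show "\<forall>\<^sub>F w in at z. norm (norm (?R w - ?R z - scale_op (w - z) (?R z o\<^sub>L ?R z)) / cmod (w - z)) \<le> cmod (w - z) * (2 * r^3)"
    proof eventually_elim
      case (elim w)
      have "cmod (w - z) < 1 / (2 * r)" using elim by (simp add: dist_norm)
      from bound[OF this] r show ?case
        by (cases "w = z") (simp_all add: divide_le_eq mult.commute)
    qed
    have "((\<lambda>w. cmod (w - z) * (2 * r^3)) \<longlongrightarrow> cmod (z - z) * (2 * r^3)) (at z)"
      by (intro tendsto_intros)
    then show "((\<lambda>w. cmod (w - z) * (2 * r^3)) \<longlongrightarrow> 0) (at z)" by simp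
  qed
  show ?thesis
    unfolding op_derivative_def
    by (rule has_derivative_iff_norm[THEN iffD2, OF conjI[OF bounded_bilinear.bounded_linear_left[OF bounded_bilinear_scale_op] lim]])
qed

section \<open>Smooth functions and flatness\<close>

abbreviation dx :: "(complex \<Rightarrow> complex) \<Rightarrow> complex \<Rightarrow> complex" where
  "dx f z \<equiv> frechet_derivative f (at z) 1"

abbreviation dy :: "(complex \<Rightarrow> complex) \<Rightarrow> complex \<Rightarrow> complex" where
  "dy f z \<equiv> frechet_derivative f (at z) \<i>"

definition smooth :: "(complex \<Rightarrow> complex) \<Rightarrow> bool" where
  "smooth f \<longleftrightarrow> (\<forall>n. C_times n f)"

lemma smooth_differentiable: "smooth f \<Longrightarrow> f differentiable at z"
  unfolding smooth_def by (metis C_times.simps(2))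

lemma smooth_has_derivative: "smooth f \<Longrightarrow> (f has_derivative frechet_derivative f (at z)) (at z)"
  using smooth_differentiable frechet_derivative_works by blast

lemma smooth_directional_derivative: "smooth f \<Longrightarrow> smooth (\<lambda>z. frechet_derivative f (at z) v)"
  unfolding smooth_def by (metis C_times.simps(2))

lemma smooth_continuous: "smooth f \<Longrightarrow> continuous_on A f"
  unfolding smooth_def by (metis C_times.simps(1) continuous_on_subset subset_UNIV)

lemma frechet_derivative_add_at:
  assumes "f differentiable at z" "g differentiable at z"
  shows "frechet_derivative (\<lambda>z. f z + g z) (at z) v = frechet_derivative f (at z) v + frechet_derivative g (at z) v"
  using frechet_derivative_at[OF has_derivative_add[OF assms[unfolded frechet_derivative_works]]] by metis

lemma frechet_derivative_cmult_at:
  fixes f :: "complex \<Rightarrow> complex"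
  assumes "f differentiable at z"
  shows "frechet_derivative (\<lambda>z. c * f z) (at z) v = c * frechet_derivative f (at z) v"
  using frechet_derivative_at[OF has_derivative_mult_right[OF assms[unfolded frechet_derivative_works]]] by metis

lemma C_times_add:
  "C_times n f \<Longrightarrow> C_times n g \<Longrightarrow> C_times n (\<lambda>z :: complex. f z + g z)"
  by (induction n arbitrary: f g) (auto simp: frechet_derivative_add_at intro: continuous_on_add)

lemma C_times_cmult: "C_times n f \<Longrightarrow> C_times n (\<lambda>z :: complex. c * f z)"
  by (induction n arbitrary: f) (auto simp: frechet_derivative_cmult_at intro: continuous_on_mult_left differentiable_mult)

lemma C_times_const: "C_times n (\<lambda>z :: complex. c)"
  by (induction n arbitrary: c) auto

lemma smooth_add: "smooth f \<Longrightarrow> smooth g \<Longrightarrow> smooth (\<lambda>z. f z + g z)"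
  and smooth_cmult: "smooth f \<Longrightarrow> smooth (\<lambda>z. c * f z)"
  and smooth_const: "smooth (\<lambda>z. c)"
  by (auto simp: smooth_def C_times_add C_times_cmult C_times_const)

lemma smooth_diff_const: "smooth f \<Longrightarrow> smooth (\<lambda>z. f z - c)"
  using smooth_add[OF _ smooth_const[of "- c"], of f] by simp

lemma frechet_derivative_diff_const: 
  fixes f :: "complex \<Rightarrow> complex"
  shows "f differentiable at z \<Longrightarrow> frechet_derivative (\<lambda>z. f z - c) (at z) = frechet_derivative f (at z)"
  using frechet_derivative_at[of "\<lambda>z. f z - c" "frechet_derivative f (at z)" z]
    has_derivative_diff[OF _ has_derivative_const, of f "frechet_derivative f (at z)" "at z" c]
  by (simp add: frechet_derivative_works)

lemma linear_combination_1_i: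
  assumes "bounded_linear D" shows "D h = of_real (Re h) * D 1 + of_real (Im h) * (D \<i> :: complex)"
proof -
  have "h = Re h *\<^sub>R 1 + Im h *\<^sub>R \<i>"
    by (simp add: complex_eq_iff)
  then have "D h = Re h *\<^sub>R D 1 + Im h *\<^sub>R D \<i>"
    by (metis assms linear_simps(1) linear_simps(5))
  then show ?thesis
    by (simp add: scaleR_conv_of_real)
qed

lemma smooth_dbar: "smooth u \<Longrightarrow> smooth (dbar u)"
proof -
  assume u: "smooth u"
  have "smooth (\<lambda>z. (1/2) * (dx u z + \<i> * dy u z))"
    by (intro smooth_cmult smooth_add smooth_directional_derivative u)
  moreover have "(\<lambda>z. (1/2) * (dx u z + \<i> * dy u z)) = dbar u"
    by (auto simp: dbar_def)
  ultimately show ?thesis by simp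
qed

text \<open>The mean value inequality is applied to \<open>p\<close>, the increment in direction
  \<open>b\<close> with its expected linear part removed, as a function of the step along
  \<open>a\<close>. Its derivative \<open>q\<close> is small because the derivative of
  \<open>f\<close> along \<open>a\<close> is itself differentiable at \<open>z\<close>.\<close>

lemma second_difference:
  fixes f :: "complex \<Rightarrow> complex"
  assumes f: "\<And>w. (f has_derivative D w) (at w)" and g: "((\<lambda>w. D w a) has_derivative G) (at z)" and e: "e > 0"
    and ab: "norm a \<le> 1" "norm b \<le> 1"
  obtains d where "d > 0" "\<And>h. 0 < h \<Longrightarrow> h < d \<Longrightarrow>
    norm (f (z + h *\<^sub>R a + h *\<^sub>R b) - f (z + h *\<^sub>R a) - f (z + h *\<^sub>R b) + f z - (h * h) *\<^sub>R G b) \<le> e * (h * h)"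
proof -
  have "e / 3 > 0" using e by simp
  with g obtain d where d: "d > 0" "\<And>w. norm (w - z) < d \<Longrightarrow> norm (D w a - D z a - G (w - z)) \<le> e / 3 * norm (w - z)"
    unfolding has_derivative_at_alt by metis
  have G: "bounded_linear G" using g has_derivative_bounded_linear by blast
  show thesis
  proof (rule that[of "d / 2"])
    fix h :: real assume h: "0 < h" "h < d / 2"
    define p where "p t = f (z + t *\<^sub>R a + h *\<^sub>R b) - f (z + t *\<^sub>R a) - (t * h) *\<^sub>R G b" for t
    define q where "q t = D (z + t *\<^sub>R a + h *\<^sub>R b) a - D (z + t *\<^sub>R a) a - h *\<^sub>R G b" for t
    have p: "(p has_vector_derivative q t) (at t within {0..h})" for t
    proof -
      have 1: "((\<lambda>t. f (c + t *\<^sub>R a)) has_vector_derivative D (c + t *\<^sub>R a) a) (at t within {0..h})" for c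
      proof -
        have "((\<lambda>t. c + t *\<^sub>R a) has_vector_derivative a) (at t within {0..h})"
          by (auto intro!: derivative_eq_intros)
        moreover have "(f has_derivative D (c + t *\<^sub>R a)) (at (c + t *\<^sub>R a) within (\<lambda>t. c + t *\<^sub>R a) ` {0..h})"
          using f has_derivative_at_withinI by blast
        ultimately show ?thesis
          using vector_derivative_diff_chain_within[unfolded o_def] by blast
      qed
      have e: "p = (\<lambda>t. f ((z + h *\<^sub>R b) + t *\<^sub>R a) - f (z + t *\<^sub>R a) - t *\<^sub>R (h *\<^sub>R G b))"
        by (auto simp: p_def fun_eq_iff algebra_simps)
      have "q t = D ((z + h *\<^sub>R b) + t *\<^sub>R a) a - D (z + t *\<^sub>R a) a - h *\<^sub>R G b"
        by (simp add: q_def algebra_simps)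
      then show ?thesis
        unfolding e by (auto intro!: derivative_eq_intros 1)
    qed
    have bq: "norm (q t) \<le> e * h" if t: "0 \<le> t" "t \<le> h" for t
    proof -
      have b1: "norm (t *\<^sub>R a + h *\<^sub>R b) \<le> 2 * h"
      proof -
        have "norm (t *\<^sub>R a + h *\<^sub>R b) \<le> t * norm a + h * norm b"
          using norm_triangle_ineq[of "t *\<^sub>R a" "h *\<^sub>R b"] t h by simp
        also have "\<dots> \<le> h * 1 + h * 1"
          using t h ab by (intro add_mono mult_mono) auto
        finally show ?thesis by simp
      qed
      have b2: "norm (t *\<^sub>R a) \<le> h"
        using mult_mono[OF t(2) ab(1)] t h by simp
      let ?r = "\<lambda>w. D (z + w) a - D z a - G w"
      have r: "norm (?r w) \<le> e / 3 * norm w" if "norm w < d" for w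
        using d(2)[of "z + w"] that by simp
      have "q t = ?r (t *\<^sub>R a + h *\<^sub>R b) - ?r (t *\<^sub>R a)"
        by (simp add: q_def linear_simps[OF G] add.assoc)
      then have "norm (q t) \<le> norm (?r (t *\<^sub>R a + h *\<^sub>R b)) + norm (?r (t *\<^sub>R a))"
        by (simp only: norm_triangle_ineq4)
      also have "\<dots> \<le> e / 3 * norm (t *\<^sub>R a + h *\<^sub>R b) + e / 3 * norm (t *\<^sub>R a)"
        by (intro add_mono r) (use b1 b2 h in auto)
      also have "\<dots> \<le> e / 3 * (2 * h) + e / 3 * h"
        using b1 b2 e by (intro add_mono mult_left_mono) auto
      finally show ?thesis by simp
    qed
    have "norm (p h - p 0) \<le> (e * h) * norm (h - 0)"
    proof (rule differentiable_bound[of "{0..h}" p "\<lambda>t s. s *\<^sub>R q t"])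
      fix t assume t: "t \<in> {0..h}"
      show "(p has_derivative (\<lambda>s. s *\<^sub>R q t)) (at t within {0..h})"
        using p by (simp add: has_vector_derivative_def)
      show "onorm (\<lambda>s. s *\<^sub>R q t) \<le> e * h"
        using bq[of t] t onorm_scaleR_left[OF bounded_linear_ident, of "q t"] by (simp add: onorm_id)
    qed (use h in auto)
    then show "norm (f (z + h *\<^sub>R a + h *\<^sub>R b) - f (z + h *\<^sub>R a) - f (z + h *\<^sub>R b) + f z - (h * h) *\<^sub>R G b) \<le> e * (h * h)"
      using h by (simp add: p_def algebra_simps)
  qed (use d in auto)
qed

text \<open>The second difference is symmetric in the two directions, so both mixed derivatives are
  its limit after division by \<open>h * h\<close>. As \<open>e\<close> is a third of their
  distance, two errors \<open>e\<close> cannot bridge it.\<close>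

lemma mixed_derivatives_commute:
  assumes f: "smooth f"
  shows "dy (dx f) z = dx (dy f) z"
proof (rule ccontr)
  assume ne: "dy (dx f) z \<noteq> dx (dy f) z"
  define e where "e = norm (dy (dx f) z - dx (dy f) z) / 3"
  have e: "e > 0" using ne by (simp add: e_def)
  let ?s = "\<lambda>h a b. f (z + h *\<^sub>R a + h *\<^sub>R b) - f (z + h *\<^sub>R a) - f (z + h *\<^sub>R b) + f z"
  obtain d1 where d1: "d1 > 0" "\<And>h. 0 < h \<Longrightarrow> h < d1 \<Longrightarrow> norm (?s h 1 \<i> - (h * h) *\<^sub>R dy (dx f) z) \<le> e * (h * h)"
    by (rule second_difference[OF smooth_has_derivative[OF f] smooth_has_derivative[OF smooth_directional_derivative[OF f]] e,
          of 1 \<i> z]) auto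
  obtain d2 where d2: "d2 > 0" "\<And>h. 0 < h \<Longrightarrow> h < d2 \<Longrightarrow> norm (?s h \<i> 1 - (h * h) *\<^sub>R dx (dy f) z) \<le> e * (h * h)"
    by (rule second_difference[OF smooth_has_derivative[OF f] smooth_has_derivative[OF smooth_directional_derivative[OF f]] e,
          of \<i> 1 z]) auto
  define h where "h = min d1 d2 / 2"
  have h: "0 < h" "h < d1" "h < d2" using d1(1) d2(1) by (auto simp: h_def)
  have "?s h 1 \<i> = ?s h \<i> 1" by (simp add: algebra_simps)
  then have "(h * h) *\<^sub>R (dy (dx f) z - dx (dy f) z)
      = (?s h \<i> 1 - (h * h) *\<^sub>R dx (dy f) z) - (?s h 1 \<i> - (h * h) *\<^sub>R dy (dx f) z)"
    by (simp add: scaleR_diff_right)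
  then have "norm ((h * h) *\<^sub>R (dy (dx f) z - dx (dy f) z)) \<le> e * (h * h) + e * (h * h)"
    using norm_triangle_ineq4 d1(2)[OF h(1,2)] d2(2)[OF h(1,3)] by (smt (verit))
  then have "(h * h) * (3 * e) \<le> (h * h) * (2 * e)"
    using h unfolding norm_scaleR e_def by (simp add: abs_mult)
  then show False
    using h e by simp
qed

lemma frechet_derivative_dbar_form:
  assumes "smooth f" "smooth g"
  shows "frechet_derivative (\<lambda>z. (1/2) * (f z + \<i> * g z)) (at z) v
      = (1/2) * (frechet_derivative f (at z) v + \<i> * frechet_derivative g (at z) v)"
proof -
  have "frechet_derivative (\<lambda>z. (1/2) * (f z + \<i> * g z)) (at z) v = (1/2) * frechet_derivative (\<lambda>z. f z + \<i> * g z) (at z) v"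
    by (rule frechet_derivative_cmult_at) (intro smooth_differentiable smooth_add smooth_cmult assms)
  also have "frechet_derivative (\<lambda>z. f z + \<i> * g z) (at z) v = frechet_derivative f (at z) v + frechet_derivative (\<lambda>z. \<i> * g z) (at z) v"
    by (rule frechet_derivative_add_at) (intro smooth_differentiable smooth_cmult assms)+
  also have "frechet_derivative (\<lambda>z. \<i> * g z) (at z) v = \<i> * frechet_derivative g (at z) v"
    by (rule frechet_derivative_cmult_at) (intro smooth_differentiable assms)
  finally show ?thesis .
qed

lemma dbar_eq: "dbar u = (\<lambda>z. (1/2) * (dx u z + \<i> * dy u z))"
  by (auto simp: dbar_def)

lemma dbar_dx:
  assumes u: "smooth u" shows "dbar (dx u) z = dx (dbar u) z"
  unfolding dbar_eq by (subst frechet_derivative_dbar_form) (auto simp: mixed_derivatives_commute[OF u] smooth_directional_derivative u)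

section \<open>Test functions and functions with flat \<open>dbar\<close> derivative\<close>

lemma test_function_smooth: "test_function f \<Longrightarrow> smooth f"
  by (simp add: test_function_def smooth_def)

lemma test_function_derivative:
  assumes f: "test_function (f :: complex \<Rightarrow> complex)"
  shows "test_function (\<lambda>z. frechet_derivative f (at z) v)"
proof -
  have "frechet_derivative f (at z) v = 0" if "z \<notin> closure {x. f x \<noteq> 0}" for z
  proof -
    have "(f has_derivative (\<lambda>_. 0)) (at z)"
    proof (rule has_derivative_transform_within_open[of "\<lambda>_. 0" _ z UNIV "- closure {x. f x \<noteq> 0}"])
      show "0 = f x" if "x \<in> - closure {x. f x \<noteq> 0}" for x
        using that closure_subset[of "{x. f x \<noteq> 0}"] by auto
    qed (use that in auto)
    then show ?thesis
      using frechet_derivative_at by metis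
  qed
  then have "{z. frechet_derivative f (at z) v \<noteq> 0} \<subseteq> closure {x. f x \<noteq> 0}"
    by blast
  then have "compact (closure {z. frechet_derivative f (at z) v \<noteq> 0})"
    using f unfolding test_function_def
    by (meson closed_closure closure_minimal compact_closure bounded_subset compact_imp_bounded)
  then show ?thesis
    using smooth_directional_derivative[OF test_function_smooth[OF f], of v]
    by (simp add: test_function_def smooth_def)
qed

lemma test_function_bounded:
  assumes f: "test_function (f :: complex \<Rightarrow> complex)"
  obtains M where "\<And>z. cmod (f z) \<le> M"
proof -
  let ?K = "closure {z. f z \<noteq> 0}"
  have "compact (f ` ?K)"
    using f smooth_continuous[OF test_function_smooth[OF f]] by (auto simp: test_function_def intro!: compact_continuous_image)
  then obtain M where M: "\<And>w. w \<in> f ` ?K \<Longrightarrow> norm w \<le> M"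
    using compact_imp_bounded bounded_iff by metis
  have "cmod (f z) \<le> max M 0" for z
    using M[of "f z"] closure_subset[of "{z. f z \<noteq> 0}"] by (cases "f z = 0") auto
  then show thesis by (rule that)
qed

text \<open>Serves for \<open>\<rho>' - 1\<close> to the left of the gap and for
  \<open>\<rho>'\<close> to the right of it. The constant \<open>k\<close> is there because the
  former has compact support only up to a constant.\<close>

definition almost_analytic_null :: "real set \<Rightarrow> (complex \<Rightarrow> complex) \<Rightarrow> bool" where
  "almost_analytic_null U u \<longleftrightarrow> (\<exists>k. test_function (\<lambda>z. u z - k)) \<and>
     (\<forall>N>0. \<exists>C. \<forall>z. cmod (dbar u z) \<le> C * \<bar>Im z\<bar> ^ N) \<and> (\<forall>x\<in>U. u (complex_of_real x) = 0)"

lemma almost_analytic_null_smooth: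
  assumes "almost_analytic_null U u" shows "smooth u"
proof -
  obtain k where "test_function (\<lambda>z. u z - k)"
    using assms by (auto simp: almost_analytic_null_def)
  from smooth_diff_const[OF test_function_smooth[OF this], of "- k"] show ?thesis
    by simp
qed

text \<open>Taylor's bound for a horizontal step. Such a step keeps \<open>Im z\<close> fixed and is
  therefore compatible with bounds by powers of \<open>\<bar>Im z\<bar>\<close>.\<close>

lemma horizontal_increment_bound:
  assumes f: "smooth f" and M: "\<And>z. cmod (dx (dx f) z) \<le> M" and h: "h > 0"
  shows "cmod (f (z + of_real h) - f z - of_real h * dx f z) \<le> M * h * h"
proof -
  have deriv: "((\<lambda>t. g (z + of_real t)) has_vector_derivative dx g (z + of_real t)) (at t within {0..h})" if "smooth g" for g t
  proof -
    have "((\<lambda>t. z + of_real t) has_vector_derivative 1) (at t within {0..h})"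
      by (auto intro!: derivative_eq_intros)
    moreover have "(g has_derivative frechet_derivative g (at (z + of_real t))) (at (z + of_real t) within (\<lambda>t. z + of_real t) ` {0..h})"
      using smooth_has_derivative[OF that] has_derivative_at_withinI by blast
    ultimately show ?thesis
      using vector_derivative_diff_chain_within[unfolded o_def] by blast
  qed
  have onorm_le: "onorm (\<lambda>s::real. s *\<^sub>R q) = norm q" for q :: complex
    using onorm_scaleR_left[OF bounded_linear_ident, of q] by (simp add: onorm_id)
  have M0: "M \<ge> 0" using M norm_ge_zero order_trans by blast
  have 1: "cmod (dx f (z + of_real t) - dx f z) \<le> M * h" if t: "0 \<le> t" "t \<le> h" for t
  proof -
    have "norm (dx f (z + of_real t) - dx f (z + of_real 0)) \<le> M * norm (t - 0)"
    proof (rule differentiable_bound[of "{0..h}" "\<lambda>t. dx f (z + of_real t)" "\<lambda>t s. s *\<^sub>R dx (dx f) (z + of_real t)"])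
      fix s assume "s \<in> {0..h}"
      show "((\<lambda>t. dx f (z + of_real t)) has_derivative (\<lambda>r. r *\<^sub>R dx (dx f) (z + of_real s))) (at s within {0..h})"
        using deriv[OF smooth_directional_derivative[OF f]] by (simp add: has_vector_derivative_def)
    qed (use t M in \<open>auto simp: onorm_le\<close>)
    also have "M * norm (t - 0) \<le> M * h" using t M0 by (intro mult_left_mono) auto
    finally show ?thesis by simp
  qed
  let ?p = "\<lambda>t. f (z + of_real t) - of_real t * dx f z"
  have "norm (?p h - ?p 0) \<le> (M * h) * norm (h - 0)"
  proof (rule differentiable_bound[of "{0..h}" ?p "\<lambda>t s. s *\<^sub>R (dx f (z + of_real t) - dx f z)"])
    fix t assume t: "t \<in> {0..h}"
    have "(?p has_vector_derivative dx f (z + of_real t) - 1 * dx f z) (at t within {0..h})"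
      by (intro has_vector_derivative_diff deriv f has_vector_derivative_mult_left) (auto intro!: derivative_eq_intros)
    then show "(?p has_derivative (\<lambda>s. s *\<^sub>R (dx f (z + of_real t) - dx f z))) (at t within {0..h})"
      by (simp add: has_vector_derivative_def)
    show "onorm (\<lambda>s::real. s *\<^sub>R (dx f (z + of_real t) - dx f z)) \<le> M * h"
      using 1[of t] t by (simp add: onorm_le)
  qed (use h in auto)
  then show ?thesis
    using h by (simp add: algebra_simps)
qed

text \<open>Adds the exponent 0, where flatness means boundedness and follows from compact support
  of the derivatives.\<close>

lemma almost_analytic_null_dbar_bound:
  assumes u: "almost_analytic_null U u"
  shows "\<exists>C. \<forall>z. cmod (dbar u z) \<le> C * \<bar>Im z\<bar> ^ N"
proof (cases "N > 0")
  case True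
  then show ?thesis using u by (auto simp: almost_analytic_null_def)
next
  case False
  note sm = almost_analytic_null_smooth[OF u]
  obtain k where k: "test_function (\<lambda>z. u z - k)"
    using u by (auto simp: almost_analytic_null_def)
  have td: "test_function (\<lambda>z. frechet_derivative u (at z) v)" for v
    using test_function_derivative[OF k, of v]
    by (simp add: frechet_derivative_diff_const smooth_differentiable[OF sm])
  obtain M1 where M1: "\<And>z. cmod (dx u z) \<le> M1" using test_function_bounded[OF td] by blast
  obtain M2 where M2: "\<And>z. cmod (dy u z) \<le> M2" using test_function_bounded[OF td] by blast
  have "cmod (dbar u z) \<le> M1 + M2" for z
  proof -
    have "cmod (dbar u z) = cmod (dx u z + \<i> * dy u z) / 2"
      unfolding dbar_def norm_divide by simp
    also have "\<dots> \<le> (cmod (dx u z) + cmod (dy u z)) / 2"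
      using norm_triangle_ineq[of "dx u z" "\<i> * dy u z"] by (simp add: norm_mult)
    also have "\<dots> \<le> cmod (dx u z) + cmod (dy u z)"
      by simp
    also have "\<dots> \<le> M1 + M2"
      by (intro add_mono M1 M2)
    finally show ?thesis .
  qed
  with False show ?thesis by (intro exI[of _ "M1 + M2"]) simp
qed

text \<open>As \<open>dbar\<close> commutes with \<open>dx\<close>, flatness of
  \<open>f = dbar u\<close> has to pass to \<open>dx f\<close>. This is an interpolation: a
  difference quotient of step \<open>h\<close> is of size
  \<open>\<bar>Im z\<bar> ^ (2 * N) / h\<close>, its error of size \<open>M * h\<close>, and
  \<open>h = \<bar>Im z\<bar> ^ N\<close> balances both at order \<open>N\<close>.\<close>

lemma almost_analytic_null_dx:
  assumes U: "open U" and u: "almost_analytic_null U u"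
  shows "almost_analytic_null U (dx u)"
  unfolding almost_analytic_null_def
proof (intro conjI allI impI ballI)
  note sm = almost_analytic_null_smooth[OF u]
  obtain k where k: "test_function (\<lambda>z. u z - k)"
    using u by (auto simp: almost_analytic_null_def)
  have "test_function (dx u)"
    using test_function_derivative[OF k, of 1]
    by (simp add: frechet_derivative_diff_const smooth_differentiable[OF sm])
  then show "\<exists>k. test_function (\<lambda>z. dx u z - k)"
    by (intro exI[of _ 0]) simp
  have td: "test_function (\<lambda>z. frechet_derivative u (at z) v)" for v
    using test_function_derivative[OF k, of v]
    by (simp add: frechet_derivative_diff_const smooth_differentiable[OF sm])
  show "\<exists>C. \<forall>z. cmod (dbar (dx u) z) \<le> C * \<bar>Im z\<bar> ^ N" if "N > 0" for N
  proof -
    let ?f = "dbar u"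
    have smf: "smooth ?f" using sm by (rule smooth_dbar)
    obtain C where C: "\<And>z. cmod (?f z) \<le> C * \<bar>Im z\<bar> ^ (2 * N)"
      using almost_analytic_null_dbar_bound[OF u] by blast
    obtain M where M: "\<And>z. cmod (dx (dx ?f) z) \<le> M"
    proof -
      have e1: "dx ?f = (\<lambda>z. (1/2) * (dx (dx u) z + \<i> * dx (dy u) z))"
        unfolding dbar_eq by (intro ext frechet_derivative_dbar_form smooth_directional_derivative sm)
      have e: "dx (dx ?f) z = (1/2) * (dx (dx (dx u)) z + \<i> * dx (dx (dy u)) z)" for z
        unfolding e1 by (intro frechet_derivative_dbar_form smooth_directional_derivative sm)
      obtain M1 where M1: "\<And>z. cmod (dx (dx (dx u)) z) \<le> M1"
        using test_function_bounded[OF test_function_derivative[OF test_function_derivative[OF td[of 1], of 1], of 1]] by blast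
      obtain M2 where M2: "\<And>z. cmod (dx (dx (dy u)) z) \<le> M2"
        using test_function_bounded[OF test_function_derivative[OF test_function_derivative[OF td[of \<i>], of 1], of 1]] by blast
      have "cmod (dx (dx ?f) z) \<le> M1 + M2" for z
      proof -
        have "cmod (dx (dx ?f) z) = cmod (dx (dx (dx u)) z + \<i> * dx (dx (dy u)) z) / 2"
          unfolding e norm_mult by simp
        also have "\<dots> \<le> (cmod (dx (dx (dx u)) z) + cmod (dx (dx (dy u)) z)) / 2"
          using norm_triangle_ineq[of "dx (dx (dx u)) z" "\<i> * dx (dx (dy u)) z"] by (simp add: norm_mult)
        also have "\<dots> \<le> cmod (dx (dx (dx u)) z) + cmod (dx (dx (dy u)) z)"
          by simp
        also have "\<dots> \<le> M1 + M2"
          by (intro add_mono M1 M2)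
        finally show ?thesis .
      qed
      then show thesis by (rule that)
    qed
    have M0: "M \<ge> 0" using M norm_ge_zero order_trans by blast
    have b: "cmod (dx ?f z) \<le> 2 * C * \<bar>Im z\<bar> ^ (2 * N) / h + M * h" if h: "h > 0" for z h
    proof -
      have "cmod (of_real h * dx ?f z) \<le> cmod (?f (z + of_real h) - ?f z) + cmod (?f (z + of_real h) - ?f z - of_real h * dx ?f z)"
        using norm_triangle_ineq4[of "?f (z + of_real h) - ?f z" "?f (z + of_real h) - ?f z - of_real h * dx ?f z"] by simp
      also have "\<dots> \<le> (C * \<bar>Im z\<bar> ^ (2 * N) + C * \<bar>Im z\<bar> ^ (2 * N)) + M * h * h"
        using C[of "z + of_real h"] C[of z]
        by (intro add_mono order_trans[OF norm_triangle_ineq4] horizontal_increment_bound smf M h) auto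
      finally have "h * cmod (dx ?f z) \<le> 2 * C * \<bar>Im z\<bar> ^ (2 * N) + M * h * h"
        using h by (simp add: norm_mult)
      then show ?thesis
        using h by (simp add: field_simps)
    qed
    have "cmod (dbar (dx u) z) \<le> (2 * C + M) * \<bar>Im z\<bar> ^ N" for z
    proof (cases "Im z = 0")
      case True
      \<comment> \<open>On the real axis the first term vanishes and every \<open>h\<close> is
        allowed, which forces the value 0.\<close>
      have "cmod (dx ?f z) \<le> M * h" if "h > 0" for h
        using b[OF that, of z] True \<open>N > 0\<close> by (simp add: zero_power)
      then have le: "cmod (dx ?f z) * (M + 1) \<le> M * cmod (dx ?f z)" if "cmod (dx ?f z) > 0"
      proof -
        have "M + 1 > 0" using M0 by simp
        then show ?thesis
          using \<open>\<And>h. h > 0 \<Longrightarrow> cmod (dx ?f z) \<le> M * h\<close>[of "cmod (dx ?f z) / (M + 1)"] that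
          by (simp add: pos_le_divide_eq)
      qed
      have "cmod (dx ?f z) \<le> 0"
        by (rule ccontr) (use le in \<open>auto simp: algebra_simps\<close>)
      then show ?thesis
        using True \<open>N > 0\<close> by (simp add: zero_power dbar_dx[OF sm])
    next
      case False
      let ?h = "\<bar>Im z\<bar> ^ N"
      have h: "?h > 0" using False by simp
      have "\<bar>Im z\<bar> ^ (2 * N) = ?h * ?h"
        by (simp only: mult_2 power_add)
      then have "2 * C * \<bar>Im z\<bar> ^ (2 * N) / ?h = 2 * C * ?h"
        using False by simp
      then show ?thesis
        using b[OF h, of z] by (simp only: dbar_dx[OF sm] distrib_right)
    qed
    then show ?thesis by blast
  qed
  show "dx u (complex_of_real x) = 0" if x: "x \<in> U" for x
  proof -
    have "((\<lambda>t. u (complex_of_real t)) has_vector_derivative dx u (complex_of_real x)) (at x)"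
    proof -
      have "(complex_of_real has_vector_derivative 1) (at x)"
        using has_vector_derivative_of_real[OF DERIV_ident] by simp
      moreover have "(u has_derivative frechet_derivative u (at (of_real x))) (at (of_real x))"
        using smooth_has_derivative[OF sm] by blast
      ultimately show ?thesis
        using vector_derivative_diff_chain_within[unfolded o_def, of complex_of_real 1 x UNIV u]
          has_derivative_at_withinI by blast
    qed
    moreover have "((\<lambda>t. u (complex_of_real t)) has_vector_derivative 0) (at x)"
      using u x by (intro has_vector_derivative_transform_within_open[OF has_vector_derivative_const U x, of 0])
        (auto simp: almost_analytic_null_def)
    ultimately show ?thesis
      using vector_derivative_unique_at by blast
  qed
qed

text \<open>\<open>dy u\<close> is a combination of \<open>dbar u\<close> and \<open>dx u\<close>;
  the bound of the former by \<open>\<bar>Im z\<bar>\<close> is also one by the distance from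
  \<open>z\<close> to any real point.\<close>

lemma almost_analytic_null_dy_bound:
  assumes u: "almost_analytic_null U u" and C1: "\<And>s z. s \<in> S \<Longrightarrow> cmod (dx u z) \<le> C1 * cmod (z - of_real s) ^ N"
  shows "\<exists>C3\<ge>0. \<forall>s\<in>S. \<forall>z. cmod (dy u z) \<le> C3 * cmod (z - of_real s) ^ N"
proof -
  obtain C2 where C2: "\<And>z. cmod (dbar u z) \<le> C2 * \<bar>Im z\<bar> ^ N"
    using almost_analytic_null_dbar_bound[OF u] by blast
  have "cmod (dy u z) \<le> (2 * \<bar>C2\<bar> + \<bar>C1\<bar>) * cmod (z - of_real s) ^ N" if s: "s \<in> S" for z s
  proof -
    have "2 * dbar u z = dx u z + \<i> * dy u z"
      by (simp add: dbar_def)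
    then have "dy u z = - \<i> * (2 * dbar u z - dx u z)"
      by simp
    then have "cmod (dy u z) \<le> 2 * cmod (dbar u z) + cmod (dx u z)"
      using norm_triangle_ineq4[of "2 * dbar u z" "dx u z"] by (simp add: norm_mult)
    also have "\<dots> \<le> 2 * (\<bar>C2\<bar> * cmod (z - of_real s) ^ N) + \<bar>C1\<bar> * cmod (z - of_real s) ^ N"
    proof (intro add_mono mult_left_mono)
      have "\<bar>Im z\<bar> \<le> cmod (z - of_real s)"
        using abs_Im_le_cmod[of "z - of_real s"] by simp
      then have "\<bar>Im z\<bar> ^ N \<le> cmod (z - of_real s) ^ N"
        by (intro power_mono) auto
      then have "\<bar>C2\<bar> * \<bar>Im z\<bar> ^ N \<le> \<bar>C2\<bar> * cmod (z - of_real s) ^ N"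
        by (intro mult_left_mono) auto
      moreover have "C2 * \<bar>Im z\<bar> ^ N \<le> \<bar>C2\<bar> * \<bar>Im z\<bar> ^ N"
        by (intro mult_right_mono) auto
      ultimately show "cmod (dbar u z) \<le> \<bar>C2\<bar> * cmod (z - of_real s) ^ N"
        using C2[of z] by linarith
      have "C1 * cmod (z - of_real s) ^ N \<le> \<bar>C1\<bar> * cmod (z - of_real s) ^ N"
        by (intro mult_right_mono) auto
      then show "cmod (dx u z) \<le> \<bar>C1\<bar> * cmod (z - of_real s) ^ N"
        using C1[OF s, of z] by linarith
    qed auto
    finally show ?thesis by (simp add: algebra_simps)
  qed
  then show ?thesis
    by (intro exI[of _ "2 * \<bar>C2\<bar> + \<bar>C1\<bar>"]) auto
qed

text \<open>A function vanishing on \<open>U\<close> whose \<open>dbar\<close> derivative is flat on the real axis vanishes to infinite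
  order on the closure of \<open>U\<close>: the \<open>x\<close>-derivative is of the same kind, and it controls the
  \<open>y\<close>-derivative through the Cauchy-Riemann operator.\<close>

lemma almost_analytic_null_flat:
  assumes U: "open U" and u: "almost_analytic_null U u"
  shows "\<exists>C. \<forall>s\<in>closure U. \<forall>z. cmod (u z) \<le> C * cmod (z - of_real s) ^ N
      \<and> cmod (dx u z) \<le> C * cmod (z - of_real s) ^ N \<and> cmod (dy u z) \<le> C * cmod (z - of_real s) ^ N"
proof -
  have main: "\<exists>C. \<forall>s\<in>closure U. \<forall>z. cmod (u z) \<le> C * cmod (z - of_real s) ^ N" if "almost_analytic_null U u" for u N
    using that
  proof (induction N arbitrary: u)
    case 0
    then obtain k where "test_function (\<lambda>z. u z - k)"
      by (auto simp: almost_analytic_null_def)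
    from test_function_bounded[OF this] obtain M where "\<And>z. cmod (u z - k) \<le> M" by blast
    then have "cmod (u z) \<le> M + cmod k" for z
      using norm_triangle_ineq[of "u z - k" k] by (smt (verit) diff_add_cancel)
    then show ?case by (intro exI[of _ "M + cmod k"]) simp
  next
    case (Suc N)
    note sm = almost_analytic_null_smooth[OF Suc.prems]
    obtain C1 where C1: "\<And>s z. s \<in> closure U \<Longrightarrow> cmod (dx u z) \<le> C1 * cmod (z - of_real s) ^ N"
      using Suc.IH[OF almost_analytic_null_dx[OF U Suc.prems]] by blast
    have "\<exists>C3\<ge>0. \<forall>s\<in>closure U. \<forall>z. cmod (dy u z) \<le> C3 * cmod (z - of_real s) ^ N"
      by (rule almost_analytic_null_dy_bound[OF Suc.prems]) (rule C1)
    then obtain C3 where C3a: "C3 \<ge> 0" and C3b: "\<forall>s\<in>closure U. \<forall>z. cmod (dy u z) \<le> C3 * cmod (z - of_real s) ^ N"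
      by (elim exE conjE)
    note C3 = C3a C3b[rule_format]
    let ?C = "\<bar>C1\<bar> + C3"
    have "cmod (u z) \<le> ?C * cmod (z - of_real s) ^ Suc N" if s: "s \<in> closure U" for z s
    proof -
      let ?d = "cmod (z - of_real s)"
      have us: "u (of_real s) = 0"
      proof -
        have "closed {s. u (complex_of_real s) = 0}"
          using smooth_continuous[OF sm, of UNIV]
          by (intro closed_Collect_eq) (auto intro!: continuous_on_compose2[where t=UNIV and g=u] continuous_intros)
        moreover have "U \<subseteq> {s. u (complex_of_real s) = 0}"
          using Suc.prems by (auto simp: almost_analytic_null_def)
        ultimately show ?thesis
          using s closure_minimal by blast
      qed
      \<comment> \<open>Here the order rises by one: the gradient is at most
        \<open>?C * ?d ^ N\<close> on the ball around \<open>s\<close> that reaches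
        \<open>z\<close>, and the mean value inequality contributes another factor
        \<open>?d\<close>.\<close>
      have "norm (u z - u (of_real s)) \<le> (?C * ?d ^ N) * norm (z - of_real s)"
      proof (rule differentiable_bound[of "cball (of_real s) ?d" u "\<lambda>w. frechet_derivative u (at w)"])
        fix w assume w: "w \<in> cball (complex_of_real s) ?d"
        show "(u has_derivative frechet_derivative u (at w)) (at w within cball (of_real s) ?d)"
          using smooth_has_derivative[OF sm] has_derivative_at_withinI by blast
        have wd: "cmod (w - of_real s) \<le> ?d" using w by (simp add: dist_norm norm_minus_commute)
        then have wp: "cmod (w - of_real s) ^ N \<le> ?d ^ N" by (intro power_mono) auto
        show "onorm (frechet_derivative u (at w)) \<le> ?C * ?d ^ N"
        proof (rule onorm_le)
          fix h
          have "frechet_derivative u (at w) h = of_real (Re h) * dx u w + of_real (Im h) * dy u w"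
            by (rule linear_combination_1_i[OF has_derivative_bounded_linear[OF smooth_has_derivative[OF sm]]])
          then have "norm (frechet_derivative u (at w) h) \<le> \<bar>Re h\<bar> * cmod (dx u w) + \<bar>Im h\<bar> * cmod (dy u w)"
            using norm_triangle_ineq[of "of_real (Re h) * dx u w" "of_real (Im h) * dy u w"] by (simp add: norm_mult)
          also have "\<dots> \<le> norm h * (\<bar>C1\<bar> * ?d ^ N) + norm h * (C3 * ?d ^ N)"
          proof (intro add_mono mult_mono abs_Re_le_cmod abs_Im_le_cmod)
            have "C1 * cmod (w - of_real s) ^ N \<le> \<bar>C1\<bar> * ?d ^ N"
              using wp by (intro mult_mono) auto
            then show "cmod (dx u w) \<le> \<bar>C1\<bar> * ?d ^ N" using C1[OF s, of w] by linarith
            have "C3 * cmod (w - of_real s) ^ N \<le> C3 * ?d ^ N"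
              using wp C3(1) by (intro mult_left_mono) auto
            then show "cmod (dy u w) \<le> C3 * ?d ^ N" using C3(2)[OF s, of w] by linarith
          qed auto
          finally show "norm (frechet_derivative u (at w) h) \<le> ?C * ?d ^ N * norm h"
            by (simp add: algebra_simps)
        qed
      qed (auto simp: dist_norm norm_minus_commute)
      then show ?thesis
        by (simp add: us mult_ac)
    qed
    then show ?case by blast
  qed
  obtain C0 where C0: "\<And>s z. s \<in> closure U \<Longrightarrow> cmod (u z) \<le> C0 * cmod (z - of_real s) ^ N"
    using main[OF u] by blast
  obtain C1 where C1: "\<And>s z. s \<in> closure U \<Longrightarrow> cmod (dx u z) \<le> C1 * cmod (z - of_real s) ^ N"
    using main[OF almost_analytic_null_dx[OF U u]] by blast
  have "\<exists>C3\<ge>0. \<forall>s\<in>closure U. \<forall>z. cmod (dy u z) \<le> C3 * cmod (z - of_real s) ^ N"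
    by (rule almost_analytic_null_dy_bound[OF u]) (rule C1)
  then obtain C2 where C2': "\<forall>s\<in>closure U. \<forall>z. cmod (dy u z) \<le> C2 * cmod (z - of_real s) ^ N"
    by (elim exE conjE)
  note C2 = C2'[rule_format]
  define C where "C = max C0 (max C1 C2)"
  have le: "c * cmod w ^ N \<le> C * cmod w ^ N" if "c \<in> {C0, C1, C2}" for c w
    using that by (intro mult_right_mono) (auto simp: C_def)
  show ?thesis
  proof (intro exI[of _ C] ballI allI conjI)
    fix s z assume s: "s \<in> closure U"
    show "cmod (u z) \<le> C * cmod (z - of_real s) ^ N"
      by (rule order_trans[OF C0[OF s]]) (rule le, simp)
    show "cmod (dx u z) \<le> C * cmod (z - of_real s) ^ N"
      by (rule order_trans[OF C1[OF s]]) (rule le, simp)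
    show "cmod (dy u z) \<le> C * cmod (z - of_real s) ^ N"
      by (rule order_trans[OF C2[OF s]]) (rule le, simp)
  qed
qed

section \<open>Green's formula and holomorphic functions with real singularities\<close>

text \<open>Fubini's theorem for complex rectangles, carried over from pairs of reals along the
  measure preserving identification of the two.\<close>

lemma integral_complex_box:
  fixes f :: "complex \<Rightarrow> 'b::banach"
  assumes f: "continuous_on (cbox (Complex p m) (Complex q n)) f"
  shows "integral (cbox (Complex p m) (Complex q n)) f = integral {p..q} (\<lambda>x. integral {m..n} (\<lambda>y. f (Complex x y)))"
    and "integral (cbox (Complex p m) (Complex q n)) f = integral {m..n} (\<lambda>y. integral {p..q} (\<lambda>x. f (Complex x y)))"
proof -
  define F where "F = (\<lambda>(x, y). f (Complex x y))"
  have img1: "(\<lambda>z. (Re z, Im z)) ` cbox u v = cbox (Re u, Im u) (Re v, Im v)" for u v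
  proof (intro equalityI subsetI)
    fix w assume "w \<in> cbox (Re u, Im u) (Re v, Im v)"
    then have "Complex (fst w) (snd w) \<in> cbox u v" "w = (Re (Complex (fst w) (snd w)), Im (Complex (fst w) (snd w)))"
      by (auto simp: in_cbox_complex_iff cbox_Pair_eq)
    then show "w \<in> (\<lambda>z. (Re z, Im z)) ` cbox u v" by blast
  qed (auto simp: in_cbox_complex_iff cbox_Pair_eq)
  have img2: "(\<lambda>(x, y). Complex x y) ` cbox u v = cbox (Complex (fst u) (snd u)) (Complex (fst v) (snd v))" for u v
  proof (intro equalityI subsetI)
    fix w assume "w \<in> cbox (Complex (fst u) (snd u)) (Complex (fst v) (snd v))"
    then have "(Re w, Im w) \<in> cbox u v" "w = (case (Re w, Im w) of (x, y) \<Rightarrow> Complex x y)"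
      by (cases u; cases v; auto simp: in_cbox_complex_iff cbox_Pair_eq)+
    then show "w \<in> (\<lambda>(x, y). Complex x y) ` cbox u v" by blast
  qed (cases u; cases v; auto simp: in_cbox_complex_iff cbox_Pair_eq)
  have cont: "measure lborel ((\<lambda>z. (Re z, Im z)) ` cbox u v) = 1 * measure lborel (cbox u v)" for u v
  proof (cases "Re u \<le> Re v \<and> Im u \<le> Im v")
    case True
    then have "u \<in> cbox u v" by (simp add: in_cbox_complex_iff)
    then have "measure lborel (cbox u v) = (Re v - Re u) * (Im v - Im u)"
      by (subst content_cbox') (auto simp: Basis_complex_def)
    then show ?thesis
      using True unfolding img1 content_Pair by simp
  next
    case False
    then have "cbox u v = {}" by (auto simp: in_cbox_complex_iff)
    then show ?thesis by simp
  qed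
  have Fc: "continuous_on (cbox (p, m) (q, n)) F"
  proof -
    have "continuous_on (cbox (p, m) (q, n)) (f \<circ> (\<lambda>(x, y). Complex x y))"
    proof (rule continuous_on_compose)
      show "continuous_on (cbox (p, m) (q, n)) (\<lambda>(x, y). Complex x y)"
        unfolding case_prod_beta Complex_eq by (intro continuous_intros)
      show "continuous_on ((\<lambda>(x, y). Complex x y) ` cbox (p, m) (q, n)) f"
        using f by (simp add: img2)
    qed
    moreover have "f \<circ> (\<lambda>(x, y). Complex x y) = F" by (auto simp: F_def fun_eq_iff)
    ultimately show ?thesis by simp
  qed
  have "((\<lambda>z. F (Re z, Im z)) has_integral (1 / 1) *\<^sub>R integral (cbox (p, m) (q, n)) F)
      ((\<lambda>(x, y). Complex x y) ` cbox (p, m) (q, n))"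
  proof (rule has_integral_twiddle[where g="\<lambda>z. (Re z, Im z)" and f=F])
    show "(F has_integral integral (cbox (p, m) (q, n)) F) (cbox (p, m) (q, n))"
      using integrable_continuous[OF Fc] by (rule integrable_integral)
    show "\<exists>w z. (\<lambda>z. (Re z, Im z)) ` cbox u v = cbox w z" for u v using img1 by blast
    show "\<exists>w z. (\<lambda>(x, y). Complex x y) ` cbox u v = cbox w z" for u v using img2 by blast
  qed (auto simp: cont intro!: continuous_intros)
  then have "(f has_integral integral (cbox (p, m) (q, n)) F) (cbox (Complex p m) (Complex q n))"
    by (simp add: img2 F_def)
  then have e: "integral (cbox (Complex p m) (Complex q n)) f = integral (cbox (p, m) (q, n)) F"
    by (rule integral_unique)
  show "integral (cbox (Complex p m) (Complex q n)) f = integral {p..q} (\<lambda>x. integral {m..n} (\<lambda>y. f (Complex x y)))"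
    unfolding e integral_prod_continuous[OF Fc] by (simp add: F_def)
  have sw: "continuous_on (cbox (m, p) (n, q)) (\<lambda>(x, y). f (Complex y x))"
  proof -
    have "continuous_on (cbox (m, p) (n, q)) (F \<circ> prod.swap)"
      by (rule continuous_on_compose[OF continuous_on_swap]) (use Fc in simp)
    moreover have "F \<circ> prod.swap = (\<lambda>(x, y). f (Complex y x))" by (auto simp: F_def fun_eq_iff)
    ultimately show ?thesis by simp
  qed
  have "integral (cbox (p, m) (q, n)) (\<lambda>(x, y). f (Complex x y)) = integral (cbox (m, p) (n, q)) (\<lambda>(x, y). f (Complex y x))"
    by (rule integral_swap_2dim) (use Fc in \<open>simp add: F_def\<close>)
  then show "integral (cbox (Complex p m) (Complex q n)) f = integral {m..n} (\<lambda>y. integral {p..q} (\<lambda>x. f (Complex x y)))"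
    unfolding e F_def integral_prod_continuous[OF sw] by simp
qed

lemma has_vector_derivative_along_line:
  fixes g :: "complex \<Rightarrow> complex"
  assumes "(g has_derivative D) (at (a + of_real t * b))"
  shows "((\<lambda>t. g (a + of_real t * b)) has_vector_derivative D b) (at t within T)"
proof -
  have "((\<lambda>t. a + of_real t * b) has_vector_derivative 1 * b) (at t within T)"
    by (auto intro!: derivative_eq_intros simp: has_vector_derivative_def scaleR_conv_of_real)
  moreover have "(g has_derivative D) (at (a + of_real t * b) within (\<lambda>t. a + of_real t * b) ` T)"
    using assms by (rule has_derivative_at_withinI)
  ultimately have "((g \<circ> (\<lambda>t. a + of_real t * b)) has_vector_derivative D (1 * b)) (at t within T)"
    by (rule vector_derivative_diff_chain_within)
  then show ?thesis by (simp add: o_def)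
qed

text \<open>The integrand on the left is \<open>2 * dbar g\<close>. For each partial derivative
  Fubini's theorem puts its own variable inside, and the fundamental theorem leaves the boundary
  values.\<close>

lemma green_rectangle:
  fixes g :: "complex \<Rightarrow> complex"
  assumes pq: "p \<le> q" "m \<le> n"
    and D: "\<And>z. z \<in> cbox (Complex p m) (Complex q n) \<Longrightarrow> (g has_derivative D z) (at z)"
    and c1: "continuous_on (cbox (Complex p m) (Complex q n)) (\<lambda>z. D z 1)"
    and c2: "continuous_on (cbox (Complex p m) (Complex q n)) (\<lambda>z. D z \<i>)"
  shows "integral (cbox (Complex p m) (Complex q n)) (\<lambda>z. D z 1 + \<i> * D z \<i>)
    = integral {m..n} (\<lambda>y. g (Complex q y) - g (Complex p y)) + \<i> * integral {p..q} (\<lambda>x. g (Complex x n) - g (Complex x m))"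
proof -
  let ?R = "cbox (Complex p m) (Complex q n)"
  have "integral ?R (\<lambda>z. D z 1 + \<i> * D z \<i>) = integral ?R (\<lambda>z. D z 1) + integral ?R (\<lambda>z. \<i> * D z \<i>)"
    by (intro integral_add integrable_continuous c1 continuous_on_mult_left c2)
  also have "integral ?R (\<lambda>z. \<i> * D z \<i>) = \<i> * integral ?R (\<lambda>z. D z \<i>)"
    by (rule integral_mult_right)
  also have "integral ?R (\<lambda>z. D z 1) = integral {m..n} (\<lambda>y. integral {p..q} (\<lambda>x. D (Complex x y) 1))"
    by (rule integral_complex_box(2)[OF c1])
  also have "\<dots> = integral {m..n} (\<lambda>y. g (Complex q y) - g (Complex p y))"
  proof (rule integral_cong)
    fix y assume y: "y \<in> {m..n}"
    have "((\<lambda>x. D (Complex x y) 1) has_integral g (Complex q y) - g (Complex p y)) {p..q}"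
    proof (rule fundamental_theorem_of_calculus[OF pq(1)])
      fix x assume x: "x \<in> {p..q}"
      have e: "Complex t y = \<i> * of_real y + of_real t * 1" for t by (simp add: complex_eq_iff)
      have "(g has_derivative D (Complex x y)) (at (\<i> * of_real y + of_real x * 1))"
        using D[of "Complex x y"] x y unfolding e[symmetric] by (simp add: in_cbox_complex_iff)
      from has_vector_derivative_along_line[OF this]
      show "((\<lambda>x. g (Complex x y)) has_vector_derivative D (Complex x y) 1) (at x within {p..q})"
        unfolding e .
    qed
    then show "integral {p..q} (\<lambda>x. D (Complex x y) 1) = g (Complex q y) - g (Complex p y)"
      by (rule integral_unique)
  qed
  also have "integral ?R (\<lambda>z. D z \<i>) = integral {p..q} (\<lambda>x. integral {m..n} (\<lambda>y. D (Complex x y) \<i>))"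
    by (rule integral_complex_box(1)[OF c2])
  also have "\<dots> = integral {p..q} (\<lambda>x. g (Complex x n) - g (Complex x m))"
  proof (rule integral_cong)
    fix x assume x: "x \<in> {p..q}"
    have "((\<lambda>y. D (Complex x y) \<i>) has_integral g (Complex x n) - g (Complex x m)) {m..n}"
    proof (rule fundamental_theorem_of_calculus[OF pq(2)])
      fix y assume y: "y \<in> {m..n}"
      have e: "Complex x t = of_real x + of_real t * \<i>" for t by (simp add: complex_eq_iff)
      have "(g has_derivative D (Complex x y)) (at (of_real x + of_real y * \<i>))"
        using D[of "Complex x y"] x y unfolding e[symmetric] by (simp add: in_cbox_complex_iff)
      from has_vector_derivative_along_line[OF this]
      show "((\<lambda>y. g (Complex x y)) has_vector_derivative D (Complex x y) \<i>) (at y within {m..n})"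
        unfolding e .
    qed
    then show "integral {m..n} (\<lambda>y. D (Complex x y) \<i>) = g (Complex x n) - g (Complex x m)"
      by (rule integral_unique)
  qed
  finally show ?thesis .
qed

text \<open>On a circle of radius \<open>r\<close> around a real point \<open>x\<close> one has \<open>|(w - x)\<^sup>2 - r\<^sup>2| = 2 r |Im w|\<close>, so the
  maximum principle for \<open>((w - x)\<^sup>2 - r\<^sup>2)\<^sup>2 f w\<close> turns the bound in terms of \<open>Im w\<close> into a bound on the
  real axis.\<close>

lemma real_singularities_bound:
  fixes S :: "complex set"
  assumes S: "closed S" "S \<subseteq> \<real>" "S \<noteq> {}" and f: "f holomorphic_on - S"
    and bd: "\<And>z. Im z \<noteq> 0 \<Longrightarrow> cmod (f z) \<le> C / (Im z)\<^sup>2" and z: "z \<notin> S"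
  shows "cmod (f z) \<le> 36 * C / (infdist z S)\<^sup>2"
proof -
  define d where "d = infdist z S"
  have d: "d > 0" using z S infdist_pos_not_in_closed d_def by metis
  have C: "C \<ge> 0" using order_trans[OF norm_ge_zero bd[of \<i>]] by simp
  show ?thesis
  proof (cases "\<bar>Im z\<bar> \<ge> d / 3")
    case True
    then have "(d / 3)\<^sup>2 \<le> (Im z)\<^sup>2"
      using d by (metis abs_ge_zero divide_nonneg_nonneg less_imp_le power2_abs power_mono zero_le_numeral)
    have "Im z \<noteq> 0" using True d by auto
    then have "cmod (f z) \<le> C / (Im z)\<^sup>2" by (rule bd)
    also have "\<dots> \<le> C / (d / 3)\<^sup>2"
      using \<open>(d / 3)\<^sup>2 \<le> (Im z)\<^sup>2\<close> C d by (intro divide_left_mono mult_pos_pos) (auto simp: \<open>Im z \<noteq> 0\<close>)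
    also have "\<dots> = 9 * C / d\<^sup>2" by (simp add: power_divide)
    also have "\<dots> \<le> 36 * C / d\<^sup>2" using C d by (intro divide_right_mono) auto
    finally show ?thesis by (simp add: d_def)
  next
    case False
    \<comment> \<open>The disc of radius \<open>d / 3\<close> about the real part of
      \<open>z\<close> contains \<open>z\<close> and avoids \<open>S\<close>, since
      \<open>\<bar>Im z\<bar> + r < d\<close>. On its boundary \<open>h\<close> is at most
      \<open>4 r\<^sup>2 C\<close>, at \<open>z\<close> it is at least
      \<open>r ^ 4 * cmod (f z)\<close>, and
      \<open>4 C / r\<^sup>2 = 36 C / d\<^sup>2\<close>.\<close>
    define r where "r = d / 3"
    have r: "r > 0" "\<bar>Im z\<bar> < r" using d False by (auto simp: r_def)
    define x where "x = complex_of_real (Re z)"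
    have zx: "z - x = \<i> * of_real (Im z)" by (simp add: x_def complex_eq_iff)
    have disj: "w \<notin> S" if "w \<in> cball x r" for w
    proof
      assume "w \<in> S"
      then have "d \<le> dist z w" unfolding d_def by (rule infdist_le)
      also have "\<dots> \<le> dist z x + dist x w" by (rule dist_triangle)
      also have "\<dots> \<le> \<bar>Im z\<bar> + r" using that zx by (simp add: dist_norm norm_mult)
      also have "\<dots> < d" using r d by (simp add: r_def)
      finally show False by simp
    qed
    define h where "h w = ((w - x)\<^sup>2 - (of_real r)\<^sup>2)\<^sup>2 * f w" for w
    have hol: "h holomorphic_on cball x r"
      unfolding h_def by (intro holomorphic_intros holomorphic_on_subset[OF f]) (use disj in auto)
    have "cmod (h z) \<le> 4 * r\<^sup>2 * C"
    proof (rule maximum_modulus_frontier[of h "cball x r"])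
      show "h holomorphic_on interior (cball x r)"
        using hol interior_subset holomorphic_on_subset by blast
      show "continuous_on (closure (cball x r)) h"
        using holomorphic_on_imp_continuous_on[OF hol] by simp
      show "z \<in> cball x r"
        using r zx by (simp add: dist_norm norm_minus_commute[of x] norm_mult)
      fix w assume "w \<in> frontier (cball x r)"
      then have w: "cmod (w - x) = r" by (simp add: frontier_cball dist_norm norm_minus_commute)
      define a b where "a = Re (w - x)" and "b = Im (w - x)"
      have wab: "w - x = Complex a b" by (simp add: a_def b_def complex_eq_iff)
      have ab: "a\<^sup>2 + b\<^sup>2 = r\<^sup>2" using w by (simp add: wab cmod_def) (metis real_sqrt_pow2 sum_power2_ge_zero)
      have "(w - x)\<^sup>2 - (of_real r)\<^sup>2 = Complex (a\<^sup>2 - b\<^sup>2 - r\<^sup>2) (2 * (a * b))"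
        unfolding wab by (simp add: complex_eq_iff power2_eq_square)
      also have "\<dots> = 2 * \<i> * of_real b * (w - x)"
        unfolding ab[symmetric] wab by (simp add: complex_eq_iff power2_eq_square)
      finally have e: "cmod ((w - x)\<^sup>2 - (of_real r)\<^sup>2) = 2 * \<bar>b\<bar> * r"
        by (simp add: norm_mult w)
      have bI: "b = Im w" by (simp add: b_def x_def)
      show "cmod (h w) \<le> 4 * r\<^sup>2 * C"
      proof (cases "b = 0")
        case True
        then show ?thesis using e C by (simp add: h_def norm_mult norm_power)
      next
        case False
        have "cmod (h w) = (2 * \<bar>b\<bar> * r)\<^sup>2 * cmod (f w)"
          unfolding h_def norm_mult norm_power e ..
        also have "\<dots> \<le> (2 * \<bar>b\<bar> * r)\<^sup>2 * (C / b\<^sup>2)"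
          using bd[of w] False by (intro mult_left_mono) (auto simp: bI)
        also have "\<dots> = 4 * r\<^sup>2 * C" using False by (simp add: power_mult_distrib)
        finally show ?thesis .
      qed
    qed auto
    moreover have "r ^ 4 * cmod (f z) \<le> cmod (h z)"
    proof -
      have "(z - x)\<^sup>2 - (of_real r)\<^sup>2 = - of_real ((Im z)\<^sup>2 + r\<^sup>2)"
        unfolding zx by (simp add: power_mult_distrib)
      then have "cmod ((z - x)\<^sup>2 - (of_real r)\<^sup>2) = (Im z)\<^sup>2 + r\<^sup>2"
        by (simp only: norm_minus_cancel norm_of_real) simp
      then have "cmod (h z) = ((Im z)\<^sup>2 + r\<^sup>2)\<^sup>2 * cmod (f z)"
        unfolding h_def norm_mult norm_power by simp
      moreover have "(r\<^sup>2)\<^sup>2 \<le> ((Im z)\<^sup>2 + r\<^sup>2)\<^sup>2"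
        by (intro power_mono) auto
      ultimately show ?thesis
        using mult_right_mono[of "(r\<^sup>2)\<^sup>2" "((Im z)\<^sup>2 + r\<^sup>2)\<^sup>2" "cmod (f z)"] by simp
    qed
    ultimately have "r\<^sup>2 * (r\<^sup>2 * cmod (f z)) \<le> r\<^sup>2 * (4 * C)"
      by (simp add: power4_eq_xxxx power2_eq_square mult_ac)
    then have "r\<^sup>2 * cmod (f z) \<le> 4 * C"
      by (rule mult_left_le_imp_le) (use r in simp)
    then have "d\<^sup>2 * cmod (f z) \<le> 36 * C"
      by (simp add: r_def power_divide)
    then have "cmod (f z) \<le> 36 * C / d\<^sup>2"
      using d by (simp add: field_simps)
    then show ?thesis by (simp add: d_def)
  qed
qed

text \<open>Cauchy's estimate on the circle of radius \<open>d / 2\<close>: there the distance to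
  \<open>S\<close> is at least \<open>d / 2\<close>, so \<open>f\<close> is at most
  \<open>144 C / d\<^sup>2\<close>.\<close>

lemma real_singularities_deriv_bound:
  fixes S :: "complex set"
  assumes S: "closed S" "S \<subseteq> \<real>" "S \<noteq> {}" and f: "f holomorphic_on - S"
    and bd: "\<And>z. Im z \<noteq> 0 \<Longrightarrow> cmod (f z) \<le> C / (Im z)\<^sup>2" and z: "z \<notin> S"
  shows "cmod (deriv f z) \<le> 288 * C / (infdist z S)^3"
proof -
  define d where "d = infdist z S"
  have d: "d > 0" using z S infdist_pos_not_in_closed d_def by metis
  have C: "C \<ge> 0" using order_trans[OF norm_ge_zero bd[of \<i>]] by simp
  have inf: "infdist w S \<ge> d / 2" if "cmod (z - w) \<le> d / 2" for w
    using infdist_triangle[of z S w] that by (simp add: d_def dist_norm)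
  have nin: "w \<notin> S" if "w \<in> cball z (d / 2)" for w
    using inf[of w] that d by (auto simp: dist_norm)
  have "norm ((deriv ^^ 1) f z) \<le> fact 1 * (144 * C / d\<^sup>2) / (d / 2) ^ 1"
  proof (rule Cauchy_inequality)
    have hol: "f holomorphic_on cball z (d / 2)"
      by (rule holomorphic_on_subset[OF f]) (use nin in auto)
    then show "f holomorphic_on ball z (d / 2)"
      using ball_subset_cball holomorphic_on_subset by blast
    show "continuous_on (cball z (d / 2)) f"
      using hol by (rule holomorphic_on_imp_continuous_on)
    fix w assume w: "cmod (z - w) = d / 2"
    then have wS: "w \<notin> S" using nin by (simp add: dist_norm)
    have i: "infdist w S \<ge> d / 2" using inf w by simp
    have "cmod (f w) \<le> 36 * C / (infdist w S)\<^sup>2"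
      using real_singularities_bound[OF S f bd wS] by blast
    also have "\<dots> \<le> 36 * C / (d / 2)\<^sup>2"
      using i d C by (intro divide_left_mono power_mono mult_pos_pos zero_less_power) auto
    finally show "cmod (f w) \<le> 144 * C / d\<^sup>2" by (simp add: power_divide)
  qed (use d in auto)
  also have "\<dots> = 288 * C / d ^ 3"
    using d by (simp add: power2_eq_square power3_eq_cube)
  finally show ?thesis by (simp add: d_def)
qed

text \<open>At distance \<open>d\<close> from \<open>S\<close> the factor \<open>f\<close> is of
  order -2 in \<open>d\<close> and its derivative of order -3. Flatness of \<open>u\<close> to order
  5 outweighs both, so the product and its derivative tend to 0 and the extension by zero is
  continuously differentiable across \<open>S\<close>.\<close>

lemma flat_product_C1:
  fixes S :: "complex set"
  assumes S: "closed S" "S \<subseteq> \<real>" and f: "f holomorphic_on - S"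
    and bd: "\<And>z. Im z \<noteq> 0 \<Longrightarrow> cmod (f z) \<le> C / (Im z)\<^sup>2"
    and U: "open U" and u: "almost_analytic_null U u"
    and A: "open A" and SA: "S \<inter> A \<subseteq> complex_of_real ` closure U"
  shows "\<exists>D. (\<forall>z\<in>A. ((\<lambda>z. if z \<in> S then 0 else u z * f z) has_derivative D z) (at z)) \<and>
    continuous_on A (\<lambda>z. D z 1) \<and> continuous_on A (\<lambda>z. D z \<i>) \<and>
    (\<forall>z\<in>- S. D z 1 + \<i> * D z \<i> = 2 * (dbar u z * f z)) \<and> (\<forall>z\<in>S. D z = (\<lambda>_. 0))"
proof -
  define D where "D z = (if z \<in> S then (\<lambda>_. 0) else (\<lambda>h. u z * (deriv f z * h) + frechet_derivative u (at z) h * f z))" for z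
  let ?g = "\<lambda>z. if z \<in> S then 0 else u z * f z"
  note smu = almost_analytic_null_smooth[OF u]
  have oS: "open (- S)" using S by auto
  have off: "(?g has_derivative D z) (at z)" if z: "z \<notin> S" for z
  proof -
    have "(f has_derivative (\<lambda>h. deriv f z * h)) (at z)"
      using holomorphic_derivI[OF f oS, of z] z by (simp add: has_field_derivative_def)
    from has_derivative_mult[OF smooth_has_derivative[OF smu] this]
    have "((\<lambda>z. u z * f z) has_derivative D z) (at z)"
      using z by (simp add: D_def)
    then show ?thesis
      by (rule has_derivative_transform_within_open[OF _ oS]) (use z in auto)
  qed
  have off_cont: "isCont (\<lambda>z. D z v) z" if z: "z \<notin> S" for z v
  proof -
    have hd: "deriv f holomorphic_on - S" using f oS by (rule holomorphic_deriv)
    have "continuous_on (- S) (\<lambda>z. u z * (deriv f z * v) + frechet_derivative u (at z) v * f z)"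
      by (intro continuous_intros smooth_continuous smu smooth_directional_derivative
          holomorphic_on_imp_continuous_on hd f)
    moreover have "continuous_on (- S) (\<lambda>z. D z v) = continuous_on (- S) (\<lambda>z. u z * (deriv f z * v) + frechet_derivative u (at z) v * f z)"
      by (rule continuous_on_cong) (auto simp: D_def)
    ultimately show ?thesis
      using continuous_on_eq_continuous_at[OF oS] z by auto
  qed
  obtain K where K: "\<And>s z. s \<in> closure U \<Longrightarrow> cmod (u z) \<le> K * cmod (z - of_real s) ^ 5"
     "\<And>s z. s \<in> closure U \<Longrightarrow> cmod (dx u z) \<le> K * cmod (z - of_real s) ^ 5"
     "\<And>s z. s \<in> closure U \<Longrightarrow> cmod (dy u z) \<le> K * cmod (z - of_real s) ^ 5"
    using almost_analytic_null_flat[OF U u, of 5] by metis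
  have near: "\<exists>e>0. \<exists>L. \<forall>w. cmod (w - s) < e \<longrightarrow>
      cmod (?g w) \<le> L * (cmod (w - s) * cmod (w - s)) \<and> cmod (D w 1) \<le> L * cmod (w - s) \<and> cmod (D w \<i>) \<le> L * cmod (w - s)"
    if s: "s \<in> S" "s \<in> A" for s
  proof -
    obtain e where e: "e > 0" "ball s e \<subseteq> A" using A s openE by blast
    define L where "L = \<bar>K\<bar> * 36 * C + \<bar>K\<bar> * 288 * C"
    have C: "C \<ge> 0" using order_trans[OF norm_ge_zero bd[of \<i>]] by simp
    have L: "L \<ge> 0" using C by (simp add: L_def)
    have "cmod (?g w) \<le> L * (cmod (w - s) * cmod (w - s)) \<and> cmod (D w 1) \<le> L * cmod (w - s) \<and> cmod (D w \<i>) \<le> L * cmod (w - s)"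
      if w: "cmod (w - s) < min (e / 2) 1" for w
    proof (cases "w \<in> S")
      case True
      then show ?thesis using L by (simp add: D_def)
    next
      case False
      have Sne: "S \<noteq> {}" using s by auto
      \<comment> \<open>Flatness is used at the point of \<open>S\<close> nearest to
        \<open>w\<close>, because the bounds on \<open>f\<close> involve the distance to all of
        \<open>S\<close>. The radius \<open>e / 2\<close> keeps that point in \<open>A\<close>,
        hence in the closure of \<open>U\<close>.\<close>
      obtain s' where s': "s' \<in> S" "infdist w S = dist w s'"
        using infdist_attains_inf[OF S(1) Sne] by metis
      define d where "d = cmod (w - s')"
      have di: "infdist w S = d" using s' by (simp add: d_def dist_norm)
      have d0: "d > 0" using False S(1) Sne infdist_pos_not_in_closed[of S w] by (simp add: di)
      have ds: "d \<le> cmod (w - s)"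
        using infdist_le[OF s(1), of w] by (simp add: di dist_norm)
      have "cmod (s' - s) \<le> cmod (w - s) + cmod (w - s')"
        using norm_triangle_ineq4[of "w - s" "w - s'"] by simp
      then have "s' \<in> ball s e" using w ds by (simp add: d_def dist_norm norm_minus_commute)
      then have "s' \<in> S \<inter> A" using s' e by auto
      then obtain x where x: "x \<in> closure U" "s' = of_real x" using SA by auto
      have Kd: "K * d ^ 5 \<le> \<bar>K\<bar> * d ^ 5" using d0 by (intro mult_right_mono) auto
      have b: "cmod (u w) \<le> \<bar>K\<bar> * d ^ 5" "cmod (dx u w) \<le> \<bar>K\<bar> * d ^ 5" "cmod (dy u w) \<le> \<bar>K\<bar> * d ^ 5"
        using K[OF x(1), of w] Kd unfolding x(2)[symmetric] d_def[symmetric] by linarith+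
      have fb: "cmod (f w) \<le> 36 * C / d\<^sup>2" "cmod (deriv f w) \<le> 288 * C / d ^ 3"
        using real_singularities_bound[OF S(1,2) Sne f bd False]
          real_singularities_deriv_bound[OF S(1,2) Sne f bd False] by (simp_all add: di)
      have d1: "d < 1" using ds w by simp
      have d53: "d ^ 5 * (1 / d\<^sup>2) = d * d * d" "d ^ 5 * (1 / d ^ 3) = d * d"
        using d0 by (simp_all add: power_numeral_reduce field_simps)
      have prod1: "a * b \<le> \<bar>K\<bar> * 36 * C * (d * d * d)" if "a \<le> \<bar>K\<bar> * d ^ 5" "b \<le> 36 * C / d\<^sup>2" "0 \<le> a" "0 \<le> b" for a b
      proof -
        have "a * b \<le> (\<bar>K\<bar> * d ^ 5) * (36 * C / d\<^sup>2)"
          using that d0 by (intro mult_mono) auto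
        also have "\<dots> = \<bar>K\<bar> * 36 * C * (d ^ 5 * (1 / d\<^sup>2))" by simp
        finally show ?thesis unfolding d53 .
      qed
      have prod2: "a * b \<le> \<bar>K\<bar> * 288 * C * (d * d)" if "a \<le> \<bar>K\<bar> * d ^ 5" "b \<le> 288 * C / d ^ 3" "0 \<le> a" "0 \<le> b" for a b
      proof -
        have "a * b \<le> (\<bar>K\<bar> * d ^ 5) * (288 * C / d ^ 3)"
          using that d0 by (intro mult_mono) auto
        also have "\<dots> = \<bar>K\<bar> * 288 * C * (d ^ 5 * (1 / d ^ 3))" by simp
        finally show ?thesis unfolding d53 .
      qed
      have ddd: "d * d * d \<le> d * d" "d * d \<le> d"
        using d0 d1 by (auto simp: mult_left_le)
      have dd: "d * d \<le> cmod (w - s) * cmod (w - s)"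
        using ds d0 by (intro mult_mono) auto
      have K1: "\<bar>K\<bar> * 36 * C \<ge> 0" and K2: "\<bar>K\<bar> * 288 * C \<ge> 0" using C by auto
      have g: "cmod (?g w) \<le> L * (cmod (w - s) * cmod (w - s))"
      proof -
        have "cmod (?g w) \<le> \<bar>K\<bar> * 36 * C * (d * d * d)"
          using False prod1[OF b(1) fb(1)] by (simp add: norm_mult)
        also have "\<dots> \<le> L * (cmod (w - s) * cmod (w - s))"
        proof (rule mult_mono[OF _ order_trans[OF ddd(1) dd] L])
          show "\<bar>K\<bar> * 36 * C \<le> L" using K2 by (simp add: L_def)
        qed (use d0 in simp)
        finally show ?thesis .
      qed
      have Dv: "cmod (D w v) \<le> L * cmod (w - s)" if v: "cmod v = 1" "cmod (frechet_derivative u (at w) v) \<le> \<bar>K\<bar> * d ^ 5" for v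
      proof -
        have "cmod (D w v) \<le> cmod (u w) * cmod (deriv f w) + cmod (frechet_derivative u (at w) v) * cmod (f w)"
          using False norm_triangle_ineq[of "u w * (deriv f w * v)" "frechet_derivative u (at w) v * f w"] v
          by (simp add: D_def norm_mult)
        also have "\<dots> \<le> \<bar>K\<bar> * 288 * C * (d * d) + \<bar>K\<bar> * 36 * C * (d * d * d)"
          by (intro add_mono prod1 prod2 b fb v) auto
        also have "\<dots> \<le> \<bar>K\<bar> * 288 * C * d + \<bar>K\<bar> * 36 * C * d"
          using ddd K1 K2 by (intro add_mono mult_left_mono) auto
        also have "\<dots> = L * d" by (simp add: L_def algebra_simps)
        also have "\<dots> \<le> L * cmod (w - s)" using ds L by (rule mult_left_mono)
        finally show ?thesis .
      qed
      show ?thesis using g Dv[of 1] Dv[of \<i>] b by simp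
    qed
    then show ?thesis
      using e(1) by (intro exI[of _ "min (e / 2) 1"] conjI exI[of _ L]) auto
  qed
  have at_S: "(?g has_derivative D s) (at s)" "isCont (\<lambda>z. D z 1) s" "isCont (\<lambda>z. D z \<i>) s" if s: "s \<in> S" "s \<in> A" for s
  proof -
    obtain e L where e: "e > 0" and L: "\<And>w. cmod (w - s) < e \<Longrightarrow> cmod (?g w) \<le> L * (cmod (w - s) * cmod (w - s))"
       "\<And>w. cmod (w - s) < e \<Longrightarrow> cmod (D w 1) \<le> L * cmod (w - s)" "\<And>w. cmod (w - s) < e \<Longrightarrow> cmod (D w \<i>) \<le> L * cmod (w - s)"
      using near[OF s] by metis
    have ev: "\<forall>\<^sub>F w in at s. cmod (w - s) < e"
      using e by (auto simp: eventually_at dist_norm)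
    have lim0: "((\<lambda>w. L * cmod (w - s)) \<longlongrightarrow> 0) (at s)"
    proof -
      have "((\<lambda>w. L * cmod (w - s)) \<longlongrightarrow> L * cmod (s - s)) (at s)" by (intro tendsto_intros)
      then show ?thesis by simp
    qed
    have Ds: "D s = (\<lambda>_. 0)" using s by (simp add: D_def)
    have c: "isCont (\<lambda>z. D z v) s" if "\<And>w. cmod (w - s) < e \<Longrightarrow> cmod (D w v) \<le> L * cmod (w - s)" for v
    proof -
      have "((\<lambda>z. D z v) \<longlongrightarrow> 0) (at s)"
        by (rule Lim_null_comparison[OF _ lim0]) (rule eventually_mono[OF ev that])
      then show ?thesis by (simp add: isCont_def Ds)
    qed
    show "isCont (\<lambda>z. D z 1) s" "isCont (\<lambda>z. D z \<i>) s"
      using c L by blast+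
    have "((\<lambda>w. norm (?g w - ?g s - D s (w - s)) / norm (w - s)) \<longlongrightarrow> 0) (at s)"
    proof (rule Lim_null_comparison[OF eventually_mono[OF ev] lim0])
      fix w assume w: "cmod (w - s) < e"
      have "cmod (?g w) / cmod (w - s) \<le> L * cmod (w - s)"
        using L(1)[OF w] s by (cases "w = s") (simp_all add: pos_divide_le_eq mult.assoc)
      then show "norm (norm (?g w - ?g s - D s (w - s)) / norm (w - s)) \<le> L * cmod (w - s)"
        using s by (simp add: Ds)
    qed
    then show "(?g has_derivative D s) (at s)"
      unfolding has_derivative_iff_norm Ds by simp
  qed
  show ?thesis
  proof (intro exI[of _ D] conjI ballI)
    show "(?g has_derivative D z) (at z)" if "z \<in> A" for z
      using off at_S(1) that by blast
    show "continuous_on A (\<lambda>z. D z 1)" "continuous_on A (\<lambda>z. D z \<i>)"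
      using off_cont at_S(2,3) by (blast intro: continuous_at_imp_continuous_on)+
    show "D z 1 + \<i> * D z \<i> = 2 * (dbar u z * f z)" if "z \<in> - S" for z
      using that by (simp add: D_def dbar_def algebra_simps)
    show "D z = (\<lambda>_. 0)" if "z \<in> S" for z
      using that by (simp add: D_def)
  qed
qed

text \<open>Green's formula is applied to \<open>(\<rho>' - 1) f\<close> left of the line and to
  \<open>\<rho>' f\<close> right of it; the \<open>dbar\<close> derivatives agree. The line occurs
  with opposite signs and contributes \<open>(\<rho>' - 1) f - \<rho>' f = - f\<close>. The factor
  \<open>- 1 / 2\<close> appears because the formula integrates twice the \<open>dbar\<close>
  derivative.\<close>

lemma dbar_integral_line:
  fixes S :: "complex set" and f \<rho>' :: "complex \<Rightarrow> complex"
  assumes S: "closed S" "S \<subseteq> \<real>" and f: "f holomorphic_on - S"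
    and bd: "\<And>z. Im z \<noteq> 0 \<Longrightarrow> cmod (f z) \<le> C / (Im z)\<^sup>2"
    and bd2: "\<And>z. cmod z \<ge> r \<Longrightarrow> z \<notin> S \<and> cmod (f z) \<le> C2 / (cmod z)\<^sup>2"
    and c: "complex_of_real c \<notin> S"
    and tf: "test_function \<rho>'" and db: "\<And>N. N > 0 \<Longrightarrow> \<exists>C. \<forall>z. cmod (dbar \<rho>' z) \<le> C * \<bar>Im z\<bar> ^ N"
    and U1: "open U1" "\<And>x. x \<in> U1 \<Longrightarrow> \<rho>' (of_real x) = 1" "S \<inter> {z. Re z < c} \<subseteq> complex_of_real ` closure U1"
    and U2: "open U2" "\<And>x. x \<in> U2 \<Longrightarrow> \<rho>' (of_real x) = 0" "S \<inter> {z. Re z > c} \<subseteq> complex_of_real ` closure U2"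
  shows "(\<lambda>n. - 1 / 2 * integral {- real n..real n} (\<lambda>t. f (Complex c t))) \<longlonglongrightarrow> integral UNIV (\<lambda>z. dbar \<rho>' z * f z)"
proof -
  define F where "F z = dbar \<rho>' z * f z" for z
  define u1 where "u1 z = \<rho>' z - 1" for z
  note sm = test_function_smooth[OF tf]
  have dbar_u1: "dbar u1 = dbar \<rho>'"
    unfolding u1_def dbar_eq by (simp add: frechet_derivative_diff_const smooth_differentiable[OF sm])
  have n1: "almost_analytic_null U1 u1"
    unfolding almost_analytic_null_def dbar_u1
  proof (intro conjI)
    show "\<exists>k. test_function (\<lambda>z. u1 z - k)"
      by (rule exI[of _ "- 1"]) (use tf in \<open>simp add: u1_def\<close>)
  qed (use db U1 in \<open>auto simp: u1_def\<close>)
  have n2: "almost_analytic_null U2 \<rho>'"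
    unfolding almost_analytic_null_def
  proof (intro conjI)
    show "\<exists>k. test_function (\<lambda>z. \<rho>' z - k)"
      by (rule exI[of _ "0"]) (use tf in simp)
  qed (use db U2 in auto)
  \<comment> \<open>The strip of half width \<open>e\<close> around the line is free of
    \<open>S\<close>, so both half planes can be enlarged to open sets containing the line without
    reaching the other part of \<open>S\<close>.\<close>
  obtain e where e: "e > 0" "ball (complex_of_real c) e \<subseteq> - S"
    using S(1) c by (meson ComplI open_Compl openE)
  have gap: "\<not> (c - e < Re z \<and> Re z < c + e)" if "z \<in> S" for z
  proof
    assume a: "c - e < Re z \<and> Re z < c + e"
    have "z = of_real (Re z)" using S(2) that by (auto simp: complex_is_Real_iff complex_eq_iff)
    then have "dist (complex_of_real c) z = \<bar>c - Re z\<bar>" by (metis dist_of_real dist_real_def)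
    then have "z \<in> ball (complex_of_real c) e" using a by auto
    then show False using e that by auto
  qed
  have vert: "Complex c t \<notin> S" for t
    using gap[of "Complex c t"] e by auto
  let ?A1 = "{z. Re z < c + e}" and ?A2 = "{z. Re z > c - e}"
  have A: "open ?A1" "open ?A2"
    by (auto intro!: open_Collect_less continuous_intros)
  have SA1: "S \<inter> ?A1 \<subseteq> complex_of_real ` closure U1" and SA2: "S \<inter> ?A2 \<subseteq> complex_of_real ` closure U2"
    using gap U1(3) U2(3) e(1) by fastforce+
  let ?g1 = "\<lambda>z. if z \<in> S then 0 else u1 z * f z" and ?g2 = "\<lambda>z. if z \<in> S then 0 else \<rho>' z * f z"
  have "\<exists>D. (\<forall>z\<in>?A1. (?g1 has_derivative D z) (at z)) \<and>
      continuous_on ?A1 (\<lambda>z. D z 1) \<and> continuous_on ?A1 (\<lambda>z. D z \<i>) \<and>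
      (\<forall>z\<in>- S. D z 1 + \<i> * D z \<i> = 2 * (dbar u1 z * f z)) \<and> (\<forall>z\<in>S. D z = (\<lambda>_. 0))"
    by (rule flat_product_C1[OF S f bd U1(1) n1 A(1) SA1])
  then obtain D1 where D1': "\<forall>z\<in>?A1. (?g1 has_derivative D1 z) (at z)"
      "continuous_on ?A1 (\<lambda>z. D1 z 1)" "continuous_on ?A1 (\<lambda>z. D1 z \<i>)"
      "\<forall>z\<in>- S. D1 z 1 + \<i> * D1 z \<i> = 2 * (dbar u1 z * f z)" "\<forall>z\<in>S. D1 z = (\<lambda>_. 0)"
    by (elim exE conjE)
  note D1 = D1'[rule_format]
  have "\<exists>D. (\<forall>z\<in>?A2. (?g2 has_derivative D z) (at z)) \<and>
      continuous_on ?A2 (\<lambda>z. D z 1) \<and> continuous_on ?A2 (\<lambda>z. D z \<i>) \<and>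
      (\<forall>z\<in>- S. D z 1 + \<i> * D z \<i> = 2 * (dbar \<rho>' z * f z)) \<and> (\<forall>z\<in>S. D z = (\<lambda>_. 0))"
    by (rule flat_product_C1[OF S f bd U2(1) n2 A(2) SA2])
  then obtain D2 where D2': "\<forall>z\<in>?A2. (?g2 has_derivative D2 z) (at z)"
      "continuous_on ?A2 (\<lambda>z. D2 z 1)" "continuous_on ?A2 (\<lambda>z. D2 z \<i>)"
      "\<forall>z\<in>- S. D2 z 1 + \<i> * D2 z \<i> = 2 * (dbar \<rho>' z * f z)" "\<forall>z\<in>S. D2 z = (\<lambda>_. 0)"
    by (elim exE conjE)
  note D2 = D2'[rule_format]
  have F0: "F z = 0" if "z \<in> S" for z
  proof -
    obtain C where "cmod (dbar \<rho>' z) \<le> C * \<bar>Im z\<bar> ^ 1" using db[of 1] by auto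
    moreover have "Im z = 0" using S(2) that by (auto simp: complex_is_Real_iff)
    ultimately show ?thesis by (simp add: F_def)
  qed
  have F1: "D1 z 1 + \<i> * D1 z \<i> = 2 * F z" if "z \<in> ?A1" for z
    using D1(4,5)[of z] that F0[of z] by (cases "z \<in> S") (auto simp: F_def dbar_u1)
  have F2: "D2 z 1 + \<i> * D2 z \<i> = 2 * F z" if "z \<in> ?A2" for z
    using D2(4,5)[of z] that F0[of z] by (cases "z \<in> S") (auto simp: F_def)
  obtain r0 where r0: "\<And>z. z \<in> closure {z. \<rho>' z \<noteq> 0} \<Longrightarrow> cmod z \<le> r0"
    using tf compact_imp_bounded bounded_iff unfolding test_function_def by metis
  have out: "\<rho>' z = 0" if "cmod z > r0" for z
    using r0[of z] that closure_subset[of "{z. \<rho>' z \<noteq> 0}"] by (auto simp: not_le[symmetric])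
  have Fout: "F z = 0" if "cmod z > r0" for z
  proof -
    have "(\<rho>' has_derivative (\<lambda>_. 0)) (at z)"
      by (rule has_derivative_transform_within_open[of "\<lambda>_. 0" _ z UNIV "{z. cmod z > r0}"])
         (use that out in \<open>auto intro!: open_Collect_less continuous_intros\<close>)
    then have "frechet_derivative \<rho>' (at z) = (\<lambda>_. 0)" by (rule frechet_derivative_at[symmetric])
    then show ?thesis by (simp add: F_def dbar_def)
  qed
  have fcont: "continuous_on X (\<lambda>t. f (h t))" if "continuous_on X h" "\<And>t. t \<in> X \<Longrightarrow> h t \<notin> S" for X and h :: "real \<Rightarrow> complex"
    using continuous_on_compose2[OF holomorphic_on_imp_continuous_on[OF f] that(1)] that(2) by blast
  have rcont: "continuous_on X (\<lambda>t. \<rho>' (h t))" if "continuous_on X h" for X and h :: "real \<Rightarrow> complex"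
    using continuous_on_compose2[OF smooth_continuous[OF sm, of UNIV] that] by blast
  have Cc: "continuous_on X (\<lambda>t. Complex a t)" "continuous_on X (\<lambda>t. Complex t a)" for X a
    unfolding Complex_eq by (intro continuous_intros)+
  define n0 where "n0 = \<bar>r\<bar> + \<bar>r0\<bar> + \<bar>c\<bar> + 1"
  \<comment> \<open>Outside the support the left product is \<open>- f\<close> and the right one is
    0. The three outer sides on the left have total length at most \<open>6 n\<close>, and
    \<open>f\<close> is at most \<open>\<bar>C2\<bar> / n\<^sup>2\<close> on them; half of the
    product is the error.\<close>
  have key: "cmod (- 1 / 2 * integral {- n..n} (\<lambda>t. f (Complex c t)) - integral UNIV F) \<le> 3 * \<bar>C2\<bar> / n" if n: "n \<ge> n0" for n :: real
  proof -
    have nn: "n > 0" "n > r0" "n \<ge> r" "\<bar>c\<bar> < n" using n by (auto simp: n0_def)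
    have big: "cmod (Complex x y) \<ge> n" if "\<bar>x\<bar> = n \<or> \<bar>y\<bar> = n" for x y
      using that abs_Re_le_cmod[of "Complex x y"] abs_Im_le_cmod[of "Complex x y"] by auto
    have bigS: "Complex x y \<notin> S \<and> \<rho>' (Complex x y) = 0 \<and> cmod (f (Complex x y)) \<le> \<bar>C2\<bar> / n\<^sup>2" if "\<bar>x\<bar> = n \<or> \<bar>y\<bar> = n" for x y
    proof -
      note b = big[OF that]
      have "C2 / (cmod (Complex x y))\<^sup>2 \<le> \<bar>C2\<bar> / (cmod (Complex x y))\<^sup>2" by (intro divide_right_mono) auto
      also have "\<dots> \<le> \<bar>C2\<bar> / n\<^sup>2"
        using b nn by (intro divide_left_mono power_mono mult_pos_pos zero_less_power) auto
      finally show ?thesis using bd2[of "Complex x y"] out[of "Complex x y"] b nn by fastforce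
    qed
    let ?L = "cbox (Complex (- n) (- n)) (Complex c n)" and ?R = "cbox (Complex c (- n)) (Complex n n)"
    have LA: "?L \<subseteq> ?A1" and RA: "?R \<subseteq> ?A2" using e by (auto simp: in_cbox_complex_iff)
    have g1: "integral ?L (\<lambda>z. D1 z 1 + \<i> * D1 z \<i>) = integral {- n..n} (\<lambda>y. ?g1 (Complex c y) - ?g1 (Complex (- n) y))
        + \<i> * integral {- n..c} (\<lambda>x. ?g1 (Complex x n) - ?g1 (Complex x (- n)))"
      using LA D1 nn by (intro green_rectangle) (auto intro: continuous_on_subset)
    have g2: "integral ?R (\<lambda>z. D2 z 1 + \<i> * D2 z \<i>) = integral {- n..n} (\<lambda>y. ?g2 (Complex n y) - ?g2 (Complex c y))
        + \<i> * integral {c..n} (\<lambda>x. ?g2 (Complex x n) - ?g2 (Complex x (- n)))"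
      using RA D2 nn by (intro green_rectangle) (auto intro: continuous_on_subset)
    have FL: "((\<lambda>z. 2 * F z) has_integral integral ?L (\<lambda>z. D1 z 1 + \<i> * D1 z \<i>)) ?L"
    proof (rule has_integral_eq[of ?L "\<lambda>z. D1 z 1 + \<i> * D1 z \<i>"])
      show "((\<lambda>z. D1 z 1 + \<i> * D1 z \<i>) has_integral integral ?L (\<lambda>z. D1 z 1 + \<i> * D1 z \<i>)) ?L"
        by (intro integrable_integral integrable_continuous continuous_intros continuous_on_subset[OF D1(2) LA] continuous_on_subset[OF D1(3) LA])
    qed (use F1 LA in blast)
    have FR: "((\<lambda>z. 2 * F z) has_integral integral ?R (\<lambda>z. D2 z 1 + \<i> * D2 z \<i>)) ?R"
    proof (rule has_integral_eq[of ?R "\<lambda>z. D2 z 1 + \<i> * D2 z \<i>"])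
      show "((\<lambda>z. D2 z 1 + \<i> * D2 z \<i>) has_integral integral ?R (\<lambda>z. D2 z 1 + \<i> * D2 z \<i>)) ?R"
        by (intro integrable_integral integrable_continuous continuous_intros continuous_on_subset[OF D2(2) RA] continuous_on_subset[OF D2(3) RA])
    qed (use F2 RA in blast)
    let ?Q = "cbox (Complex (- n) (- n)) (Complex n n)"
    have "?Q \<inter> {x. x \<bullet> 1 \<le> c} = ?L" "?Q \<inter> {x. x \<bullet> 1 \<ge> c} = ?R"
      using nn by (auto simp: in_cbox_complex_iff inner_complex_def)
    then have "((\<lambda>z. 2 * F z) has_integral (integral ?L (\<lambda>z. D1 z 1 + \<i> * D1 z \<i>) + integral ?R (\<lambda>z. D2 z 1 + \<i> * D2 z \<i>))) ?Q"
      using FL FR by (intro has_integral_split[where c=c and k=1]) (auto simp: Basis_complex_def)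
    moreover have "2 * F z = 0" if "z \<notin> ?Q" for z
    proof -
      have "cmod z > r0"
        using that nn abs_Re_le_cmod[of z] abs_Im_le_cmod[of z] by (auto simp: in_cbox_complex_iff)
      then show ?thesis using Fout by simp
    qed
    ultimately have "((\<lambda>z. 2 * F z) has_integral (integral ?L (\<lambda>z. D1 z 1 + \<i> * D1 z \<i>) + integral ?R (\<lambda>z. D2 z 1 + \<i> * D2 z \<i>))) UNIV"
      by (intro has_integral_on_superset[of _ _ ?Q UNIV]) auto
    then have tot: "2 * integral UNIV F = integral ?L (\<lambda>z. D1 z 1 + \<i> * D1 z \<i>) + integral ?R (\<lambda>z. D2 z 1 + \<i> * D2 z \<i>)"
      unfolding integral_mult_right[symmetric] by (rule integral_unique)
    have X: "integral {- n..n} (\<lambda>y. ?g1 (Complex c y) - ?g1 (Complex (- n) y)) = integral {- n..n} (\<lambda>y. u1 (Complex c y) * f (Complex c y) + f (Complex (- n) y))"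
      by (rule integral_cong) (use vert bigS nn in \<open>simp add: u1_def\<close>)
    have Y: "integral {- n..n} (\<lambda>y. ?g2 (Complex n y) - ?g2 (Complex c y)) = integral {- n..n} (\<lambda>y. - (\<rho>' (Complex c y) * f (Complex c y)))"
      by (rule integral_cong) (use vert bigS nn in simp)
    have Z1: "integral {- n..c} (\<lambda>x. ?g1 (Complex x n) - ?g1 (Complex x (- n))) = integral {- n..c} (\<lambda>x. f (Complex x (- n)) - f (Complex x n))"
      by (rule integral_cong) (use bigS nn in \<open>simp add: u1_def\<close>)
    have Z2: "integral {c..n} (\<lambda>x. ?g2 (Complex x n) - ?g2 (Complex x (- n))) = 0"
    proof -
      have "integral {c..n} (\<lambda>x. ?g2 (Complex x n) - ?g2 (Complex x (- n))) = integral {c..n} (\<lambda>x. 0)"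
        by (rule integral_cong) (use bigS nn in simp)
      then show ?thesis by simp
    qed
    have ic: "(\<lambda>y. f (Complex c y)) integrable_on {- n..n}" "(\<lambda>y. f (Complex (- n) y)) integrable_on {- n..n}"
      "(\<lambda>y. \<rho>' (Complex c y) * f (Complex c y)) integrable_on {- n..n}"
      "(\<lambda>y. u1 (Complex c y) * f (Complex c y) + f (Complex (- n) y)) integrable_on {- n..n}"
      unfolding u1_def
      by (intro integrable_continuous_interval continuous_intros fcont rcont Cc; use vert bigS nn in simp)+
    have "integral {- n..n} (\<lambda>y. u1 (Complex c y) * f (Complex c y) + f (Complex (- n) y)) + integral {- n..n} (\<lambda>y. - (\<rho>' (Complex c y) * f (Complex c y)))
      = integral {- n..n} (\<lambda>y. (u1 (Complex c y) * f (Complex c y) + f (Complex (- n) y)) + - (\<rho>' (Complex c y) * f (Complex c y)))"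
      by (intro integral_add[symmetric] ic integrable_neg)
    also have "\<dots> = integral {- n..n} (\<lambda>y. f (Complex (- n) y) - f (Complex c y))"
      by (rule integral_cong) (simp add: u1_def algebra_simps)
    also have "\<dots> = integral {- n..n} (\<lambda>y. f (Complex (- n) y)) - integral {- n..n} (\<lambda>y. f (Complex c y))"
      by (intro integral_diff ic)
    finally have "2 * integral UNIV F = integral {- n..n} (\<lambda>y. f (Complex (- n) y)) - integral {- n..n} (\<lambda>y. f (Complex c y))
       + \<i> * integral {- n..c} (\<lambda>x. f (Complex x (- n)) - f (Complex x n))"
      unfolding tot g1 g2 X Y Z1 Z2 by (simp add: algebra_simps)
    moreover have "- 1 / 2 * b - I = - (a + w) / 2" if "2 * I = a - b + w" for a b w I :: complex
    proof -
      have "I = (a - b + w) / 2" using that by (metis nonzero_mult_div_cancel_left zero_neq_numeral)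
      show ?thesis unfolding \<open>I = (a - b + w) / 2\<close> by (simp add: field_simps)
    qed
    ultimately have "- 1 / 2 * integral {- n..n} (\<lambda>t. f (Complex c t)) - integral UNIV F
       = - (integral {- n..n} (\<lambda>y. f (Complex (- n) y)) + \<i> * integral {- n..c} (\<lambda>x. f (Complex x (- n)) - f (Complex x n))) / 2"
      by blast
    then have "cmod (- 1 / 2 * integral {- n..n} (\<lambda>t. f (Complex c t)) - integral UNIV F)
       = cmod (integral {- n..n} (\<lambda>y. f (Complex (- n) y)) + \<i> * integral {- n..c} (\<lambda>x. f (Complex x (- n)) - f (Complex x n))) / 2"
      by (simp only: norm_divide norm_minus_cancel norm_numeral)
    also have "\<dots> \<le> (\<bar>C2\<bar> / n\<^sup>2 * (n - - n) + 2 * \<bar>C2\<bar> / n\<^sup>2 * (c - - n)) / 2"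
    proof (intro divide_right_mono order_trans[OF norm_triangle_ineq] add_mono)
      show "cmod (integral {- n..n} (\<lambda>y. f (Complex (- n) y))) \<le> \<bar>C2\<bar> / n\<^sup>2 * (n - - n)"
        by (rule integral_bound) (use nn bigS in \<open>auto intro!: fcont Cc\<close>)
      have "cmod (integral {- n..c} (\<lambda>x. f (Complex x (- n)) - f (Complex x n))) \<le> 2 * \<bar>C2\<bar> / n\<^sup>2 * (c - - n)"
      proof (rule integral_bound)
        show "continuous_on {- n..c} (\<lambda>x. f (Complex x (- n)) - f (Complex x n))"
          by (intro continuous_intros fcont Cc) (use nn bigS in auto)
        fix x
        have "cmod (f (Complex x (- n)) - f (Complex x n)) \<le> \<bar>C2\<bar> / n\<^sup>2 + \<bar>C2\<bar> / n\<^sup>2"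
          by (rule order_trans[OF norm_triangle_ineq4 add_mono]) (use nn bigS in auto)
        then show "cmod (f (Complex x (- n)) - f (Complex x n)) \<le> 2 * \<bar>C2\<bar> / n\<^sup>2" by simp
      qed (use nn in auto)
      then show "cmod (\<i> * integral {- n..c} (\<lambda>x. f (Complex x (- n)) - f (Complex x n))) \<le> 2 * \<bar>C2\<bar> / n\<^sup>2 * (c - - n)"
        by (simp add: norm_mult)
    qed simp
    also have "\<dots> \<le> (\<bar>C2\<bar> / n\<^sup>2 * (2 * n) + 2 * \<bar>C2\<bar> / n\<^sup>2 * (2 * n)) / 2"
      using nn by (intro divide_right_mono add_mono mult_left_mono) auto
    also have "\<dots> = 3 * \<bar>C2\<bar> / n"
      using nn by (simp add: power2_eq_square field_simps)
    finally show ?thesis .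
  qed
  have "(\<lambda>n. - 1 / 2 * integral {- real n..real n} (\<lambda>t. f (Complex c t)) - integral UNIV F) \<longlonglongrightarrow> 0"
  proof (rule Lim_null_comparison)
    show "\<forall>\<^sub>F n in sequentially. cmod (- 1 / 2 * integral {- real n..real n} (\<lambda>t. f (Complex c t)) - integral UNIV F) \<le> 3 * \<bar>C2\<bar> / real n"
      using eventually_ge_at_top[of "nat \<lceil>n0\<rceil>"] by eventually_elim (rule key, linarith)
    show "(\<lambda>n. 3 * \<bar>C2\<bar> / real n) \<longlonglongrightarrow> 0"
      by (rule lim_const_over_n)
  qed
  then show ?thesis
    unfolding F_def[abs_def] by (simp add: LIM_zero_iff)
qed

section \<open>Integrals over a vertical line\<close>

lemma integrable_lorentzian:
  assumes g: "g > 0"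
  shows "integrable lborel (\<lambda>t::real. 1 / (g\<^sup>2 + t\<^sup>2))"
proof -
  have pos: "g\<^sup>2 + t\<^sup>2 > 0" for t :: real using g by (simp add: add_pos_nonneg)
  have "set_integrable lborel (einterval (-\<infinity>) \<infinity>) (\<lambda>t. 1 / (g\<^sup>2 + t\<^sup>2))"
  proof (rule interval_integral_FTC_nonneg(1))
    show "DERIV (\<lambda>t. arctan (t / g) / g) t :> 1 / (g\<^sup>2 + t\<^sup>2)" for t
    proof -
      have "DERIV (\<lambda>t. arctan (t / g) / g) t :> (1 / g) * inverse (1 + (t / g)\<^sup>2) / g"
        using g by (auto intro!: derivative_eq_intros simp: divide_inverse)
      also have "(1 / g) * inverse (1 + (t / g)\<^sup>2) / g = 1 / (g\<^sup>2 + t\<^sup>2)"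
      proof -
        have "1 + (t / g)\<^sup>2 = (g\<^sup>2 + t\<^sup>2) / g\<^sup>2" using g by (simp add: power_divide add_divide_distrib)
        then show ?thesis using g by (simp add: power2_eq_square)
      qed
      finally show ?thesis .
    qed
    show "isCont (\<lambda>t. 1 / (g\<^sup>2 + t\<^sup>2)) t" for t
      using pos[of t] by (intro continuous_intros) auto
    show "AE t in lborel. - \<infinity> < ereal t \<longrightarrow> ereal t < \<infinity> \<longrightarrow> 0 \<le> 1 / (g\<^sup>2 + t\<^sup>2)"
      using pos by (auto intro!: always_eventually less_imp_le)
    have t1: "filterlim (\<lambda>t. t / g) at_top at_top" "filterlim (\<lambda>t. t / g) at_bot at_bot"
      using g by real_asymp+
    show "(((\<lambda>t. arctan (t / g) / g) \<circ> real_of_ereal) \<longlongrightarrow> - (pi / 2) / g) (at_right (- \<infinity>))"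
      unfolding ereal_tendsto_simps by (intro tendsto_intros filterlim_compose[OF tendsto_arctan_at_bot t1(2)]) (use g in auto)
    show "(((\<lambda>t. arctan (t / g) / g) \<circ> real_of_ereal) \<longlongrightarrow> (pi / 2) / g) (at_left \<infinity>)"
      unfolding ereal_tendsto_simps by (intro tendsto_intros filterlim_compose[OF tendsto_arctan_at_top t1(1)]) (use g in auto)
  qed auto
  then show ?thesis by (simp add: set_integrable_def)
qed

lemma integrable_dominated:
  fixes f :: "real \<Rightarrow> complex"
  assumes "continuous_on UNIV f" "\<And>t. cmod (f t) \<le> K * b t" "integrable lborel b"
  shows "integrable lborel f"
proof (rule Bochner_Integration.integrable_bound[where f="\<lambda>t. K * b t"])
  show "f \<in> borel_measurable lborel"
    using borel_measurable_continuous_onI[OF assms(1)] by simp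
  show "AE t in lborel. norm (f t) \<le> norm (K * b t)"
    using assms(2) by (auto intro!: always_eventually order_trans[OF _ abs_ge_self])
qed (use assms(3) in simp)

lemma tendsto_symmetric_integral:
  fixes f :: "real \<Rightarrow> complex"
  assumes f: "integrable lborel f"
  shows "(\<lambda>n. integral {- real n..real n} f) \<longlonglongrightarrow> (LINT t|lborel. f t)"
proof -
  have "(\<lambda>n. LINT t|lborel. indicator {- real n..real n} t *\<^sub>R f t) \<longlonglongrightarrow> (LINT t|lborel. f t)"
  proof (rule integral_dominated_convergence[where w="\<lambda>t. norm (f t)"])
    show "AE t in lborel. (\<lambda>n. indicator {- real n..real n} t *\<^sub>R f t) \<longlonglongrightarrow> f t"
    proof (rule always_eventually, rule allI, rule tendsto_eventually)
      fix t :: real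
      show "\<forall>\<^sub>F n in sequentially. indicator {- real n..real n} t *\<^sub>R f t = f t"
        using eventually_ge_at_top[of "nat \<lceil>\<bar>t\<bar>\<rceil>"]
      proof eventually_elim
        case (elim n)
        then have "\<bar>t\<bar> \<le> real n" by linarith
        then have "t \<in> {- real n..real n}" by auto
        then show ?case by simp
      qed
    qed
  qed (use f in \<open>auto intro!: always_eventually borel_measurable_integrable simp: indicator_def\<close>)
  moreover have "(LINT t|lborel. indicator {- real n..real n} t *\<^sub>R f t) = integral {- real n..real n} f" for n
  proof -
    have "set_integrable lborel {- real n..real n} f"
      unfolding set_integrable_def using f by (intro integrable_mult_indicator) auto
    from set_borel_integral_eq_integral(2)[OF this] show ?thesis
      by (simp add: set_lebesgue_integral_def)
  qed
  ultimately show ?thesis by simp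
qed

text \<open>With a majorant of product form \<open>m a * b t\<close> the remainder after a finite
  set is at most a tail of \<open>m\<close> times \<open>b t\<close>, whose integral tends to 0. The
  bound \<open>B\<close> on \<open>b\<close> serves the Weierstrass test, which makes the sum
  continuous in \<open>t\<close>.\<close>

lemma line_integral_has_sum:
  fixes f :: "'a \<Rightarrow> real \<Rightarrow> complex"
  assumes f: "\<And>a. a \<in> A \<Longrightarrow> continuous_on UNIV (f a)"
    and bd: "\<And>a t. a \<in> A \<Longrightarrow> cmod (f a t) \<le> m a * b t"
    and m: "m summable_on A" "\<And>a. a \<in> A \<Longrightarrow> m a \<ge> 0"
    and b: "integrable lborel b" "\<And>t. 0 \<le> b t" "\<And>t. b t \<le> B"
  shows "((\<lambda>a. LINT t|lborel. f a t) has_sum (LINT t|lborel. (\<Sum>\<^sub>\<infinity>a\<in>A. f a t))) A"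
proof -
  define s where "s t = (\<Sum>\<^sub>\<infinity>a\<in>A. f a t)" for t
  define M where "M = infsum m A"
  have ul: "uniform_limit UNIV (\<lambda>F t. \<Sum>a\<in>F. f a t) s (finite_subsets_at_top A)"
    unfolding s_def
  proof (rule Weierstrass_m_test_general)
    show "cmod (f a t) \<le> m a * B" if "a \<in> A" for a t
      by (rule order_trans[OF bd[OF that] mult_left_mono[OF b(3) m(2)[OF that]]])
    show "(\<lambda>a. m a * B) summable_on A" using m(1) by (rule summable_on_cmult_left)
  qed
  have sc: "continuous_on UNIV s"
  proof (rule uniform_limit_theorem[OF _ ul])
    show "\<forall>\<^sub>F F in finite_subsets_at_top A. continuous_on UNIV (\<lambda>t. \<Sum>a\<in>F. f a t)"
      by (rule eventually_finite_subsets_at_top_weakI) (auto intro!: continuous_on_sum f)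
  qed simp
  have tail: "cmod (s t - (\<Sum>a\<in>F. f a t)) \<le> (M - sum m F) * b t" if F: "finite F" "F \<subseteq> A" for F t
  proof -
    have mA: "(\<lambda>a. m a * b t) summable_on A" using m(1) by (rule summable_on_cmult_left)
    have ab: "(\<lambda>a. norm (f a t)) summable_on A"
      by (rule summable_on_comparison_test[OF mA]) (use bd in auto)
    have fs: "(\<lambda>a. f a t) summable_on A" using ab by (rule abs_summable_summable)
    have "s t - (\<Sum>a\<in>F. f a t) = (\<Sum>\<^sub>\<infinity>a\<in>A - F. f a t)"
      unfolding s_def using infsum_Diff[OF fs _ F(2)] F by simp
    also have "cmod \<dots> \<le> (\<Sum>\<^sub>\<infinity>a\<in>A - F. norm (f a t))"
      by (rule norm_infsum_bound) (rule summable_on_subset_banach[OF ab], auto)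
    also have "\<dots> \<le> (\<Sum>\<^sub>\<infinity>a\<in>A - F. m a * b t)"
      by (rule infsum_mono) (use bd in \<open>auto intro: summable_on_subset_banach[OF ab] summable_on_subset_banach[OF mA]\<close>)
    also have "\<dots> = (\<Sum>\<^sub>\<infinity>a\<in>A. m a * b t) - (\<Sum>a\<in>F. m a * b t)"
      using infsum_Diff[OF mA _ F(2)] F by simp
    also have "\<dots> = (M - sum m F) * b t"
      unfolding M_def by (simp add: infsum_cmult_left' sum_distrib_right[symmetric] left_diff_distrib)
    finally show ?thesis .
  qed
  have fi: "integrable lborel (f a)" if "a \<in> A" for a
    by (rule integrable_dominated[OF f[OF that] bd[OF that] b(1)])
  have si: "integrable lborel s"
  proof (rule integrable_dominated[OF sc _ b(1)])
    show "cmod (s t) \<le> M * b t" for t using tail[of "{}" t] by simp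
  qed
  have "((\<lambda>F. \<Sum>a\<in>F. LINT t|lborel. f a t) \<longlongrightarrow> (LINT t|lborel. s t)) (finite_subsets_at_top A)"
  proof (rule LIM_zero_cancel, rule Lim_null_comparison)
    show "\<forall>\<^sub>F F in finite_subsets_at_top A. norm ((\<Sum>a\<in>F. LINT t|lborel. f a t) - (LINT t|lborel. s t)) \<le> (M - sum m F) * (LINT t|lborel. b t)"
    proof (rule eventually_finite_subsets_at_top_weakI)
      fix F assume F: "finite F" "F \<subseteq> A"
      have Fi: "integrable lborel (\<lambda>t. \<Sum>a\<in>F. f a t)"
        using F fi by (intro Bochner_Integration.integrable_sum) auto
      have "(\<Sum>a\<in>F. LINT t|lborel. f a t) = (LINT t|lborel. (\<Sum>a\<in>F. f a t))"
        using F fi by (intro Bochner_Integration.integral_sum[symmetric]) auto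
      then have "(\<Sum>a\<in>F. LINT t|lborel. f a t) - (LINT t|lborel. s t) = (LINT t|lborel. (\<Sum>a\<in>F. f a t) - s t)"
        using Fi si by simp
      also have "norm \<dots> \<le> (LINT t|lborel. (M - sum m F) * b t)"
        by (rule Bochner_Integration.integral_norm_bound_integral) (use Fi si b tail[OF F] in \<open>auto simp: norm_minus_commute\<close>)
      finally show "norm ((\<Sum>a\<in>F. LINT t|lborel. f a t) - (LINT t|lborel. s t)) \<le> (M - sum m F) * (LINT t|lborel. b t)"
        by simp
    qed
    have "(sum m \<longlongrightarrow> M) (finite_subsets_at_top A)"
      using has_sum_infsum[OF m(1)] by (simp add: has_sum_def M_def)
    then have "((\<lambda>F. (M - sum m F) * (LINT t|lborel. b t)) \<longlongrightarrow> (M - M) * (LINT t|lborel. b t)) (finite_subsets_at_top A)"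
      by (intro tendsto_intros)
    then show "((\<lambda>F. (M - sum m F) * (LINT t|lborel. b t)) \<longlongrightarrow> 0) (finite_subsets_at_top A)"
      by simp
  qed
  then show ?thesis
    by (simp add: has_sum_def s_def)
qed

lemma line_integral_derivative_zero:
  fixes G f :: "real \<Rightarrow> complex"
  assumes G: "\<And>t. (G has_vector_derivative f t) (at t)" and f: "integrable lborel f"
    and lim: "(G \<longlongrightarrow> 0) at_top" "(G \<longlongrightarrow> 0) at_bot"
  shows "(LINT t|lborel. f t) = 0"
proof -
  have "integral {- real n..real n} f = G (real n) - G (- real n)" for n
    by (intro integral_unique fundamental_theorem_of_calculus) (auto intro: has_vector_derivative_at_within G)
  moreover have "(\<lambda>n. G (real n) - G (- real n)) \<longlonglongrightarrow> 0 - 0"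
    by (intro tendsto_diff filterlim_compose[OF lim(1)] filterlim_compose[OF lim(2)] filterlim_real_sequentially
        filterlim_compose[OF filterlim_uminus_at_bot_at_top])
  ultimately have "(\<lambda>n. integral {- real n..real n} f) \<longlonglongrightarrow> 0" by simp
  then show ?thesis
    using tendsto_symmetric_integral[OF f] LIMSEQ_unique by blast
qed

no_notation fps_nth (infixl "$" 75)

section \<open>Exponential decay of matrix entries\<close>

lemma op_on_ent_zero: "op_on D A \<Longrightarrow> i \<notin> sites D \<or> j \<notin> sites D \<Longrightarrow> ent A i j = 0"
  unfolding op_on_iff by blast

lemma has_sum_norm_le:
  fixes f :: "'a \<Rightarrow> 'b::real_normed_vector"
  assumes "(f has_sum x) A" and bd: "\<And>F. finite F \<Longrightarrow> F \<subseteq> A \<Longrightarrow> (\<Sum>i\<in>F. norm (f i)) \<le> B"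
  shows "norm x \<le> B"
proof (rule tendsto_upperbound)
  show "((\<lambda>F. norm (sum f F)) \<longlongrightarrow> norm x) (finite_subsets_at_top A)"
    using assms(1) unfolding has_sum_def by (rule tendsto_norm)
  show "\<forall>\<^sub>F F in finite_subsets_at_top A. norm (sum f F) \<le> B"
    by (rule eventually_finite_subsets_at_top_weakI) (rule order_trans[OF norm_sum bd])
qed simp

lemma exp_summable_int:
  fixes \<alpha> :: real
  assumes "\<alpha> > 0" shows "(\<lambda>m::int. exp (- \<alpha> * \<bar>of_int m\<bar>)) summable_on UNIV"
proof -
  have geo: "(\<lambda>n::nat. exp (- \<alpha> * real n)) summable_on UNIV"
  proof -
    have "(\<lambda>n. (exp (- \<alpha>)) ^ n) summable_on UNIV"
      using assms by (intro norm_summable_imp_summable_on) (simp add: norm_power summable_geometric)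
    then show ?thesis
      by (simp add: exp_of_nat_mult[symmetric] mult.commute)
  qed
  have 1: "(\<lambda>m::int. exp (- \<alpha> * \<bar>of_int m\<bar>)) summable_on range int"
    by (subst summable_on_reindex) (use geo in \<open>auto simp: o_def\<close>)
  have 2: "(\<lambda>m::int. exp (- \<alpha> * \<bar>of_int m\<bar>)) summable_on (\<lambda>n. - int n) ` {1..}"
    by (subst summable_on_reindex) (use summable_on_subset_banach[OF geo, of "{1..}"] in \<open>auto simp: o_def inj_on_def\<close>)
  have "(\<lambda>m::int. exp (- \<alpha> * \<bar>of_int m\<bar>)) summable_on (range int \<union> (\<lambda>n. - int n) ` {1..})"
    by (rule summable_on_Un_disjoint[OF 1 2]) auto
  moreover have "range int \<union> (\<lambda>n. - int n) ` {1..} = UNIV"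
  proof -
    have "m \<in> range int \<union> (\<lambda>n. - int n) ` {1..}" for m
    proof (cases "m \<ge> 0")
      case True then show ?thesis by (metis UnI1 nonneg_int_cases rangeI)
    next
      case False
      then have "m = - int (nat (- m))" "nat (- m) \<in> {1..}" by auto
      then show ?thesis by blast
    qed
    then show ?thesis by blast
  qed
  ultimately show ?thesis by simp
qed

lemma summable_on_product_nonneg:
  fixes f :: "'a \<Rightarrow> real" and g :: "'b \<Rightarrow> real"
  assumes f: "f summable_on A" "\<And>x. x \<in> A \<Longrightarrow> f x \<ge> 0" and g: "g summable_on B" "\<And>x. x \<in> B \<Longrightarrow> g x \<ge> 0"
  shows "(\<lambda>(x, y). f x * g y) summable_on A \<times> B"
proof (rule nonneg_bounded_partial_sums_imp_summable_on[where C="infsum f A * infsum g B"])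
  show "\<forall>\<^sub>F F in finite_subsets_at_top (A \<times> B). (\<Sum>(x, y)\<in>F. f x * g y) \<le> infsum f A * infsum g B"
  proof (rule eventually_finite_subsets_at_top_weakI)
    fix F assume F: "finite F" "F \<subseteq> A \<times> B"
    have "(\<Sum>(x, y)\<in>F. f x * g y) \<le> (\<Sum>(x, y)\<in>fst ` F \<times> snd ` F. f x * g y)"
    proof (rule sum_mono2)
      show "F \<subseteq> fst ` F \<times> snd ` F" by (auto intro: rev_image_eqI)
      fix p assume "p \<in> fst ` F \<times> snd ` F - F"
      then have "fst p \<in> A" "snd p \<in> B" using F(2) by auto
      then show "0 \<le> (case p of (x, y) \<Rightarrow> f x * g y)" using f(2) g(2) by (simp add: case_prod_beta)
    qed (use F in auto)
    also have "\<dots> = sum f (fst ` F) * sum g (snd ` F)"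
      by (simp add: sum_product sum.cartesian_product)
    also have "\<dots> \<le> infsum f A * infsum g B"
      using F f g by (intro mult_mono finite_sum_le_infsum sum_nonneg infsum_nonneg) auto
    finally show "(\<Sum>(x, y)\<in>F. f x * g y) \<le> infsum f A * infsum g B" .
  qed
qed (use f g in auto)

section \<open>Lattice sites and exponential sums over them\<close>

definition lattice_point :: "nat \<Rightarrow> nat \<Rightarrow> int \<times> int \<Rightarrow> plane" where
  "lattice_point a1 a2 = (\<lambda>(m, n). of_int m *\<^sub>R (real a1 *\<^sub>R axis 1 1) + of_int n *\<^sub>R (real a2 *\<^sub>R axis 2 1))"

lemma lattice_point_nth [simp]:
  "lattice_point a1 a2 p $ 1 = of_int (fst p) * real a1" "lattice_point a1 a2 p $ 2 = of_int (snd p) * real a2"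
  by (cases p; simp add: lattice_point_def axis_def)+

lemma bulk_lattice_eq: "bulk_lattice a1 a2 = range (lattice_point a1 a2)"
  by (auto simp: bulk_lattice_def lattice_point_def image_def)

lemma plane_eqI: "x $ 1 = y $ 1 \<Longrightarrow> x $ 2 = y $ 2 \<Longrightarrow> x = (y :: plane)"
  by (simp add: vec_eq_iff forall_2)

lemma lattice_point_add: "lattice_point a1 a2 p + lattice_point a1 a2 q = lattice_point a1 a2 (p + q)"
  and lattice_point_diff: "lattice_point a1 a2 p - lattice_point a1 a2 q = lattice_point a1 a2 (p - q)"
  by (rule plane_eqI; simp add: algebra_simps)+

lemma lattice_add: "x \<in> bulk_lattice a1 a2 \<Longrightarrow> y \<in> bulk_lattice a1 a2 \<Longrightarrow> x + y \<in> bulk_lattice a1 a2"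
  and lattice_diff: "x \<in> bulk_lattice a1 a2 \<Longrightarrow> y \<in> bulk_lattice a1 a2 \<Longrightarrow> x - y \<in> bulk_lattice a1 a2"
  by (auto simp: bulk_lattice_eq lattice_point_add lattice_point_diff)

lemma norm1_triangle: "norm1 (x - z) \<le> norm1 (x - y) + norm1 (y - z)"
  and norm1_commute: "norm1 (x - y) = norm1 (y - x)" and norm1_nonneg: "norm1 x \<ge> 0"
  and norm1_component: "\<bar>x $ 2\<bar> \<le> norm1 x" "\<bar>x $ 1\<bar> \<le> norm1 x"
  by (auto simp: norm1_def)

text \<open>The constant of all convolution estimates: by translation of the lattice it also bounds
  the finite sums centred at any other lattice point.\<close>

definition site_sum :: "plane set \<Rightarrow> real \<Rightarrow> real" where
  "site_sum D \<alpha> = (\<Sum>\<^sub>\<infinity>i\<in>sites D. exp (- \<alpha> * norm1 (fst i)))"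

lemma site_sum_summable:
  assumes "\<alpha> > 0" "a1 > 0" "a2 > 0"
  shows "(\<lambda>i :: plane \<times> 2. exp (- \<alpha> * norm1 (fst i))) summable_on sites (bulk_lattice a1 a2)"
proof -
  let ?h = "\<lambda>(p, s :: 2). (lattice_point a1 a2 p, s)"
  have inj: "inj ?h"
  proof (rule injI)
    fix x y :: "(int \<times> int) \<times> 2"
    assume e: "?h x = ?h y"
    then have "lattice_point a1 a2 (fst x) = lattice_point a1 a2 (fst y)" "snd x = snd y"
      by (auto simp: case_prod_beta)
    from arg_cong[OF this(1), of "\<lambda>v :: plane. v $ 1"] arg_cong[OF this(1), of "\<lambda>v :: plane. v $ 2"] this(2)
    show "x = y" using assms by (simp add: prod_eq_iff)
  qed
  have s2: "(\<lambda>(p, s :: 2). (case p of (m :: int, n :: int) \<Rightarrow> exp (- \<alpha> * \<bar>of_int m\<bar>) * exp (- \<alpha> * \<bar>of_int n\<bar>)) * 1) summable_on UNIV \<times> UNIV"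
  proof (rule summable_on_product_nonneg)
    show "(\<lambda>p. case p of (m :: int, n :: int) \<Rightarrow> exp (- \<alpha> * \<bar>of_int m\<bar>) * exp (- \<alpha> * \<bar>of_int n\<bar>)) summable_on UNIV"
      using summable_on_product_nonneg[OF exp_summable_int[OF assms(1)] _ exp_summable_int[OF assms(1)]] by simp
  qed auto
  have "((\<lambda>i. exp (- \<alpha> * norm1 (fst i))) \<circ> ?h) summable_on UNIV"
  proof (rule summable_on_comparison_test)
    show "(\<lambda>(p, s :: 2). (case p of (m :: int, n :: int) \<Rightarrow> exp (- \<alpha> * \<bar>of_int m\<bar>) * exp (- \<alpha> * \<bar>of_int n\<bar>)) * 1) summable_on UNIV"
      using s2 by simp
    fix x :: "(int \<times> int) \<times> 2"
    obtain m n s where x: "x = ((m, n), s)" by (metis prod.exhaust)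
    have ge: "\<bar>real_of_int k\<bar> * 1 \<le> \<bar>of_int k\<bar> * real a" if "a > 0" for k and a :: nat
      using that by (intro mult_left_mono) auto
    have "\<alpha> * (\<bar>of_int m\<bar> + \<bar>of_int n\<bar>) \<le> \<alpha> * norm1 (lattice_point a1 a2 (m, n))"
      using ge[of a1 m] ge[of a2 n] assms by (intro mult_left_mono) (auto simp: norm1_def abs_mult)
    then show "((\<lambda>i. exp (- \<alpha> * norm1 (fst i))) \<circ> ?h) x
      \<le> (case x of (p, s) \<Rightarrow> (case p of (m, n) \<Rightarrow> exp (- \<alpha> * \<bar>of_int m\<bar>) * exp (- \<alpha> * \<bar>of_int n\<bar>)) * 1)"
      by (simp add: x exp_add[symmetric] algebra_simps)
  qed (auto simp: case_prod_beta)
  then have "(\<lambda>i :: plane \<times> 2. exp (- \<alpha> * norm1 (fst i))) summable_on range ?h"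
    using summable_on_reindex[OF inj] by blast
  moreover have "range ?h = sites (bulk_lattice a1 a2)"
    by (auto simp: bulk_lattice_eq image_iff)
  ultimately show ?thesis by simp
qed

lemma site_sum_bound:
  assumes a: "\<alpha> > 0" "a1 > 0" "a2 > 0" and p: "p \<in> bulk_lattice a1 a2"
    and F: "finite F" "F \<subseteq> sites (bulk_lattice a1 a2)"
  shows "(\<Sum>i\<in>F. exp (- \<alpha> * norm1 (fst i - p))) \<le> site_sum (bulk_lattice a1 a2) \<alpha>"
proof -
  let ?h = "\<lambda>i :: plane \<times> 2. (fst i - p, snd i)"
  have inj: "inj_on ?h F" by (auto simp: inj_on_def prod_eq_iff)
  have "(\<Sum>i\<in>F. exp (- \<alpha> * norm1 (fst i - p))) = (\<Sum>i\<in>?h ` F. exp (- \<alpha> * norm1 (fst i)))"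
    by (simp add: sum.reindex[OF inj])
  also have "\<dots> \<le> site_sum (bulk_lattice a1 a2) \<alpha>"
    unfolding site_sum_def using F p
    by (intro finite_sum_le_infsum site_sum_summable[OF a]) (auto intro!: lattice_diff)
  finally show ?thesis .
qed

lemma site_sum_nonneg: "site_sum D \<alpha> \<ge> 0"
  unfolding site_sum_def by (rule infsum_nonneg) simp

text \<open>For \<open>e = 1\<close> the entries also decay in the distance of both sites from the \<open>x\<^sub>1\<close>-axis.\<close>

definition decays :: "plane set \<Rightarrow> real \<Rightarrow> real \<Rightarrow> real \<Rightarrow> lop \<Rightarrow> bool" where
  "decays D \<mu> e C T \<longleftrightarrow> (\<forall>i\<in>sites D. \<forall>j\<in>sites D. cmod (ent T i j)
     \<le> C * exp (- \<mu> * (norm1 (fst i - fst j) + e * (\<bar>fst i $ 2\<bar> + \<bar>fst j $ 2\<bar>))))"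

lemma decays_weaken:
  assumes T: "decays D \<mu> e C T" and le: "\<mu>' \<le> \<mu>" "C \<le> C'" "0 \<le> C'" "0 \<le> \<mu>'" "0 \<le> e'" "e' \<le> e"
  shows "decays D \<mu>' e' C' T"
  unfolding decays_def
proof (intro ballI)
  fix i j assume ij: "i \<in> sites D" "j \<in> sites D"
  let ?w = "\<lambda>e. norm1 (fst i - fst j) + e * (\<bar>fst i $ 2\<bar> + \<bar>fst j $ 2\<bar>)"
  have "?w e' \<le> ?w e" using le by (intro add_left_mono mult_right_mono) auto
  moreover have "0 \<le> ?w e'" using le norm1_nonneg by (intro add_nonneg_nonneg mult_nonneg_nonneg) auto
  ultimately have w: "\<mu>' * ?w e' \<le> \<mu> * ?w e"
    using le by (intro mult_mono) auto
  have "cmod (ent T i j) \<le> C * exp (- \<mu> * ?w e)" using T ij by (auto simp: decays_def)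
  also have "\<dots> \<le> C' * exp (- \<mu>' * ?w e')"
    using le w by (intro mult_mono) auto
  finally show "cmod (ent T i j) \<le> C' * exp (- \<mu>' * ?w e')" .
qed

lemma decays_diff:
  assumes "decays D \<mu> e C T" "decays D \<mu> e C' T'"
  shows "decays D \<mu> e (C + C') (T - T')"
  unfolding decays_def
proof (intro ballI)
  fix i j assume ij: "i \<in> sites D" "j \<in> sites D"
  have "cmod (ent (T - T') i j) \<le> cmod (ent T i j) + cmod (ent T' i j)"
    by (simp add: norm_triangle_ineq4)
  also have "\<dots> \<le> C * exp (- \<mu> * (norm1 (fst i - fst j) + e * (\<bar>fst i $ 2\<bar> + \<bar>fst j $ 2\<bar>)))
      + C' * exp (- \<mu> * (norm1 (fst i - fst j) + e * (\<bar>fst i $ 2\<bar> + \<bar>fst j $ 2\<bar>)))"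
    using assms[unfolded decays_def, rule_format, OF ij] by (rule add_mono)
  finally show "cmod (ent (T - T') i j) \<le> (C + C') * exp (- \<mu> * (norm1 (fst i - fst j) + e * (\<bar>fst i $ 2\<bar> + \<bar>fst j $ 2\<bar>)))"
    by (simp only: distrib_right)
qed

lemma decays_mult_op:
  assumes T: "decays D \<mu> e C T" and g: "\<And>i. cmod (g i) \<le> 1" and cl: "complex_linear T" and C: "C \<ge> 0"
  shows "decays D \<mu> e C (mult_op g o\<^sub>L T)" "decays D \<mu> e C (T o\<^sub>L mult_op g)"
proof -
  have le: "cmod (g k) * x \<le> y" if "x \<le> y" "0 \<le> x" for k x y
    using mult_right_mono[OF g[of k] that(2)] that by linarith
  note T' = T[unfolded decays_def, rule_format]
  show "decays D \<mu> e C (mult_op g o\<^sub>L T)"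
    unfolding decays_def
  proof (intro ballI)
    fix i j assume ij: "i \<in> sites D" "j \<in> sites D"
    show "cmod (ent (mult_op g o\<^sub>L T) i j) \<le> C * exp (- \<mu> * (norm1 (fst i - fst j) + e * (\<bar>fst i $ 2\<bar> + \<bar>fst j $ 2\<bar>)))"
      unfolding ent_mult_op(2)[OF g] norm_mult by (rule le[OF T'[OF ij] norm_ge_zero])
  qed
  show "decays D \<mu> e C (T o\<^sub>L mult_op g)"
    unfolding decays_def
  proof (intro ballI)
    fix i j assume ij: "i \<in> sites D" "j \<in> sites D"
    have eq: "cmod (ent (T o\<^sub>L mult_op g) i j) = cmod (g j) * cmod (ent T i j)"
      unfolding ent_mult_op(3)[OF g cl] norm_mult by (rule mult.commute)
    show "cmod (ent (T o\<^sub>L mult_op g) i j) \<le> C * exp (- \<mu> * (norm1 (fst i - fst j) + e * (\<bar>fst i $ 2\<bar> + \<bar>fst j $ 2\<bar>)))"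
      unfolding eq by (rule le[OF T'[OF ij] norm_ge_zero])
  qed
qed

text \<open>The triangle inequality carries heights from the intermediate site to the outer ones, so
  the concentration of one factor near the axis is inherited by the product. A quarter of the rate
  is kept for the result; the factor \<open>exp (- (\<mu> / 2) * norm1 (fst k - fst i))\<close> is
  set aside for the sum over the intermediate site \<open>k\<close>.\<close>

lemma decays_compose:
  assumes A: "decays D \<mu> e C A" "op_on D A" and B: "decays D \<mu> e' C' B" "op_on D B"
    and D: "D = bulk_lattice a1 a2" "a1 > 0" "a2 > 0"
    and pos: "\<mu> > 0" "C \<ge> 0" "C' \<ge> 0" and e: "e = 0 \<or> e = 1" "e' = 0 \<or> e' = 1"
  shows "decays D (\<mu> / 4) (max e e') (C * C' * site_sum D (\<mu> / 2)) (A o\<^sub>L B)"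
  unfolding decays_def
proof (intro ballI)
  fix i j assume ij: "i \<in> sites D" "j \<in> sites D"
  let ?w = "\<lambda>e i j. norm1 (fst i - fst j) + e * (\<bar>fst i $ 2\<bar> + \<bar>fst j $ 2\<bar>)"
  show "cmod (ent (A o\<^sub>L B) i j) \<le> C * C' * site_sum D (\<mu> / 2) * exp (- (\<mu> / 4) * ?w (max e e') i j)"
  proof (rule has_sum_norm_le[OF has_sum_ent_compose[OF op_on_complex_linear[OF A(2)]]])
    fix F :: "(plane \<times> 2) set" assume F: "finite F"
    have trm: "norm (ent A i k * ent B k j) \<le> C * C' * exp (- (\<mu> / 4) * ?w (max e e') i j) * exp (- (\<mu> / 2) * norm1 (fst k - fst i))"
      if k: "k \<in> sites D" for k
    proof -
      have ineq: "?w (max e e') i j + 2 * norm1 (fst k - fst i) \<le> 4 * (?w e i k + ?w e' k j)"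
      proof -
        define a b hi hj hk where "a = norm1 (fst i - fst k)" and "b = norm1 (fst k - fst j)"
          and "hi = \<bar>fst i $ 2\<bar>" and "hj = \<bar>fst j $ 2\<bar>" and "hk = \<bar>fst k $ 2\<bar>"
        note defs = a_def[symmetric] b_def[symmetric] hi_def[symmetric] hj_def[symmetric] hk_def[symmetric]
        have n: "norm1 (fst i - fst j) \<le> a + b" unfolding a_def b_def by (rule norm1_triangle)
        have c: "norm1 (fst k - fst i) = a" unfolding a_def by (rule norm1_commute)
        have h: "hi \<le> hk + a" "hk \<le> hi + a" "hj \<le> hk + b" "hk \<le> hj + b" "a \<ge> 0" "b \<ge> 0" "hi \<ge> 0" "hj \<ge> 0" "hk \<ge> 0"
          using norm1_component(1)[of "fst i - fst k"] norm1_component(1)[of "fst k - fst j"] norm1_nonneg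
          unfolding a_def b_def hi_def hj_def hk_def by auto
        have "(a + b) + max e e' * (hi + hj) + 2 * a \<le> 4 * ((a + e * (hi + hk)) + (b + e' * (hk + hj)))"
          using e by (elim disjE; simp; insert h; linarith)
        then show ?thesis
          unfolding defs c using n by linarith
      qed
      have scale: "\<mu> / 4 * W + \<mu> / 2 * x \<le> \<mu> * X + \<mu> * Y" if "W + 2 * x \<le> 4 * (X + Y)" for W x X Y
      proof -
        have "\<mu> / 4 * (W + 2 * x) \<le> \<mu> / 4 * (4 * (X + Y))"
          by (rule mult_left_mono[OF that]) (use pos in simp)
        also have "\<dots> = \<mu> * X + \<mu> * Y" by (simp add: algebra_simps)
        finally show ?thesis by (simp add: field_simps)
      qed
      note le = scale[OF ineq]
      have ex: "exp (- \<mu> * ?w e i k) * exp (- \<mu> * ?w e' k j)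
          \<le> exp (- (\<mu> / 4) * ?w (max e e') i j) * exp (- (\<mu> / 2) * norm1 (fst k - fst i))"
        unfolding exp_add[symmetric] exp_le_cancel_iff using le by linarith
      have "norm (ent A i k * ent B k j) \<le> (C * exp (- \<mu> * ?w e i k)) * (C' * exp (- \<mu> * ?w e' k j))"
        unfolding norm_mult using A(1) B(1) ij k pos by (intro mult_mono) (auto simp: decays_def)
      also have "\<dots> = C * C' * (exp (- \<mu> * ?w e i k) * exp (- \<mu> * ?w e' k j))"
        by (simp add: mult_ac)
      also have "\<dots> \<le> C * C' * (exp (- (\<mu> / 4) * ?w (max e e') i j) * exp (- (\<mu> / 2) * norm1 (fst k - fst i)))"
        using pos by (intro mult_left_mono[OF ex]) auto
      finally show ?thesis by (simp add: mult_ac)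
    qed
    have "(\<Sum>k\<in>F. norm (ent A i k * ent B k j)) = (\<Sum>k\<in>F \<inter> sites D. norm (ent A i k * ent B k j))"
      by (rule sum.mono_neutral_right[OF F]) (auto simp: op_on_ent_zero[OF A(2)])
    also have "\<dots> \<le> (\<Sum>k\<in>F \<inter> sites D. C * C' * exp (- (\<mu> / 4) * ?w (max e e') i j) * exp (- (\<mu> / 2) * norm1 (fst k - fst i)))"
      by (rule sum_mono) (rule trm, simp)
    also have "\<dots> = C * C' * exp (- (\<mu> / 4) * ?w (max e e') i j) * (\<Sum>k\<in>F \<inter> sites D. exp (- (\<mu> / 2) * norm1 (fst k - fst i)))"
      by (rule sum_distrib_left[symmetric])
    also have "\<dots> \<le> C * C' * exp (- (\<mu> / 4) * ?w (max e e') i j) * site_sum D (\<mu> / 2)"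
      unfolding D(1) using F ij pos D by (intro mult_left_mono site_sum_bound) auto
    finally show "(\<Sum>k\<in>F. norm (ent A i k * ent B k j)) \<le> C * C' * site_sum D (\<mu> / 2) * exp (- (\<mu> / 4) * ?w (max e e') i j)"
      by (simp add: mult_ac)
  qed
qed

lemma tight_binding_decays:
  assumes "tight_binding D lam H"
  obtains C where "C \<ge> 0" "decays D lam 0 C H"
proof -
  obtain C where C: "C > 0" "\<forall>x\<in>D. \<forall>y\<in>D. norm (op_kernel H x y) \<le> C * exp (- lam * norm1 (x - y))"
    using assms by (auto simp: tight_binding_def)
  have "cmod (ent H i j) \<le> norm (op_kernel H (fst i) (fst j))" for i j
  proof -
    have "ent H i j = op_kernel H (fst i) (fst j) $ snd i $ snd j"
      by (simp add: ent_def op_kernel_def)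
    then show ?thesis
      using order_trans[OF Finite_Cartesian_Product.norm_nth_le Finite_Cartesian_Product.norm_nth_le] by metis
  qed
  then have "cmod (ent H i j) \<le> C * exp (- lam * norm1 (fst i - fst j))" if "fst i \<in> D" "fst j \<in> D" for i j
    using C(2) that by (meson order_trans)
  then have "decays D lam 0 C H"
    unfolding decays_def by (auto simp: mem_Times_iff)
  then show thesis using C(1) that[of C] by auto
qed

lemma ent_position_op:
  assumes "\<And>x. \<bar>f x\<bar> \<le> C"
  shows "ent (position_op D f) i j = (if i = j \<and> fst i \<in> D then of_real (f (fst i)) else 0)"
  by (cases i) (auto simp: ent_def position_op_apply[OF assms])

lemma ent_id_on: "ent (id_on D) i j = (if i = j \<and> i \<in> sites D then 1 else 0)"
  by (simp add: ent_def id_on_apply)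

lemma ent_commutator_position_op:
  assumes f: "\<And>x. \<bar>f x\<bar> \<le> 1" and H: "op_on D H"
  shows "ent (commutator H (position_op D f)) i j = ent H i j * of_real (f (fst j) - f (fst i))"
proof -
  have z: "ent H i j = 0" if "\<not> (fst i \<in> D \<and> fst j \<in> D)"
    using H that unfolding op_on_iff by (cases i; cases j) auto
  show ?thesis
    unfolding commutator_def
    using ent_position_op_right[OF f op_on_complex_linear[OF H], where D=D and i=i and j=j]
      ent_position_op_left[OF f, where D=D and A=H and i=i and j=j] z
    by (auto simp: algebra_simps)
qed

lemma switch_function_bounds:
  assumes sw: "switch_function j \<Lambda>"
  shows "\<exists>b1 b2. (\<forall>x. x $ j > b1 \<longrightarrow> \<Lambda> x = 1) \<and> (\<forall>x. x $ j < b2 \<longrightarrow> \<Lambda> x = 0)"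
proof -
  from sw have "\<exists>b1 b2. b1 > b2 \<and> (\<forall>x. x $ j > b1 \<longrightarrow> \<Lambda> x = 1) \<and> (\<forall>x. x $ j < b2 \<longrightarrow> \<Lambda> x = 0)"
    unfolding switch_function_def by (elim conjE)
  then show ?thesis by metis
qed

lemma switch_function_range: "switch_function j \<Lambda> \<Longrightarrow> \<Lambda> x \<in> {0..1}"
  unfolding switch_function_def by (meson rangeI subsetD)

text \<open>An entry vanishes unless \<open>\<Lambda>\<close> differs at its two sites. Then the
  sites are not both beyond the same threshold, and the sum of their heights is at most their
  distance plus \<open>2 * b0\<close>; half of the decay of \<open>H\<close> is spent on
  this.\<close>

lemma decays_switch_commutator:
  assumes sw: "switch_function 2 \<Lambda>" and H: "op_on D H" "decays D lam 0 C H" and pos: "lam > 0" "C \<ge> 0"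
  obtains C' where "C' \<ge> 0" "decays D (lam / 2) 1 C' (commutator H (position_op D \<Lambda>))"
proof -
  obtain b1 b2 where b: "\<And>x. x $ 2 > b1 \<Longrightarrow> \<Lambda> x = 1" "\<And>x. x $ 2 < b2 \<Longrightarrow> \<Lambda> x = 0"
    using switch_function_bounds[OF sw] by metis
  have r: "\<Lambda> x \<in> {0..1}" for x by (rule switch_function_range[OF sw])
  have f1: "\<bar>\<Lambda> x\<bar> \<le> 1" for x using r[of x] by (simp add: abs_le_iff)
  define b0 where "b0 = max \<bar>b1\<bar> \<bar>b2\<bar>"
  have "decays D (lam / 2) 1 (C * exp (lam * b0)) (commutator H (position_op D \<Lambda>))"
    unfolding decays_def
  proof (intro ballI)
    fix i j assume ij: "i \<in> sites D" "j \<in> sites D"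
    let ?n = "norm1 (fst i - fst j)" and ?h = "\<bar>fst i $ 2\<bar> + \<bar>fst j $ 2\<bar>"
    show "cmod (ent (commutator H (position_op D \<Lambda>)) i j) \<le> C * exp (lam * b0) * exp (- (lam / 2) * (?n + 1 * ?h))"
    proof (cases "\<Lambda> (fst i) = \<Lambda> (fst j)")
      case True
      then show ?thesis using pos by (simp add: ent_commutator_position_op[OF f1 H(1)])
    next
      case False
      have "\<not> (fst i $ 2 > b1 \<and> fst j $ 2 > b1)" "\<not> (fst i $ 2 < b2 \<and> fst j $ 2 < b2)"
        using False b by metis+
      then have h: "?h \<le> ?n + 2 * b0"
        unfolding norm1_def b0_def by simp argo
      have "\<bar>\<Lambda> (fst j) - \<Lambda> (fst i)\<bar> \<le> 1"
        using r[of "fst i"] r[of "fst j"] by (auto simp: abs_le_iff)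
      then have "cmod (ent (commutator H (position_op D \<Lambda>)) i j) \<le> cmod (ent H i j) * 1"
        unfolding ent_commutator_position_op[OF f1 H(1)] norm_mult norm_of_real by (intro mult_left_mono) auto
      also have "\<dots> \<le> C * exp (- lam * ?n)"
        using H(2) ij by (auto simp: decays_def)
      also have "\<dots> \<le> C * (exp (lam * b0) * exp (- (lam / 2) * (?n + 1 * ?h)))"
      proof (rule mult_left_mono[OF _ pos(2)])
        have "lam * ?h \<le> lam * (?n + 2 * b0)" using h pos by (intro mult_left_mono) auto
        then show "exp (- lam * ?n) \<le> exp (lam * b0) * exp (- (lam / 2) * (?n + 1 * ?h))"
          unfolding exp_add[symmetric] exp_le_cancel_iff by (simp add: algebra_simps)
      qed
      finally show ?thesis by (simp add: mult_ac)
    qed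
  qed
  then show thesis by (rule that[rotated]) (use pos in auto)
qed

section \<open>Combes-Thomas estimate\<close>

lemma exp_diff_le:
  fixes x t :: real
  assumes "\<bar>x\<bar> \<le> t" shows "\<bar>exp x - 1\<bar> \<le> exp t - 1"
proof (cases "x \<ge> 0")
  case True then show ?thesis using assms by simp
next
  case False
  have "1 - exp x \<le> - x" using exp_ge_add_one_self[of x] by linarith
  also have "\<dots> \<le> t" using assms by simp
  also have "\<dots> \<le> exp t - 1" using exp_ge_add_one_self[of t] by linarith
  finally show ?thesis using False by simp
qed

text \<open>Conjugation with \<open>exp \<phi>\<close>, \<open>\<phi>\<close> bounded and \<open>\<mu>\<close>-Lipschitz, changes \<open>H\<close> by a small operator \<open>E\<close>; so the
  conjugated resolvent \<open>R\<^sub>\<phi> = R - R E R\<^sub>\<phi>\<close> is bounded by twice the norm bound of \<open>R\<close>.\<close>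

lemma combes_thomas:
  assumes D: "D = bulk_lattice a1 a2" "a1 > 0" "a2 > 0"
    and H: "op_on D H" "decays D lam 0 C H" and pos: "lam > 0" "C \<ge> 0" "g > 0"
  obtains \<mu> where "\<mu> > 0" "\<And>z R r. inverse_on D (shifted D H z) R \<Longrightarrow> norm R \<le> 1 / r \<Longrightarrow> r \<ge> g \<Longrightarrow> decays D \<mu> 0 (2 / r) R"
proof -
  define Z where "Z = site_sum D (lam / 2)"
  have Z: "Z \<ge> 0" by (simp add: Z_def site_sum_nonneg)
  \<comment> \<open>The first bound lets the decay of \<open>H\<close> absorb
    \<open>exp (\<mu> * t)\<close>, the second makes the Schur bound of \<open>E\<close> at most
    \<open>g / 2\<close>. Neither involves \<open>z\<close> or \<open>r\<close>, so one rate serves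
    a whole vertical line.\<close>
  define \<mu> where "\<mu> = min (lam / 4) (g * lam / (8 * (C * Z + 1)))"
  have CZ: "C * Z + 1 > 0" using pos Z by (simp add: add_nonneg_pos)
  have mu: "\<mu> > 0" "\<mu> \<le> lam / 4" "\<mu> \<le> g * lam / (8 * (C * Z + 1))"
    using pos CZ by (simp add: \<mu>_def) (simp_all only: \<mu>_def min.cobounded1 min.cobounded2)
  have small: "C * (\<mu> * (4 / lam)) * Z \<le> g / 2"
  proof -
    have "\<mu> * (8 * (C * Z + 1)) \<le> g * lam"
      using mu(3) CZ by (simp add: pos_le_divide_eq)
    moreover have "\<mu> * (8 * (C * Z)) \<le> \<mu> * (8 * (C * Z + 1))" using mu by simp
    ultimately have "\<mu> * (8 * (C * Z)) \<le> g * lam" by linarith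
    then show ?thesis using pos by (simp add: field_simps)
  qed
  show thesis
  proof (rule that[OF mu(1)])
    fix z R r
    assume inv: "inverse_on D (shifted D H z) R" and nR: "norm R \<le> 1 / r" and r: "r \<ge> g"
    have Rop: "op_on D R" using inv by (simp add: inverse_on_def)
    have r0: "r > 0" using r pos by simp
    show "decays D \<mu> 0 (2 / r) R"
      unfolding decays_def
    proof (intro ballI)
      fix i j assume ij: "i \<in> sites D" "j \<in> sites D"
      define n where "n = norm1 (fst i - fst j)"
      \<comment> \<open>Cutting the distance to \<open>j\<close> off at \<open>n\<close> makes
        multiplication by \<open>exp \<phi>\<close> bounded, while \<open>\<phi>\<close> still has
        the full value \<open>\<mu> * n\<close> at \<open>i\<close> and 0 at
        \<open>j\<close>.\<close>
      define \<phi> where "\<phi> x = \<mu> * min n (norm1 (x - fst j))" for x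
      have n0: "n \<ge> 0" by (simp add: n_def norm1_nonneg)
      have phi: "0 \<le> \<phi> x" "\<phi> x \<le> \<mu> * n" for x
        using mu(1) n0 norm1_nonneg[of "x - fst j"] by (auto simp: \<phi>_def intro!: mult_nonneg_nonneg mult_left_mono)
      have lip: "\<bar>\<phi> x - \<phi> y\<bar> \<le> \<mu> * norm1 (x - y)" for x y
      proof -
        have "\<bar>min n (norm1 (x - fst j)) - min n (norm1 (y - fst j))\<bar> \<le> norm1 (x - y)"
          using norm1_triangle[of x "fst j" y] norm1_triangle[of y "fst j" x] norm1_commute[of x y] norm1_nonneg[of "x - y"]
          unfolding min_def abs_le_iff by (simp split: if_splits)
        then show ?thesis
          using mu(1) unfolding \<phi>_def right_diff_distrib[symmetric] by (simp add: abs_mult)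
      qed
      define P where "P = position_op D (\<lambda>x. exp (\<phi> x))"
      define N where "N = position_op D (\<lambda>x. exp (- \<phi> x))"
      have Pb: "\<bar>exp (\<phi> x)\<bar> \<le> exp (\<mu> * n)" and Nb: "\<bar>exp (- \<phi> x)\<bar> \<le> 1" for x
        using phi[of x] by auto
      have Pop: "op_on D P" and Nop: "op_on D N"
        unfolding P_def N_def by (rule op_on_position_op, rule Pb, rule op_on_position_op, rule Nb)
      have conj_ent: "ent (P o\<^sub>L (T o\<^sub>L N)) k l = of_real (exp (\<phi> (fst k) - \<phi> (fst l))) * ent T k l" if T: "op_on D T" for T k l
      proof -
        have z: "ent T k l = 0" if "\<not> (fst k \<in> D \<and> fst l \<in> D)"
          using T that unfolding op_on_iff by (cases k; cases l) auto
        show ?thesis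
          unfolding P_def N_def ent_position_op_left[OF Pb] ent_position_op_right[OF Nb op_on_complex_linear[OF T]]
          using z by (auto simp: exp_diff exp_minus divide_inverse)
      qed
      have NP: "N o\<^sub>L P = id_on D"
      proof (rule complex_linear_eqI)
        show "ent (N o\<^sub>L P) k l = ent (id_on D) k l" for k l
          unfolding N_def ent_position_op_left[OF Nb] P_def
          by (simp add: ent_position_op[OF Pb] ent_id_on mem_Times_iff flip: exp_add of_real_mult)
      qed (use Pop Nop op_on_complex_linear in auto)
      define E where "E = (P o\<^sub>L (H o\<^sub>L N)) - H"
      have Eop: "op_on D E" unfolding E_def using Pop Nop H(1) by blast
      have Eent: "cmod (ent E k l) \<le> C * (\<mu> * (4 / lam)) * exp (- (lam / 2) * norm1 (fst k - fst l))"
        if kl: "k \<in> sites D" "l \<in> sites D" for k l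
      proof -
        let ?t = "norm1 (fst k - fst l)"
        have t: "?t \<ge> 0" by (rule norm1_nonneg)
        have "ent E k l = of_real (exp (\<phi> (fst k) - \<phi> (fst l)) - 1) * ent H k l"
          by (simp add: E_def conj_ent[OF H(1)] algebra_simps)
        then have "cmod (ent E k l) = \<bar>exp (\<phi> (fst k) - \<phi> (fst l)) - 1\<bar> * cmod (ent H k l)"
          by (simp only: norm_mult norm_of_real)
        also have "\<dots> \<le> (exp (\<mu> * ?t) - 1) * (C * exp (- lam * ?t))"
        proof (intro mult_mono exp_diff_le[OF lip])
          show "cmod (ent H k l) \<le> C * exp (- lam * ?t)" using H(2) kl by (auto simp: decays_def)
        qed (use mu t in auto)
        also have "\<dots> \<le> (\<mu> * (4 / lam) * exp (lam / 2 * ?t)) * (C * exp (- lam * ?t))"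
        proof (intro mult_right_mono)
          \<comment> \<open>This is \<open>exp x - 1 \<le> x * exp x\<close>. The factor
            \<open>?t\<close> is absorbed by \<open>4 / lam * exp (lam / 4 * ?t)\<close>; the
            remaining factor \<open>\<mu>\<close> provides the smallness.\<close>
          have "1 - \<mu> * ?t \<le> exp (- (\<mu> * ?t))" using exp_ge_add_one_self[of "- (\<mu> * ?t)"] by simp
          then have "(1 - \<mu> * ?t) * exp (\<mu> * ?t) \<le> exp (- (\<mu> * ?t)) * exp (\<mu> * ?t)" by (intro mult_right_mono) auto
          then have "exp (\<mu> * ?t) - 1 \<le> \<mu> * ?t * exp (\<mu> * ?t)" by (simp add: exp_minus algebra_simps)
          also have "\<dots> \<le> \<mu> * (4 / lam * exp (lam / 4 * ?t)) * exp (lam / 4 * ?t)"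
          proof (intro mult_mono)
            have "lam / 4 * ?t \<le> exp (lam / 4 * ?t)" using exp_ge_add_one_self[of "lam / 4 * ?t"] by linarith
            then have "4 / lam * (lam / 4 * ?t) \<le> 4 / lam * exp (lam / 4 * ?t)" using pos by (intro mult_left_mono) auto
            then show "?t \<le> 4 / lam * exp (lam / 4 * ?t)" using pos by simp
            have "\<mu> * ?t \<le> lam / 4 * ?t" using mu t by (intro mult_right_mono) auto
            then show "exp (\<mu> * ?t) \<le> exp (lam / 4 * ?t)" by simp
          qed (use mu pos t in auto)
          also have "\<dots> = \<mu> * (4 / lam) * (exp (lam / 4 * ?t) * exp (lam / 4 * ?t))" by simp
          also have "exp (lam / 4 * ?t) * exp (lam / 4 * ?t) = exp (lam / 2 * ?t)" unfolding exp_add[symmetric] by (simp add: field_simps)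
          finally show "exp (\<mu> * ?t) - 1 \<le> \<mu> * (4 / lam) * exp (lam / 2 * ?t)" .
        qed (use pos in auto)
        also have "\<dots> = C * (\<mu> * (4 / lam)) * (exp (lam / 2 * ?t) * exp (- lam * ?t))" by simp
        also have "exp (lam / 2 * ?t) * exp (- lam * ?t) = exp (- (lam / 2) * ?t)"
          unfolding exp_add[symmetric] by (simp add: field_simps)
        finally show ?thesis .
      qed
      have sumE: "(\<Sum>k\<in>F. h k) \<le> g / 2" if F: "finite F" and h0: "\<And>k. k \<in> F \<Longrightarrow> k \<notin> sites D \<Longrightarrow> h k = 0"
         and h: "\<And>k. k \<in> F \<Longrightarrow> k \<in> sites D \<Longrightarrow> h k \<le> C * (\<mu> * (4 / lam)) * exp (- (lam / 2) * norm1 (fst k - p))" and p: "p \<in> D"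
        for F h p
      proof -
        have "(\<Sum>k\<in>F. h k) = (\<Sum>k\<in>F \<inter> sites D. h k)"
          by (rule sum.mono_neutral_right[OF F]) (use h0 in auto)
        also have "\<dots> \<le> (\<Sum>k\<in>F \<inter> sites D. C * (\<mu> * (4 / lam)) * exp (- (lam / 2) * norm1 (fst k - p)))"
          by (rule sum_mono) (use h in auto)
        also have "\<dots> = C * (\<mu> * (4 / lam)) * (\<Sum>k\<in>F \<inter> sites D. exp (- (lam / 2) * norm1 (fst k - p)))"
          by (rule sum_distrib_left[symmetric])
        also have "\<dots> \<le> C * (\<mu> * (4 / lam)) * Z"
          unfolding Z_def D(1) using F p pos D mu by (intro mult_left_mono site_sum_bound) auto
        also have "\<dots> \<le> g / 2" by (rule small)
        finally show ?thesis .
      qed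
      have E0: "ent E k l = 0" if "k \<notin> sites D \<or> l \<notin> sites D" for k l
        using Eop that unfolding op_on_iff by blast
      have nE: "norm E \<le> g / 2"
      proof (rule schur_test[OF op_on_complex_linear[OF Eop]])
        fix k and F :: "(plane \<times> 2) set" assume F: "finite F"
        show "(\<Sum>l\<in>F. cmod (ent E k l)) \<le> g / 2"
        proof (cases "k \<in> sites D")
          case True
          show ?thesis
          proof (rule sumE[OF F, where p="fst k"])
            show "cmod (ent E k l) \<le> C * (\<mu> * (4 / lam)) * exp (- (lam / 2) * norm1 (fst l - fst k))" if "l \<in> sites D" for l
              using Eent[OF True that] norm1_commute[of "fst l" "fst k"] by simp
          qed (use E0 True in \<open>auto simp: mem_Times_iff\<close>)
        qed (use E0 pos in simp)
        show "(\<Sum>l\<in>F. cmod (ent E l k)) \<le> g / 2"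
        proof (cases "k \<in> sites D")
          case True
          show ?thesis
            by (rule sumE[OF F, where p="fst k"]) (use E0 Eent True in \<open>auto simp: mem_Times_iff\<close>)
        qed (use E0 pos in simp)
      qed
      define R\<phi> where "R\<phi> = P o\<^sub>L (R o\<^sub>L N)"
      have Rphiop: "op_on D R\<phi>" unfolding R\<phi>_def using Pop Nop Rop by blast
      have AR: "shifted D H z o\<^sub>L R = id_on D" and RA: "R o\<^sub>L shifted D H z = id_on D"
        using inv by (auto simp: inverse_on_def)
      have PN: "P o\<^sub>L N = id_on D"
      proof (rule complex_linear_eqI)
        show "ent (P o\<^sub>L N) k l = ent (id_on D) k l" for k l
          unfolding P_def ent_position_op_left[OF Pb] N_def
          by (simp add: ent_position_op[OF Nb] ent_id_on mem_Times_iff flip: exp_add of_real_mult)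
      qed (use Pop Nop op_on_complex_linear in auto)
      have "P o\<^sub>L (shifted D H z o\<^sub>L N) = (P o\<^sub>L (H o\<^sub>L N)) - scale_op z (P o\<^sub>L N)"
        by (simp only: compose_simps(3,4) scale_op_compose(1) scale_op_compose(2)[OF op_on_complex_linear[OF Pop]] op_on_id[OF Nop])
      then have "shifted D H z + E = P o\<^sub>L (shifted D H z o\<^sub>L N)"
        unfolding E_def PN by simp
      then have "(shifted D H z + E) o\<^sub>L R\<phi> = P o\<^sub>L (shifted D H z o\<^sub>L ((N o\<^sub>L P) o\<^sub>L (R o\<^sub>L N)))"
        unfolding R\<phi>_def by (simp only: compose_assoc)
      also have "\<dots> = P o\<^sub>L ((shifted D H z o\<^sub>L R) o\<^sub>L N)"
        unfolding NP by (simp only: compose_assoc[symmetric] op_on_id[OF Rop])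
      also have "\<dots> = id_on D" unfolding AR by (simp only: op_on_id[OF Nop] PN)
      finally have X: "(shifted D H z + E) o\<^sub>L R\<phi> = id_on D" .
      have "R o\<^sub>L ((shifted D H z + E) o\<^sub>L R\<phi>) = R" by (simp only: X op_on_id[OF Rop])
      then have "(R o\<^sub>L (shifted D H z o\<^sub>L R\<phi>)) + (R o\<^sub>L (E o\<^sub>L R\<phi>)) = R"
        by (simp only: compose_simps(1,2))
      then have "((R o\<^sub>L shifted D H z) o\<^sub>L R\<phi>) + (R o\<^sub>L (E o\<^sub>L R\<phi>)) = R"
        by (simp only: compose_assoc)
      then have eq: "R\<phi> = R - (R o\<^sub>L (E o\<^sub>L R\<phi>))"
        unfolding RA op_on_id[OF Rphiop] by (simp add: algebra_simps)
      have "norm R\<phi> \<le> norm R + norm R * (norm E * norm R\<phi>)"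
        by (subst (1) eq, rule order_trans[OF norm_triangle_ineq4], rule add_left_mono,
            rule order_trans[OF norm_blinfun_compose mult_left_mono[OF norm_blinfun_compose]]) simp
      also have "\<dots> \<le> 1 / r + 1 / r * (r / 2 * norm R\<phi>)"
        using nR nE r r0 by (intro add_mono mult_mono) auto
      finally have nRphi: "norm R\<phi> \<le> 2 / r" using r0 by simp
      have phij: "\<phi> (fst j) = 0" using n0 by (simp add: \<phi>_def norm1_def)
      have phii: "\<phi> (fst i) = \<mu> * n" by (simp add: \<phi>_def n_def)
      have "ent R\<phi> i j = of_real (exp (\<mu> * n)) * ent R i j"
        unfolding R\<phi>_def conj_ent[OF Rop] phij phii by simp
      then have "exp (\<mu> * n) * cmod (ent R i j) = cmod (ent R\<phi> i j)"
        by (simp add: norm_mult)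
      also have "\<dots> \<le> 2 / r" by (rule order_trans[OF cmod_ent_le nRphi])
      finally have "exp (- (\<mu> * n)) * (exp (\<mu> * n) * cmod (ent R i j)) \<le> exp (- (\<mu> * n)) * (2 / r)"
        by (intro mult_left_mono) auto
      then have "cmod (ent R i j) \<le> exp (- (\<mu> * n)) * (2 / r)"
        by (simp add: mult.assoc[symmetric] exp_add[symmetric])
      then show "cmod (ent R i j) \<le> 2 / r * exp (- \<mu> * (norm1 (fst i - fst j) + 0 * (\<bar>fst i $ 2\<bar> + \<bar>fst j $ 2\<bar>)))"
        by (simp add: n_def mult.commute)
    qed
  qed
qed

section \<open>The spin integrand on a spectral gap\<close>

definition site_weight :: "plane set \<Rightarrow> (plane \<times> 2 \<Rightarrow> real) \<Rightarrow> plane \<times> 2 \<Rightarrow> complex" where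
  "site_weight D \<gamma> i = (if i \<in> sites D then complex_of_real (\<gamma> i) else 0)"

text \<open>Turns \<open>\<Lambda>1 S\<close> into multiplication by a single real weight on sites.
  Working with arbitrary weights bounded by 1 keeps the switch function out of the kernel.\<close>

definition weight_op :: "plane set \<Rightarrow> (plane \<times> 2 \<Rightarrow> real) \<Rightarrow> lop" where
  "weight_op D \<gamma> = mult_op (site_weight D \<gamma>)"

lemma site_weight_bound:
  assumes "\<forall>i. \<bar>\<gamma> i\<bar> \<le> 1"
  shows "cmod (site_weight D \<gamma> i) \<le> 1"
  using assms[rule_format, of i] by (simp add: site_weight_def)

lemma op_on_weight_op:
  assumes "\<forall>i. \<bar>\<gamma> i\<bar> \<le> 1" shows "op_on D (weight_op D \<gamma>)"
proof -
  note b = site_weight_bound[OF assms, of D]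
  have "complex_linear (weight_op D \<gamma>)"
    unfolding weight_op_def by (rule complex_linear_mult_op[where g="site_weight D \<gamma>", OF b])
  moreover have "ent (weight_op D \<gamma>) i j = 0" if "i \<notin> sites D \<or> j \<notin> sites D" for i j
    unfolding weight_op_def ent_mult_op(1)[where g="site_weight D \<gamma>", OF b]
    using that by (auto simp: site_weight_def)
  ultimately show ?thesis
    unfolding op_on_iff by blast
qed

lemma ent_weight_op:
  assumes "\<forall>i. \<bar>\<gamma> i\<bar> \<le> 1" "op_on D T"
  shows "ent (weight_op D \<gamma> o\<^sub>L T) i j = of_real (\<gamma> i) * ent T i j"
    and "ent (T o\<^sub>L weight_op D \<gamma>) i j = ent T i j * of_real (\<gamma> j)"
  unfolding weight_op_def ent_mult_op(2)[where g="site_weight D \<gamma>", OF site_weight_bound[OF assms(1)]]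
    ent_mult_op(3)[where g="site_weight D \<gamma>", OF site_weight_bound[OF assms(1)] op_on_complex_linear[OF assms(2)]]
  using op_on_ent_zero[OF assms(2), of i j] by (auto simp: site_weight_def)

definition spin_sign :: "2 \<Rightarrow> real" where
  "spin_sign s = (if s = 1 then 1 / 2 else - 1 / 2)"

abbreviation spin_weight :: "(plane \<Rightarrow> real) \<Rightarrow> plane \<times> 2 \<Rightarrow> real" where
  "spin_weight f \<equiv> \<lambda>(x, s). f x * spin_sign s"

lemma spin_weight_bound:
  assumes "\<forall>x. \<bar>f x\<bar> \<le> 1" shows "\<forall>i. \<bar>spin_weight f i\<bar> \<le> 1"
proof (intro allI)
  fix i :: "plane \<times> 2"
  have "\<bar>spin_sign (snd i)\<bar> \<le> 1" by (simp add: spin_sign_def)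
  then have "\<bar>f (fst i)\<bar> * \<bar>spin_sign (snd i)\<bar> \<le> 1 * 1"
    using assms by (intro mult_mono) auto
  then show "\<bar>spin_weight f i\<bar> \<le> 1" by (simp add: case_prod_beta abs_mult)
qed

lemma position_spin_op:
  assumes f: "\<forall>x. \<bar>f x\<bar> \<le> 1"
  shows "position_op D f o\<^sub>L spin_op D = weight_op D (spin_weight f)"
proof (rule blinfun_eqI, rule ell2_eqI)
  fix u and i :: "plane \<times> 2"
  obtain x s where i: "i = (x, s)" by (cases i)
  show "ell2_fun ((position_op D f o\<^sub>L spin_op D) u) i = ell2_fun (weight_op D (spin_weight f) u) i"
    unfolding i weight_op_def mult_op_apply[where g="site_weight D (spin_weight f)", OF site_weight_bound[OF spin_weight_bound[OF f]]]
    by (simp add: position_op_apply[where f=f, OF f[rule_format]] spin_op_apply spin_sign_def site_weight_def)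
qed

text \<open>The scalar \<open>z\<close> drops out of commutators, so
  \<open>[H, G] = [H - z, G]\<close> on \<open>H_D\<close>, and in each term one of the outer
  resolvents cancels.\<close>

lemma resolvent_commutator:
  assumes H: "op_on D H" and z: "z \<notin> spectrum D H" and G: "op_on D G"
  shows "resolvent D H z o\<^sub>L commutator H G o\<^sub>L resolvent D H z = (G o\<^sub>L resolvent D H z) - (resolvent D H z o\<^sub>L G)"
proof -
  let ?R = "resolvent D H z"
  note R = op_on_resolvent[OF z]
  have inv: "shifted D H z o\<^sub>L ?R = id_on D" "?R o\<^sub>L shifted D H z = id_on D"
    using resolvent_inverse[OF z] by (auto simp: inverse_on_def)
  have "commutator H G = (shifted D H z o\<^sub>L G) - (G o\<^sub>L shifted D H z)"
    unfolding commutator_def compose_simps(3,4) scale_op_compose(1) scale_op_compose(2)[OF op_on_complex_linear[OF G]] op_on_id[OF G]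
    by simp
  then have "?R o\<^sub>L commutator H G o\<^sub>L ?R = (?R o\<^sub>L (shifted D H z o\<^sub>L G) o\<^sub>L ?R) - (?R o\<^sub>L (G o\<^sub>L shifted D H z) o\<^sub>L ?R)"
    by (simp only: compose_simps(3)[of _ _ ?R] compose_simps(4)[of ?R])
  also have "?R o\<^sub>L (shifted D H z o\<^sub>L G) o\<^sub>L ?R = (?R o\<^sub>L shifted D H z) o\<^sub>L (G o\<^sub>L ?R)"
    by (simp only: compose_assoc)
  also have "?R o\<^sub>L (G o\<^sub>L shifted D H z) o\<^sub>L ?R = (?R o\<^sub>L G) o\<^sub>L (shifted D H z o\<^sub>L ?R)"
    by (simp only: compose_assoc)
  finally show ?thesis
    unfolding inv using op_on_id[OF op_on_compose[OF G R]] op_on_id[OF op_on_compose[OF R G]] by simp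
qed

text \<open>One side, one switch in the second direction, one point \<open>c\<close> of the gap. The
  switch in the first direction, the density function and the step size are not fixed here, so
  whatever is defined below without them as arguments is independent of them.\<close>

locale bulk_gap =
  fixes a1 a2 :: nat and D :: "plane set" and H :: lop and lam CH c :: real and \<Lambda> :: "plane \<Rightarrow> real"
  assumes D: "D = bulk_lattice a1 a2" "a1 > 0" "a2 > 0"
    and H: "op_on D H" "selfadjoint H" "decays D lam 0 CH H" and lam: "lam > 0" "CH \<ge> 0"
    and transl: "translation_invariant D H" and c: "complex_of_real c \<notin> spectrum D H"
    and sw: "switch_function 2 \<Lambda>"
begin

abbreviation R :: "complex \<Rightarrow> lop" where "R z \<equiv> resolvent D H z"

definition A :: lop where "A = commutator H (position_op D \<Lambda>)"

text \<open>The integrand without \<open>dbar \<rho>'\<close>, after \<open>R [H, G] R\<close> has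
  been replaced by \<open>[G, R]\<close>; each expanded term contains exactly two
  resolvents.\<close>

definition W :: "(plane \<times> 2 \<Rightarrow> real) \<Rightarrow> complex \<Rightarrow> lop" where
  "W \<gamma> z = ((R z o\<^sub>L A) o\<^sub>L ((weight_op D \<gamma> o\<^sub>L R z) - (R z o\<^sub>L weight_op D \<gamma>)))
     - (((weight_op D \<gamma> o\<^sub>L R z) - (R z o\<^sub>L weight_op D \<gamma>)) o\<^sub>L (A o\<^sub>L R z))"

lemma switch_abs: "\<bar>\<Lambda> x\<bar> \<le> 1"
  using switch_function_range[OF sw, of x] by (simp add: abs_le_iff)

lemma op_on_A: "op_on D A"
  unfolding A_def commutator_def using H(1) op_on_position_op[where f=\<Lambda>, OF switch_abs]
  by (intro op_on_diff op_on_compose)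

lemma spectrum_props: "closed (spectrum D H)" "spectrum D H \<subseteq> \<real>"
proof -
  show "closed (spectrum D H)" using open_resolvent_set[OF H(1)] by (simp add: closed_def)
  show "spectrum D H \<subseteq> \<real>"
  proof
    fix z assume "z \<in> spectrum D H"
    then show "z \<in> \<real>" using spectrum_real[OF H(1,2), of z] by (cases "Im z = 0") (auto simp: complex_is_Real_iff)
  qed
qed

lemma op_on_W:
  assumes "\<forall>i. \<bar>\<gamma> i\<bar> \<le> 1" "z \<notin> spectrum D H" shows "op_on D (W \<gamma> z)"
  unfolding W_def using op_on_A op_on_resolvent[OF assms(2)] op_on_weight_op[OF assms(1)]
  by (intro op_on_diff op_on_compose)

text \<open>At spectral points the resolvent is an unspecified operator. The spectrum being real,
  both sides vanish there together with \<open>dbar \<rho>'\<close>.\<close>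

lemma spin_integrand_eq:
  assumes f: "\<forall>x. \<bar>\<Lambda>1 x\<bar> \<le> 1" and db: "\<And>z. Im z = 0 \<Longrightarrow> dbar \<rho>' z = 0"
  shows "spin_integrand D H \<rho>' \<Lambda> \<Lambda>1 z = scale_op (dbar \<rho>' z) (W (spin_weight \<Lambda>1) z)"
proof (cases "z \<in> spectrum D H")
  case True
  then have "dbar \<rho>' z = 0" using db spectrum_props by (auto simp: complex_is_Real_iff)
  then show ?thesis by (simp add: spin_integrand_def Let_def)
next
  case False
  let ?G = "weight_op D (spin_weight \<Lambda>1)"
  note rc = resolvent_commutator[OF H(1) False op_on_weight_op[OF spin_weight_bound[OF f]]]
  have "R z o\<^sub>L A o\<^sub>L R z o\<^sub>L commutator H ?G o\<^sub>L R z = (R z o\<^sub>L A) o\<^sub>L (R z o\<^sub>L commutator H ?G o\<^sub>L R z)"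
    "R z o\<^sub>L commutator H ?G o\<^sub>L R z o\<^sub>L A o\<^sub>L R z = (R z o\<^sub>L commutator H ?G o\<^sub>L R z) o\<^sub>L (A o\<^sub>L R z)"
    by (simp_all only: compose_assoc)
  then show ?thesis
    unfolding spin_integrand_def Let_def position_spin_op[OF f] A_def[symmetric] W_def by (simp only: rc)
qed

lemma norm_W:
  "norm (W \<gamma> z) \<le> 4 * norm A * norm (weight_op D \<gamma>) * (norm (R z))\<^sup>2"
proof -
  let ?G = "weight_op D \<gamma>"
  define r a g where "r = norm (R z)" and "a = norm A" and "g = norm ?G"
  have nn: "r \<ge> 0" "a \<ge> 0" "g \<ge> 0" by (simp_all add: r_def a_def g_def)
  have K: "norm ((?G o\<^sub>L R z) - (R z o\<^sub>L ?G)) \<le> g * r + r * g"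
    unfolding r_def g_def by (intro order_trans[OF norm_triangle_ineq4] add_mono norm_blinfun_compose)
  have RA: "norm (R z o\<^sub>L A) \<le> r * a" and AR: "norm (A o\<^sub>L R z) \<le> a * r"
    unfolding r_def a_def by (rule norm_blinfun_compose)+
  have "norm (W \<gamma> z) \<le> (r * a) * (g * r + r * g) + (g * r + r * g) * (a * r)"
    unfolding W_def
    by (intro order_trans[OF norm_triangle_ineq4] add_mono order_trans[OF norm_blinfun_compose] mult_mono K RA AR)
       (use nn in auto)
  also have "\<dots> = 4 * a * g * r\<^sup>2" by (simp add: power2_eq_square algebra_simps)
  finally show ?thesis by (simp add: r_def a_def g_def)
qed

lemma W_derivative:
  assumes g: "\<forall>i. \<bar>\<gamma> i\<bar> \<le> 1" and z: "z \<notin> spectrum D H"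
  shows "\<exists>W'. op_derivative (W \<gamma>) W' z"
proof -
  note G = op_on_complex_linear[OF op_on_weight_op[OF g], of D] and A = op_on_complex_linear[OF op_on_A]
    and R = op_on_complex_linear[OF op_on_resolvent[OF z]]
  note dR = op_derivative_resolvent[OF H(1) z]
  note d1 = op_derivative_compose[OF dR op_derivative_const[of A] R]
  note d2 = op_derivative_compose[OF op_derivative_const[of A] dR A]
  note d3 = op_derivative_diff[OF op_derivative_compose[OF op_derivative_const[of "weight_op D \<gamma>"] dR G]
      op_derivative_compose[OF dR op_derivative_const[of "weight_op D \<gamma>"] R]]
  have "complex_linear (R z o\<^sub>L A)" "complex_linear ((weight_op D \<gamma> o\<^sub>L R z) - (R z o\<^sub>L weight_op D \<gamma>))"
    using R A G by blast+
  from op_derivative_diff[OF op_derivative_compose[OF d1 d3 this(1)] op_derivative_compose[OF d3 d2 this(2)]]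
  show ?thesis
    unfolding W_def[abs_def] by blast
qed

lemma W_holomorphic:
  assumes g: "\<forall>i. \<bar>\<gamma> i\<bar> \<le> 1"
  shows "(\<lambda>z. ent (W \<gamma> z) i j) holomorphic_on - spectrum D H"
  unfolding holomorphic_on_def field_differentiable_def
proof (intro ballI)
  fix z assume "z \<in> - spectrum D H"
  then obtain W' where "op_derivative (W \<gamma>) W' z" using W_derivative[OF g] by blast
  from op_derivative_ent[OF this]
  show "\<exists>f'. ((\<lambda>z. ent (W \<gamma> z) i j) has_field_derivative f') (at z within - spectrum D H)"
    using has_field_derivative_at_within by blast
qed

lemma norm_W_Im:
  assumes "Im z \<noteq> 0"
  shows "norm (W \<gamma> z) \<le> 4 * norm A * norm (weight_op D \<gamma>) / (Im z)\<^sup>2"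
proof -
  have "(norm (R z))\<^sup>2 \<le> (1 / \<bar>Im z\<bar>)\<^sup>2"
    by (intro power_mono norm_resolvent_Im[OF H(1,2) assms]) simp
  then have "4 * norm A * norm (weight_op D \<gamma>) * (norm (R z))\<^sup>2 \<le> 4 * norm A * norm (weight_op D \<gamma>) * (1 / \<bar>Im z\<bar>)\<^sup>2"
    by (rule mult_left_mono) simp
  then show ?thesis
    using norm_W[of \<gamma> z] by (simp add: power_divide)
qed

text \<open>Beyond \<open>2 * norm H + 1\<close> the number \<open>cmod z - norm H\<close> is at
  least half of \<open>cmod z\<close>; two resolvents then give the order -2 required on the outer
  sides of the rectangles.\<close>

lemma W_large:
  assumes z: "cmod z \<ge> 2 * norm H + 1"
  shows "z \<notin> spectrum D H" "norm (W \<gamma> z) \<le> 16 * norm A * norm (weight_op D \<gamma>) / (cmod z)\<^sup>2"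
proof -
  have z': "cmod z > norm H" "cmod z > 0" using z norm_ge_zero[of H] by linarith+
  show "z \<notin> spectrum D H" by (rule spectrum_bounded[OF H(1) z'(1)])
  have "norm (R z) \<le> 1 / (cmod z - norm H)"
    by (rule norm_resolvent_large[OF H(1) z'(1)])
  also have "\<dots> \<le> 1 / (cmod z / 2)"
    using z z' norm_ge_zero[of H] by (intro frac_le) linarith+
  finally have "norm (R z) \<le> 2 / cmod z" by simp
  then have "(norm (R z))\<^sup>2 \<le> (2 / cmod z)\<^sup>2" by (rule power_mono) simp
  then have "4 * norm A * norm (weight_op D \<gamma>) * (norm (R z))\<^sup>2 \<le> 4 * norm A * norm (weight_op D \<gamma>) * (2 / cmod z)\<^sup>2"
    by (rule mult_left_mono) simp
  then show "norm (W \<gamma> z) \<le> 16 * norm A * norm (weight_op D \<gamma>) / (cmod z)\<^sup>2"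
    using norm_W[of \<gamma> z] by (simp add: power_divide)
qed

text \<open>Flatness of order 3 against the bound \<open>1 / (Im z)\<^sup>2\<close> leaves a factor
  \<open>\<bar>Im z\<bar>\<close>, which makes the integrand continuous across the real axis. The
  compact support of \<open>\<rho>'\<close> reduces the integral to a box.\<close>

lemma integrand_integrable:
  assumes g: "\<forall>i. \<bar>\<gamma> i\<bar> \<le> 1" and tf: "test_function \<rho>'" and db: "\<exists>C. \<forall>z. cmod (dbar \<rho>' z) \<le> C * \<bar>Im z\<bar> ^ 3"
  shows "(\<lambda>z. scale_op (dbar \<rho>' z) (W \<gamma> z)) integrable_on UNIV"
proof -
  define F where "F z = scale_op (dbar \<rho>' z) (W \<gamma> z)" for z
  note sm = test_function_smooth[OF tf]
  obtain C where C: "\<And>z. cmod (dbar \<rho>' z) \<le> C * \<bar>Im z\<bar> ^ 3" using db by blast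
  define K where "K = C * (4 * norm A * norm (weight_op D \<gamma>))"
  have Fb: "norm (F z) \<le> K * \<bar>Im z\<bar>" for z
  proof (cases "Im z = 0")
    case True
    then have "dbar \<rho>' z = 0" using C[of z] by simp
    then show ?thesis by (simp add: F_def True)
  next
    case False
    have "norm (F z) \<le> (C * \<bar>Im z\<bar> ^ 3) * (4 * norm A * norm (weight_op D \<gamma>) / (Im z)\<^sup>2)"
      unfolding F_def norm_scale_op
      by (intro mult_mono C norm_W_Im[OF False] order_trans[OF norm_ge_zero C]) auto
    also have "\<dots> = K * (\<bar>Im z\<bar> ^ 3 / \<bar>Im z\<bar>\<^sup>2)" by (simp add: K_def)
    also have "\<bar>Im z\<bar> ^ 3 / \<bar>Im z\<bar>\<^sup>2 = \<bar>Im z\<bar>" using False by (simp add: power3_eq_cube power2_eq_square)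
    finally show ?thesis .
  qed
  have cont: "isCont F z" for z
  proof (cases "Im z = 0")
    case True
    then have F0: "F z = 0" using Fb[of z] by simp
    have "(F \<longlongrightarrow> 0) (at z)"
    proof (rule Lim_null_comparison)
      show "\<forall>\<^sub>F w in at z. norm (F w) \<le> K * \<bar>Im w\<bar>" using Fb by (rule always_eventually[OF allI])
      have "((\<lambda>w. K * \<bar>Im w\<bar>) \<longlongrightarrow> K * \<bar>Im z\<bar>) (at z)" by (intro tendsto_intros)
      then show "((\<lambda>w. K * \<bar>Im w\<bar>) \<longlongrightarrow> 0) (at z)" using True by simp
    qed
    then show ?thesis by (simp add: isCont_def F0)
  next
    case False
    obtain W' where "op_derivative (W \<gamma>) W' z"
      using W_derivative[OF g spectrum_real[OF H(1,2) False]] by blast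
    then have "isCont (W \<gamma>) z" by (rule op_derivative_isCont)
    moreover have "isCont (dbar \<rho>') z"
      using smooth_continuous[OF smooth_dbar[OF sm], of UNIV] by (simp add: continuous_on_eq_continuous_at)
    ultimately show ?thesis
      unfolding F_def isCont_def by (intro bounded_bilinear.tendsto[OF bounded_bilinear_scale_op])
  qed
  obtain r0 where r0: "\<And>z. z \<in> closure {z. \<rho>' z \<noteq> 0} \<Longrightarrow> cmod z \<le> r0"
    using tf compact_imp_bounded bounded_iff unfolding test_function_def by metis
  have Fout: "F z = 0" if "cmod z > r0" for z
  proof -
    have "(\<rho>' has_derivative (\<lambda>_. 0)) (at z)"
    proof (rule has_derivative_transform_within_open[of "\<lambda>_. 0" _ z UNIV "{z. cmod z > r0}"])
      show "0 = \<rho>' x" if "x \<in> {z. cmod z > r0}" for x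
        using r0[of x] that closure_subset[of "{z. \<rho>' z \<noteq> 0}"] by (auto simp: not_le[symmetric])
    qed (use that in \<open>auto intro!: open_Collect_less continuous_intros\<close>)
    then have "frechet_derivative \<rho>' (at z) = (\<lambda>_. 0)" by (rule frechet_derivative_at[symmetric])
    then show ?thesis by (simp add: F_def dbar_def)
  qed
  let ?Q = "cbox (Complex (- \<bar>r0\<bar>) (- \<bar>r0\<bar>)) (Complex \<bar>r0\<bar> \<bar>r0\<bar>)"
  have "F integrable_on ?Q"
    by (intro integrable_continuous continuous_at_imp_continuous_on ballI cont)
  then obtain y where "(F has_integral y) ?Q" by (auto simp: integrable_on_def)
  then have "(F has_integral y) UNIV"
  proof (rule has_integral_on_superset)
    fix z assume "z \<notin> ?Q"
    then have "\<bar>Re z\<bar> > r0 \<or> \<bar>Im z\<bar> > r0" by (auto simp: in_cbox_complex_iff abs_le_iff not_le)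
    then have "cmod z > r0" using abs_Re_le_cmod[of z] abs_Im_le_cmod[of z] by linarith
    then show "F z = 0" by (rule Fout)
  qed simp
  then show ?thesis unfolding F_def[abs_def] by (auto simp: integrable_on_def)
qed

text \<open>The density function enters only through its values on both sides of the gap.\<close>

lemma integral_entry:
  assumes g: "\<forall>i. \<bar>\<gamma> i\<bar> \<le> 1" and tf: "test_function \<rho>'"
    and db: "\<And>N. N > 0 \<Longrightarrow> \<exists>C. \<forall>z. cmod (dbar \<rho>' z) \<le> C * \<bar>Im z\<bar> ^ N"
    and U1: "open U1" "\<And>x. x \<in> U1 \<Longrightarrow> \<rho>' (of_real x) = 1" "spectrum D H \<inter> {z. Re z < c} \<subseteq> complex_of_real ` closure U1"
    and U2: "open U2" "\<And>x. x \<in> U2 \<Longrightarrow> \<rho>' (of_real x) = 0" "spectrum D H \<inter> {z. Re z > c} \<subseteq> complex_of_real ` closure U2"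
  shows "(\<lambda>n. - 1 / 2 * integral {- real n..real n} (\<lambda>t. ent (W \<gamma> (Complex c t)) i j))
    \<longlonglongrightarrow> ent (integral UNIV (\<lambda>z. scale_op (dbar \<rho>' z) (W \<gamma> z))) i j"
proof -
  have "integral UNIV ((\<lambda>T. ent T i j) \<circ> (\<lambda>z. scale_op (dbar \<rho>' z) (W \<gamma> z))) = ent (integral UNIV (\<lambda>z. scale_op (dbar \<rho>' z) (W \<gamma> z))) i j"
    by (rule integral_linear[OF integrand_integrable[OF g tf db] bounded_linear_ent]) simp
  then have e: "ent (integral UNIV (\<lambda>z. scale_op (dbar \<rho>' z) (W \<gamma> z))) i j = integral UNIV (\<lambda>z. dbar \<rho>' z * ent (W \<gamma> z) i j)"
    by (simp add: o_def)
  show ?thesis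
    unfolding e
  proof (rule dbar_integral_line[OF spectrum_props W_holomorphic[OF g] _ _ c tf db U1 U2])
    show "cmod (ent (W \<gamma> z) i j) \<le> 4 * norm A * norm (weight_op D \<gamma>) / (Im z)\<^sup>2" if "Im z \<noteq> 0" for z
      by (rule order_trans[OF cmod_ent_le norm_W_Im[OF that]])
    show "z \<notin> spectrum D H \<and> cmod (ent (W \<gamma> z) i j) \<le> 16 * norm A * norm (weight_op D \<gamma>) / (cmod z)\<^sup>2"
      if "2 * norm H + 1 \<le> cmod z" for z
      using W_large[OF that] order_trans[OF cmod_ent_le W_large(2)[OF that]] by blast
  qed
qed

lemma complex_linear_integral:
  assumes g: "\<forall>i. \<bar>\<gamma> i\<bar> \<le> 1" and int: "(\<lambda>z. scale_op (dbar \<rho>' z) (W \<gamma> z)) integrable_on UNIV" (is "?F integrable_on _")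
    and db: "\<And>z. Im z = 0 \<Longrightarrow> dbar \<rho>' z = 0"
  shows "op_on D (integral UNIV (\<lambda>z. scale_op (dbar \<rho>' z) (W \<gamma> z)))"
proof -
  have opF: "op_on D (?F z)" for z
  proof (cases "z \<in> spectrum D H")
    case True
    then have "dbar \<rho>' z = 0" using db spectrum_props by (auto simp: complex_is_Real_iff)
    then show ?thesis by (simp add: op_on_0)
  next
    case False
    show ?thesis by (rule op_on_scale_op[OF op_on_W[OF g False]])
  qed
  have cl: "complex_linear (integral UNIV ?F)"
    unfolding complex_linear_def
  proof (intro allI)
    fix a x
    have 1: "integral UNIV ((\<lambda>T. blinfun_apply T v) \<circ> ?F) = integral UNIV ?F v" for v
      by (rule integral_linear[OF int blinfun.bounded_linear_left])
    have i: "((\<lambda>T. blinfun_apply T x) \<circ> ?F) integrable_on UNIV"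
      by (rule integrable_linear[OF int blinfun.bounded_linear_left])
    have "integral UNIV (cscale a \<circ> ((\<lambda>T. blinfun_apply T x) \<circ> ?F)) = cscale a (integral UNIV ((\<lambda>T. blinfun_apply T x) \<circ> ?F))"
      by (rule integral_linear[OF i bounded_bilinear.bounded_linear_right[OF bounded_bilinear_cscale]])
    moreover have "cscale a \<circ> ((\<lambda>T. blinfun_apply T x) \<circ> ?F) = (\<lambda>T. blinfun_apply T (cscale a x)) \<circ> ?F"
      using complex_linearD[OF op_on_complex_linear[OF opF]] by (auto simp: fun_eq_iff)
    ultimately show "integral UNIV ?F (cscale a x) = cscale a (integral UNIV ?F x)"
      by (simp only: 1)
  qed
  moreover have "ent (integral UNIV ?F) i j = 0" if "i \<notin> sites D \<or> j \<notin> sites D" for i j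
  proof -
    have "integral UNIV ((\<lambda>T. ent T i j) \<circ> ?F) = ent (integral UNIV ?F) i j"
      by (rule integral_linear[OF int bounded_linear_ent])
    moreover have "(\<lambda>T. ent T i j) \<circ> ?F = (\<lambda>_. 0)"
      using op_on_ent_zero[OF opF that] by (auto simp: fun_eq_iff)
    ultimately show ?thesis by simp
  qed
  ultimately show ?thesis unfolding op_on_iff by blast
qed

section \<open>The kernel of the diagonal\<close>

text \<open>The coefficient of \<open>\<gamma> j\<close> in the diagonal entry \<open>i\<close> of
  \<open>W \<gamma>\<close> at the point \<open>Complex c t\<close> of the line, see
  \<open>W_diagonal\<close>.\<close>

definition w :: "real \<Rightarrow> plane \<times> 2 \<Rightarrow> plane \<times> 2 \<Rightarrow> complex" where
  "w t i j = ent (R (Complex c t) o\<^sub>L A) i j * ent (R (Complex c t)) j i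
     + ent (R (Complex c t)) i j * ent (A o\<^sub>L R (Complex c t)) j i"

definition kern :: "plane \<times> 2 \<Rightarrow> plane \<times> 2 \<Rightarrow> complex" where
  "kern i j = - 1 / 2 * (LINT t|lborel. w t i j)"

lemma line_resolvent: "Complex c t \<notin> spectrum D H"
  using norm_resolvent_gap[OF H(1,2) c] by metis

text \<open>Expanding the commutators with the weight gives four terms. Two of them have the weight
  outermost and contain the diagonal of \<open>R A R = [\<Lambda>, R]\<close>, which is zero. In the
  other two the weight stands between operators and produces the sum over \<open>j\<close>.\<close>

lemma W_diagonal:
  assumes g: "\<forall>i. \<bar>\<gamma> i\<bar> \<le> 1"
  shows "((\<lambda>j. of_real (\<gamma> j) * w t i j) has_sum ent (W \<gamma> (Complex c t)) i i) UNIV"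
proof -
  let ?R = "R (Complex c t)" and ?G = "weight_op D \<gamma>"
  note R = op_on_resolvent[OF line_resolvent, of t]
  note RA = op_on_compose[OF R op_on_A] and AR = op_on_compose[OF op_on_A R]
  have RAR: "ent (?R o\<^sub>L A o\<^sub>L ?R) i i = 0"
    unfolding A_def resolvent_commutator[OF H(1) line_resolvent op_on_position_op[where f=\<Lambda>, OF switch_abs]]
    using ent_position_op_left[where f=\<Lambda>, OF switch_abs, where A="?R" and D=D and i=i and j=i]
      ent_position_op_right[where f=\<Lambda>, OF switch_abs op_on_complex_linear[OF R], where D=D and i=i and j=i]
    by simp
  have "W \<gamma> (Complex c t) = (((?R o\<^sub>L A) o\<^sub>L (?G o\<^sub>L ?R)) - ((?R o\<^sub>L A o\<^sub>L ?R) o\<^sub>L ?G))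
      - ((?G o\<^sub>L (?R o\<^sub>L A o\<^sub>L ?R)) - ((?R o\<^sub>L ?G) o\<^sub>L (A o\<^sub>L ?R)))"
    unfolding W_def compose_simps(3,4) by (simp only: compose_assoc)
  moreover have "op_on D (?R o\<^sub>L A o\<^sub>L ?R)" using RA R by blast
  ultimately have "ent (W \<gamma> (Complex c t)) i i = ent ((?R o\<^sub>L A) o\<^sub>L (?G o\<^sub>L ?R)) i i + ent ((?R o\<^sub>L ?G) o\<^sub>L (A o\<^sub>L ?R)) i i"
    by (simp add: ent_weight_op[OF g] RAR)
  moreover have "((\<lambda>k. ent (?R o\<^sub>L A) i k * (of_real (\<gamma> k) * ent ?R k i)) has_sum ent ((?R o\<^sub>L A) o\<^sub>L (?G o\<^sub>L ?R)) i i) UNIV"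
    using has_sum_ent_compose[OF op_on_complex_linear[OF RA], of i "?G o\<^sub>L ?R" i] by (simp only: ent_weight_op(1)[OF g R])
  moreover have "((\<lambda>k. ent ?R i k * of_real (\<gamma> k) * ent (A o\<^sub>L ?R) k i) has_sum ent ((?R o\<^sub>L ?G) o\<^sub>L (A o\<^sub>L ?R)) i i) UNIV"
    using has_sum_ent_compose[OF op_on_complex_linear[OF op_on_compose[OF R op_on_weight_op[OF g]]], of i "A o\<^sub>L ?R" i]
    by (simp only: ent_weight_op(2)[OF g R])
  ultimately have "((\<lambda>k. ent (?R o\<^sub>L A) i k * (of_real (\<gamma> k) * ent ?R k i) + ent ?R i k * of_real (\<gamma> k) * ent (A o\<^sub>L ?R) k i)
      has_sum ent (W \<gamma> (Complex c t)) i i) UNIV"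
    by (simp only: has_sum_add)
  then show ?thesis
    by (simp add: w_def algebra_simps)
qed

text \<open>Summing over the first index composes the factors in the opposite order. The operator
  \<open>R R A + A R R\<close> obtained is the \<open>z\<close>-derivative of
  \<open>R A + A R\<close>, which makes its line integral vanish.\<close>

lemma w_column_sum:
  "((\<lambda>i. w t i j) has_sum ent ((R (Complex c t) o\<^sub>L (R (Complex c t) o\<^sub>L A)) + ((A o\<^sub>L R (Complex c t)) o\<^sub>L R (Complex c t))) j j) UNIV"
proof -
  let ?R = "R (Complex c t)"
  note R = op_on_resolvent[OF line_resolvent, of t]
  note AR = op_on_compose[OF op_on_A R]
  have "((\<lambda>i. ent ?R j i * ent (?R o\<^sub>L A) i j + ent (A o\<^sub>L ?R) j i * ent ?R i j)
     has_sum (ent (?R o\<^sub>L (?R o\<^sub>L A)) j j + ent ((A o\<^sub>L ?R) o\<^sub>L ?R) j j)) UNIV"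
    by (intro has_sum_add has_sum_ent_compose op_on_complex_linear[OF R] op_on_complex_linear[OF AR])
  then show ?thesis
    by (simp add: w_def mult.commute)
qed

lemma line_derivative:
  "((\<lambda>t. R (Complex c t)) has_vector_derivative scale_op \<i> (R (Complex c t) o\<^sub>L R (Complex c t))) (at t)"
proof -
  have "(R has_derivative (\<lambda>h. scale_op h (R (Complex c t) o\<^sub>L R (Complex c t)))) (at (Complex c t))"
    using op_derivative_resolvent[OF H(1) line_resolvent] unfolding op_derivative_def .
  moreover have "((\<lambda>t. Complex c t) has_vector_derivative \<i>) (at t)"
  proof -
    have "(\<lambda>t. Complex c t) = (\<lambda>t. of_real c + of_real t * \<i>)" by (auto simp: complex_eq_iff)
    then show ?thesis by (auto intro!: derivative_eq_intros simp: has_vector_derivative_def scaleR_conv_of_real)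
  qed
  ultimately show ?thesis
    using vector_derivative_diff_chain_within[of "\<lambda>t. Complex c t" \<i> t UNIV R, unfolded o_def] has_derivative_at_withinI by blast
qed

lemma line_continuous:
  "continuous_on UNIV (\<lambda>t. ent (R (Complex c t)) i j)" "continuous_on UNIV (\<lambda>t. ent (R (Complex c t) o\<^sub>L A) i j)"
  "continuous_on UNIV (\<lambda>t. ent (A o\<^sub>L R (Complex c t)) i j)"
proof -
  have R: "continuous_on UNIV (\<lambda>t. R (Complex c t))"
    using has_vector_derivative_continuous[OF line_derivative] by (simp add: continuous_on_eq_continuous_at)
  have RA: "continuous_on UNIV (\<lambda>t. R (Complex c t) o\<^sub>L A)" and AR: "continuous_on UNIV (\<lambda>t. A o\<^sub>L R (Complex c t))"
    by (intro bounded_bilinear.continuous_on[OF bounded_bilinear_blinfun_compose] R continuous_on_const)+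
  show "continuous_on UNIV (\<lambda>t. ent (R (Complex c t)) i j)" "continuous_on UNIV (\<lambda>t. ent (R (Complex c t) o\<^sub>L A) i j)"
    "continuous_on UNIV (\<lambda>t. ent (A o\<^sub>L R (Complex c t)) i j)"
    by (intro bounded_linear.continuous_on[OF bounded_linear_ent] R RA AR)+
qed

lemma w_continuous: "continuous_on UNIV (\<lambda>t. w t i j)"
  unfolding w_def by (intro continuous_intros line_continuous)

lemma W_line_continuous:
  assumes g: "\<forall>i. \<bar>\<gamma> i\<bar> \<le> 1" shows "continuous_on UNIV (\<lambda>t. ent (W \<gamma> (Complex c t)) i j)"
proof (rule continuous_on_compose2[OF holomorphic_on_imp_continuous_on[OF W_holomorphic[OF g]]])
  show "continuous_on UNIV (\<lambda>t. Complex c t)" unfolding Complex_eq by (intro continuous_intros)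
qed (use line_resolvent in auto)

end

section \<open>Uniform decay along the line and zero sums of the kernel\<close>

lemma site_exp_summable:
  assumes "\<alpha> > 0" "a1 > 0" "a2 > 0" "p \<in> bulk_lattice a1 a2"
  shows "(\<lambda>i :: plane \<times> 2. exp (- \<alpha> * norm1 (fst i - p))) summable_on sites (bulk_lattice a1 a2)"
proof (rule nonneg_bounded_partial_sums_imp_summable_on[where C="site_sum (bulk_lattice a1 a2) \<alpha>"])
  show "\<forall>\<^sub>F F in finite_subsets_at_top (sites (bulk_lattice a1 a2)).
      (\<Sum>i\<in>F. exp (- \<alpha> * norm1 (fst i - p))) \<le> site_sum (bulk_lattice a1 a2) \<alpha>"
    by (rule eventually_finite_subsets_at_top_weakI) (rule site_sum_bound[OF assms])
qed simp

abbreviation decay_weight :: "real \<Rightarrow> plane \<times> 2 \<Rightarrow> plane \<times> 2 \<Rightarrow> real" where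
  "decay_weight \<nu> i j \<equiv> exp (- \<nu> * (norm1 (fst i - fst j) + 1 * (\<bar>fst i $ 2\<bar> + \<bar>fst j $ 2\<bar>)))"

lemma decay_weight_commute: "decay_weight \<nu> i j = decay_weight \<nu> j i"
  by (simp add: norm1_commute[of "fst i"] add.commute)

lemma decay_weight_summable:
  assumes "\<nu> > 0" "a1 > 0" "a2 > 0" "j \<in> sites (bulk_lattice a1 a2)"
  shows "(\<lambda>i. decay_weight \<nu> i j) summable_on sites (bulk_lattice a1 a2)"
proof (rule summable_on_comparison_test)
  show "(\<lambda>i. exp (- \<nu> * norm1 (fst i - fst j))) summable_on sites (bulk_lattice a1 a2)"
    using assms by (intro site_exp_summable) auto
qed (use assms in auto)

context bulk_gap
begin

text \<open>Two resolvents occur in every term, each bringing a factor \<open>2 / r t\<close> with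
  \<open>r t = sqrt (g\<^sup>2 + t\<^sup>2)\<close>; together they give the Lorentzian. The
  concentration near the axis comes from \<open>A\<close> alone.\<close>

lemma decay_constants:
  "\<exists>\<nu> K g. \<nu> > 0 \<and> K \<ge> 0 \<and> g > 0 \<and>
    (\<forall>\<gamma> t. (\<forall>i. \<bar>\<gamma> i\<bar> \<le> 1) \<longrightarrow> decays D \<nu> 1 (K * (1 / (g\<^sup>2 + t\<^sup>2))) (W \<gamma> (Complex c t))) \<and>
    (\<forall>t. \<forall>i\<in>sites D. \<forall>j\<in>sites D. cmod (w t i j) \<le> K * (1 / (g\<^sup>2 + t\<^sup>2)) * decay_weight \<nu> i j) \<and>
    (\<forall>t. norm (R (Complex c t)) \<le> 1 / sqrt (g\<^sup>2 + t\<^sup>2))"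
proof -
  obtain g where g: "g > 0" "\<And>t. norm (R (Complex c t)) \<le> 1 / sqrt (g\<^sup>2 + t\<^sup>2)"
    using norm_resolvent_gap[OF H(1,2) c] by metis
  obtain \<mu> where mu: "\<mu> > 0" "\<And>z T r. inverse_on D (shifted D H z) T \<Longrightarrow> norm T \<le> 1 / r \<Longrightarrow> r \<ge> g \<Longrightarrow> decays D \<mu> 0 (2 / r) T"
    using combes_thomas[OF D H(1,3) lam g(1)] by blast
  obtain CA where CA: "CA \<ge> 0" "decays D (lam / 2) 1 CA A"
    using decays_switch_commutator[OF sw H(1,3) lam] unfolding A_def[symmetric] by blast
  define \<nu> where "\<nu> = min \<mu> (lam / 2)"
  have nu: "\<nu> > 0" "\<nu> \<le> \<mu>" "\<nu> \<le> lam / 2" using mu(1) lam(1) by (auto simp: \<nu>_def)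
  \<comment> \<open>The site sums of two successive compositions, which divide the rate by 16 in
    all. The constant \<open>K\<close> adds those needed for \<open>W\<close> and for
    \<open>w\<close>.\<close>
  define Z1 Z2 where "Z1 = site_sum D (\<nu> / 2)" and "Z2 = site_sum D (\<nu> / 4 / 2)"
  have Z: "Z1 \<ge> 0" "Z2 \<ge> 0" by (simp_all add: Z1_def Z2_def site_sum_nonneg)
  define K where "K = 16 * CA * Z1 * Z2 + 8 * CA * Z1"
  have K: "K \<ge> 0" using CA Z by (simp add: K_def)
  define r where "r t = sqrt (g\<^sup>2 + t\<^sup>2)" for t
  have r: "r t \<ge> g" "r t > 0" "r t * r t = g\<^sup>2 + t\<^sup>2" for t
  proof -
    have "sqrt (g\<^sup>2) \<le> sqrt (g\<^sup>2 + t\<^sup>2)" by (intro real_sqrt_le_mono) simp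
    then show "r t \<ge> g" using g(1) by (simp add: r_def)
    then show "r t > 0" using g(1) by linarith
    show "r t * r t = g\<^sup>2 + t\<^sup>2" by (simp add: r_def)
  qed
  have dR: "decays D \<nu> 0 (2 / r t) (R (Complex c t))" for t
    by (rule decays_weaken[OF mu(2)[OF resolvent_inverse[OF line_resolvent] g(2)[folded r_def] r(1)]])
       (use nu r(2)[of t] in auto)
  have dA: "decays D \<nu> 1 CA A"
    by (rule decays_weaken[OF CA(2)]) (use nu CA in auto)
  note opR = op_on_resolvent[OF line_resolvent]
  have dRA: "decays D (\<nu> / 4) 1 (2 / r t * CA * Z1) (R (Complex c t) o\<^sub>L A)" for t
    using decays_compose[OF dR[of t] opR[of t] dA op_on_A D nu(1)] r(2)[of t] CA by (simp add: Z1_def)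
  have dAR: "decays D (\<nu> / 4) 1 (2 / r t * CA * Z1) (A o\<^sub>L R (Complex c t))" for t
    using decays_compose[OF dA op_on_A dR[of t] opR[of t] D nu(1)] r(2)[of t] CA by (simp add: Z1_def mult_ac)
  have main: "decays D (\<nu> / 16) 1 (K * (1 / (g\<^sup>2 + t\<^sup>2))) (W \<gamma> (Complex c t))" if ga: "\<forall>i. \<bar>\<gamma> i\<bar> \<le> 1" for \<gamma> t
  proof -
    let ?G = "weight_op D \<gamma>" and ?R = "R (Complex c t)"
    have dR4: "decays D (\<nu> / 4) 0 (2 / r t) ?R"
      by (rule decays_weaken[OF dR]) (use nu r(2)[of t] in auto)
    have "decays D (\<nu> / 4) 0 (2 / r t) (?G o\<^sub>L ?R)" "decays D (\<nu> / 4) 0 (2 / r t) (?R o\<^sub>L ?G)"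
      unfolding weight_op_def
      using decays_mult_op[where g="site_weight D \<gamma>", OF dR4 site_weight_bound[OF ga] op_on_complex_linear[OF opR]] r(2)[of t]
      by auto
    from decays_diff[OF this] have dK: "decays D (\<nu> / 4) 0 (4 / r t) ((?G o\<^sub>L ?R) - (?R o\<^sub>L ?G))"
      by simp
    have opK: "op_on D ((?G o\<^sub>L ?R) - (?R o\<^sub>L ?G))"
      using opR op_on_weight_op[OF ga] by (intro op_on_diff op_on_compose)
    have c0: "0 \<le> 2 / r t * CA * Z1" "0 \<le> 4 / r t" "\<nu> / 4 > 0" using r(2)[of t] CA Z nu by auto
    have m: "max 1 0 = (1::real)" "max 0 1 = (1::real)" "\<nu> / 4 / 4 = \<nu> / 16" by auto
    have d1: "decays D (\<nu> / 4 / 4) (max 1 0) (2 / r t * CA * Z1 * (4 / r t) * site_sum D (\<nu> / 4 / 2)) ((?R o\<^sub>L A) o\<^sub>L ((?G o\<^sub>L ?R) - (?R o\<^sub>L ?G)))"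
      by (rule decays_compose[OF dRA op_on_compose[OF opR op_on_A] dK opK D c0(3,1,2)]) auto
    have d2: "decays D (\<nu> / 4 / 4) (max 0 1) (4 / r t * (2 / r t * CA * Z1) * site_sum D (\<nu> / 4 / 2)) (((?G o\<^sub>L ?R) - (?R o\<^sub>L ?G)) o\<^sub>L (A o\<^sub>L ?R))"
      by (rule decays_compose[OF dK opK dAR op_on_compose[OF op_on_A opR] D c0(3,2,1)]) auto
    have "decays D (\<nu> / 16) 1 (2 / r t * CA * Z1 * (4 / r t) * Z2 + 4 / r t * (2 / r t * CA * Z1) * Z2) (W \<gamma> (Complex c t))"
      unfolding W_def Z2_def by (rule decays_diff[OF d1[unfolded m] d2[unfolded m]])
    moreover have "2 / r t * CA * Z1 * (4 / r t) * Z2 + 4 / r t * (2 / r t * CA * Z1) * Z2 = 16 * CA * Z1 * Z2 * (1 / (r t * r t))"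
      by simp
    ultimately have d3: "decays D (\<nu> / 16) 1 (16 * CA * Z1 * Z2 * (1 / (g\<^sup>2 + t\<^sup>2))) (W \<gamma> (Complex c t))"
      by (simp only: r(3))
    have l: "16 * CA * Z1 * Z2 * (1 / (g\<^sup>2 + t\<^sup>2)) \<le> K * (1 / (g\<^sup>2 + t\<^sup>2))"
      using CA Z by (intro mult_right_mono) (auto simp: K_def)
    show ?thesis
      by (rule decays_weaken[OF d3 _ l]) (use nu K in auto)
  qed
  have mainw: "cmod (w t i j) \<le> K * (1 / (g\<^sup>2 + t\<^sup>2)) * decay_weight (\<nu> / 16) i j" if ij: "i \<in> sites D" "j \<in> sites D" for t i j
  proof -
    let ?E = "decay_weight (\<nu> / 4) i j"
    have E: "cmod (ent (R (Complex c t) o\<^sub>L A) i j) \<le> 2 / r t * CA * Z1 * ?E"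
      "cmod (ent (A o\<^sub>L R (Complex c t)) j i) \<le> 2 / r t * CA * Z1 * ?E"
      using dRA[unfolded decays_def, rule_format, OF ij] dAR[unfolded decays_def, rule_format, OF ij(2,1)]
      by (simp_all add: norm1_commute add.commute)
    have Rb: "cmod (ent (R (Complex c t)) i j) \<le> 2 / r t" for i j
      by (rule order_trans[OF cmod_ent_le order_trans[OF g(2)[folded r_def]]]) (use r(2)[of t] in \<open>simp add: divide_right_mono\<close>)
    have "cmod (w t i j) \<le> (2 / r t * CA * Z1 * ?E) * (2 / r t) + (2 / r t) * (2 / r t * CA * Z1 * ?E)"
      unfolding w_def using r(2)[of t] CA Z
      by (intro order_trans[OF norm_triangle_ineq] add_mono) (auto simp only: norm_mult intro!: mult_mono E Rb, auto)
    also have "\<dots> = 8 * CA * Z1 * (1 / (r t * r t)) * ?E" by simp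
    also have "\<dots> \<le> K * (1 / (r t * r t)) * decay_weight (\<nu> / 16) i j"
    proof (intro mult_mono)
      show "8 * CA * Z1 \<le> K" using CA Z by (simp add: K_def)
      have "\<nu> / 16 * (norm1 (fst i - fst j) + 1 * (\<bar>fst i $ 2\<bar> + \<bar>fst j $ 2\<bar>)) \<le> \<nu> / 4 * (norm1 (fst i - fst j) + 1 * (\<bar>fst i $ 2\<bar> + \<bar>fst j $ 2\<bar>))"
        using nu norm1_nonneg[of "fst i - fst j"] by (intro mult_right_mono) auto
      then show "?E \<le> decay_weight (\<nu> / 16) i j" by simp
    qed (use K r(2)[of t] CA Z in auto)
    finally show ?thesis by (simp only: r(3))
  qed
  show ?thesis
    by (rule exI[of _ "\<nu> / 16"], rule exI[of _ K], rule exI[of _ g])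
       (use nu K g main mainw in auto)
qed

text \<open>By \<open>integral_entry\<close> this will be the entry of \<open>spin_Sigma\<close> for
  the weight of \<open>\<Lambda>1 S\<close>, in a form free of the density function.\<close>

definition line_entry :: "(plane \<times> 2 \<Rightarrow> real) \<Rightarrow> plane \<times> 2 \<Rightarrow> plane \<times> 2 \<Rightarrow> complex" where
  "line_entry \<gamma> i j = - 1 / 2 * (LINT t|lborel. ent (W \<gamma> (Complex c t)) i j)"

text \<open>The interface between the operator estimates and the summation over columns. All parts
  come from integrating over the line with the Lorentzian as majorant; this also justifies
  exchanging that integral with the sums over sites.\<close>

lemma kernel_properties:
  "\<exists>\<nu> K. \<nu> > 0 \<and> K \<ge> 0 \<and>
    (\<forall>i\<in>sites D. \<forall>j\<in>sites D. cmod (kern i j) \<le> K * decay_weight \<nu> i j) \<and>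
    (\<forall>\<gamma>. (\<forall>i. \<bar>\<gamma> i\<bar> \<le> 1) \<longrightarrow> (\<forall>i\<in>sites D. \<forall>j\<in>sites D.
       cmod (line_entry \<gamma> i j) \<le> K * decay_weight \<nu> i j \<and>
       (\<lambda>n. - 1 / 2 * integral {- real n..real n} (\<lambda>t. ent (W \<gamma> (Complex c t)) i j)) \<longlonglongrightarrow> line_entry \<gamma> i j)) \<and>
    (\<forall>\<gamma>. (\<forall>i. \<bar>\<gamma> i\<bar> \<le> 1) \<longrightarrow> (\<forall>i\<in>sites D. ((\<lambda>j. of_real (\<gamma> j) * kern i j) has_sum line_entry \<gamma> i i) (sites D))) \<and>
    (\<forall>j\<in>sites D. ((\<lambda>i. kern i j) has_sum 0) (sites D))"
proof -
  obtain \<nu> K g where nu: "\<nu> > 0" and K: "K \<ge> 0" and g: "g > 0"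
    and dW: "\<forall>\<gamma> t. (\<forall>i. \<bar>\<gamma> i\<bar> \<le> 1) \<longrightarrow> decays D \<nu> 1 (K * (1 / (g\<^sup>2 + t\<^sup>2))) (W \<gamma> (Complex c t))"
    and dw: "\<forall>t. \<forall>i\<in>sites D. \<forall>j\<in>sites D. cmod (w t i j) \<le> K * (1 / (g\<^sup>2 + t\<^sup>2)) * decay_weight \<nu> i j"
    and nR: "\<forall>t. norm (R (Complex c t)) \<le> 1 / sqrt (g\<^sup>2 + t\<^sup>2)"
    using decay_constants by (elim exE conjE)
  define b where "b t = 1 / (g\<^sup>2 + t\<^sup>2)" for t
  have pos: "g\<^sup>2 + t\<^sup>2 > 0" for t using g by (simp add: add_pos_nonneg)
  have b: "integrable lborel b" "0 \<le> b t" "b t \<le> 1 / g\<^sup>2" for t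
  proof -
    show "integrable lborel b" unfolding b_def[abs_def] by (rule integrable_lorentzian[OF g])
    show "0 \<le> b t" using pos[of t] by (simp add: b_def)
    show "b t \<le> 1 / g\<^sup>2" unfolding b_def using g pos[of t] by (intro divide_left_mono) auto
  qed
  define B where "B = (LINT t|lborel. b t)"
  have B: "B \<ge> 0" unfolding B_def by (intro integral_nonneg_AE) (use b in auto)
  have bound: "cmod (- 1 / 2 * (LINT t|lborel. f t)) \<le> (K * B) * E" and int: "integrable lborel f"
    if f: "continuous_on UNIV f" "\<And>t. cmod (f t) \<le> K * b t * E" for f :: "real \<Rightarrow> complex" and E
  proof -
    have f2: "cmod (f t) \<le> (K * E) * b t" for t using f(2)[of t] by (simp add: mult_ac)
    show fi: "integrable lborel f"
      by (rule integrable_dominated[OF f(1) f2 b(1)])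
    have "cmod (LINT t|lborel. f t) \<le> (LINT t|lborel. (K * E) * b t)"
      by (rule Bochner_Integration.integral_norm_bound_integral[OF fi]) (use b f2 in auto)
    also have "\<dots> = (K * B) * E" by (simp add: B_def mult_ac)
    finally have 1: "cmod (LINT t|lborel. f t) \<le> (K * B) * E" .
    have "cmod (- 1 / 2 * (LINT t|lborel. f t)) = 1 / 2 * cmod (LINT t|lborel. f t)"
      unfolding norm_mult by simp
    also have "\<dots> \<le> cmod (LINT t|lborel. f t)" by simp
    finally show "cmod (- 1 / 2 * (LINT t|lborel. f t)) \<le> (K * B) * E" using 1 by linarith
  qed
  have wb: "cmod (w t i j) \<le> K * b t * decay_weight \<nu> i j" if "i \<in> sites D" "j \<in> sites D" for t i j
    using dw that unfolding b_def by blast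
  have Wb: "cmod (ent (W \<gamma> (Complex c t)) i j) \<le> K * b t * decay_weight \<nu> i j"
    if "\<forall>i. \<bar>\<gamma> i\<bar> \<le> 1" "i \<in> sites D" "j \<in> sites D" for \<gamma> t i j
  proof -
    have "decays D \<nu> 1 (K * (1 / (g\<^sup>2 + t\<^sup>2))) (W \<gamma> (Complex c t))" using dW that(1) by blast
    then show ?thesis using that(2,3) unfolding decays_def b_def by blast
  qed
  have p1: "cmod (kern i j) \<le> (K * B) * decay_weight \<nu> i j" if "i \<in> sites D" "j \<in> sites D" for i j
    unfolding kern_def by (rule bound[OF w_continuous wb[OF that]])
  have p2: "cmod (line_entry \<gamma> i j) \<le> (K * B) * decay_weight \<nu> i j"
    "(\<lambda>n. - 1 / 2 * integral {- real n..real n} (\<lambda>t. ent (W \<gamma> (Complex c t)) i j)) \<longlonglongrightarrow> line_entry \<gamma> i j"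
    if "\<forall>i. \<bar>\<gamma> i\<bar> \<le> 1" "i \<in> sites D" "j \<in> sites D" for \<gamma> i j
  proof -
    show "cmod (line_entry \<gamma> i j) \<le> (K * B) * decay_weight \<nu> i j"
      unfolding line_entry_def by (rule bound[OF W_line_continuous[OF that(1)] Wb[OF that]])
    have "integrable lborel (\<lambda>t. ent (W \<gamma> (Complex c t)) i j)"
      by (rule int[OF W_line_continuous[OF that(1)] Wb[OF that]])
    from tendsto_symmetric_integral[OF this]
    show "(\<lambda>n. - 1 / 2 * integral {- real n..real n} (\<lambda>t. ent (W \<gamma> (Complex c t)) i j)) \<longlonglongrightarrow> line_entry \<gamma> i j"
      unfolding line_entry_def by (intro tendsto_intros)
  qed
  have p3: "((\<lambda>j. of_real (\<gamma> j) * kern i j) has_sum line_entry \<gamma> i i) (sites D)"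
    if ga: "\<forall>i. \<bar>\<gamma> i\<bar> \<le> 1" and i: "i \<in> sites D" for \<gamma> i
  proof -
    have "((\<lambda>j. LINT t|lborel. of_real (\<gamma> j) * w t i j) has_sum (LINT t|lborel. (\<Sum>\<^sub>\<infinity>j\<in>sites D. of_real (\<gamma> j) * w t i j))) (sites D)"
    proof (rule line_integral_has_sum[where m="\<lambda>j. K * decay_weight \<nu> j i" and b=b])
      show "continuous_on UNIV (\<lambda>t. of_real (\<gamma> j) * w t i j)" for j
        by (intro continuous_intros w_continuous)
      show "cmod (of_real (\<gamma> j) * w t i j) \<le> K * decay_weight \<nu> j i * b t" if "j \<in> sites D" for j t
      proof -
        have "cmod (of_real (\<gamma> j) * w t i j) \<le> 1 * cmod (w t i j)"
          unfolding norm_mult using ga[rule_format, of j] by (intro mult_right_mono) auto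
        also have "\<dots> \<le> K * b t * decay_weight \<nu> i j" using wb[OF i that] by simp
        finally show ?thesis unfolding decay_weight_commute[of \<nu> i j] by (simp only: mult_ac)
      qed
      show "(\<lambda>j. K * decay_weight \<nu> j i) summable_on sites D"
        using decay_weight_summable[OF nu D(2,3)] i unfolding D(1) by (intro summable_on_cmult_right) auto
    qed (use b K in auto)
    moreover have "(\<Sum>\<^sub>\<infinity>j\<in>sites D. of_real (\<gamma> j) * w t i j) = ent (W \<gamma> (Complex c t)) i i" for t
    proof (rule infsumI)
      have z: "w t i j = 0" if "j \<notin> sites D" for j
        unfolding w_def using op_on_ent_zero[OF op_on_resolvent[OF line_resolvent], of j i] op_on_ent_zero[OF op_on_resolvent[OF line_resolvent], of i j]
          that by simp
      show "((\<lambda>j. of_real (\<gamma> j) * w t i j) has_sum ent (W \<gamma> (Complex c t)) i i) (sites D)"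
        by (rule has_sum_cong_neutral[THEN iffD1, OF _ _ _ W_diagonal[OF ga]]) (auto simp: z)
    qed
    ultimately have "((\<lambda>j. LINT t|lborel. of_real (\<gamma> j) * w t i j) has_sum (LINT t|lborel. ent (W \<gamma> (Complex c t)) i i)) (sites D)"
      by simp
    from has_sum_cmult_right[OF this, of "- 1 / 2"]
    show ?thesis
      unfolding line_entry_def kern_def by (simp add: mult_ac)
  qed
  have p4: "((\<lambda>i. kern i j) has_sum 0) (sites D)" if j: "j \<in> sites D" for j
  proof -
    let ?f = "\<lambda>t. ent ((R (Complex c t) o\<^sub>L (R (Complex c t) o\<^sub>L A)) + ((A o\<^sub>L R (Complex c t)) o\<^sub>L R (Complex c t))) j j"
    have "((\<lambda>i. LINT t|lborel. w t i j) has_sum (LINT t|lborel. (\<Sum>\<^sub>\<infinity>i\<in>sites D. w t i j))) (sites D)"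
    proof (rule line_integral_has_sum[where m="\<lambda>i. K * decay_weight \<nu> i j" and b=b])
      show "continuous_on UNIV (\<lambda>t. w t i j)" for i by (rule w_continuous)
      show "cmod (w t i j) \<le> K * decay_weight \<nu> i j * b t" if "i \<in> sites D" for i t
        using wb[OF that j, of t] by (simp only: mult_ac)
      show "(\<lambda>i. K * decay_weight \<nu> i j) summable_on sites D"
        using decay_weight_summable[OF nu D(2,3)] j unfolding D(1) by (intro summable_on_cmult_right) auto
    qed (use b K in auto)
    moreover have "(\<Sum>\<^sub>\<infinity>i\<in>sites D. w t i j) = ?f t" for t
    proof (rule infsumI)
      have z: "w t i j = 0" if "i \<notin> sites D" for i
        unfolding w_def using op_on_ent_zero[OF op_on_resolvent[OF line_resolvent], of j i] op_on_ent_zero[OF op_on_resolvent[OF line_resolvent], of i j]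
          that by simp
      show "((\<lambda>i. w t i j) has_sum ?f t) (sites D)"
        by (rule has_sum_cong_neutral[THEN iffD1, OF _ _ _ w_column_sum]) (auto simp: z)
    qed
    moreover have "(LINT t|lborel. ?f t) = 0"
    proof (rule line_integral_derivative_zero)
      \<comment> \<open>Along the line the derivative in \<open>t\<close> is \<open>\<i>\<close>
        times that in \<open>z\<close>, hence the factor \<open>- \<i>\<close> of this primitive. It
        tends to 0 at both ends with the norm of the resolvent.\<close>
      let ?G = "\<lambda>t. - \<i> * ent ((R (Complex c t) o\<^sub>L A) + (A o\<^sub>L R (Complex c t))) j j"
      show "(?G has_vector_derivative ?f t) (at t)" for t
      proof -
        let ?R = "R (Complex c t)"
        note opR = op_on_complex_linear[OF op_on_resolvent[OF line_resolvent]]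
        have bl: "bounded_linear (\<lambda>T. - \<i> * ent ((T o\<^sub>L A) + (A o\<^sub>L T)) j j)"
          by (intro bounded_linear_compose[OF bounded_linear_mult_right] bounded_linear_compose[OF bounded_linear_ent]
              bounded_linear_add bounded_bilinear.bounded_linear_left[OF bounded_bilinear_blinfun_compose]
              bounded_bilinear.bounded_linear_right[OF bounded_bilinear_blinfun_compose])
        from bounded_linear.has_vector_derivative[OF bl line_derivative]
        have "(?G has_vector_derivative - \<i> * ent ((scale_op \<i> (?R o\<^sub>L ?R) o\<^sub>L A) + (A o\<^sub>L scale_op \<i> (?R o\<^sub>L ?R))) j j) (at t)" .
        moreover have "- \<i> * ent ((scale_op \<i> (?R o\<^sub>L ?R) o\<^sub>L A) + (A o\<^sub>L scale_op \<i> (?R o\<^sub>L ?R))) j j = ?f t"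
          by (simp add: scale_op_compose op_on_complex_linear[OF op_on_A] compose_assoc distrib_left[symmetric])
        ultimately show ?thesis by simp
      qed
      have Gb: "cmod (?G t) \<le> 2 * norm A / sqrt (g\<^sup>2 + t\<^sup>2)" for t
      proof -
        have "cmod (?G t) = cmod (ent (R (Complex c t) o\<^sub>L A) j j + ent (A o\<^sub>L R (Complex c t)) j j)"
          by (simp add: norm_mult)
        also have "\<dots> \<le> norm (R (Complex c t)) * norm A + norm A * norm (R (Complex c t))"
          by (intro order_trans[OF norm_triangle_ineq] add_mono order_trans[OF cmod_ent_le norm_blinfun_compose])
        also have "\<dots> = 2 * norm A * norm (R (Complex c t))" by simp
        also have "\<dots> \<le> 2 * norm A * (1 / sqrt (g\<^sup>2 + t\<^sup>2))"
          using nR by (intro mult_left_mono) auto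
        finally show ?thesis by simp
      qed
      have lim1: "((\<lambda>t. 2 * a / sqrt (g\<^sup>2 + t\<^sup>2)) \<longlongrightarrow> 0) at_top" for a :: real
        using g by real_asymp
      have lim2: "((\<lambda>t. 2 * a / sqrt (g\<^sup>2 + t\<^sup>2)) \<longlongrightarrow> 0) at_bot" for a :: real
        using g by real_asymp
      show "(?G \<longlongrightarrow> 0) at_top"
        by (rule Lim_null_comparison[OF always_eventually[OF allI[OF Gb]] lim1])
      show "(?G \<longlongrightarrow> 0) at_bot"
        by (rule Lim_null_comparison[OF always_eventually[OF allI[OF Gb]] lim2])
      have Rc: "continuous_on UNIV (\<lambda>t. R (Complex c t))"
        using has_vector_derivative_continuous[OF line_derivative] by (simp add: continuous_on_eq_continuous_at)
      have fc: "continuous_on UNIV ?f"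
        by (intro bounded_linear.continuous_on[OF bounded_linear_ent] continuous_on_add
            bounded_bilinear.continuous_on[OF bounded_bilinear_blinfun_compose] Rc continuous_on_const)
      have fb: "cmod (?f t) \<le> (2 * norm A) * b t" for t
      proof -
        have "cmod (?f t) \<le> norm (R (Complex c t)) * (norm (R (Complex c t)) * norm A) + (norm A * norm (R (Complex c t))) * norm (R (Complex c t))"
          unfolding ent_simps
          by (intro order_trans[OF norm_triangle_ineq] add_mono order_trans[OF cmod_ent_le]
              order_trans[OF norm_blinfun_compose mult_left_mono[OF norm_blinfun_compose]]
              order_trans[OF norm_blinfun_compose mult_right_mono[OF norm_blinfun_compose]]) auto
        also have "\<dots> = 2 * norm A * (norm (R (Complex c t)))\<^sup>2" by (simp add: power2_eq_square)
        also have "\<dots> \<le> 2 * norm A * (1 / sqrt (g\<^sup>2 + t\<^sup>2))\<^sup>2"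
          using nR by (intro mult_left_mono power_mono) auto
        also have "\<dots> = (2 * norm A) * b t"
          using pos[of t] by (simp add: b_def power_divide)
        finally show ?thesis .
      qed
      show "integrable lborel ?f"
        by (rule integrable_dominated[OF fc fb b(1)])
    qed
    ultimately have "((\<lambda>i. LINT t|lborel. w t i j) has_sum 0) (sites D)"
      by (simp only:)
    from has_sum_cmult_right[OF this, of "- 1 / 2"]
    show ?thesis unfolding kern_def by simp
  qed
  show ?thesis
    by (rule exI[of _ \<nu>], rule exI[of _ "K * B"]) (use nu K B p1 p2 p3 p4 in auto)
qed

end

section \<open>Translations\<close>

lemma reindex_operator:
  fixes \<pi> :: "'i \<Rightarrow> 'i"
  assumes "inj \<pi>"
  obtains U where "complex_linear U" "\<And>v i. ell2_fun (U v) i = ell2_fun v (\<pi> i)"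
proof -
  define T where "T = (\<lambda>v. Abs_ell2 (\<lambda>i. ell2_fun v (\<pi> i)))"
  have bd: "L2_set (\<lambda>i. cmod (ell2_fun v (\<pi> i))) F \<le> norm v" if F: "finite F" for v F
  proof -
    have "L2_set (\<lambda>i. cmod (ell2_fun v (\<pi> i))) F = L2_set (\<lambda>i. cmod (ell2_fun v i)) (\<pi> ` F)"
      unfolding L2_set_def using assms by (simp add: sum.reindex inj_on_subset)
    also have "\<dots> \<le> norm v" using F by (intro L2_set_le_norm_ell2) simp
    finally show ?thesis .
  qed
  have T: "ell2_fun (T v) i = ell2_fun v (\<pi> i)" for v i
    unfolding T_def by (subst Abs_ell2_inverse) (use square_summable_bound(1)[OF bd] in auto)
  have "bounded_linear T"
  proof (rule bounded_linear_intro[where K=1])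
    show "T (x + y) = T x + T y" "T (r *\<^sub>R x) = r *\<^sub>R T x" for x y r
      by (rule ell2_eqI; simp add: T)+
    show "norm (T x) \<le> norm x * 1" for x
      using square_summable_bound(2)[OF bd, of x] by (simp add: norm_ell2_def T)
  qed
  then have app: "blinfun_apply (Blinfun T) = T"
    by (rule bounded_linear_Blinfun_apply)
  show thesis
  proof (rule that[of "Blinfun T"])
    show "complex_linear (Blinfun T)"
      unfolding complex_linear_def app by (auto intro!: ell2_eqI simp: T)
  qed (simp add: app T)
qed

context bulk_gap
begin

definition shift :: "plane \<Rightarrow> plane \<times> 2 \<Rightarrow> plane \<times> 2" where
  "shift n i = (fst i + n, snd i)"

lemma shift_sites: "n \<in> D \<Longrightarrow> shift n i \<in> sites D \<longleftrightarrow> i \<in> sites D"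
  using lattice_add[of "fst i" a1 a2 n] lattice_diff[of "fst i + n" a1 a2 n] by (auto simp: shift_def D mem_Times_iff)

lemma ent_H_shift:
  assumes n: "n \<in> D" shows "ent H (shift n i) (shift n j) = ent H i j"
proof (cases "i \<in> sites D \<and> j \<in> sites D")
  case True
  then have "op_kernel H (fst i + n) (fst j + n) = op_kernel H (fst i) (fst j)"
    using transl n unfolding translation_invariant_def by (auto simp: mem_Times_iff)
  then have "op_kernel H (fst i + n) (fst j + n) $ snd i $ snd j = op_kernel H (fst i) (fst j) $ snd i $ snd j"
    by simp
  then show ?thesis by (simp add: op_kernel_def ent_def shift_def)
next
  case False
  then have "ent H i j = 0" "ent H (shift n i) (shift n j) = 0"
    using op_on_ent_zero[OF H(1)] shift_sites[OF n] by blast+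
  then show ?thesis by simp
qed

text \<open>The resolvent conjugated by the translation inverts the conjugate of
  \<open>H - z\<close>, which is \<open>H - z\<close> again; inverses on \<open>H_D\<close> are
  unique.\<close>

lemma ent_resolvent_shift:
  assumes n: "n \<in> D" and z: "z \<notin> spectrum D H"
  shows "ent (R z) (shift n i) (shift n j) = ent (R z) i j"
proof -
  have inv: "shift n (shift (- n) i) = i" "shift (- n) (shift n i) = i" for i
    by (simp_all add: shift_def)
  then have inj: "inj (shift n)" "inj (shift (- n))" by (metis injI)+
  obtain U where U: "complex_linear U" "\<And>v i. ell2_fun (U v) i = ell2_fun v (shift n i)"
    using reindex_operator[OF inj(1)] by blast
  obtain V where V: "complex_linear V" "\<And>v i. ell2_fun (V v) i = ell2_fun v (shift (- n) i)"
    using reindex_operator[OF inj(2)] by blast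
  have VU: "V o\<^sub>L U = id_blinfun"
    by (rule blinfun_eqI, rule ell2_eqI) (simp add: U V inv)
  have Vk: "V (ket j) = ket (shift n j)" for j
    by (rule ell2_eqI) (auto simp: V inv)
  have eU: "ent (U o\<^sub>L T o\<^sub>L V) i j = ent T (shift n i) (shift n j)" for T i j
    by (simp add: ent_def U Vk)
  define R' where "R' = U o\<^sub>L R z o\<^sub>L V"
  note opR = op_on_resolvent[OF z]
  have opR': "op_on D R'"
    unfolding op_on_iff R'_def eU
    using U V op_on_complex_linear[OF opR] op_on_ent_zero[OF opR] shift_sites[OF n] by blast
  have conj: "U o\<^sub>L shifted D H z o\<^sub>L V = shifted D H z"
  proof (rule complex_linear_eqI)
    show "complex_linear (U o\<^sub>L shifted D H z o\<^sub>L V)" "complex_linear (shifted D H z)"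
      using U V op_on_complex_linear[OF op_on_shifted[OF H(1)]] by blast+
    show "ent (U o\<^sub>L shifted D H z o\<^sub>L V) i j = ent (shifted D H z) i j" for i j
      unfolding eU using ent_H_shift[OF n, of i j] shift_sites[OF n] inj(1) by (simp add: ent_id_on inj_eq)
  qed
  have idc: "U o\<^sub>L id_on D o\<^sub>L V = id_on D"
  proof (rule complex_linear_eqI)
    show "complex_linear (U o\<^sub>L id_on D o\<^sub>L V)" "complex_linear (id_on D)"
      using U V by blast+
    show "ent (U o\<^sub>L id_on D o\<^sub>L V) i j = ent (id_on D) i j" for i j
      unfolding eU using shift_sites[OF n] inj(1) by (simp add: ent_id_on inj_eq)
  qed
  have i: "shifted D H z o\<^sub>L R z = id_on D" "R z o\<^sub>L shifted D H z = id_on D"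
    using resolvent_inverse[OF z] by (auto simp: inverse_on_def)
  have comp: "(U o\<^sub>L S o\<^sub>L V) o\<^sub>L (U o\<^sub>L T o\<^sub>L V) = U o\<^sub>L (S o\<^sub>L T) o\<^sub>L V" for S T
  proof -
    have "(U o\<^sub>L S o\<^sub>L V) o\<^sub>L (U o\<^sub>L T o\<^sub>L V) = (U o\<^sub>L S) o\<^sub>L ((V o\<^sub>L U) o\<^sub>L (T o\<^sub>L V))"
      by (simp only: compose_assoc)
    then show ?thesis unfolding VU by (simp only: compose_id compose_assoc)
  qed
  have "(U o\<^sub>L shifted D H z o\<^sub>L V) o\<^sub>L R' = id_on D" "R' o\<^sub>L (U o\<^sub>L shifted D H z o\<^sub>L V) = id_on D"
    unfolding R'_def comp i idc by (rule refl)+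
  then have "inverse_on D (shifted D H z) R'"
    unfolding conj inverse_on_def using opR' by blast
  then have "R z = R'" by (rule resolvent_eqI)
  then show ?thesis using eU[of "R z" i j] by (simp add: R'_def)
qed

text \<open>Horizontal translations leave \<open>\<Lambda>\<close>, and with it the entries of
  \<open>A\<close>, unchanged. A vertical component would move the switch, whence the condition on
  \<open>n $ 2\<close>.\<close>

lemma kern_shift:
  assumes n: "n \<in> D" "n $ 2 = 0"
  shows "kern (shift n i) (shift n j) = kern i j"
proof -
  have L: "\<Lambda> (fst (shift n i)) = \<Lambda> (fst i)" for i
  proof -
    have "fst (shift n i) $ 2 = fst i $ 2" using n(2) by (simp add: shift_def)
    then show ?thesis using sw unfolding switch_function_def by blast
  qed
  have Aent: "ent A (shift n i) (shift n j) = ent A i j" for i j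
    unfolding A_def ent_commutator_position_op[where f=\<Lambda>, OF switch_abs H(1)] L ent_H_shift[OF n(1)] by (rule refl)
  have bij: "bij (shift n)"
    by (rule o_bij[of "shift (- n)"]) (auto simp: shift_def)
  have comp: "ent (S o\<^sub>L T) (shift n i) (shift n j) = ent (S o\<^sub>L T) i j"
    if S: "complex_linear S" and e: "\<And>i j. ent S (shift n i) (shift n j) = ent S i j" "\<And>i j. ent T (shift n i) (shift n j) = ent T i j" for S T i j
  proof -
    have "((\<lambda>k. ent S (shift n i) (shift n k) * ent T (shift n k) (shift n j)) has_sum ent (S o\<^sub>L T) (shift n i) (shift n j)) UNIV"
      using has_sum_reindex_bij_betw[OF bij, of "\<lambda>k. ent S (shift n i) k * ent T k (shift n j)"]
        has_sum_ent_compose[OF S, of "shift n i" T "shift n j"] by simp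
    then show ?thesis
      unfolding e using has_sum_ent_compose[OF S, of i T j] has_sum_unique by blast
  qed
  note Rs = ent_resolvent_shift[OF n(1) line_resolvent]
  have "w t (shift n i) (shift n j) = w t i j" for t
    unfolding w_def comp[OF op_on_complex_linear[OF op_on_resolvent[OF line_resolvent]] Rs Aent]
      comp[OF op_on_complex_linear[OF op_on_A] Aent Rs] Rs by (rule refl)
  then show ?thesis by (simp add: kern_def)
qed

end

section \<open>Summation over columns\<close>

text \<open>With \<open>F\<close> empty this is the plain comparison bound for the whole sum, the
  form in which it is often applied below.\<close>

lemma infsum_tail_bound:
  fixes f :: "'a \<Rightarrow> complex"
  assumes f: "\<And>x. x \<in> A \<Longrightarrow> cmod (f x) \<le> h x" and h: "h summable_on A" and F: "finite F" "F \<subseteq> A"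
  shows "cmod (infsum f A - sum f F) \<le> infsum h A - sum h F" and "f summable_on A"
proof -
  have ab: "(\<lambda>a. norm (f a)) summable_on A"
    by (rule summable_on_comparison_test[OF h]) (use f in auto)
  show fs: "f summable_on A" using ab by (rule abs_summable_summable)
  have "infsum f A - sum f F = infsum f (A - F)"
    using infsum_Diff[OF fs _ F(2)] F by simp
  also have "cmod \<dots> \<le> (\<Sum>\<^sub>\<infinity>a\<in>A - F. norm (f a))"
    by (rule norm_infsum_bound) (rule summable_on_subset_banach[OF ab], auto)
  also have "\<dots> \<le> infsum h (A - F)"
    by (rule infsum_mono) (use f in \<open>auto intro: summable_on_subset_banach[OF ab] summable_on_subset_banach[OF h]\<close>)
  also have "\<dots> = infsum h A - sum h F"
    using infsum_Diff[OF h _ F(2)] F by simp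
  finally show "cmod (infsum f A - sum f F) \<le> infsum h A - sum h F" .
qed

lemma dominated_convergence_infsum:
  fixes f :: "nat \<Rightarrow> 'a \<Rightarrow> complex"
  assumes lim: "\<And>x. x \<in> A \<Longrightarrow> (\<lambda>M. f M x) \<longlonglongrightarrow> g x"
    and bd: "\<And>M x. x \<in> A \<Longrightarrow> cmod (f M x) \<le> h x" and h: "h summable_on A"
  shows "(\<lambda>M. infsum (f M) A) \<longlonglongrightarrow> infsum g A"
proof (rule LIMSEQ_I)
  fix e :: real assume e: "e > 0"
  have gb: "cmod (g x) \<le> h x" if "x \<in> A" for x
    by (rule tendsto_upperbound[OF tendsto_norm[OF lim[OF that]]]) (use bd that in \<open>auto intro!: always_eventually\<close>)
  have "(sum h \<longlongrightarrow> infsum h A) (finite_subsets_at_top A)"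
    using has_sum_infsum[OF h] by (simp add: has_sum_def)
  then have "\<forall>\<^sub>F F in finite_subsets_at_top A. dist (sum h F) (infsum h A) < e / 3"
    using e by (intro tendstoD) auto
  then obtain F where F: "finite F" "F \<subseteq> A" "dist (sum h F) (infsum h A) < e / 3"
    unfolding eventually_finite_subsets_at_top by blast
  then have t: "infsum h A - sum h F < e / 3" unfolding dist_real_def by linarith
  have "(\<lambda>M. sum (f M) F) \<longlonglongrightarrow> sum g F"
    by (intro tendsto_sum lim) (use F in auto)
  then obtain M0 where M0: "\<forall>M\<ge>M0. cmod (sum (f M) F - sum g F) < e / 3"
    using LIMSEQ_D[of _ _ "e / 3"] e by (metis zero_less_divide_iff zero_less_numeral)
  have "cmod (infsum (f M) A - infsum g A) < e" if "M \<ge> M0" for M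
  proof -
    have 1: "cmod (infsum (f M) A - sum (f M) F) < e / 3"
      by (rule le_less_trans[OF infsum_tail_bound(1)[OF bd h F(1,2)] t])
    have 2: "cmod (infsum g A - sum g F) < e / 3"
      by (rule le_less_trans[OF infsum_tail_bound(1)[OF gb h F(1,2)] t])
    have 3: "cmod (sum (f M) F - sum g F) < e / 3" using M0 that by blast
    have "infsum (f M) A - infsum g A = (infsum (f M) A - sum (f M) F) + (sum (f M) F - sum g F) - (infsum g A - sum g F)"
      by simp
    then have "cmod (infsum (f M) A - infsum g A) \<le> cmod (infsum (f M) A - sum (f M) F) + cmod (sum (f M) F - sum g F) + cmod (infsum g A - sum g F)"
      by (simp only:) (rule order_trans[OF norm_triangle_ineq4 add_right_mono[OF norm_triangle_ineq]])
    then show ?thesis using 1 2 3 by linarith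
  qed
  then show "\<exists>M0. \<forall>M\<ge>M0. norm (infsum (f M) A - infsum g A) < e" by blast
qed

lemma has_sum_finite_sum:
  fixes f :: "'b \<Rightarrow> 'a \<Rightarrow> complex"
  assumes "finite I" "\<And>m. (f m has_sum x m) A"
  shows "((\<lambda>l. \<Sum>m\<in>I. f m l) has_sum (\<Sum>m\<in>I. x m)) A"
  using assms(1) by (induction I rule: finite_induct) (auto intro: has_sum_add assms(2))

lemma sum_int_concat:
  fixes f :: "int \<Rightarrow> 'a::comm_monoid_add"
  assumes "x \<le> y" "y \<le> z"
  shows "sum f {x..<y} + sum f {y..<z} = sum f {x..<z}"
proof -
  have "{x..<z} = {x..<y} \<union> {y..<z}" using assms by auto
  moreover have "{x..<y} \<inter> {y..<z} = {}" by auto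
  ultimately show ?thesis by (simp add: sum.union_disjoint)
qed

text \<open>Sliding the window by \<open>l\<close> changes the sum at its two ends only, each time
  by at most \<open>\<bar>l\<bar>\<close>. Once the window extends beyond the transition zone, the
  left end contributes 0, while at the right end terms equal to 1 are lost or, for negative
  \<open>l\<close>, gained.\<close>

lemma window_shift:
  fixes \<theta> :: "int \<Rightarrow> real"
  assumes b: "\<And>m. \<bar>\<theta> m\<bar> \<le> 1" and hi: "\<And>m. m \<ge> B \<Longrightarrow> \<theta> m = 1" and lo: "\<And>m. m \<le> - B \<Longrightarrow> \<theta> m = 0"
  defines "c \<equiv> \<lambda>(M :: nat) l. \<Sum>m\<in>{- int M..<int M}. \<theta> (m - l)"
  shows "\<bar>c M l - c M 0\<bar> \<le> 2 * \<bar>of_int l\<bar>" and "int M \<ge> B + \<bar>l\<bar> \<Longrightarrow> c M l - c M 0 = - of_int l"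
proof -
  let ?S = "\<lambda>x y. \<Sum>m\<in>{x..<y}. \<theta> m"
  have cat: "?S x y + ?S y z = ?S x z" if "x \<le> y" "y \<le> z" for x y z
    using sum_int_concat[of x y z \<theta>] that by simp
  have cl: "c M l = ?S (- int M - l) (int M - l)" for l
    unfolding c_def by (rule sum.reindex_bij_witness[of _ "\<lambda>m. m + l" "\<lambda>m. m - l"]) auto
  have sb: "\<bar>?S x y\<bar> \<le> of_int (y - x)" if "x \<le> y" for x y
  proof -
    have "\<bar>?S x y\<bar> \<le> (\<Sum>m\<in>{x..<y}. 1)" by (rule order_trans[OF sum_abs sum_mono]) (rule b)
    then show ?thesis using that by simp
  qed
  have s1: "?S x y = of_int (y - x)" if "B \<le> x" "x \<le> y" for x y
    using that hi by simp
  have s0: "?S x y = 0" if "y \<le> - B" for x y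
    using that lo by (intro sum.neutral) auto
  have pos: "c M l - c M 0 = ?S (- int M - l) (- int M) - ?S (int M - l) (int M)" if "l \<ge> 0"
    using cat[of "- int M - l" "- int M" "int M"] cat[of "- int M - l" "int M - l" "int M"] that
    unfolding cl by simp
  have neg: "c M l - c M 0 = ?S (int M) (int M - l) - ?S (- int M) (- int M - l)" if "l < 0"
    using cat[of "- int M" "int M" "int M - l"] cat[of "- int M" "- int M - l" "int M - l"] that
    unfolding cl by simp
  show "\<bar>c M l - c M 0\<bar> \<le> 2 * \<bar>of_int l\<bar>"
  proof (cases "l \<ge> 0")
    case True
    then show ?thesis
      unfolding pos[OF True] using sb[of "- int M - l" "- int M"] sb[of "int M - l" "int M"] by simp
  next
    case False
    then have "l < 0" by simp
    then show ?thesis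
      unfolding neg[OF \<open>l < 0\<close>] using sb[of "int M" "int M - l"] sb[of "- int M" "- int M - l"] by simp
  qed
  assume M: "int M \<ge> B + \<bar>l\<bar>"
  show "c M l - c M 0 = - of_int l"
  proof (cases "l \<ge> 0")
    case True
    then show ?thesis
      unfolding pos[OF True] using s0[of "- int M" "- int M - l"] s1[of "int M - l" "int M"] M by simp
  next
    case False
    then have "l < 0" by simp
    then show ?thesis
      unfolding neg[OF \<open>l < 0\<close>] using s0[of "- int M - l" "- int M"] s1[of "int M" "int M - l"] M by simp
  qed
qed

text \<open>The first form brings the column index outside; the second isolates the index held fixed
  in the zero column sums. Both regroup one summable triple family.\<close>

lemma infsum_regroup:
  fixes F :: "'a \<Rightarrow> 'b \<Rightarrow> 'c \<Rightarrow> complex"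
  assumes s: "(\<lambda>(a, b, c). F a b c) summable_on UNIV"
  shows "(\<Sum>\<^sub>\<infinity>a. \<Sum>\<^sub>\<infinity>(b, c). F a b c) = (\<Sum>\<^sub>\<infinity>b. \<Sum>\<^sub>\<infinity>(a, c). F a b c)"
    and "(\<Sum>\<^sub>\<infinity>a. \<Sum>\<^sub>\<infinity>(b, c). F a b c) = (\<Sum>\<^sub>\<infinity>c. \<Sum>\<^sub>\<infinity>(a, b). F a b c)"
proof -
  let ?f = "\<lambda>(a, b, c). F a b c"
  have b1: "bij (\<lambda>(b, a, c). (a, b, c))" and b2: "bij (\<lambda>(c, a, b). (a, b, c))"
    by (rule o_bij[where g="\<lambda>(a, b, c). (b, a, c)"]; force)
       (rule o_bij[where g="\<lambda>(a, b, c). (c, a, b)"]; force)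
  have s1: "(\<lambda>(b, a, c). F a b c) summable_on UNIV"
    using summable_on_reindex_bij_betw[OF b1, of ?f] s by (simp add: case_prod_beta')
  have s2: "(\<lambda>(c, a, b). F a b c) summable_on UNIV"
    using summable_on_reindex_bij_betw[OF b2, of ?f] s by (simp add: case_prod_beta')
  have e0: "(\<Sum>\<^sub>\<infinity>a. \<Sum>\<^sub>\<infinity>(b, c). F a b c) = infsum ?f UNIV"
    using infsum_Sigma'_banach[of "\<lambda>a (b, c). F a b c" UNIV "\<lambda>_. UNIV"] s by (simp add: case_prod_beta')
  have e1: "(\<Sum>\<^sub>\<infinity>b. \<Sum>\<^sub>\<infinity>(a, c). F a b c) = infsum (\<lambda>(b, a, c). F a b c) UNIV"
    using infsum_Sigma'_banach[of "\<lambda>b (a, c). F a b c" UNIV "\<lambda>_. UNIV"] s1 by (simp add: case_prod_beta')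
  have e2: "(\<Sum>\<^sub>\<infinity>c. \<Sum>\<^sub>\<infinity>(a, b). F a b c) = infsum (\<lambda>(c, a, b). F a b c) UNIV"
    using infsum_Sigma'_banach[of "\<lambda>c (a, b). F a b c" UNIV "\<lambda>_. UNIV"] s2 by (simp add: case_prod_beta')
  show "(\<Sum>\<^sub>\<infinity>a. \<Sum>\<^sub>\<infinity>(b, c). F a b c) = (\<Sum>\<^sub>\<infinity>b. \<Sum>\<^sub>\<infinity>(a, c). F a b c)"
    unfolding e0 e1 using infsum_reindex_bij_betw[OF b1, of ?f] by (simp add: case_prod_beta')
  show "(\<Sum>\<^sub>\<infinity>a. \<Sum>\<^sub>\<infinity>(b, c). F a b c) = (\<Sum>\<^sub>\<infinity>c. \<Sum>\<^sub>\<infinity>(a, b). F a b c)"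
    unfolding e0 e2 using infsum_reindex_bij_betw[OF b2, of ?f] by (simp add: case_prod_beta')
qed

text \<open>The column sums are \<open>t m = (\<Sum>l. \<theta> (m - l) \<kappa> l)\<close> with \<open>\<kappa>\<close> of zero sum. Summing over \<open>m\<close> in a
  symmetric window gives \<open>(\<Sum>l. \<kappa> l (c M l - c M 0))\<close>, where \<open>c M l\<close> is the sum of the switch \<open>\<theta>\<close> over the window
  shifted by \<open>l\<close>, and \<open>c M l - c M 0\<close> is eventually \<open>- l\<close> whatever the switch.\<close>

lemma column_limit:
  fixes q :: "int \<Rightarrow> 'p \<Rightarrow> 'p \<Rightarrow> complex" and v :: "'p \<Rightarrow> real" and \<theta> :: "int \<Rightarrow> real"
  assumes v: "v summable_on UNIV" "\<And>p. v p \<ge> 0" and nu: "\<nu> > 0" and K: "K \<ge> 0"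
    and q: "\<And>l p p'. cmod (q l p p') \<le> K * exp (- \<nu> * \<bar>of_int l\<bar>) * (v p * v p')"
    and zero: "\<And>p'. ((\<lambda>(l, p). q l p p') has_sum 0) UNIV"
    and th: "\<And>m. \<bar>\<theta> m\<bar> \<le> 1" "\<And>m. m \<ge> B \<Longrightarrow> \<theta> m = 1" "\<And>m. m \<le> - B \<Longrightarrow> \<theta> m = 0"
    and d: "\<And>m p. ((\<lambda>(m', p'). of_real (\<theta> m') * q (m - m') p p') has_sum d m p) UNIV"
  shows "(\<lambda>M. \<Sum>m\<in>{- int M..<int M}. \<Sum>\<^sub>\<infinity>p. d m p) \<longlonglongrightarrow> - (\<Sum>\<^sub>\<infinity>l. of_int l * (\<Sum>\<^sub>\<infinity>(p, p'). q l p p'))"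
proof -
  define \<kappa> where "\<kappa> l = (\<Sum>\<^sub>\<infinity>(p, p'). q l p p')" for l
  define V where "V = (\<Sum>\<^sub>\<infinity>(p, p'). v p * v p')"
  have vv: "(\<lambda>(p, p'). v p * v p') summable_on UNIV"
    using summable_on_product_nonneg[OF v(1) _ v(1)] v(2) by simp
  have V: "V \<ge> 0" unfolding V_def by (rule infsum_nonneg) (use v in auto)
  have ex: "(\<lambda>l::int. K * exp (- \<nu> * \<bar>of_int (m - l)\<bar>)) summable_on UNIV" for m
  proof -
    have "bij (\<lambda>l::int. m - l)" by (rule o_bij[of "\<lambda>l. m - l"]) auto
    from summable_on_reindex_bij_betw[OF this, of "\<lambda>l. K * exp (- \<nu> * \<bar>of_int l\<bar>)"]
    show ?thesis using summable_on_cmult_right[OF exp_summable_int[OF nu], of K] by simp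
  qed
  have trip: "(\<lambda>(m', p, p'). of_real (s m') * q (m - m') p p') summable_on UNIV" if s: "\<And>m'. \<bar>s m'\<bar> \<le> 1" for s :: "int \<Rightarrow> real" and m
  proof (rule infsum_tail_bound(2)[of UNIV _ "\<lambda>(m', pp). K * exp (- \<nu> * \<bar>of_int (m - m')\<bar>) * (case pp of (p, p') \<Rightarrow> v p * v p')" "{}"])
    show "(\<lambda>(m', pp). K * exp (- \<nu> * \<bar>of_int (m - m')\<bar>) * (case pp of (p, p') \<Rightarrow> v p * v p')) summable_on UNIV"
      using summable_on_product_nonneg[OF ex[of m] _ vv] v(2) K by (simp add: case_prod_beta')
    fix x :: "int \<times> 'p \<times> 'p"
    obtain m' p p' where x: "x = (m', p, p')" by (metis prod.exhaust)
    have "cmod (of_real (s m') * q (m - m') p p') \<le> 1 * cmod (q (m - m') p p')"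
      unfolding norm_mult using s[of m'] by (intro mult_right_mono) auto
    also have "\<dots> \<le> K * exp (- \<nu> * \<bar>of_int (m - m')\<bar>) * (v p * v p')" using q[of "m - m'" p p'] by simp
    finally show "cmod (case x of (m', p, p') \<Rightarrow> of_real (s m') * q (m - m') p p')
        \<le> (case x of (m', pp) \<Rightarrow> K * exp (- \<nu> * \<bar>of_int (m - m')\<bar>) * (case pp of (p, p') \<Rightarrow> v p * v p'))"
      by (simp add: x)
  qed auto
  have kb: "cmod (\<kappa> l) \<le> K * V * exp (- \<nu> * \<bar>of_int l\<bar>)" for l
  proof -
    have s: "(\<lambda>(p, p'). K * exp (- \<nu> * \<bar>of_int l\<bar>) * (v p * v p')) summable_on UNIV"
      using summable_on_cmult_right[OF vv, of "K * exp (- \<nu> * \<bar>of_int l\<bar>)"] by (simp add: case_prod_beta')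
    have "cmod (\<kappa> l) \<le> (\<Sum>\<^sub>\<infinity>(p, p'). K * exp (- \<nu> * \<bar>of_int l\<bar>) * (v p * v p'))"
      unfolding \<kappa>_def using infsum_tail_bound(1)[of UNIV "\<lambda>(p, p'). q l p p'", OF _ s, of "{}"] q by (simp add: case_prod_beta')
    also have "\<dots> = K * exp (- \<nu> * \<bar>of_int l\<bar>) * V"
      unfolding V_def by (subst infsum_cmult_right'[symmetric]) (simp add: case_prod_beta')
    finally show ?thesis by (simp add: mult_ac)
  qed
  have t: "(\<Sum>\<^sub>\<infinity>p. d m p) = (\<Sum>\<^sub>\<infinity>l. of_real (\<theta> (m - l)) * \<kappa> l)" for m
  proof -
    have "(\<Sum>\<^sub>\<infinity>p. d m p) = (\<Sum>\<^sub>\<infinity>p. \<Sum>\<^sub>\<infinity>(m', p'). of_real (\<theta> m') * q (m - m') p p')"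
      by (rule infsum_cong) (rule infsumI[OF d, symmetric])
    also have "\<dots> = (\<Sum>\<^sub>\<infinity>m'. \<Sum>\<^sub>\<infinity>(p, p'). of_real (\<theta> m') * q (m - m') p p')"
      by (rule infsum_regroup(1)[symmetric], rule trip, rule th(1))
    also have "\<dots> = (\<Sum>\<^sub>\<infinity>m'. of_real (\<theta> m') * \<kappa> (m - m'))"
      unfolding \<kappa>_def by (rule infsum_cong, subst infsum_cmult_right'[symmetric]) (simp add: case_prod_beta')
    also have "\<dots> = (\<Sum>\<^sub>\<infinity>l. of_real (\<theta> (m - l)) * \<kappa> l)"
    proof -
      have "bij (\<lambda>l::int. m - l)" by (rule o_bij[of "\<lambda>l. m - l"]) auto
      from infsum_reindex_bij_betw[OF this, of "\<lambda>m'. of_real (\<theta> m') * \<kappa> (m - m')"] show ?thesis by simp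
    qed
    finally show ?thesis .
  qed
  have k0: "(\<Sum>\<^sub>\<infinity>l. \<kappa> l) = 0"
  proof -
    \<comment> \<open>Summability is at hand for the family in \<open>- l\<close>, the case
      \<open>m = 0\<close> with weight 1. The reflection is undone once inside the sums and once at
      the end.\<close>
    have bij: "bij (\<lambda>l::int. - l)" by (rule o_bij[of "\<lambda>l. - l"]) auto
    have "(\<lambda>(m', p, p'). q (- m') p p') summable_on UNIV"
      using trip[of "\<lambda>_. 1" 0] by simp
    then have "(\<Sum>\<^sub>\<infinity>l. \<Sum>\<^sub>\<infinity>(p, p'). q (- l) p p') = (\<Sum>\<^sub>\<infinity>p'. \<Sum>\<^sub>\<infinity>(l, p). q (- l) p p')"
      by (rule infsum_regroup(2))
    also have "\<dots> = (\<Sum>\<^sub>\<infinity>p'::'p. 0)"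
    proof (rule infsum_cong)
      fix p'
      have "bij (\<lambda>(l::int, p). (- l, p))" by (rule o_bij[of "\<lambda>(l, p). (- l, p)"]) auto
      from infsum_reindex_bij_betw[OF this, of "\<lambda>(l, p). q l p p'"]
      show "(\<Sum>\<^sub>\<infinity>(l, p). q (- l) p p') = 0"
        using infsumI[OF zero[of p']] by (simp add: case_prod_beta')
    qed
    finally have "(\<Sum>\<^sub>\<infinity>l. \<kappa> (- l)) = 0" by (simp add: \<kappa>_def)
    then show ?thesis using infsum_reindex_bij_betw[OF bij, of \<kappa>] by simp
  qed
  have ks: "\<kappa> summable_on UNIV"
    by (rule infsum_tail_bound(2)[where h="\<lambda>l. K * V * exp (- \<nu> * \<bar>of_int l\<bar>)" and F="{}"])
       (use kb summable_on_cmult_right[OF exp_summable_int[OF nu]] in auto)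
  define c where "c M l = (\<Sum>m\<in>{- int M..<int M}. \<theta> (m - l))" for M :: nat and l
  note win = window_shift[of \<theta> B, OF th, folded c_def]
  \<comment> \<open>Half of the rate absorbs the factor \<open>\<bar>l\<bar>\<close> that comes from
    the window bound.\<close>
  have lin: "\<bar>real_of_int l\<bar> * exp (- \<nu> * \<bar>of_int l\<bar>) \<le> 2 / \<nu> * exp (- (\<nu> / 2) * \<bar>of_int l\<bar>)" for l :: int
  proof -
    let ?x = "\<bar>real_of_int l\<bar>"
    have "\<nu> / 2 * ?x \<le> exp (\<nu> / 2 * ?x)" using exp_ge_add_one_self[of "\<nu> / 2 * ?x"] by linarith
    then have "?x \<le> 2 / \<nu> * exp (\<nu> / 2 * ?x)" using nu by (simp add: field_simps)
    then have "?x * exp (- \<nu> * ?x) \<le> 2 / \<nu> * exp (\<nu> / 2 * ?x) * exp (- \<nu> * ?x)" by (rule mult_right_mono) simp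
    also have "\<dots> = 2 / \<nu> * (exp (\<nu> / 2 * ?x) * exp (- \<nu> * ?x))" by simp
    also have "exp (\<nu> / 2 * ?x) * exp (- \<nu> * ?x) = exp (- (\<nu> / 2) * ?x)" unfolding exp_add[symmetric] by (simp add: field_simps)
    finally show ?thesis .
  qed
  have s_eq: "(\<Sum>m\<in>{- int M..<int M}. \<Sum>\<^sub>\<infinity>p. d m p) = (\<Sum>\<^sub>\<infinity>l. \<kappa> l * of_real (c M l - c M 0))" for M
  proof -
    have sm: "(\<lambda>l. of_real (\<theta> (m - l)) * \<kappa> l) summable_on UNIV" for m
    proof (rule infsum_tail_bound(2)[of UNIV _ "\<lambda>l. K * V * exp (- \<nu> * \<bar>of_int l\<bar>)" "{}"])
      fix l
      have "cmod (of_real (\<theta> (m - l)) * \<kappa> l) \<le> 1 * cmod (\<kappa> l)"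
        unfolding norm_mult using th(1)[of "m - l"] by (intro mult_right_mono) auto
      then show "cmod (of_real (\<theta> (m - l)) * \<kappa> l) \<le> K * V * exp (- \<nu> * \<bar>of_int l\<bar>)" using kb[of l] by simp
    qed (use summable_on_cmult_right[OF exp_summable_int[OF nu]] in auto)
    have "((\<lambda>l. \<Sum>m\<in>{- int M..<int M}. of_real (\<theta> (m - l)) * \<kappa> l) has_sum (\<Sum>m\<in>{- int M..<int M}. \<Sum>\<^sub>\<infinity>l. of_real (\<theta> (m - l)) * \<kappa> l)) UNIV"
      by (rule has_sum_finite_sum) (rule finite_atLeastLessThan_int, rule has_sum_infsum[OF sm])
    moreover have "(\<Sum>m\<in>{- int M..<int M}. of_real (\<theta> (m - l)) * \<kappa> l) = \<kappa> l * of_real (c M l)" for l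
      unfolding c_def of_real_sum sum_distrib_right[symmetric] by (rule mult.commute)
    ultimately have "((\<lambda>l. \<kappa> l * of_real (c M l)) has_sum (\<Sum>m\<in>{- int M..<int M}. \<Sum>\<^sub>\<infinity>p. d m p)) UNIV"
      unfolding t by (simp only:)
    \<comment> \<open>A zero is added. \<open>c M 0\<close> grows with the window, but its multiple
      of the vanishing sum of \<open>\<kappa>\<close> may be subtracted, and the differences
      \<open>c M l - c M 0\<close> are bounded in \<open>M\<close>.\<close>
    moreover have "((\<lambda>l. \<kappa> l * - of_real (c M 0)) has_sum 0 * - of_real (c M 0)) UNIV"
      using has_sum_cmult_left[OF has_sum_infsum[OF ks], of "- of_real (c M 0)"] unfolding k0 .
    ultimately have "((\<lambda>l. \<kappa> l * of_real (c M l) + \<kappa> l * - of_real (c M 0)) has_sum (\<Sum>m\<in>{- int M..<int M}. \<Sum>\<^sub>\<infinity>p. d m p) + 0 * - of_real (c M 0)) UNIV"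
      by (rule has_sum_add)
    moreover have "\<kappa> l * of_real (c M l) + \<kappa> l * - of_real (c M 0) = \<kappa> l * of_real (c M l - c M 0)" for l
      by (simp add: algebra_simps)
    ultimately have "((\<lambda>l. \<kappa> l * of_real (c M l - c M 0)) has_sum (\<Sum>m\<in>{- int M..<int M}. \<Sum>\<^sub>\<infinity>p. d m p)) UNIV"
      by simp
    then show ?thesis by (rule infsumI[symmetric])
  qed
  have "(\<lambda>M. \<Sum>\<^sub>\<infinity>l. \<kappa> l * of_real (c M l - c M 0)) \<longlonglongrightarrow> (\<Sum>\<^sub>\<infinity>l. - (of_int l * \<kappa> l))"
  proof (rule dominated_convergence_infsum)
    fix l
    have "\<forall>\<^sub>F M in sequentially. \<kappa> l * of_real (c M l - c M 0) = - (of_int l * \<kappa> l)"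
      using eventually_ge_at_top[of "nat (B + \<bar>l\<bar>)"]
    proof eventually_elim
      case (elim M)
      then have "int M \<ge> B + \<bar>l\<bar>" by linarith
      then show ?case by (simp add: win(2))
    qed
    then show "(\<lambda>M. \<kappa> l * of_real (c M l - c M 0)) \<longlonglongrightarrow> - (of_int l * \<kappa> l)"
      by (rule tendsto_eventually)
    show "cmod (\<kappa> l * of_real (c M l - c M 0)) \<le> 4 * K * V / \<nu> * exp (- (\<nu> / 2) * \<bar>of_int l\<bar>)" for M
    proof -
      have "cmod (\<kappa> l * of_real (c M l - c M 0)) \<le> (K * V * exp (- \<nu> * \<bar>of_int l\<bar>)) * (2 * \<bar>of_int l\<bar>)"
        unfolding norm_mult norm_of_real using win(1)[of M l] K V by (intro mult_mono kb) auto
      also have "\<dots> = 2 * K * V * (\<bar>of_int l\<bar> * exp (- \<nu> * \<bar>of_int l\<bar>))" by simp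
      also have "\<dots> \<le> 2 * K * V * (2 / \<nu> * exp (- (\<nu> / 2) * \<bar>of_int l\<bar>))"
        using K V by (intro mult_left_mono lin) auto
      finally show ?thesis by (simp add: mult_ac)
    qed
    show "(\<lambda>l::int. 4 * K * V / \<nu> * exp (- (\<nu> / 2) * \<bar>of_int l\<bar>)) summable_on UNIV"
      by (rule summable_on_cmult_right[OF exp_summable_int]) (use nu in simp)
  qed
  also have "(\<Sum>\<^sub>\<infinity>l. - (of_int l * \<kappa> l)) = - (\<Sum>\<^sub>\<infinity>l. of_int l * \<kappa> l)"
    by (rule infsum_uminus)
  finally show ?thesis
    unfolding s_eq \<kappa>_def .
qed

text \<open>A strip is a block of \<open>k\<close> columns, so symmetric sums over strips are sums
  over windows of \<open>k * N\<close> columns to each side. The induction adds one block at each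
  end.\<close>

lemma sum_blocks:
  fixes f :: "int \<Rightarrow> 'a::comm_monoid_add"
  shows "(\<Sum>n = - int N..int N - 1. \<Sum>m\<in>{int k * n..<int k * (n + 1)}. f m) = (\<Sum>m\<in>{- int (k * N)..<int (k * N)}. f m)"
proof (induction N)
  case (Suc N)
  let ?g = "\<lambda>n. \<Sum>m\<in>{int k * n..<int k * (n + 1)}. f m"
  have "{- int (Suc N)..int (Suc N) - 1} = insert (- int N - 1) (insert (int N) {- int N..int N - 1})" by auto
  then have "(\<Sum>n = - int (Suc N)..int (Suc N) - 1. ?g n) = ?g (- int N - 1) + (?g (int N) + (\<Sum>n = - int N..int N - 1. ?g n))"
    by simp
  also have "\<dots> = ?g (- int N - 1) + ((\<Sum>m\<in>{- int (k * N)..<int (k * N)}. f m) + ?g (int N))"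
    unfolding Suc.IH by (simp add: add.commute)
  also have "?g (- int N - 1) = (\<Sum>m\<in>{- int (k * Suc N)..<- int (k * N)}. f m)"
    by (rule sum.cong) (auto simp: algebra_simps)
  also have "?g (int N) = (\<Sum>m\<in>{int (k * N)..<int (k * Suc N)}. f m)"
    by (rule sum.cong) (auto simp: algebra_simps)
  also have "(\<Sum>m\<in>{- int (k * N)..<int (k * N)}. f m) + (\<Sum>m\<in>{int (k * N)..<int (k * Suc N)}. f m) = (\<Sum>m\<in>{- int (k * N)..<int (k * Suc N)}. f m)"
    by (rule sum_int_concat) auto
  also have "(\<Sum>m\<in>{- int (k * Suc N)..<- int (k * N)}. f m) + (\<Sum>m\<in>{- int (k * N)..<int (k * Suc N)}. f m) = (\<Sum>m\<in>{- int (k * Suc N)..<int (k * Suc N)}. f m)"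
    by (rule sum_int_concat) auto
  finally show ?case .
qed simp

section \<open>The principal-value trace\<close>

context bulk_gap
begin

text \<open>\<open>m\<close> numbers the column; \<open>p\<close> combines the height within the
  column and the spin.\<close>

definition site :: "int \<Rightarrow> int \<times> 2 \<Rightarrow> plane \<times> 2" where
  "site m p = (lattice_point a1 a2 (m, fst p), snd p)"

lemma bij_site: "bij_betw (\<lambda>(m, p). site m p) UNIV (sites D)"
proof -
  have "inj (\<lambda>(m, p). site m p)"
  proof (rule injI)
    fix x y :: "int \<times> int \<times> 2"
    assume e: "(case x of (m, p) \<Rightarrow> site m p) = (case y of (m, p) \<Rightarrow> site m p)"
    then have l: "lattice_point a1 a2 (fst x, fst (snd x)) = lattice_point a1 a2 (fst y, fst (snd y))" "snd (snd x) = snd (snd y)"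
      by (auto simp: site_def case_prod_beta)
    from arg_cong[OF l(1), of "\<lambda>v :: plane. v $ 1"] arg_cong[OF l(1), of "\<lambda>v :: plane. v $ 2"] l(2)
    show "x = y" using D(2,3) by (simp add: prod_eq_iff)
  qed
  moreover have "range (\<lambda>(m, p). site m p) = sites D"
  proof (intro equalityI subsetI)
    fix i assume "i \<in> sites D"
    then obtain m n where "fst i = lattice_point a1 a2 (m, n)" by (auto simp: D bulk_lattice_eq)
    then have "i = (case (m, (n, snd i)) of (m, p) \<Rightarrow> site m p)" by (simp add: site_def prod_eq_iff)
    then show "i \<in> range (\<lambda>(m, p). site m p)" by blast
  qed (auto simp: site_def D bulk_lattice_eq)
  ultimately show ?thesis by (simp add: bij_betw_def)
qed

lemma site_sites: "site m p \<in> sites D"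
  by (auto simp: site_def D bulk_lattice_eq)

lemma site_has_sum_iff: "((\<lambda>(m, p). f (site m p)) has_sum x) UNIV \<longleftrightarrow> (f has_sum x) (sites D)"
  using has_sum_reindex_bij_betw[OF bij_site, of f x] by (simp add: case_prod_beta')

lemma site_shift: "site m p = shift (lattice_point a1 a2 (k, 0)) (site (m - k) p)"
  by (cases p) (simp add: site_def shift_def lattice_point_add)

lemma kern_site: "kern (site m p) (site m' p') = kern (site (m - m') p) (site 0 p')"
proof -
  have n: "lattice_point a1 a2 (m', 0) \<in> D" "lattice_point a1 a2 (m', 0) $ 2 = 0"
    by (auto simp: D bulk_lattice_eq)
  show ?thesis
    using kern_shift[OF n, of "site (m - m') p" "site 0 p'"] site_shift[of m p m'] site_shift[of m' p' m'] by simp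
qed

lemma lattice_abs_ge: "a > 0 \<Longrightarrow> \<bar>real_of_int m\<bar> \<le> \<bar>of_int m * real a\<bar>"
  using mult_left_mono[of 1 "real a" "\<bar>real_of_int m\<bar>"] by (simp add: abs_mult)

lemma decay_weight_site:
  assumes "\<nu> > 0"
  shows "decay_weight \<nu> (site l p) (site 0 p') \<le> exp (- \<nu> * \<bar>of_int l\<bar>) * (exp (- \<nu> * \<bar>of_int (fst p)\<bar>) * exp (- \<nu> * \<bar>of_int (fst p')\<bar>))"
proof -
  have "\<bar>real_of_int l\<bar> \<le> norm1 (fst (site l p) - fst (site 0 p'))"
    using lattice_abs_ge[OF D(2), of l] norm1_component(2)[of "fst (site l p) - fst (site 0 p')"] by (simp add: site_def)
  moreover have "\<bar>real_of_int (fst p)\<bar> \<le> \<bar>fst (site l p) $ 2\<bar>" "\<bar>real_of_int (fst p')\<bar> \<le> \<bar>fst (site 0 p') $ 2\<bar>"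
    using lattice_abs_ge[OF D(3)] by (simp_all add: site_def)
  ultimately have "\<nu> * (\<bar>of_int l\<bar> + (\<bar>of_int (fst p)\<bar> + \<bar>of_int (fst p')\<bar>))
      \<le> \<nu> * (norm1 (fst (site l p) - fst (site 0 p')) + 1 * (\<bar>fst (site l p) $ 2\<bar> + \<bar>fst (site 0 p') $ 2\<bar>))"
    using assms by (intro mult_left_mono) auto
  then show ?thesis
    unfolding exp_add[symmetric] exp_le_cancel_iff by (simp add: algebra_simps)
qed

text \<open>The \<open>\<kappa>\<close> of \<open>column_limit\<close>. The spin factor sits at the
  second index of the kernel, where the weight acts.\<close>

definition spin_kappa :: "int \<Rightarrow> complex" where
  "spin_kappa l = (\<Sum>\<^sub>\<infinity>(p, p'). kern (site l p) (site 0 p') * of_real (spin_sign (snd p')))"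

lemma spin_column_limit:
  assumes sw1: "switch_function 1 \<Lambda>1"
  shows "(\<lambda>M. \<Sum>m\<in>{- int M..<int M}. \<Sum>\<^sub>\<infinity>p. line_entry (spin_weight \<Lambda>1) (site m p) (site m p))
    \<longlonglongrightarrow> - (\<Sum>\<^sub>\<infinity>l. of_int l * spin_kappa l)"
proof -
  obtain \<nu> K where nu: "\<nu> > 0" and K: "K \<ge> 0"
    and kb: "\<forall>i\<in>sites D. \<forall>j\<in>sites D. cmod (kern i j) \<le> K * decay_weight \<nu> i j"
    and hs: "\<forall>\<gamma>. (\<forall>i. \<bar>\<gamma> i\<bar> \<le> 1) \<longrightarrow> (\<forall>i\<in>sites D. ((\<lambda>j. of_real (\<gamma> j) * kern i j) has_sum line_entry \<gamma> i i) (sites D))"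
    and zs: "\<forall>j\<in>sites D. ((\<lambda>i. kern i j) has_sum 0) (sites D)"
    using kernel_properties by (elim exE conjE)
  have r: "\<Lambda>1 x \<in> {0..1}" for x by (rule switch_function_range[OF sw1])
  have f1: "\<forall>x. \<bar>\<Lambda>1 x\<bar> \<le> 1"
  proof
    show "\<bar>\<Lambda>1 x\<bar> \<le> 1" for x using r[of x] by (simp add: abs_le_iff)
  qed
  obtain b1 b2 where b: "\<And>x. x $ 1 > b1 \<Longrightarrow> \<Lambda>1 x = 1" "\<And>x. x $ 1 < b2 \<Longrightarrow> \<Lambda>1 x = 0"
    using switch_function_bounds[OF sw1] by metis
  \<comment> \<open>A threshold counted in columns. As the spacing \<open>a1\<close> is at least 1,
    columns with \<open>m \<ge> B\<close> lie to the right of \<open>b1\<close> and those with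
    \<open>m \<le> - B\<close> to the left of \<open>b2\<close>.\<close>
  define B where "B = \<lceil>max \<bar>b1\<bar> \<bar>b2\<bar>\<rceil> + 1"
  have B: "real_of_int B > \<bar>b1\<bar>" "real_of_int B > \<bar>b2\<bar>" "B \<ge> 0"
  proof -
    have "max \<bar>b1\<bar> \<bar>b2\<bar> \<le> of_int \<lceil>max \<bar>b1\<bar> \<bar>b2\<bar>\<rceil>" by (rule le_of_int_ceiling)
    moreover have "\<bar>b1\<bar> \<le> max \<bar>b1\<bar> \<bar>b2\<bar>" "\<bar>b2\<bar> \<le> max \<bar>b1\<bar> \<bar>b2\<bar>" by simp_all
    moreover have "real_of_int B = of_int \<lceil>max \<bar>b1\<bar> \<bar>b2\<bar>\<rceil> + 1" by (simp add: B_def)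
    ultimately show "real_of_int B > \<bar>b1\<bar>" "real_of_int B > \<bar>b2\<bar>" by linarith+
    then have "real_of_int B \<ge> 0" by linarith
    then show "B \<ge> 0" by simp
  qed
  define \<theta> where "\<theta> m = \<Lambda>1 (lattice_point a1 a2 (m, 0))" for m
  have theta_site: "\<Lambda>1 (fst (site m p)) = \<theta> m" for m p
  proof -
    have "fst (site m p) $ 1 = lattice_point a1 a2 (m, 0) $ 1" by (simp add: site_def)
    then show ?thesis unfolding \<theta>_def using sw1 unfolding switch_function_def by blast
  qed
  define q where "q l p p' = kern (site l p) (site 0 p') * of_real (spin_sign (snd p'))" for l p p'
  have sgn: "\<bar>spin_sign s\<bar> \<le> 1" for s by (simp add: spin_sign_def)
  have "(\<lambda>M. \<Sum>m\<in>{- int M..<int M}. \<Sum>\<^sub>\<infinity>p. line_entry (spin_weight \<Lambda>1) (site m p) (site m p))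
    \<longlonglongrightarrow> - (\<Sum>\<^sub>\<infinity>l. of_int l * (\<Sum>\<^sub>\<infinity>(p, p'). q l p p'))"
  proof (rule column_limit[where v="\<lambda>p. exp (- \<nu> * \<bar>of_int (fst p)\<bar>)" and \<theta>=\<theta> and B=B, OF _ _ nu K])
    show "(\<lambda>p :: int \<times> 2. exp (- \<nu> * \<bar>of_int (fst p)\<bar>)) summable_on UNIV"
      using summable_on_product_nonneg[OF exp_summable_int[OF nu], of "\<lambda>_. 1" "UNIV :: 2 set"] by (simp add: case_prod_beta')
    show "cmod (q l p p') \<le> K * exp (- \<nu> * \<bar>of_int l\<bar>) * (exp (- \<nu> * \<bar>of_int (fst p)\<bar>) * exp (- \<nu> * \<bar>of_int (fst p')\<bar>))" for l p p'
    proof -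
      have "cmod (q l p p') \<le> cmod (kern (site l p) (site 0 p')) * 1"
        unfolding q_def norm_mult norm_of_real by (intro mult_left_mono sgn) simp
      also have "\<dots> \<le> K * decay_weight \<nu> (site l p) (site 0 p')"
        unfolding mult_1_right by (rule kb[rule_format, OF site_sites site_sites])
      also have "\<dots> \<le> K * (exp (- \<nu> * \<bar>of_int l\<bar>) * (exp (- \<nu> * \<bar>of_int (fst p)\<bar>) * exp (- \<nu> * \<bar>of_int (fst p')\<bar>)))"
        by (rule mult_left_mono[OF decay_weight_site[OF nu] K])
      finally show ?thesis by (simp only: mult.assoc)
    qed
    \<comment> \<open>The spin factor belongs to the index that is held fixed, so it comes out of
      the sum and the zero column sum survives.\<close>
    show "((\<lambda>(l, p). q l p p') has_sum 0) UNIV" for p'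
    proof -
      have "((\<lambda>i. kern i (site 0 p') * of_real (spin_sign (snd p'))) has_sum 0 * of_real (spin_sign (snd p'))) (sites D)"
        by (rule has_sum_cmult_left) (use zs site_sites in blast)
      then show ?thesis
        unfolding q_def using site_has_sum_iff[of "\<lambda>i. kern i (site 0 p') * of_real (spin_sign (snd p'))" 0] by simp
    qed
    show "\<bar>\<theta> m\<bar> \<le> 1" for m using f1 by (simp add: \<theta>_def)
    show "\<theta> m = 1" if "m \<ge> B" for m
      unfolding \<theta>_def
    proof (rule b(1))
      have "real_of_int B \<le> real_of_int m" using that by (rule of_int_le_iff[THEN iffD2])
      then have "b1 < real_of_int m" "0 \<le> real_of_int m" using B by linarith+
      moreover from this(2) have "real_of_int m * 1 \<le> real_of_int m * real a1"
        by (rule mult_left_mono[rotated]) (use D(2) in simp)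
      ultimately have "b1 < real_of_int m * real a1" by linarith
      then show "lattice_point a1 a2 (m, 0) $ 1 > b1" by simp
    qed
    show "\<theta> m = 0" if "m \<le> - B" for m
      unfolding \<theta>_def
    proof (rule b(2))
      have "real_of_int m \<le> real_of_int (- B)" using that by (rule of_int_le_iff[THEN iffD2])
      then have "real_of_int m < b2" "real_of_int m \<le> 0" using B unfolding of_int_minus by linarith+
      moreover from this(2) have "real_of_int m * real a1 \<le> real_of_int m * 1"
        by (rule mult_left_mono_neg[rotated]) (use D(2) in simp)
      ultimately have "real_of_int m * real a1 < b2" by linarith
      then show "lattice_point a1 a2 (m, 0) $ 1 < b2" by simp
    qed
    show "((\<lambda>(m', p'). of_real (\<theta> m') * q (m - m') p p') has_sum line_entry (spin_weight \<Lambda>1) (site m p) (site m p)) UNIV" for m p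
    proof -
      have h: "((\<lambda>j. of_real (spin_weight \<Lambda>1 j) * kern (site m p) j) has_sum line_entry (spin_weight \<Lambda>1) (site m p) (site m p)) (sites D)"
        using hs spin_weight_bound[OF f1] site_sites by blast
      have e: "of_real (spin_weight \<Lambda>1 (site m' p')) * kern (site m p) (site m' p') = of_real (\<theta> m') * q (m - m') p p'" for m' p'
        unfolding q_def kern_site[of m p m' p'] case_prod_beta theta_site by (simp add: site_def)
      show ?thesis
        using h[folded site_has_sum_iff] by (simp only: e)
    qed
  qed simp_all
  then show ?thesis by (simp only: spin_kappa_def q_def)
qed

text \<open>Summable entries make each strip trace class. The diagonal entries, grouped by columns,
  turn the symmetric sums over strips into a subsequence of the window sums of
  \<open>spin_column_limit\<close>.\<close>

lemma pv_trace_spin: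
  assumes sw1: "switch_function 1 \<Lambda>1" and k: "k \<ge> 1" and S: "op_on D S"
    and ent_S: "\<And>i j. i \<in> sites D \<Longrightarrow> j \<in> sites D \<Longrightarrow> ent S i j = line_entry (spin_weight \<Lambda>1) i j"
  shows "pv_trace_exists (real (k * a1)) D S" and "pv_trace (real (k * a1)) D S = - (\<Sum>\<^sub>\<infinity>l. of_int l * spin_kappa l)"
proof -
  define a where "a = real (k * a1)"
  have a0: "a > 0" using k D(2) by (simp add: a_def)
  have r: "\<Lambda>1 x \<in> {0..1}" for x by (rule switch_function_range[OF sw1])
  have f1: "\<forall>x. \<bar>\<Lambda>1 x\<bar> \<le> 1"
  proof
    show "\<bar>\<Lambda>1 x\<bar> \<le> 1" for x using r[of x] by (simp add: abs_le_iff)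
  qed
  obtain \<nu> K where nu: "\<nu> > 0" and K: "K \<ge> 0"
    and lb: "\<forall>\<gamma>. (\<forall>i. \<bar>\<gamma> i\<bar> \<le> 1) \<longrightarrow> (\<forall>i\<in>sites D. \<forall>j\<in>sites D.
       cmod (line_entry \<gamma> i j) \<le> K * decay_weight \<nu> i j \<and>
       (\<lambda>n. - 1 / 2 * integral {- real n..real n} (\<lambda>t. ent (W \<gamma> (Complex c t)) i j)) \<longlonglongrightarrow> line_entry \<gamma> i j)"
    using kernel_properties by (elim exE conjE)
  have Sb: "cmod (ent S i j) \<le> K * decay_weight \<nu> i j" if "i \<in> sites D" "j \<in> sites D" for i j
    using lb spin_weight_bound[OF f1] that ent_S[OF that] by auto
  have ind: "\<bar>indicator (strip n a) x :: real\<bar> \<le> 1" for n x by (simp add: indicator_def)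
  have opT: "op_on D (strip_op D a n S)" for n
    unfolding strip_op_def by (rule op_on_compose[OF op_on_position_op[where f="indicator (strip n a)", OF ind] S])
  have entT: "ent (strip_op D a n S) i j = (if fst i \<in> strip n a then ent S i j else 0)" if "i \<in> sites D" for n i j
    unfolding strip_op_def ent_position_op_left[where f="indicator (strip n a)", OF ind]
    using that by (auto simp: indicator_def)
  have tc: "trace_class D (strip_op D a n S)" for n
  proof (rule trace_class_if_summable_entries[OF opT])
    \<comment> \<open>Within a strip the first coordinate of \<open>i\<close> is at most
      \<open>a * (\<bar>n\<bar> + 1)\<close> in modulus. Decay in the distance and in the heights
      therefore controls both sites at half the rate; the exponential factor is the price.\<close>
    define C where "C = K * exp (\<nu> * (a * (\<bar>of_int n\<bar> + 1)))"
    have sm: "(\<lambda>i :: plane \<times> 2. exp (- (\<nu> / 2) * norm1 (fst i))) summable_on sites D"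
      unfolding D(1) by (rule site_sum_summable) (use nu D in auto)
    show "(\<lambda>(j, i). cmod (ent (strip_op D a n S) i j)) summable_on sites D \<times> sites D"
    proof (rule summable_on_comparison_test)
      show "(\<lambda>(j, i). (C * exp (- (\<nu> / 2) * norm1 (fst j))) * exp (- (\<nu> / 2) * norm1 (fst i))) summable_on sites D \<times> sites D"
        by (rule summable_on_product_nonneg[OF summable_on_cmult_right[OF sm] _ sm]) (use K in \<open>auto simp: C_def\<close>)
      fix x assume "x \<in> sites D \<times> sites D"
      then obtain j i where x: "x = (j, i)" and ij: "i \<in> sites D" "j \<in> sites D" by auto
      have "cmod (ent (strip_op D a n S) i j) \<le> C * exp (- (\<nu> / 2) * norm1 (fst j)) * exp (- (\<nu> / 2) * norm1 (fst i))"
      proof (cases "fst i \<in> strip n a")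
        case True
        have x1: "\<bar>fst i $ 1\<bar> \<le> a * (\<bar>of_int n\<bar> + 1)"
        proof -
          have "of_int n * a \<le> fst i $ 1" "fst i $ 1 \<le> (of_int n + 1) * a" using True by (auto simp: strip_def)
          moreover have "(of_int n + 1) * a \<le> (\<bar>of_int n\<bar> + 1) * a" "(- (\<bar>of_int n\<bar> + 1)) * a \<le> of_int n * a"
            using a0 by (intro mult_right_mono; simp)+
          ultimately have "fst i $ 1 \<le> (\<bar>of_int n\<bar> + 1) * a" "- ((\<bar>of_int n\<bar> + 1) * a) \<le> fst i $ 1"
            unfolding mult_minus_left by linarith+
          then show ?thesis unfolding abs_le_iff mult.commute[of a] by (intro conjI; linarith)
        qed
        have tri: "norm1 (fst j) \<le> norm1 (fst i) + norm1 (fst i - fst j)"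
          using norm1_triangle[of "fst j" 0 "fst i"] norm1_commute[of "fst j" "fst i"] by simp
        have n1: "norm1 (fst i) = \<bar>fst i $ 1\<bar> + \<bar>fst i $ 2\<bar>" by (simp add: norm1_def)
        have le: "norm1 (fst j) + norm1 (fst i) \<le> 2 * (a * (\<bar>of_int n\<bar> + 1) + (norm1 (fst i - fst j) + 1 * (\<bar>fst i $ 2\<bar> + \<bar>fst j $ 2\<bar>)))"
        proof -
          have "nj + ni \<le> 2 * (y + (d + 1 * (h + h')))" if "nj \<le> ni + d" "x \<le> y" "ni = x + h" "0 \<le> d" "0 \<le> h'"
            for nj ni y d h h' x :: real using that by simp
          from this[OF tri x1 n1 norm1_nonneg abs_ge_zero] show ?thesis .
        qed
        have "- \<nu> * y \<le> \<nu> * x + (- (\<nu> / 2) * s + - (\<nu> / 2) * t)" if "s + t \<le> 2 * (x + y)" for s t x y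
        proof -
          have "\<nu> * (s + t) \<le> \<nu> * (2 * (x + y))" by (rule mult_left_mono[OF that]) (use nu in simp)
          then show ?thesis by (simp add: field_simps)
        qed
        from this[OF le]
        have "decay_weight \<nu> i j \<le> exp (\<nu> * (a * (\<bar>of_int n\<bar> + 1))) * (exp (- (\<nu> / 2) * norm1 (fst j)) * exp (- (\<nu> / 2) * norm1 (fst i)))"
          unfolding exp_add[symmetric] exp_le_cancel_iff .
        then have "K * decay_weight \<nu> i j \<le> K * (exp (\<nu> * (a * (\<bar>of_int n\<bar> + 1))) * (exp (- (\<nu> / 2) * norm1 (fst j)) * exp (- (\<nu> / 2) * norm1 (fst i))))"
          by (rule mult_left_mono[OF _ K])
        then show ?thesis
          using Sb[OF ij] True entT[OF ij(1)] by (simp add: C_def mult.assoc)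
      next
        case False
        then show ?thesis using entT[OF ij(1)] K by (simp add: C_def)
      qed
      then show "(case x of (j, i) \<Rightarrow> cmod (ent (strip_op D a n S) i j))
          \<le> (case x of (j, i) \<Rightarrow> C * exp (- (\<nu> / 2) * norm1 (fst j)) * exp (- (\<nu> / 2) * norm1 (fst i)))"
        by (simp add: x)
    qed auto
  qed
  let ?d = "\<lambda>m p. line_entry (spin_weight \<Lambda>1) (site m p) (site m p)"
  have tr: "op_trace D (strip_op D a n S) = (\<Sum>m\<in>{int k * n..<int k * (n + 1)}. \<Sum>\<^sub>\<infinity>p. ?d m p)" for n
  proof -
    let ?I = "{int k * n..<int k * (n + 1)}"
    \<comment> \<open>The strip width is a multiple of the column spacing, so the edges run through
      columns; the half-open convention puts column \<open>k * n\<close> into strip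
      \<open>n\<close>.\<close>
    have mem: "fst (site m p) \<in> strip n a \<longleftrightarrow> m \<in> ?I" for m p
    proof -
      have "fst (site m p) \<in> strip n a \<longleftrightarrow> (of_int (int k * n) * real a1 \<le> of_int m * real a1 \<and> of_int m * real a1 < of_int (int k * (n + 1)) * real a1)"
        by (simp add: site_def strip_def a_def mult_ac)
      also have "\<dots> \<longleftrightarrow> m \<in> ?I"
        using D(2) by (simp only: mult_le_cancel_right mult_less_cancel_right of_int_le_iff of_int_less_iff) auto
      finally show ?thesis .
    qed
    have "op_trace D (strip_op D a n S) = (\<Sum>\<^sub>\<infinity>i\<in>sites D. ent (strip_op D a n S) i i)"
      by (simp add: op_trace_def ent_def)
    also have "\<dots> = (\<Sum>\<^sub>\<infinity>(m, p). ent (strip_op D a n S) (site m p) (site m p))"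
      using infsum_reindex_bij_betw[OF bij_site, of "\<lambda>i. ent (strip_op D a n S) i i"] by (simp add: case_prod_beta')
    also have "\<dots> = (\<Sum>\<^sub>\<infinity>(m, p)\<in>?I \<times> UNIV. ?d m p)"
      by (rule infsum_cong_neutral) (auto simp: entT[OF site_sites] mem ent_S[OF site_sites site_sites] split: if_splits)
    also have "\<dots> = (\<Sum>\<^sub>\<infinity>m\<in>?I. \<Sum>\<^sub>\<infinity>p. ?d m p)"
    proof (rule infsum_Sigma'_banach[symmetric])
      show "(\<lambda>(m, p). ?d m p) summable_on (SIGMA m:?I. UNIV)"
      proof (rule infsum_tail_bound(2)[of _ _ "\<lambda>(m, p). K * exp (- \<nu> * \<bar>of_int (fst p)\<bar>)" "{}"])
        have 1: "(\<lambda>p :: int \<times> 2. exp (- \<nu> * \<bar>of_int (fst p)\<bar>)) summable_on UNIV"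
          using summable_on_product_nonneg[OF exp_summable_int[OF nu], of "\<lambda>_. 1" "UNIV :: 2 set"] by (simp add: case_prod_beta')
        show "(\<lambda>(m, p). K * exp (- \<nu> * \<bar>of_int (fst p)\<bar>)) summable_on ?I \<times> (UNIV :: (int \<times> 2) set)"
          by (rule summable_on_product_nonneg[OF _ _ 1]) (use K in auto)
        fix x assume "x \<in> ?I \<times> (UNIV :: (int \<times> 2) set)"
        obtain m p where x: "x = (m, p)" by (cases x)
        have "cmod (?d m p) \<le> K * decay_weight \<nu> (site m p) (site m p)"
          using Sb[OF site_sites site_sites] ent_S[OF site_sites site_sites] by metis
        also have "\<dots> \<le> K * exp (- \<nu> * \<bar>of_int (fst p)\<bar>)"
        proof (rule mult_left_mono[OF _ K])
          have "\<bar>real_of_int (fst p)\<bar> \<le> \<bar>fst (site m p) $ 2\<bar>"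
            using lattice_abs_ge[OF D(3)] by (simp add: site_def)
          then have "\<nu> * \<bar>real_of_int (fst p)\<bar> \<le> \<nu> * (norm1 (fst (site m p) - fst (site m p)) + 1 * (\<bar>fst (site m p) $ 2\<bar> + \<bar>fst (site m p) $ 2\<bar>))"
            using nu by (intro mult_left_mono) (auto simp: norm1_def)
          then show "decay_weight \<nu> (site m p) (site m p) \<le> exp (- \<nu> * \<bar>of_int (fst p)\<bar>)" by simp
        qed
        finally show "cmod (case x of (m, p) \<Rightarrow> ?d m p) \<le> (case x of (m, p) \<Rightarrow> K * exp (- \<nu> * \<bar>of_int (fst p)\<bar>))"
          by (simp add: x)
      qed auto
    qed
    also have "\<dots> = (\<Sum>m\<in>?I. \<Sum>\<^sub>\<infinity>p. ?d m p)" by (rule infsum_finite) simp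
    finally show ?thesis .
  qed
  \<comment> \<open>The window for \<open>N\<close> strips on each side has half width
    \<open>k * N\<close>: a subsequence, whose limit does not depend on \<open>k\<close>.\<close>
  have "filterlim (\<lambda>N. k * N) at_top sequentially"
    using k by (intro filterlim_subseq strict_monoI) simp
  from filterlim_compose[OF spin_column_limit[OF sw1] this]
  have lim: "(\<lambda>N. \<Sum>n = - int N..int N - 1. op_trace D (strip_op D a n S)) \<longlonglongrightarrow> - (\<Sum>\<^sub>\<infinity>l. of_int l * spin_kappa l)"
    unfolding tr sum_blocks .
  then show "pv_trace_exists (real (k * a1)) D S"
    unfolding pv_trace_exists_def a_def[symmetric] using tc by (auto simp: convergent_def)
  show "pv_trace (real (k * a1)) D S = - (\<Sum>\<^sub>\<infinity>l. of_int l * spin_kappa l)"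
    unfolding pv_trace_def a_def[symmetric] using lim by (rule limI)
qed

end

section \<open>Independence of the density function\<close>

text \<open>Spectrum below \<open>c\<close> lies between \<open>b\<close> and
  \<open>inf \<Delta>\<close>, end points included. This is the closure of the open interval where
  \<open>\<rho>\<close> is 1 as long as that interval is nonempty, which is where \<open>b\<close>
  must differ from \<open>inf \<Delta>\<close>. A spectral point below \<open>c\<close> also bounds
  the gap below, so the extended infimum is real.\<close>

lemma spectrum_below_gap:
  assumes \<Delta>: "is_interval \<Delta>" "c \<in> \<Delta>" and S: "\<And>z. z \<in> S \<Longrightarrow> z = complex_of_real (Re z) \<and> Re z \<notin> \<Delta> \<and> b \<le> Re z"
    and \<rho>: "density_function b \<Delta> \<rho>" and b: "ereal b \<noteq> (INF d\<in>\<Delta>. ereal d)"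
  shows "\<exists>U. open U \<and> (\<forall>x\<in>U. \<rho> x = 1) \<and> S \<inter> {z. Re z < c} \<subseteq> complex_of_real ` closure U"
proof (cases "S \<inter> {z. Re z < c} = {}")
  case True
  then show ?thesis by (intro exI[of _ "{}"]) simp
next
  case False
  then obtain z0 where z0: "z0 \<in> S" "Re z0 < c" by blast
  have lower: "Re z \<le> d" if "z \<in> S" "Re z < c" "d \<in> \<Delta>" for z d
  proof (rule ccontr)
    assume "\<not> Re z \<le> d"
    then have "Re z \<in> \<Delta>" using that by (intro mem_is_interval_1_I[OF \<Delta>(1) that(3) \<Delta>(2)]) auto
    then show False using S[OF that(1)] by blast
  qed
  define \<alpha> where "\<alpha> = Inf \<Delta>"
  have le: "Re z \<le> \<alpha>" if "z \<in> S" "Re z < c" for z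
    unfolding \<alpha>_def using \<Delta>(2) lower[OF that] by (intro cInf_greatest) auto
  have bdd: "bdd_below \<Delta>" using lower[OF z0] by (rule bdd_belowI)
  have e: "ereal \<alpha> = (INF d\<in>\<Delta>. ereal d)" unfolding \<alpha>_def by (rule ereal_Inf'[OF bdd]) (use \<Delta>(2) in blast)
  have "b \<noteq> \<alpha>" using b e by auto
  moreover have "b \<le> \<alpha>" using S[OF z0(1)] le[OF z0] by linarith
  ultimately have ba: "b < \<alpha>" by linarith
  show ?thesis
  proof (intro exI[of _ "{b<..<\<alpha>}"] conjI ballI)
    show "\<rho> x = 1" if "x \<in> {b<..<\<alpha>}" for x
      using \<rho> that unfolding density_function_def e[symmetric] by simp
    show "S \<inter> {z. Re z < c} \<subseteq> complex_of_real ` closure {b<..<\<alpha>}"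
    proof
      fix z assume "z \<in> S \<inter> {z. Re z < c}"
      then have z: "z \<in> S" "Re z < c" by auto
      show "z \<in> complex_of_real ` closure {b<..<\<alpha>}"
        unfolding closure_greaterThanLessThan[OF ba]
        by (rule image_eqI[of _ _ "Re z"]) (use S[OF z(1)] le[OF z] in auto)
    qed
  qed simp
qed

text \<open>Spectrum above \<open>c\<close> begins at \<open>sup \<Delta>\<close> at the earliest,
  the end point of the open half line on which \<open>\<rho>\<close> vanishes, and the closure
  contains it.\<close>

lemma spectrum_above_gap:
  assumes \<Delta>: "is_interval \<Delta>" "c \<in> \<Delta>" and S: "\<And>z. z \<in> S \<Longrightarrow> z = complex_of_real (Re z) \<and> Re z \<notin> \<Delta>"
    and \<rho>: "density_function b \<Delta> \<rho>"
  shows "\<exists>U. open U \<and> (\<forall>x\<in>U. \<rho> x = 0) \<and> S \<inter> {z. Re z > c} \<subseteq> complex_of_real ` closure U"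
proof (cases "S \<inter> {z. Re z > c} = {}")
  case True
  then show ?thesis by (intro exI[of _ "{}"]) simp
next
  case False
  then obtain z0 where z0: "z0 \<in> S" "Re z0 > c" by blast
  have upper: "d \<le> Re z" if "z \<in> S" "Re z > c" "d \<in> \<Delta>" for z d
  proof (rule ccontr)
    assume "\<not> d \<le> Re z"
    then have "Re z \<in> \<Delta>" using that by (intro mem_is_interval_1_I[OF \<Delta>(1) \<Delta>(2) that(3)]) auto
    then show False using S[OF that(1)] by blast
  qed
  define \<beta> where "\<beta> = Sup \<Delta>"
  have le: "\<beta> \<le> Re z" if "z \<in> S" "Re z > c" for z
    unfolding \<beta>_def using \<Delta>(2) upper[OF that] by (intro cSup_least) auto
  have bdd: "bdd_above \<Delta>" using upper[OF z0] by (rule bdd_aboveI)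
  have e: "(SUP d\<in>\<Delta>. ereal d) \<le> ereal \<beta>"
    unfolding \<beta>_def by (intro SUP_least) (simp add: cSup_upper bdd)
  show ?thesis
  proof (intro exI[of _ "{\<beta><..}"] conjI ballI)
    show "\<rho> x = 0" if "x \<in> {\<beta><..}" for x
    proof -
      have "(SUP d\<in>\<Delta>. ereal d) < ereal x" by (rule le_less_trans[OF e]) (use that in simp)
      then show ?thesis using \<rho> unfolding density_function_def by blast
    qed
    show "S \<inter> {z. Re z > c} \<subseteq> complex_of_real ` closure {\<beta><..}"
    proof
      fix z assume "z \<in> S \<inter> {z. Re z > c}"
      then have z: "z \<in> S" "Re z > c" by auto
      show "z \<in> complex_of_real ` closure {\<beta><..}"
        unfolding closure_greaterThan
        by (rule image_eqI[of _ _ "Re z"]) (use S[OF z(1)] le[OF z] in auto)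
    qed
  qed simp
qed

text \<open>The value of the trace is written with objects of the locale only; this gives
  independence of \<open>\<Lambda>1\<close>, of the density function with its extension, and of
  \<open>k\<close> at once.\<close>

lemma (in bulk_gap) spin_conductance:
  assumes sw1: "switch_function 1 \<Lambda>1" and \<rho>: "density_function b \<Delta> \<rho>" and ext: "almost_analytic_extension \<rho> \<rho>'"
    and k: "k \<ge> 1" and \<Delta>: "is_interval \<Delta>" "c \<in> \<Delta>" "complex_of_real ` \<Delta> \<inter> spectrum D H = {}"
    and b: "\<And>x. complex_of_real x \<in> spectrum D H \<Longrightarrow> b \<le> x" "ereal b \<noteq> (INF d\<in>\<Delta>. ereal d)"
  shows "spin_integrand D H \<rho>' \<Lambda> \<Lambda>1 integrable_on UNIV"
    and "pv_trace_exists (real (k * a1)) D (spin_Sigma D H \<rho>' \<Lambda> \<Lambda>1)"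
    and "pv_trace (real (k * a1)) D (spin_Sigma D H \<rho>' \<Lambda> \<Lambda>1) = - (\<Sum>\<^sub>\<infinity>l. of_int l * spin_kappa l)"
proof -
  let ?F = "\<lambda>z. scale_op (dbar \<rho>' z) (W (spin_weight \<Lambda>1) z)"
  have r: "\<Lambda>1 x \<in> {0..1}" for x by (rule switch_function_range[OF sw1])
  have f1: "\<forall>x. \<bar>\<Lambda>1 x\<bar> \<le> 1"
  proof
    show "\<bar>\<Lambda>1 x\<bar> \<le> 1" for x using r[of x] by (simp add: abs_le_iff)
  qed
  note g = spin_weight_bound[OF f1]
  have tf: "test_function \<rho>'" and real: "\<And>x. \<rho>' (complex_of_real x) = \<rho> x"
    and db: "\<And>N. N > 0 \<Longrightarrow> \<exists>C. \<forall>z. cmod (dbar \<rho>' z) \<le> C * \<bar>Im z\<bar> ^ N"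
    using ext by (simp_all add: almost_analytic_extension_def)
  have db0: "dbar \<rho>' z = 0" if "Im z = 0" for z
  proof -
    obtain C where "\<forall>z. cmod (dbar \<rho>' z) \<le> C * \<bar>Im z\<bar> ^ 1" using db[of 1] by auto
    from this[rule_format, of z] show ?thesis using that by simp
  qed
  have F: "spin_integrand D H \<rho>' \<Lambda> \<Lambda>1 = ?F"
    by (rule HOL.ext) (rule spin_integrand_eq[OF f1 db0])
  have int: "?F integrable_on UNIV" by (rule integrand_integrable[OF g tf db]) simp
  then show "spin_integrand D H \<rho>' \<Lambda> \<Lambda>1 integrable_on UNIV" by (simp only: F)
  have \<Sigma>: "spin_Sigma D H \<rho>' \<Lambda> \<Lambda>1 = integral UNIV ?F" by (simp only: spin_Sigma_def F)
  have S: "\<And>z. z \<in> spectrum D H \<Longrightarrow> z = complex_of_real (Re z) \<and> Re z \<notin> \<Delta> \<and> b \<le> Re z"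
  proof -
    fix z assume that: "z \<in> spectrum D H"
    have z: "z = complex_of_real (Re z)"
      using spectrum_real[OF H(1,2), of z] that by (auto simp: complex_eq_iff)
    moreover have "Re z \<notin> \<Delta>" using \<Delta>(3) that z by (metis disjoint_iff image_eqI)
    moreover have "b \<le> Re z" using b(1) that z by metis
    ultimately show "z = complex_of_real (Re z) \<and> Re z \<notin> \<Delta> \<and> b \<le> Re z" by blast
  qed
  obtain U1 where U1: "open U1" "\<forall>x\<in>U1. \<rho> x = 1" "spectrum D H \<inter> {z. Re z < c} \<subseteq> complex_of_real ` closure U1"
    using spectrum_below_gap[where S="spectrum D H", OF \<Delta>(1,2) _ \<rho> b(2)] S by blast
  obtain U2 where U2: "open U2" "\<forall>x\<in>U2. \<rho> x = 0" "spectrum D H \<inter> {z. Re z > c} \<subseteq> complex_of_real ` closure U2"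
    using spectrum_above_gap[where S="spectrum D H", OF \<Delta>(1,2) _ \<rho>] S by blast
  have lim: "(\<lambda>n. - 1 / 2 * integral {- real n..real n} (\<lambda>t. ent (W (spin_weight \<Lambda>1) (Complex c t)) i j))
      \<longlonglongrightarrow> ent (integral UNIV ?F) i j" for i j
    by (rule integral_entry[OF g tf db U1(1) _ U1(3) U2(1) _ U2(3)]) (use U1(2) U2(2) real in auto)
  obtain \<nu> K where kp: "\<forall>\<gamma>. (\<forall>i. \<bar>\<gamma> i\<bar> \<le> 1) \<longrightarrow> (\<forall>i\<in>sites D. \<forall>j\<in>sites D.
       cmod (line_entry \<gamma> i j) \<le> K * decay_weight \<nu> i j \<and>
       (\<lambda>n. - 1 / 2 * integral {- real n..real n} (\<lambda>t. ent (W \<gamma> (Complex c t)) i j)) \<longlonglongrightarrow> line_entry \<gamma> i j)"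
    using kernel_properties by (elim exE conjE)
  \<comment> \<open>Both sides are limits of the same symmetric line integrals, one by Green's
    formula and the other by integrability along the line.\<close>
  have ent: "ent (spin_Sigma D H \<rho>' \<Lambda> \<Lambda>1) i j = line_entry (spin_weight \<Lambda>1) i j" if "i \<in> sites D" "j \<in> sites D" for i j
    unfolding \<Sigma> by (rule LIMSEQ_unique[OF lim]) (use kp g that in blast)
  have op: "op_on D (spin_Sigma D H \<rho>' \<Lambda> \<Lambda>1)"
    unfolding \<Sigma> by (rule complex_linear_integral[OF g int db0])
  show "pv_trace_exists (real (k * a1)) D (spin_Sigma D H \<rho>' \<Lambda> \<Lambda>1)"
    and "pv_trace (real (k * a1)) D (spin_Sigma D H \<rho>' \<Lambda> \<Lambda>1) = - (\<Sum>\<^sub>\<infinity>l. of_int l * spin_kappa l)"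
    using pv_trace_spin[OF sw1 k op ent] by simp_all
qed

theorem proposition1p6:
  fixes a1 a2 :: "side \<Rightarrow> nat"
    and De :: "plane set"
    and H :: "side \<Rightarrow> lop" and He Hd :: lop
    and L lam b :: real
    and \<Delta> :: "real set"
  defines "D \<equiv> \<lambda>s. bulk_lattice (a1 s) (a2 s)"
  assumes "\<And>s. a1 s > 0" and "\<And>s. a2 s > 0"
    and "discrete De" and "L > 0"
    and "De \<inter> {x. x $ 1 > L} = D Plus \<inter> {x. x $ 1 > L}"
    and "De \<inter> {x. - (x $ 1) > L} = D Minus \<inter> {x. - (x $ 1) > L}"
    and "\<And>s. selfadjoint (H s)" and "selfadjoint He"
    and "\<And>s. tight_binding (D s) lam (H s)" and "tight_binding De lam He" and "tight_binding De lam Hd"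
    and "He = (position_op De (indicator {x. x $ 1 > L}) o\<^sub>L H Plus o\<^sub>L position_op De (indicator {x. x $ 1 > L}))
            + (position_op De (indicator {x. x $ 1 < - L}) o\<^sub>L H Minus o\<^sub>L position_op De (indicator {x. x $ 1 < - L}))
            + Hd"
    and "\<exists>C>0. \<forall>x\<in>De. \<forall>y\<in>De. norm (op_kernel Hd x y) \<le> C * exp (- lam * (\<bar>x $ 1\<bar> + \<bar>y $ 1\<bar>))"
    and "\<And>s. translation_invariant (D s) (H s)"
    and "open \<Delta>" and "is_interval \<Delta>" and "\<Delta> \<noteq> {}"
    and "\<And>s. complex_of_real ` \<Delta> \<inter> spectrum (D s) (H s) = {}"
    and "b = Inf {x. complex_of_real x \<in> spectrum (D Plus) (H Plus) \<union> spectrum (D Minus) (H Minus) \<union> spectrum De He}"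
    and "ereal b \<noteq> (INF d\<in>\<Delta>. ereal d)"
  shows "\<forall>s \<Lambda>2. switch_function 2 \<Lambda>2 \<longrightarrow>
    (\<exists>\<sigma>. \<forall>\<Lambda>1 \<rho> \<rho>' k.
       switch_function 1 \<Lambda>1 \<and> density_function b \<Delta> \<rho> \<and> almost_analytic_extension \<rho> \<rho>' \<and> k \<ge> 1 \<longrightarrow>
         spin_integrand (D s) (H s) \<rho>' \<Lambda>2 \<Lambda>1 integrable_on UNIV \<and>
         pv_trace_exists (real (k * a1 s)) (D s) (spin_Sigma (D s) (H s) \<rho>' \<Lambda>2 \<Lambda>1) \<and>
         bulk_spin_conductance (a1 s) (a2 s) (H s) \<Lambda>2 \<Lambda>1 \<rho>' k = \<sigma>)"
proof (intro allI impI)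
  fix s \<Lambda>2 assume sw2: "switch_function 2 \<Lambda>2"
  note hyps = assms
  have tb: "tight_binding (D s) lam (H s)" for s by (rule hyps)
  have sa: "selfadjoint (H s)" for s by (rule hyps)
  obtain CH where CH: "CH \<ge> 0" "decays (D s) lam 0 CH (H s)" by (rule tight_binding_decays[OF tb])
  \<comment> \<open>The gap point is chosen before \<open>\<Lambda>1\<close>, the density function
    and \<open>k\<close>, so the value built from it can serve as \<open>\<sigma>\<close>.\<close>
  obtain c where c_gap: "c \<in> \<Delta>" using \<open>\<Delta> \<noteq> {}\<close> by blast
  have gap: "complex_of_real ` \<Delta> \<inter> spectrum (D s) (H s) = {}" by (rule hyps)
  interpret bulk_gap "a1 s" "a2 s" "D s" "H s" lam CH c \<Lambda>2
  proof
    show "D s = bulk_lattice (a1 s) (a2 s)" by (simp add: D_def)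
    show "a1 s > 0" "a2 s > 0" by (rule hyps)+
    show "op_on (D s) (H s)" "lam > 0" using tb[of s] by (simp_all add: tight_binding_def)
    show "translation_invariant (D s) (H s)" by (rule hyps)
    show "complex_of_real c \<notin> spectrum (D s) (H s)" using gap c_gap by blast
  qed (rule sa CH sw2)+
  \<comment> \<open>\<open>Inf\<close> is a lower bound only for sets that are bounded below; the
    three operator norms provide this.\<close>
  have bound: "b \<le> x" if x: "complex_of_real x \<in> spectrum (D s) (H s)" for x
  proof -
    define X where "X = {x. complex_of_real x \<in> spectrum (D Plus) (H Plus) \<union> spectrum (D Minus) (H Minus) \<union> spectrum De He}"
    have ab: "\<bar>x\<bar> \<le> norm A" if "op_on E A" "complex_of_real x \<in> spectrum E A" for E A x
      using spectrum_bounded[OF that(1), of "complex_of_real x"] that(2) by (auto simp: not_less[symmetric])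
    have op: "op_on (D s) (H s)" "op_on De He" for s
      using tb[of s] \<open>tight_binding De lam He\<close> by (simp_all add: tight_binding_def)
    have "bdd_below X"
    proof (rule bdd_belowI)
      fix y assume "y \<in> X"
      then consider "\<bar>y\<bar> \<le> norm (H Plus)" | "\<bar>y\<bar> \<le> norm (H Minus)" | "\<bar>y\<bar> \<le> norm He"
        unfolding X_def using ab[OF op(1)] ab[OF op(2)] by blast
      then show "- (norm (H Plus) + norm (H Minus) + norm He) \<le> y"
        using norm_ge_zero[of "H Plus"] norm_ge_zero[of "H Minus"] norm_ge_zero[of He] by cases linarith+
    qed
    moreover have "x \<in> X" using x unfolding X_def by (cases s) auto
    moreover have "b = Inf X" unfolding X_def by (rule hyps)
    ultimately show ?thesis by (simp add: cInf_lower)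
  qed
  show "\<exists>\<sigma>. \<forall>\<Lambda>1 \<rho> \<rho>' k.
       switch_function 1 \<Lambda>1 \<and> density_function b \<Delta> \<rho> \<and> almost_analytic_extension \<rho> \<rho>' \<and> k \<ge> 1 \<longrightarrow>
         spin_integrand (D s) (H s) \<rho>' \<Lambda>2 \<Lambda>1 integrable_on UNIV \<and>
         pv_trace_exists (real (k * a1 s)) (D s) (spin_Sigma (D s) (H s) \<rho>' \<Lambda>2 \<Lambda>1) \<and>
         bulk_spin_conductance (a1 s) (a2 s) (H s) \<Lambda>2 \<Lambda>1 \<rho>' k = \<sigma>"
  proof (intro exI allI impI, elim conjE)
    fix \<Lambda>1 \<rho> \<rho>' k
    assume a: "switch_function 1 \<Lambda>1" "density_function b \<Delta> \<rho>" "almost_analytic_extension \<rho> \<rho>'" "k \<ge> (1 :: nat)"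
    note res = spin_conductance[OF a \<open>is_interval \<Delta>\<close> c_gap gap bound \<open>ereal b \<noteq> (INF d\<in>\<Delta>. ereal d)\<close>]
    show "spin_integrand (D s) (H s) \<rho>' \<Lambda>2 \<Lambda>1 integrable_on UNIV \<and>
         pv_trace_exists (real (k * a1 s)) (D s) (spin_Sigma (D s) (H s) \<rho>' \<Lambda>2 \<Lambda>1) \<and>
         bulk_spin_conductance (a1 s) (a2 s) (H s) \<Lambda>2 \<Lambda>1 \<rho>' k =
           1 / (2 * complex_of_real pi) * - (\<Sum>\<^sub>\<infinity>l. of_int l * spin_kappa l)"
      using res unfolding bulk_spin_conductance_def D(1)[symmetric] by simp
  qed
qed

end
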